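(* Let $G$ be a torsion-free $\widehat{\mathfrak{F}}$-group. Then any acyclic complex of injective $\mathbb{Z}G$-modules is contractible, i.e. $\mathcal{I}(\mathbb{Z}G)=\mathtt{Inj}(\mathbb{Z}G)$.
   Context: Rings are unital and associative; modules are left modules. Complexes are doubly infinite (indexed by $\mathbb{Z}$). For a ring $R$, $\mathtt{Inj}(R)$ is the class of injective $R$-modules and $\mathcal{I}(R)$ is the class of $R$-modules that appear as kernels of acyclic complexes of injective $R$-modules. Group classes are closed under isomorphism and contain the trivial group. For a group class $\mathfrak{C}$: put $\mathbf{H}_0\mathfrak{C}=\mathfrak{C}$ and, for an ordinal $\alpha>0$, let $\mathbf{H}_\alpha\mathfrak{C}$ consist of the groups $G$ that admit a cellular action on a finite dimensional contractible CW-complex $X$ (so that $X$ is a $G$-CW-complex) such that each isotropy subgroup of the action belongs to $\mathbf{H}_\beta\mathfrak{C}$ for some ordinal $\beta<\alpha$. $\mathbf{H}\mathfrak{C}$ is the union of all $\mathbf{H}_\alpha\mathfrak{C}$. $\mathbf{LH}\mathfrak{C}$ consists of the groups all of whose finitely generated subgroups are contained in an $\mathbf{H}\mathfrak{C}$-subgroup. For a commutative ring $k$, $\Phi(k)_{inj}\mathfrak{C}$ is the class of groups $G$ such that for every $kG$-module $M$ one has $\mathrm{id}_{kG}M<\infty$ if and only if there is an integer $n$ with $\mathrm{id}_{kC}\,\mathrm{res}^G_CM\le n$ for every subgroup $C\subseteq G$ with $C\in\mathfrak{C}$ ($\mathrm{id}$ is injective dimension). The class $\widehat{\mathfrak{F}}(k)$: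 let $\mathfrak{F}'(k)_0=\mathfrak{F}$ be the class of finite groups, $\mathfrak{F}'(k)_{\alpha+1}=\mathbf{LH}\mathfrak{F}'(k)_\alpha\cup\Phi(k)_{inj}\mathfrak{F}'(k)_\alpha$ for any ordinal $\alpha$, and $\mathfrak{F}'(k)_\alpha=\bigcup_{\beta<\alpha}\mathfrak{F}'(k)_\beta$ for any limit ordinal $\alpha$. Then $\widehat{\mathfrak{F}}(k)$ is the class of groups contained in $\mathfrak{F}'(k)_\alpha$ for some ordinal $\alpha$. We write $\widehat{\mathfrak{F}}=\widehat{\mathfrak{F}}(\mathbb{Z})$. *)

theory Defs
  imports "HOL-Analysis.Analysis" "HOL-Algebra.Module"
    "HOL-Algebra.IntRing" "HOL-Algebra.Group_Action" "HOL-Algebra.Generated_Groups"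
begin

section \<open>Size conventions\<close>

text \<open>
  HOL cannot quantify over all types inside a formula, so "all modules" and "all spaces" range over
  the subsets of a fixed universe type. \<^verbatim>\<open>('r, 'u) universe\<close> has cardinality
  \<^verbatim>\<open>2 ^ max (|'r|, |'u|, aleph_0)\<close>. Its cardinality is unchanged by raising it to the power
  \<^verbatim>\<open>|'r|\<close>, so over a ring with elements in \<^verbatim>\<open>'r\<close> the universe contains a copy of
  the ring and of its ideals, contains an injective hull of each of its modules, and is closed under
  countable products. Hence injectivity and injective dimension computed inside it are the absolute
  ones (Baer). The parameter \<^verbatim>\<open>'u\<close> is left free: every module and every space on any
  type \<^verbatim>\<open>'u\<close> has an isomorphic copy in the universe. The class \<^verbatim>\<open>\<Phi>\<^sub>i\<^sub>n\<^sub>j\<close> below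
  does not depend on it either: a module of infinite injective dimension whose restrictions have
  bounded injective dimension contains one of cardinality at most
  \<^verbatim>\<open>2 ^ max (|'r|, aleph_0)\<close>, by closing up under solutions of the cocycle equations
  that express the vanishing of \<^verbatim>\<open>Ext\<close> on cyclic modules. Likewise a contractible
  \<^verbatim>\<open>G\<close>-CW-complex contains a contractible \<^verbatim>\<open>G\<close>-subcomplex with at most
  \<^verbatim>\<open>max (|G|, aleph_0)\<close> cells.

  A group class is a set of groups with elements in a fixed type \<^verbatim>\<open>'a\<close>. This loses
  nothing, because every operation on group classes below tests a group only through its own
  subgroups \<^verbatim>\<open>G\<lparr>carrier := H\<rparr>\<close>.
\<close>

type_synonym ('r, 'u) universe = "('r + nat + 'u) set"

section \<open>Modules over noncommutative rings\<close>

text \<open>The locale \<^verbatim>\<open>module\<close> of HOL-Algebra requires a commutative ring of scalars; its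
  record type of modules is reused, of which the inherited fields \<^verbatim>\<open>mult\<close> and
  \<^verbatim>\<open>one\<close> play no role.\<close>

locale left_module = R?: Ring.ring R + M?: abelian_group M
  for R :: "'r ring" (structure) and M :: "('r, 'm) Module.module" (structure) +
  assumes smult_closed: "\<lbrakk>a \<in> carrier R; x \<in> carrier M\<rbrakk> \<Longrightarrow> a \<odot>\<^bsub>M\<^esub> x \<in> carrier M"
    and smult_l_distr: "\<lbrakk>a \<in> carrier R; b \<in> carrier R; x \<in> carrier M\<rbrakk> \<Longrightarrow>
      (a \<oplus>\<^bsub>R\<^esub> b) \<odot>\<^bsub>M\<^esub> x = a \<odot>\<^bsub>M\<^esub> x \<oplus>\<^bsub>M\<^esub> b \<odot>\<^bsub>M\<^esub> x"
    and smult_r_distr: "\<lbrakk>a \<in> carrier R; x \<in> carrier M; y \<in> carrier M\<rbrakk> \<Longrightarrow>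
      a \<odot>\<^bsub>M\<^esub> (x \<oplus>\<^bsub>M\<^esub> y) = a \<odot>\<^bsub>M\<^esub> x \<oplus>\<^bsub>M\<^esub> a \<odot>\<^bsub>M\<^esub> y"
    and smult_assoc: "\<lbrakk>a \<in> carrier R; b \<in> carrier R; x \<in> carrier M\<rbrakk> \<Longrightarrow>
      (a \<otimes>\<^bsub>R\<^esub> b) \<odot>\<^bsub>M\<^esub> x = a \<odot>\<^bsub>M\<^esub> (b \<odot>\<^bsub>M\<^esub> x)"
    and smult_one: "x \<in> carrier M \<Longrightarrow> \<one>\<^bsub>R\<^esub> \<odot>\<^bsub>M\<^esub> x = x"

definition lmod_hom ::
  "'r ring \<Rightarrow> ('r, 'm) Module.module \<Rightarrow> ('r, 'n) Module.module \<Rightarrow> ('m \<Rightarrow> 'n) set" where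
  "lmod_hom R M N = {f \<in> carrier M \<rightarrow> carrier N.
     (\<forall>x\<in>carrier M. \<forall>y\<in>carrier M. f (x \<oplus>\<^bsub>M\<^esub> y) = f x \<oplus>\<^bsub>N\<^esub> f y) \<and>
     (\<forall>a\<in>carrier R. \<forall>x\<in>carrier M. f (a \<odot>\<^bsub>M\<^esub> x) = a \<odot>\<^bsub>N\<^esub> f x)}"

definition lmod_ker ::
  "('r, 'm) Module.module \<Rightarrow> ('r, 'n) Module.module \<Rightarrow> ('m \<Rightarrow> 'n) \<Rightarrow> 'm set" where
  "lmod_ker M N f = {x \<in> carrier M. f x = \<zero>\<^bsub>N\<^esub>}"

type_synonym ('r, 'u) lmod = "('r, ('r, 'u) universe) Module.module"

definition injective_module :: "'r ring \<Rightarrow> ('r, 'u) lmod \<Rightarrow> bool" where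
  "injective_module R I \<longleftrightarrow> left_module R I \<and>
     (\<forall>(A :: ('r, 'u) lmod) (B :: ('r, 'u) lmod) i f.
        left_module R A \<and> left_module R B \<and> i \<in> lmod_hom R A B \<and> inj_on i (carrier A) \<and>
        f \<in> lmod_hom R A I \<longrightarrow>
        (\<exists>g\<in>lmod_hom R B I. \<forall>x\<in>carrier A. g (i x) = f x))"

definition Inj :: "'r ring \<Rightarrow> ('r, 'u) lmod set" where
  "Inj R = {I. injective_module R I}"

definition injective_resolution :: "'r ring \<Rightarrow> ('r, 'u) lmod \<Rightarrow> (nat \<Rightarrow> ('r, 'u) lmod) \<Rightarrow>
    (('r, 'u) universe \<Rightarrow> ('r, 'u) universe) \<Rightarrow>
    (nat \<Rightarrow> ('r, 'u) universe \<Rightarrow> ('r, 'u) universe) \<Rightarrow> bool" where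
  "injective_resolution R M I \<epsilon> d \<longleftrightarrow>
     (\<forall>i. injective_module R (I i)) \<and>
     \<epsilon> \<in> lmod_hom R M (I 0) \<and> inj_on \<epsilon> (carrier M) \<and>
     (\<forall>i. d i \<in> lmod_hom R (I i) (I (Suc i))) \<and>
     \<epsilon> ` carrier M = lmod_ker (I 0) (I 1) (d 0) \<and>
     (\<forall>i. d i ` carrier (I i) = lmod_ker (I (Suc i)) (I (Suc (Suc i))) (d (Suc i)))"

text \<open>The infimum of the empty set is \<^term>\<open>\<infinity>\<close>; the zero module gets dimension \<^term>\<open>0\<close>.\<close>

definition inj_dim :: "'r ring \<Rightarrow> ('r, 'u) lmod \<Rightarrow> enat" where
  "inj_dim R M = Inf {enat n | n. \<exists>I \<epsilon> d. injective_resolution R M I \<epsilon> d \<and>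
                                   (\<forall>i>n. carrier (I i) = {\<zero>\<^bsub>I i\<^esub>})}"

section \<open>Doubly infinite complexes\<close>

definition module_complex ::
  "'r ring \<Rightarrow> (int \<Rightarrow> ('r, 'm) Module.module) \<Rightarrow> (int \<Rightarrow> 'm \<Rightarrow> 'm) \<Rightarrow> bool" where
  "module_complex R C d \<longleftrightarrow> (\<forall>i. left_module R (C i)) \<and>
     (\<forall>i. d i \<in> lmod_hom R (C i) (C (i + 1))) \<and>
     (\<forall>i. \<forall>x\<in>carrier (C i). d (i + 1) (d i x) = \<zero>\<^bsub>C (i + 2)\<^esub>)"

definition acyclic_complex ::
  "'r ring \<Rightarrow> (int \<Rightarrow> ('r, 'm) Module.module) \<Rightarrow> (int \<Rightarrow> 'm \<Rightarrow> 'm) \<Rightarrow> bool" where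
  "acyclic_complex R C d \<longleftrightarrow> module_complex R C d \<and>
     (\<forall>i. d i ` carrier (C i) = lmod_ker (C (i + 1)) (C (i + 2)) (d (i + 1)))"

definition contractible_complex ::
  "'r ring \<Rightarrow> (int \<Rightarrow> ('r, 'm) Module.module) \<Rightarrow> (int \<Rightarrow> 'm \<Rightarrow> 'm) \<Rightarrow> bool" where
  "contractible_complex R C d \<longleftrightarrow> module_complex R C d \<and>
     (\<exists>s. (\<forall>i. s i \<in> lmod_hom R (C i) (C (i - 1))) \<and>
          (\<forall>i. \<forall>x\<in>carrier (C i). d (i - 1) (s i x) \<oplus>\<^bsub>C i\<^esub> s (i + 1) (d i x) = x))"

text \<open>The class \<^verbatim>\<open>\<I>(R)\<close>, closed under isomorphism.\<close>

definition acyclic_kernels :: "'r ring \<Rightarrow> ('r, 'u) lmod set" where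
  "acyclic_kernels R = {M. left_module R M \<and>
     (\<exists>(C :: int \<Rightarrow> ('r, 'u) lmod) d i h.
        acyclic_complex R C d \<and> (\<forall>j. injective_module R (C j)) \<and>
        h \<in> lmod_hom R M (C i) \<and>
        bij_betw h (carrier M) (lmod_ker (C i) (C (i + 1)) (d i)))}"

section \<open>Group rings\<close>

text \<open>Elements are functions of finite support, vanishing outside the group. Hence for a subgroup
  \<^verbatim>\<open>H\<close> of \<^verbatim>\<open>G\<close> the ring \<^verbatim>\<open>group_ring k (G\<lparr>carrier := H\<rparr>)\<close> is literally a
  subring of \<^verbatim>\<open>group_ring k G\<close>, and the restriction of a \<^verbatim>\<open>kG\<close>-module is
  given by the same record (lemma \<^verbatim>\<open>left_module_restrict\<close>).\<close>

definition group_ring :: "'k ring \<Rightarrow> 'a monoid \<Rightarrow> ('a \<Rightarrow> 'k) ring" where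
  "group_ring k G =
     \<lparr>carrier = {f. finite {x. f x \<noteq> \<zero>\<^bsub>k\<^esub>} \<and> (\<forall>x\<in>carrier G. f x \<in> carrier k) \<and>
                   (\<forall>x. x \<notin> carrier G \<longrightarrow> f x = \<zero>\<^bsub>k\<^esub>)},
      monoid.mult = (\<lambda>f g x. if x \<in> carrier G
                then \<Oplus>\<^bsub>k\<^esub>y\<in>{y \<in> carrier G. f y \<noteq> \<zero>\<^bsub>k\<^esub>}. f y \<otimes>\<^bsub>k\<^esub> g (inv\<^bsub>G\<^esub> y \<otimes>\<^bsub>G\<^esub> x)
                else \<zero>\<^bsub>k\<^esub>),
      monoid.one = (\<lambda>x. if x = \<one>\<^bsub>G\<^esub> then \<one>\<^bsub>k\<^esub> else \<zero>\<^bsub>k\<^esub>),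
      ring.zero = (\<lambda>_. \<zero>\<^bsub>k\<^esub>),
      ring.add = (\<lambda>f g x. f x \<oplus>\<^bsub>k\<^esub> g x)\<rparr>"

context
  fixes k :: "'k ring" and G :: "'a monoid"
  assumes k: "cring k" and G: "Group.group G"
begin

interpretation k: cring k by (rule k)
interpretation G: Group.group G by (rule G)

lemma group_ring_mult_eq:
  assumes f: "f \<in> carrier (group_ring k G)" and g: "g \<in> carrier (group_ring k G)"
    and S: "finite S" "S \<subseteq> carrier G" "{y. f y \<noteq> \<zero>\<^bsub>k\<^esub>} \<subseteq> S" and x: "x \<in> carrier G"
  shows "(f \<otimes>\<^bsub>group_ring k G\<^esub> g) x =
           (\<Oplus>\<^bsub>k\<^esub>y\<in>S. f y \<otimes>\<^bsub>k\<^esub> g (inv\<^bsub>G\<^esub> y \<otimes>\<^bsub>G\<^esub> x))"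
proof -
  have "(\<Oplus>\<^bsub>k\<^esub>y\<in>{y \<in> carrier G. f y \<noteq> \<zero>\<^bsub>k\<^esub>}. f y \<otimes>\<^bsub>k\<^esub> g (inv\<^bsub>G\<^esub> y \<otimes>\<^bsub>G\<^esub> x)) =
           (\<Oplus>\<^bsub>k\<^esub>y\<in>S. f y \<otimes>\<^bsub>k\<^esub> g (inv\<^bsub>G\<^esub> y \<otimes>\<^bsub>G\<^esub> x))"
    using f g S x
    by (intro k.add.finprod_mono_neutral_cong_left) (auto simp: group_ring_def)
  then show ?thesis
    using x by (simp add: group_ring_def)
qed

lemma group_ring_mult_closed:
  assumes f: "f \<in> carrier (group_ring k G)" and g: "g \<in> carrier (group_ring k G)"
  shows "f \<otimes>\<^bsub>group_ring k G\<^esub> g \<in> carrier (group_ring k G)"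
proof -
  let ?S = "{y. f y \<noteq> \<zero>\<^bsub>k\<^esub>}" and ?T = "{y. g y \<noteq> \<zero>\<^bsub>k\<^esub>}"
  let ?m = "f \<otimes>\<^bsub>group_ring k G\<^esub> g"
  have S: "finite ?S" "?S \<subseteq> carrier G" and T: "finite ?T" "?T \<subseteq> carrier G"
    using f g by (auto simp: group_ring_def)
  have out: "?m x = \<zero>\<^bsub>k\<^esub>" if "x \<notin> carrier G" for x
    using that by (simp add: group_ring_def)
  have eq: "?m x = (\<Oplus>\<^bsub>k\<^esub>y\<in>?S. f y \<otimes>\<^bsub>k\<^esub> g (inv\<^bsub>G\<^esub> y \<otimes>\<^bsub>G\<^esub> x))" if "x \<in> carrier G" for x
    using group_ring_mult_eq[OF f g S] that by simp
  have cl: "f x \<in> carrier k" "g x \<in> carrier k" if "x \<in> carrier G" for x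
    using f g that by (auto simp: group_ring_def)
  have "{x. ?m x \<noteq> \<zero>\<^bsub>k\<^esub>} \<subseteq> (\<lambda>(y, z). y \<otimes>\<^bsub>G\<^esub> z) ` (?S \<times> ?T)"
  proof
    fix x assume x: "x \<in> {x. ?m x \<noteq> \<zero>\<^bsub>k\<^esub>}"
    then have xG: "x \<in> carrier G" using out by auto
    have "\<exists>y\<in>?S. g (inv\<^bsub>G\<^esub> y \<otimes>\<^bsub>G\<^esub> x) \<noteq> \<zero>\<^bsub>k\<^esub>"
    proof (rule ccontr)
      assume "\<not> ?thesis"
      then have "?m x = \<zero>\<^bsub>k\<^esub>"
        unfolding eq[OF xG] using S cl by (intro k.add.finprod_one_eqI) (auto simp: subset_iff)
      with x show False by simp
    qed
    then obtain y where y: "y \<in> ?S" "inv\<^bsub>G\<^esub> y \<otimes>\<^bsub>G\<^esub> x \<in> ?T" by auto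
    then have "x = y \<otimes>\<^bsub>G\<^esub> (inv\<^bsub>G\<^esub> y \<otimes>\<^bsub>G\<^esub> x)"
      using S xG by (auto simp: G.m_assoc[symmetric])
    with y show "x \<in> (\<lambda>(y, z). y \<otimes>\<^bsub>G\<^esub> z) ` (?S \<times> ?T)" by force
  qed
  then have "finite {x. ?m x \<noteq> \<zero>\<^bsub>k\<^esub>}"
    using S(1) T(1) by (meson finite_SigmaI finite_imageI finite_subset)
  moreover have "?m x \<in> carrier k" if "x \<in> carrier G" for x
    unfolding eq[OF that] using S cl that by (intro k.finsum_closed) auto
  ultimately show ?thesis
    using out by (simp add: group_ring_def)
qed

lemma finsum_swap:
  assumes "finite A" "finite B" "\<And>x y. x \<in> A \<Longrightarrow> y \<in> B \<Longrightarrow> h x y \<in> carrier k"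
  shows "(\<Oplus>\<^bsub>k\<^esub>x\<in>A. \<Oplus>\<^bsub>k\<^esub>y\<in>B. h x y) = (\<Oplus>\<^bsub>k\<^esub>y\<in>B. \<Oplus>\<^bsub>k\<^esub>x\<in>A. h x y)"
  using assms(1,3)
proof (induction A)
  case (insert a A)
  have "(\<Oplus>\<^bsub>k\<^esub>y\<in>B. \<Oplus>\<^bsub>k\<^esub>x\<in>insert a A. h x y) = (\<Oplus>\<^bsub>k\<^esub>y\<in>B. h a y \<oplus>\<^bsub>k\<^esub> (\<Oplus>\<^bsub>k\<^esub>x\<in>A. h x y))"
    using insert by (intro k.finsum_cong') (auto intro!: k.finsum_closed k.finsum_insert)
  also have "\<dots> = (\<Oplus>\<^bsub>k\<^esub>y\<in>B. h a y) \<oplus>\<^bsub>k\<^esub> (\<Oplus>\<^bsub>k\<^esub>y\<in>B. \<Oplus>\<^bsub>k\<^esub>x\<in>A. h x y)"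
    using insert by (intro k.finsum_addf) (auto intro!: k.finsum_closed)
  finally show ?case
    using insert by (subst k.finsum_insert) (auto intro!: k.finsum_closed)
qed simp

lemma group_ring_mult_assoc:
  assumes f: "f \<in> carrier (group_ring k G)" and g: "g \<in> carrier (group_ring k G)"
    and h: "h \<in> carrier (group_ring k G)"
  shows "(f \<otimes>\<^bsub>group_ring k G\<^esub> g) \<otimes>\<^bsub>group_ring k G\<^esub> h =
         f \<otimes>\<^bsub>group_ring k G\<^esub> (g \<otimes>\<^bsub>group_ring k G\<^esub> h)"
proof
  fix x
  let ?S = "{y. f y \<noteq> \<zero>\<^bsub>k\<^esub>}" and ?T = "{y. g y \<noteq> \<zero>\<^bsub>k\<^esub>}"
  let ?m = "f \<otimes>\<^bsub>group_ring k G\<^esub> g"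
  let ?U = "{y. ?m y \<noteq> \<zero>\<^bsub>k\<^esub>}"
  define W where "W = ?U \<union> (\<lambda>(y, z). y \<otimes>\<^bsub>G\<^esub> z) ` (?S \<times> ?T)"
  note mc = group_ring_mult_closed[OF f g] and gh = group_ring_mult_closed[OF g h]
  have S: "finite ?S" "?S \<subseteq> carrier G" and T: "finite ?T" "?T \<subseteq> carrier G"
    and U: "finite ?U" "?U \<subseteq> carrier G"
    using f g mc by (auto simp: group_ring_def [of k G])
  have W: "finite W" "W \<subseteq> carrier G"
    using S T U unfolding W_def by auto
  have cl: "f x \<in> carrier k" "g x \<in> carrier k" "h x \<in> carrier k" if "x \<in> carrier G" for x
    using f g h that by (auto simp: group_ring_def)
  show "(?m \<otimes>\<^bsub>group_ring k G\<^esub> h) x = (f \<otimes>\<^bsub>group_ring k G\<^esub> (g \<otimes>\<^bsub>group_ring k G\<^esub> h)) x"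
  proof (cases "x \<in> carrier G")
    case False then show ?thesis by (simp add: group_ring_def)
  next
    case x: True
    have inner: "(g \<otimes>\<^bsub>group_ring k G\<^esub> h) (inv\<^bsub>G\<^esub> z \<otimes>\<^bsub>G\<^esub> x) =
        (\<Oplus>\<^bsub>k\<^esub>y\<in>W. g (inv\<^bsub>G\<^esub> z \<otimes>\<^bsub>G\<^esub> y) \<otimes>\<^bsub>k\<^esub> h (inv\<^bsub>G\<^esub> y \<otimes>\<^bsub>G\<^esub> x))" if z: "z \<in> ?S" for z
    proof -
      let ?i = "\<lambda>y. inv\<^bsub>G\<^esub> z \<otimes>\<^bsub>G\<^esub> y"
      have zG: "z \<in> carrier G" using z S by auto
      have sub: "?T \<subseteq> ?i ` W"
      proof
        fix y assume y: "y \<in> ?T"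
        then have "z \<otimes>\<^bsub>G\<^esub> y \<in> W" using z by (force simp: W_def)
        moreover have "?i (z \<otimes>\<^bsub>G\<^esub> y) = y" using y T zG by (auto simp: G.m_assoc[symmetric])
        ultimately show "y \<in> ?i ` W" by (metis imageI)
      qed
      have iW: "finite (?i ` W)" "?i ` W \<subseteq> carrier G" using W zG by auto
      have inj: "inj_on ?i W"
        using W zG by (intro inj_onI) (metis G.inv_closed G.Units_eq G.Units_l_cancel subsetD)
      have "(g \<otimes>\<^bsub>group_ring k G\<^esub> h) (inv\<^bsub>G\<^esub> z \<otimes>\<^bsub>G\<^esub> x) =
          (\<Oplus>\<^bsub>k\<^esub>w\<in>?i ` W. g w \<otimes>\<^bsub>k\<^esub> h (inv\<^bsub>G\<^esub> w \<otimes>\<^bsub>G\<^esub> (inv\<^bsub>G\<^esub> z \<otimes>\<^bsub>G\<^esub> x)))"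
        using group_ring_mult_eq[OF g h iW sub] zG x by simp
      also have "\<dots> = (\<Oplus>\<^bsub>k\<^esub>y\<in>W. g (?i y) \<otimes>\<^bsub>k\<^esub> h (inv\<^bsub>G\<^esub> (?i y) \<otimes>\<^bsub>G\<^esub> (inv\<^bsub>G\<^esub> z \<otimes>\<^bsub>G\<^esub> x)))"
        using W zG x inj by (intro k.finsum_reindex) (auto intro!: k.m_closed cl)
      also have "\<dots> = (\<Oplus>\<^bsub>k\<^esub>y\<in>W. g (?i y) \<otimes>\<^bsub>k\<^esub> h (inv\<^bsub>G\<^esub> y \<otimes>\<^bsub>G\<^esub> x))"
      proof (intro k.finsum_cong' refl)
        fix y assume "y \<in> W"
        then have y: "y \<in> carrier G" using W by auto
        have "inv\<^bsub>G\<^esub> (?i y) \<otimes>\<^bsub>G\<^esub> (inv\<^bsub>G\<^esub> z \<otimes>\<^bsub>G\<^esub> x) = inv\<^bsub>G\<^esub> y \<otimes>\<^bsub>G\<^esub> x"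
        proof -
          have "z \<otimes>\<^bsub>G\<^esub> (inv\<^bsub>G\<^esub> z \<otimes>\<^bsub>G\<^esub> x) = x"
            using zG x by (simp add: G.m_assoc[symmetric])
          then show ?thesis
            using y zG x by (simp add: G.inv_mult_group G.m_assoc)
        qed
        then show "g (?i y) \<otimes>\<^bsub>k\<^esub> h (inv\<^bsub>G\<^esub> (?i y) \<otimes>\<^bsub>G\<^esub> (inv\<^bsub>G\<^esub> z \<otimes>\<^bsub>G\<^esub> x)) =
            g (?i y) \<otimes>\<^bsub>k\<^esub> h (inv\<^bsub>G\<^esub> y \<otimes>\<^bsub>G\<^esub> x)" by simp
      qed (use W zG x in \<open>auto intro!: k.m_closed cl\<close>)
      finally show ?thesis .
    qed
    have "(?m \<otimes>\<^bsub>group_ring k G\<^esub> h) x = (\<Oplus>\<^bsub>k\<^esub>y\<in>W. ?m y \<otimes>\<^bsub>k\<^esub> h (inv\<^bsub>G\<^esub> y \<otimes>\<^bsub>G\<^esub> x))"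
      by (rule group_ring_mult_eq[OF mc h W _ x]) (auto simp: W_def)
    also have "\<dots> = (\<Oplus>\<^bsub>k\<^esub>y\<in>W. \<Oplus>\<^bsub>k\<^esub>z\<in>?S. (f z \<otimes>\<^bsub>k\<^esub> g (inv\<^bsub>G\<^esub> z \<otimes>\<^bsub>G\<^esub> y)) \<otimes>\<^bsub>k\<^esub> h (inv\<^bsub>G\<^esub> y \<otimes>\<^bsub>G\<^esub> x))"
    proof (intro k.finsum_cong' refl)
      fix y assume "y \<in> W"
      then have y: "y \<in> carrier G" using W by auto
      show "?m y \<otimes>\<^bsub>k\<^esub> h (inv\<^bsub>G\<^esub> y \<otimes>\<^bsub>G\<^esub> x) =
        (\<Oplus>\<^bsub>k\<^esub>z\<in>?S. (f z \<otimes>\<^bsub>k\<^esub> g (inv\<^bsub>G\<^esub> z \<otimes>\<^bsub>G\<^esub> y)) \<otimes>\<^bsub>k\<^esub> h (inv\<^bsub>G\<^esub> y \<otimes>\<^bsub>G\<^esub> x))"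
        unfolding group_ring_mult_eq[OF f g S order_refl y]
        using S y x by (intro k.finsum_ldistr) (auto intro!: k.m_closed cl)
    qed (use W S x in \<open>auto intro!: k.finsum_closed k.m_closed cl\<close>)
    also have "\<dots> = (\<Oplus>\<^bsub>k\<^esub>z\<in>?S. \<Oplus>\<^bsub>k\<^esub>y\<in>W. (f z \<otimes>\<^bsub>k\<^esub> g (inv\<^bsub>G\<^esub> z \<otimes>\<^bsub>G\<^esub> y)) \<otimes>\<^bsub>k\<^esub> h (inv\<^bsub>G\<^esub> y \<otimes>\<^bsub>G\<^esub> x))"
    proof (rule finsum_swap[OF W(1) S(1)])
      fix y z assume "y \<in> W" "z \<in> ?S"
      then have "y \<in> carrier G" "z \<in> carrier G" using W S by auto
      then show "(f z \<otimes>\<^bsub>k\<^esub> g (inv\<^bsub>G\<^esub> z \<otimes>\<^bsub>G\<^esub> y)) \<otimes>\<^bsub>k\<^esub> h (inv\<^bsub>G\<^esub> y \<otimes>\<^bsub>G\<^esub> x) \<in> carrier k"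
        using x by (auto intro!: k.m_closed cl)
    qed
    also have "\<dots> = (\<Oplus>\<^bsub>k\<^esub>z\<in>?S. f z \<otimes>\<^bsub>k\<^esub> (g \<otimes>\<^bsub>group_ring k G\<^esub> h) (inv\<^bsub>G\<^esub> z \<otimes>\<^bsub>G\<^esub> x))"
    proof (intro k.finsum_cong' refl)
      fix z assume z: "z \<in> ?S"
      then have zG: "z \<in> carrier G" using S by auto
      have "(\<Oplus>\<^bsub>k\<^esub>y\<in>W. (f z \<otimes>\<^bsub>k\<^esub> g (inv\<^bsub>G\<^esub> z \<otimes>\<^bsub>G\<^esub> y)) \<otimes>\<^bsub>k\<^esub> h (inv\<^bsub>G\<^esub> y \<otimes>\<^bsub>G\<^esub> x)) =
        (\<Oplus>\<^bsub>k\<^esub>y\<in>W. f z \<otimes>\<^bsub>k\<^esub> (g (inv\<^bsub>G\<^esub> z \<otimes>\<^bsub>G\<^esub> y) \<otimes>\<^bsub>k\<^esub> h (inv\<^bsub>G\<^esub> y \<otimes>\<^bsub>G\<^esub> x)))"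
      proof (intro k.finsum_cong' refl)
        fix y assume "y \<in> W"
        then have y: "y \<in> carrier G" using W by auto
        show "(f z \<otimes>\<^bsub>k\<^esub> g (inv\<^bsub>G\<^esub> z \<otimes>\<^bsub>G\<^esub> y)) \<otimes>\<^bsub>k\<^esub> h (inv\<^bsub>G\<^esub> y \<otimes>\<^bsub>G\<^esub> x) =
          f z \<otimes>\<^bsub>k\<^esub> (g (inv\<^bsub>G\<^esub> z \<otimes>\<^bsub>G\<^esub> y) \<otimes>\<^bsub>k\<^esub> h (inv\<^bsub>G\<^esub> y \<otimes>\<^bsub>G\<^esub> x))"
          using y zG x by (intro k.m_assoc cl) auto
      qed (use W zG x in \<open>auto intro!: k.m_closed cl\<close>)
      also have "\<dots> = f z \<otimes>\<^bsub>k\<^esub> (g \<otimes>\<^bsub>group_ring k G\<^esub> h) (inv\<^bsub>G\<^esub> z \<otimes>\<^bsub>G\<^esub> x)"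
        unfolding inner[OF z]
        using W zG x by (intro k.finsum_rdistr[symmetric]) (auto intro!: k.m_closed cl)
      finally show "(\<Oplus>\<^bsub>k\<^esub>y\<in>W. (f z \<otimes>\<^bsub>k\<^esub> g (inv\<^bsub>G\<^esub> z \<otimes>\<^bsub>G\<^esub> y)) \<otimes>\<^bsub>k\<^esub> h (inv\<^bsub>G\<^esub> y \<otimes>\<^bsub>G\<^esub> x)) =
        f z \<otimes>\<^bsub>k\<^esub> (g \<otimes>\<^bsub>group_ring k G\<^esub> h) (inv\<^bsub>G\<^esub> z \<otimes>\<^bsub>G\<^esub> x)" .
    next
      have "(g \<otimes>\<^bsub>group_ring k G\<^esub> h) y \<in> carrier k" if "y \<in> carrier G" for y
        using gh that by (auto simp: group_ring_def [of k G])
      then show "(\<lambda>z. f z \<otimes>\<^bsub>k\<^esub> (g \<otimes>\<^bsub>group_ring k G\<^esub> h) (inv\<^bsub>G\<^esub> z \<otimes>\<^bsub>G\<^esub> x)) \<in> ?S \<rightarrow> carrier k"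
        using S x by (auto intro!: k.m_closed cl)
    qed
    also have "\<dots> = (f \<otimes>\<^bsub>group_ring k G\<^esub> (g \<otimes>\<^bsub>group_ring k G\<^esub> h)) x"
      by (rule group_ring_mult_eq[OF f gh S order_refl x, symmetric])
    finally show ?thesis .
  qed
qed

lemma group_ring_carrierD:
  assumes "f \<in> carrier (group_ring k G)"
  shows "finite {x. f x \<noteq> \<zero>\<^bsub>k\<^esub>}" "{x. f x \<noteq> \<zero>\<^bsub>k\<^esub>} \<subseteq> carrier G"
    "x \<in> carrier G \<Longrightarrow> f x \<in> carrier k" "x \<notin> carrier G \<Longrightarrow> f x = \<zero>\<^bsub>k\<^esub>" "f x \<in> carrier k"
  using assms by (auto simp: group_ring_def)

lemma group_ring_add_closed:
  assumes f: "f \<in> carrier (group_ring k G)" and g: "g \<in> carrier (group_ring k G)"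
  shows "f \<oplus>\<^bsub>group_ring k G\<^esub> g \<in> carrier (group_ring k G)"
proof -
  have "{x. f x \<oplus>\<^bsub>k\<^esub> g x \<noteq> \<zero>\<^bsub>k\<^esub>} \<subseteq> {x. f x \<noteq> \<zero>\<^bsub>k\<^esub>} \<union> {x. g x \<noteq> \<zero>\<^bsub>k\<^esub>}"
    by auto
  then have "finite {x. f x \<oplus>\<^bsub>k\<^esub> g x \<noteq> \<zero>\<^bsub>k\<^esub>}"
    using group_ring_carrierD(1)[OF f] group_ring_carrierD(1)[OF g]
    by (meson finite_Un finite_subset)
  then show ?thesis
    using f g by (auto simp: group_ring_def)
qed

lemma group_ring_one_closed: "\<one>\<^bsub>group_ring k G\<^esub> \<in> carrier (group_ring k G)"
proof -
  have "finite {x. (if x = \<one>\<^bsub>G\<^esub> then \<one>\<^bsub>k\<^esub> else \<zero>\<^bsub>k\<^esub>) \<noteq> \<zero>\<^bsub>k\<^esub>}"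
    by (rule finite_subset[of _ "{\<one>\<^bsub>G\<^esub>}"]) auto
  then show ?thesis by (auto simp: group_ring_def)
qed

lemma group_ring_l_one:
  assumes f: "f \<in> carrier (group_ring k G)"
  shows "\<one>\<^bsub>group_ring k G\<^esub> \<otimes>\<^bsub>group_ring k G\<^esub> f = f"
proof
  fix x
  show "(\<one>\<^bsub>group_ring k G\<^esub> \<otimes>\<^bsub>group_ring k G\<^esub> f) x = f x"
  proof (cases "x \<in> carrier G")
    case True
    have "{y. \<one>\<^bsub>group_ring k G\<^esub> y \<noteq> \<zero>\<^bsub>k\<^esub>} \<subseteq> {\<one>\<^bsub>G\<^esub>}"
      by (auto simp: group_ring_def)
    then have "(\<one>\<^bsub>group_ring k G\<^esub> \<otimes>\<^bsub>group_ring k G\<^esub> f) x =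
        (\<Oplus>\<^bsub>k\<^esub>y\<in>{\<one>\<^bsub>G\<^esub>}. \<one>\<^bsub>group_ring k G\<^esub> y \<otimes>\<^bsub>k\<^esub> f (inv\<^bsub>G\<^esub> y \<otimes>\<^bsub>G\<^esub> x))"
      using True by (intro group_ring_mult_eq group_ring_one_closed f) auto
    also have "\<dots> = f x"
      using True group_ring_carrierD(5)[OF f] by (simp add: group_ring_def)
    finally show ?thesis .
  qed (use group_ring_carrierD(4)[OF f] in \<open>simp add: group_ring_def\<close>)
qed

lemma group_ring_r_one:
  assumes f: "f \<in> carrier (group_ring k G)"
  shows "f \<otimes>\<^bsub>group_ring k G\<^esub> \<one>\<^bsub>group_ring k G\<^esub> = f"
proof
  fix x
  show "(f \<otimes>\<^bsub>group_ring k G\<^esub> \<one>\<^bsub>group_ring k G\<^esub>) x = f x"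
  proof (cases "x \<in> carrier G")
    case x: True
    let ?S = "insert x {y. f y \<noteq> \<zero>\<^bsub>k\<^esub>}"
    have S: "finite ?S" "?S \<subseteq> carrier G"
      using group_ring_carrierD[OF f] x by auto
    have "(f \<otimes>\<^bsub>group_ring k G\<^esub> \<one>\<^bsub>group_ring k G\<^esub>) x =
        (\<Oplus>\<^bsub>k\<^esub>y\<in>?S. f y \<otimes>\<^bsub>k\<^esub> \<one>\<^bsub>group_ring k G\<^esub> (inv\<^bsub>G\<^esub> y \<otimes>\<^bsub>G\<^esub> x))"
      using S x by (intro group_ring_mult_eq group_ring_one_closed f) auto
    also have "\<dots> = (\<Oplus>\<^bsub>k\<^esub>y\<in>?S. if x = y then f y else \<zero>\<^bsub>k\<^esub>)"
    proof (intro k.finsum_cong' refl)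
      fix y assume "y \<in> ?S"
      then have "y \<in> carrier G" using S by auto
      then have "inv\<^bsub>G\<^esub> y \<otimes>\<^bsub>G\<^esub> x = \<one>\<^bsub>G\<^esub> \<longleftrightarrow> x = y"
        using x by (metis G.inv_closed G.inv_equality G.inv_inv G.l_inv)
      then show "f y \<otimes>\<^bsub>k\<^esub> \<one>\<^bsub>group_ring k G\<^esub> (inv\<^bsub>G\<^esub> y \<otimes>\<^bsub>G\<^esub> x) = (if x = y then f y else \<zero>\<^bsub>k\<^esub>)"
        using group_ring_carrierD(5)[OF f] by (auto simp: group_ring_def)
    qed (use group_ring_carrierD(5)[OF f] in auto)
    also have "\<dots> = f x"
      using S group_ring_carrierD(5)[OF f] by (intro k.add.finprod_singleton) auto
    finally show ?thesis .
  qed (use group_ring_carrierD(4)[OF f] in \<open>simp add: group_ring_def\<close>)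
qed

lemma group_ring_l_distr:
  assumes f: "f \<in> carrier (group_ring k G)" and g: "g \<in> carrier (group_ring k G)"
    and h: "h \<in> carrier (group_ring k G)"
  shows "(f \<oplus>\<^bsub>group_ring k G\<^esub> g) \<otimes>\<^bsub>group_ring k G\<^esub> h =
    f \<otimes>\<^bsub>group_ring k G\<^esub> h \<oplus>\<^bsub>group_ring k G\<^esub> g \<otimes>\<^bsub>group_ring k G\<^esub> h"
proof
  fix x
  let ?S = "{y. f y \<noteq> \<zero>\<^bsub>k\<^esub>} \<union> {y. g y \<noteq> \<zero>\<^bsub>k\<^esub>}"
  note F = group_ring_carrierD[OF f] and Gg = group_ring_carrierD[OF g] and Hh = group_ring_carrierD[OF h]
  have S: "finite ?S" "?S \<subseteq> carrier G" using F Gg by auto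
  show "((f \<oplus>\<^bsub>group_ring k G\<^esub> g) \<otimes>\<^bsub>group_ring k G\<^esub> h) x =
    (f \<otimes>\<^bsub>group_ring k G\<^esub> h \<oplus>\<^bsub>group_ring k G\<^esub> g \<otimes>\<^bsub>group_ring k G\<^esub> h) x"
  proof (cases "x \<in> carrier G")
    case x: True
    have add: "(p \<oplus>\<^bsub>group_ring k G\<^esub> q) y = p y \<oplus>\<^bsub>k\<^esub> q y" for p q y
      by (simp add: group_ring_def)
    have "((f \<oplus>\<^bsub>group_ring k G\<^esub> g) \<otimes>\<^bsub>group_ring k G\<^esub> h) x =
      (\<Oplus>\<^bsub>k\<^esub>y\<in>?S. (f \<oplus>\<^bsub>group_ring k G\<^esub> g) y \<otimes>\<^bsub>k\<^esub> h (inv\<^bsub>G\<^esub> y \<otimes>\<^bsub>G\<^esub> x))"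
      by (rule group_ring_mult_eq[OF group_ring_add_closed[OF f g] h S _ x]) (auto simp: add)
    also have "\<dots> = (\<Oplus>\<^bsub>k\<^esub>y\<in>?S. f y \<otimes>\<^bsub>k\<^esub> h (inv\<^bsub>G\<^esub> y \<otimes>\<^bsub>G\<^esub> x) \<oplus>\<^bsub>k\<^esub> g y \<otimes>\<^bsub>k\<^esub> h (inv\<^bsub>G\<^esub> y \<otimes>\<^bsub>G\<^esub> x))"
      using F(5) Gg(5) Hh(5) by (intro k.finsum_cong' refl) (auto simp: add k.l_distr)
    also have "\<dots> = (\<Oplus>\<^bsub>k\<^esub>y\<in>?S. f y \<otimes>\<^bsub>k\<^esub> h (inv\<^bsub>G\<^esub> y \<otimes>\<^bsub>G\<^esub> x)) \<oplus>\<^bsub>k\<^esub>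
        (\<Oplus>\<^bsub>k\<^esub>y\<in>?S. g y \<otimes>\<^bsub>k\<^esub> h (inv\<^bsub>G\<^esub> y \<otimes>\<^bsub>G\<^esub> x))"
      using F(5) Gg(5) Hh(5) by (intro k.finsum_addf) auto
    also have "\<dots> = (f \<otimes>\<^bsub>group_ring k G\<^esub> h \<oplus>\<^bsub>group_ring k G\<^esub> g \<otimes>\<^bsub>group_ring k G\<^esub> h) x"
      by (simp add: add group_ring_mult_eq[OF f h S _ x] group_ring_mult_eq[OF g h S _ x])
    finally show ?thesis .
  qed (simp add: group_ring_def)
qed

lemma group_ring_r_distr:
  assumes f: "f \<in> carrier (group_ring k G)" and g: "g \<in> carrier (group_ring k G)"
    and h: "h \<in> carrier (group_ring k G)"
  shows "h \<otimes>\<^bsub>group_ring k G\<^esub> (f \<oplus>\<^bsub>group_ring k G\<^esub> g) =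
    h \<otimes>\<^bsub>group_ring k G\<^esub> f \<oplus>\<^bsub>group_ring k G\<^esub> h \<otimes>\<^bsub>group_ring k G\<^esub> g"
proof
  fix x
  let ?S = "{y. h y \<noteq> \<zero>\<^bsub>k\<^esub>}"
  note F = group_ring_carrierD[OF f] and Gg = group_ring_carrierD[OF g] and Hh = group_ring_carrierD[OF h]
  have S: "finite ?S" "?S \<subseteq> carrier G" using Hh by auto
  show "(h \<otimes>\<^bsub>group_ring k G\<^esub> (f \<oplus>\<^bsub>group_ring k G\<^esub> g)) x =
    (h \<otimes>\<^bsub>group_ring k G\<^esub> f \<oplus>\<^bsub>group_ring k G\<^esub> h \<otimes>\<^bsub>group_ring k G\<^esub> g) x"
  proof (cases "x \<in> carrier G")
    case x: True
    have add: "(p \<oplus>\<^bsub>group_ring k G\<^esub> q) y = p y \<oplus>\<^bsub>k\<^esub> q y" for p q y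
      by (simp add: group_ring_def)
    show ?thesis
      unfolding add group_ring_mult_eq[OF h f S order_refl x]
        group_ring_mult_eq[OF h g S order_refl x]
        group_ring_mult_eq[OF h group_ring_add_closed[OF f g] S order_refl x]
      using F(5) Gg(5) Hh(5) by (subst k.finsum_addf[symmetric]) (auto simp: k.r_distr)
  qed (simp add: group_ring_def)
qed

lemma ring_group_ring: "Ring.ring (group_ring k G)"
proof (rule ringI)
  show "abelian_group (group_ring k G)"
  proof (rule abelian_groupI)
    fix f assume f: "f \<in> carrier (group_ring k G)"
    note F = group_ring_carrierD[OF f]
    let ?g = "\<lambda>x. \<ominus>\<^bsub>k\<^esub> f x"
    have "{x. ?g x \<noteq> \<zero>\<^bsub>k\<^esub>} \<subseteq> {x. f x \<noteq> \<zero>\<^bsub>k\<^esub>}" by auto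
    then have "?g \<in> carrier (group_ring k G)"
      using F by (auto simp: group_ring_def intro: finite_subset)
    moreover have "?g \<oplus>\<^bsub>group_ring k G\<^esub> f = \<zero>\<^bsub>group_ring k G\<^esub>"
      using F(5) by (auto simp: group_ring_def k.l_neg)
    ultimately show "\<exists>g\<in>carrier (group_ring k G). g \<oplus>\<^bsub>group_ring k G\<^esub> f = \<zero>\<^bsub>group_ring k G\<^esub>"
      by blast
  next
    fix f g h
    assume f: "f \<in> carrier (group_ring k G)" and g: "g \<in> carrier (group_ring k G)"
      and h: "h \<in> carrier (group_ring k G)"
    show "f \<oplus>\<^bsub>group_ring k G\<^esub> g \<oplus>\<^bsub>group_ring k G\<^esub> h =
      f \<oplus>\<^bsub>group_ring k G\<^esub> (g \<oplus>\<^bsub>group_ring k G\<^esub> h)"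
      using group_ring_carrierD(5)[OF f] group_ring_carrierD(5)[OF g] group_ring_carrierD(5)[OF h]
      by (auto simp: group_ring_def k.a_assoc)
  next
    fix f g
    assume f: "f \<in> carrier (group_ring k G)" and g: "g \<in> carrier (group_ring k G)"
    show "f \<oplus>\<^bsub>group_ring k G\<^esub> g = g \<oplus>\<^bsub>group_ring k G\<^esub> f"
      using group_ring_carrierD(5)[OF f] group_ring_carrierD(5)[OF g]
      by (auto simp: group_ring_def k.a_comm)
  next
    fix f assume f: "f \<in> carrier (group_ring k G)"
    show "\<zero>\<^bsub>group_ring k G\<^esub> \<oplus>\<^bsub>group_ring k G\<^esub> f = f"
      using group_ring_carrierD(5)[OF f] by (auto simp: group_ring_def)
  next
    fix f g
    assume "f \<in> carrier (group_ring k G)" and "g \<in> carrier (group_ring k G)"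
    then show "f \<oplus>\<^bsub>group_ring k G\<^esub> g \<in> carrier (group_ring k G)"
      by (rule group_ring_add_closed)
  next
    show "\<zero>\<^bsub>group_ring k G\<^esub> \<in> carrier (group_ring k G)"
      by (simp add: group_ring_def)
  qed
  show "Group.monoid (group_ring k G)"
    by (rule monoidI) (simp_all add: group_ring_mult_closed group_ring_one_closed
        group_ring_mult_assoc group_ring_l_one group_ring_r_one)
qed (simp_all add: group_ring_l_distr group_ring_r_distr)

end

lemma left_module_restrict:
  fixes k :: "'k ring" and G :: "'a monoid"
  assumes k: "cring k" and G: "Group.group G"
    and M: "left_module (group_ring k G) M" and H: "subgroup H G"
  shows "left_module (group_ring k (G\<lparr>carrier := H\<rparr>)) M"
proof -
  interpret k: cring k by (rule k)
  interpret G: Group.group G by (rule G)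
  let ?R = "group_ring k G" and ?S = "group_ring k (G\<lparr>carrier := H\<rparr>)"
  interpret M: left_module ?R M by (rule M)
  interpret H: Group.group "G\<lparr>carrier := H\<rparr>" by (rule G.subgroup_imp_group[OF H])
  have HG: "H \<subseteq> carrier G" using H by (rule subgroup.subset)
  have sub: "carrier ?S \<subseteq> carrier ?R"
    using HG by (auto simp: group_ring_def subset_iff)
  have mult: "f \<otimes>\<^bsub>?S\<^esub> g = f \<otimes>\<^bsub>?R\<^esub> g" if f: "f \<in> carrier ?S" and g: "g \<in> carrier ?S" for f g
  proof
    fix x
    note F = group_ring_carrierD[OF k G subsetD[OF sub f]]
      and Gg = group_ring_carrierD[OF k G subsetD[OF sub g]]
    have f0: "f y = \<zero>\<^bsub>k\<^esub>" and g0: "g y = \<zero>\<^bsub>k\<^esub>" if "y \<notin> H" for y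
      using f g that by (auto simp: group_ring_def)
    have eq: "{y \<in> H. f y \<noteq> \<zero>\<^bsub>k\<^esub>} = {y \<in> carrier G. f y \<noteq> \<zero>\<^bsub>k\<^esub>}"
      using f0 HG by auto
    have "(\<Oplus>\<^bsub>k\<^esub>y\<in>{y \<in> carrier G. f y \<noteq> \<zero>\<^bsub>k\<^esub>}. f y \<otimes>\<^bsub>k\<^esub> g (inv\<^bsub>G\<^esub> y \<otimes>\<^bsub>G\<^esub> x)) = \<zero>\<^bsub>k\<^esub>"
      if x: "x \<in> carrier G" "x \<notin> H"
    proof (intro k.add.finprod_one_eqI)
      fix y assume "y \<in> {y \<in> carrier G. f y \<noteq> \<zero>\<^bsub>k\<^esub>}"
      then have y: "y \<in> H" "y \<in> carrier G" using f0 by auto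
      have "inv\<^bsub>G\<^esub> y \<otimes>\<^bsub>G\<^esub> x \<notin> H"
      proof
        assume "inv\<^bsub>G\<^esub> y \<otimes>\<^bsub>G\<^esub> x \<in> H"
        then have "y \<otimes>\<^bsub>G\<^esub> (inv\<^bsub>G\<^esub> y \<otimes>\<^bsub>G\<^esub> x) \<in> H"
          using y H by (simp add: subgroup.m_closed)
        then show False
          using x y by (simp add: G.m_assoc[symmetric])
      qed
      then show "f y \<otimes>\<^bsub>k\<^esub> g (inv\<^bsub>G\<^esub> y \<otimes>\<^bsub>G\<^esub> x) = \<zero>\<^bsub>k\<^esub>"
        using F(5) g0 by simp
    qed
    moreover have "(\<Oplus>\<^bsub>k\<^esub>y\<in>{y \<in> H. f y \<noteq> \<zero>\<^bsub>k\<^esub>}.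
        f y \<otimes>\<^bsub>k\<^esub> g (inv\<^bsub>G\<lparr>carrier := H\<rparr>\<^esub> y \<otimes>\<^bsub>G\<^esub> x)) =
      (\<Oplus>\<^bsub>k\<^esub>y\<in>{y \<in> carrier G. f y \<noteq> \<zero>\<^bsub>k\<^esub>}. f y \<otimes>\<^bsub>k\<^esub> g (inv\<^bsub>G\<^esub> y \<otimes>\<^bsub>G\<^esub> x))"
      unfolding eq
    proof (intro k.finsum_cong' refl)
      fix y assume "y \<in> {y \<in> carrier G. f y \<noteq> \<zero>\<^bsub>k\<^esub>}"
      then have "y \<in> H" using f0 by auto
      then show "f y \<otimes>\<^bsub>k\<^esub> g (inv\<^bsub>G\<lparr>carrier := H\<rparr>\<^esub> y \<otimes>\<^bsub>G\<^esub> x) =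
          f y \<otimes>\<^bsub>k\<^esub> g (inv\<^bsub>G\<^esub> y \<otimes>\<^bsub>G\<^esub> x)"
        by (simp add: G.m_inv_consistent[OF H])
    qed (use F(5) Gg(5) in auto)
    ultimately show "(f \<otimes>\<^bsub>?S\<^esub> g) x = (f \<otimes>\<^bsub>?R\<^esub> g) x"
      using HG by (auto simp: group_ring_def)
  qed
  interpret S: Ring.ring ?S
    by (rule ring_group_ring[OF k H.is_group])
  have "\<one>\<^bsub>?S\<^esub> = \<one>\<^bsub>?R\<^esub>" "\<And>f g. f \<oplus>\<^bsub>?S\<^esub> g = f \<oplus>\<^bsub>?R\<^esub> g"
    by (simp_all add: group_ring_def)
  then show ?thesis
    using sub mult
    by (intro left_module.intro S.ring_axioms M.M.abelian_group_axioms left_module_axioms.intro)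
       (auto simp: subset_iff M.smult_closed M.smult_l_distr M.smult_r_distr M.smult_assoc M.smult_one)
qed

section \<open>CW-complexes with a group action\<close>

definition unit_disc :: "nat \<Rightarrow> (nat \<Rightarrow> real) topology" where
  "unit_disc n = subtopology (Euclidean_space n) {x. (\<Sum>i<n. (x i)\<^sup>2) \<le> 1}"

definition open_unit_disc :: "nat \<Rightarrow> (nat \<Rightarrow> real) topology" where
  "open_unit_disc n = subtopology (Euclidean_space n) {x. (\<Sum>i<n. (x i)\<^sup>2) < 1}"

text \<open>\<^verbatim>\<open>E n\<close> is the set of open \<^verbatim>\<open>n\<close>-cells, as subsets of the space.\<close>

definition characteristic_map ::
  "'x topology \<Rightarrow> (nat \<Rightarrow> 'x set set) \<Rightarrow> nat \<Rightarrow> 'x set \<Rightarrow> ((nat \<Rightarrow> real) \<Rightarrow> 'x) \<Rightarrow> bool" where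
  "characteristic_map X E n e h \<longleftrightarrow>
     continuous_map (unit_disc n) X h \<and>
     homeomorphic_map (open_unit_disc n) (subtopology X e) h \<and>
     (\<exists>F. finite F \<and> F \<subseteq> (\<Union>m<n. E m) \<and>
          h ` (topspace (unit_disc n) - topspace (open_unit_disc n)) \<subseteq> \<Union>F)"

definition CW_complex :: "'x topology \<Rightarrow> (nat \<Rightarrow> 'x set set) \<Rightarrow> bool" where
  "CW_complex X E \<longleftrightarrow>
     Hausdorff_space X \<and>
     (\<Union>n. \<Union>(E n)) = topspace X \<and>
     (\<forall>m n. \<forall>e\<in>E m. \<forall>e'\<in>E n. (m, e) \<noteq> (n, e') \<longrightarrow> e \<inter> e' = {}) \<and>
     (\<forall>n. \<forall>e\<in>E n. \<exists>h. characteristic_map X E n e h) \<and>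
     (\<forall>A. A \<subseteq> topspace X \<and> (\<forall>n. \<forall>e\<in>E n. closedin X (A \<inter> X closure_of e)) \<longrightarrow> closedin X A)"

text \<open>For a discrete group, a \<^verbatim>\<open>G\<close>-CW-complex is a CW-complex with an action by
  cell-permuting homeomorphisms in which an element fixing a cell setwise fixes it pointwise.\<close>

definition G_CW_complex ::
  "'a monoid \<Rightarrow> 'x topology \<Rightarrow> (nat \<Rightarrow> 'x set set) \<Rightarrow> ('a \<Rightarrow> 'x \<Rightarrow> 'x) \<Rightarrow> bool" where
  "G_CW_complex G X E \<phi> \<longleftrightarrow>
     CW_complex X E \<and> group_action G (topspace X) \<phi> \<and>
     (\<forall>g\<in>carrier G. homeomorphic_map X X (\<phi> g)) \<and>
     (\<forall>g\<in>carrier G. \<forall>n. \<forall>e\<in>E n. \<phi> g ` e \<in> E n) \<and>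
     (\<forall>g\<in>carrier G. \<forall>n. \<forall>e\<in>E n. \<phi> g ` e = e \<longrightarrow> (\<forall>x\<in>e. \<phi> g x = x))"

text \<open>Nonemptiness must be required explicitly: the library counts the empty space as
  contractible.\<close>

definition fin_dim_contractible_G_CW ::
  "'a monoid \<Rightarrow> 'x topology \<Rightarrow> (nat \<Rightarrow> 'x set set) \<Rightarrow> ('a \<Rightarrow> 'x \<Rightarrow> 'x) \<Rightarrow> bool" where
  "fin_dim_contractible_G_CW G X E \<phi> \<longleftrightarrow>
     G_CW_complex G X E \<phi> \<and> (\<exists>N. \<forall>n>N. E n = {}) \<and>
     topspace X \<noteq> {} \<and> contractible_space X"

section \<open>Ordinals\<close>

text \<open>The order types of all well-orders on subsets of \<^verbatim>\<open>'x\<close>, that is, all ordinals of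
  cardinality at most \<^verbatim>\<open>|'x|\<close>.\<close>

lemma Well_order_empty: "Well_order ({} :: 'x rel)"
  by (simp add: well_order_on_def linear_order_on_def partial_order_on_def preorder_on_def
      refl_on_def trans_def antisym_def total_on_def)

lemma ordLeq_empty: "Well_order r \<Longrightarrow> ({} :: 'x rel, r) \<in> ordLeq"
  by (auto simp: ordLeq_def embed_def Well_order_empty)

quotient_type 'x ordinal = "'x rel" / partial: "\<lambda>r s. (r, s) \<in> ordIso"
proof (rule part_equivpI)
  show "\<exists>r :: 'x rel. (r, r) \<in> ordIso"
    by (rule exI[of _ "{}"]) (simp add: ordIso_reflexive Well_order_empty)
  show "symp (\<lambda>r s :: 'x rel. (r, s) \<in> ordIso)"
    by (rule sympI) (rule ordIso_symmetric)
  show "transp (\<lambda>r s :: 'x rel. (r, s) \<in> ordIso)"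
    by (rule transpI) (rule ordIso_transitive)
qed

instantiation ordinal :: (type) "{wellorder, zero}"
begin

lift_definition zero_ordinal :: "'a ordinal" is "{}"
  by (simp add: ordIso_reflexive Well_order_empty)

lift_definition less_eq_ordinal :: "'a ordinal \<Rightarrow> 'a ordinal \<Rightarrow> bool"
  is "\<lambda>r s. (r, s) \<in> ordLeq"
  by (meson ordIso_ordLeq_trans ordLeq_ordIso_trans ordIso_symmetric)

lift_definition less_ordinal :: "'a ordinal \<Rightarrow> 'a ordinal \<Rightarrow> bool"
  is "\<lambda>r s. (r, s) \<in> ordLess"
  by (meson ordIso_ordLess_trans ordLess_ordIso_trans ordIso_symmetric)

instance
proof
  fix x y z :: "'a ordinal"
  show "x < y \<longleftrightarrow> x \<le> y \<and> \<not> y \<le> x"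
    by transfer (metis not_ordLess_ordLeq ordLess_imp_ordLeq ordLess_or_ordLeq ordIso_iff_ordLeq ordLeq_Well_order_simp)
  show "x \<le> x"
    by transfer (metis ordIso_iff_ordLeq)
  show "x \<le> y \<Longrightarrow> y \<le> z \<Longrightarrow> x \<le> z"
    by transfer (rule ordLeq_transitive)
  show "x \<le> y \<Longrightarrow> y \<le> x \<Longrightarrow> x = y"
    by transfer (simp add: ordIso_iff_ordLeq)
  show "x \<le> y \<or> y \<le> x"
    by transfer (metis ordIso_iff_ordLeq ordLeq_Well_order_simp ordLeq_total)
next
  fix P :: "'a ordinal \<Rightarrow> bool" and a
  assume step: "\<And>x. (\<And>y. y < x \<Longrightarrow> P y) \<Longrightarrow> P x"
  have "wf {(x, y). x < (y :: 'a ordinal)}"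
  proof (rule wf_subset)
    show "wf (inv_image ordLess (rep_ordinal :: 'a ordinal \<Rightarrow> 'a rel))"
      by (rule wf_inv_image) (rule wf_ordLess)
    have "(rep_ordinal x, rep_ordinal y) \<in> ordLess" if "x < y" for x y :: "'a ordinal"
      using that by (simp add: less_ordinal.rep_eq)
    then show "{(x, y). x < (y :: 'a ordinal)} \<subseteq> inv_image ordLess rep_ordinal"
      by (auto simp: inv_image_def)
  qed
  then show "P a"
    by (induction a rule: wf_induct_rule) (auto intro: step)
qed

end

lemma zero_le_ordinal: "0 \<le> (\<alpha> :: 'x ordinal)"
  by transfer (metis ordIso_iff_ordLeq ordLeq_Well_order_simp ordLeq_empty)

definition is_successor :: "'x ordinal \<Rightarrow> 'x ordinal \<Rightarrow> bool" where
  "is_successor \<alpha> \<beta> \<longleftrightarrow> \<beta> < \<alpha> \<and> (\<forall>\<gamma>. \<beta> < \<gamma> \<longrightarrow> \<alpha> \<le> \<gamma>)"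

section \<open>Operations on group classes\<close>

text \<open>The transfinite hierarchies below are increasing sequences of subsets of the type
  \<^verbatim>\<open>'a monoid\<close>. Such a sequence becomes stationary at an ordinal of cardinality at most
  that of \<^verbatim>\<open>'a monoid\<close>, so unions over \<^verbatim>\<open>'a monoid ordinal\<close> are unions over all
  ordinals.\<close>

definition finite_groups :: "'a monoid set" where
  "finite_groups = {G. Group.group G \<and> finite (carrier G)}"

function H_stage :: "'u itself \<Rightarrow> 'a monoid set \<Rightarrow> 'a monoid ordinal \<Rightarrow> 'a monoid set" where
  "H_stage U \<CC> \<alpha> =
     (if \<alpha> = 0 then \<CC>
      else {G. Group.group G \<and>
              (\<exists>(X :: ('a, 'u) universe topology) E \<phi>.
                 fin_dim_contractible_G_CW G X E \<phi> \<and>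
                 (\<forall>x\<in>topspace X. \<exists>\<beta>\<in>{..<\<alpha>}.
                    G\<lparr>carrier := stabilizer G \<phi> x\<rparr> \<in> H_stage U \<CC> \<beta>))})"
  by pat_completeness auto
termination
  by (relation "inv_image {(x, y). x < y} (\<lambda>(U, \<CC>, \<alpha>). \<alpha>)") (auto intro: wf)

declare H_stage.simps [simp del]

definition H_class :: "'u itself \<Rightarrow> 'a monoid set \<Rightarrow> 'a monoid set" where
  "H_class U \<CC> = (\<Union>\<alpha>. H_stage U \<CC> \<alpha>)"

definition LH_class :: "'u itself \<Rightarrow> 'a monoid set \<Rightarrow> 'a monoid set" where
  "LH_class U \<CC> = {G. Group.group G \<and>
     (\<forall>A. finite A \<and> A \<subseteq> carrier G \<longrightarrow>
        (\<exists>K. subgroup K G \<and> generate G A \<subseteq> K \<and> G\<lparr>carrier := K\<rparr> \<in> H_class U \<CC>))}"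

definition Phi_inj :: "'u itself \<Rightarrow> 'k ring \<Rightarrow> 'a monoid set \<Rightarrow> 'a monoid set" where
  "Phi_inj U k \<CC> = {G. Group.group G \<and>
     (\<forall>M :: ('a \<Rightarrow> 'k, 'u) lmod. left_module (group_ring k G) M \<longrightarrow>
        (inj_dim (group_ring k G) M < \<infinity> \<longleftrightarrow>
         (\<exists>n :: nat. \<forall>C. subgroup C G \<and> G\<lparr>carrier := C\<rparr> \<in> \<CC> \<longrightarrow>
            inj_dim (group_ring k (G\<lparr>carrier := C\<rparr>)) M \<le> enat n)))}"

function F_stage :: "'u itself \<Rightarrow> 'k ring \<Rightarrow> 'a monoid ordinal \<Rightarrow> 'a monoid set" where
  "F_stage U k \<alpha> =
     (if \<alpha> = 0 then finite_groups
      else if \<exists>\<beta>. is_successor \<alpha> \<beta>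
      then \<Union>\<beta>\<in>{\<beta>. is_successor \<alpha> \<beta>}. LH_class U (F_stage U k \<beta>) \<union> Phi_inj U k (F_stage U k \<beta>)
      else \<Union>\<beta>\<in>{..<\<alpha>}. F_stage U k \<beta>)"
  by pat_completeness auto
termination
  by (relation "inv_image {(x, y). x < y} (\<lambda>(U, k, \<alpha>). \<alpha>)")
     (auto intro: wf simp: is_successor_def)

declare F_stage.simps [simp del]

definition F_hat :: "'u itself \<Rightarrow> 'k ring \<Rightarrow> 'a monoid set" where
  "F_hat U k = (\<Union>\<alpha>. F_stage U k \<alpha>)"

definition torsion_free :: "'a monoid \<Rightarrow> bool" where
  "torsion_free G \<longleftrightarrow>
     (\<forall>x\<in>carrier G. \<forall>n::nat. n > 0 \<and> x [^]\<^bsub>G\<^esub> n = \<one>\<^bsub>G\<^esub> \<longrightarrow> x = \<one>\<^bsub>G\<^esub>)"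

end

(* Call a group good if every acyclic complex of injective modules over its integral group ring is
   contractible. By transfinite induction every torsion-free group in a stage of the hierarchy is
   good. A finite torsion-free group is trivial, and the cycles of an acyclic complex of divisible
   groups are divisible. Goodness passes to subgroups by coinduction.

   For a group in Phi_inj, the cycles of the product of all the shifts of the complex to the right
   have injective dimension 0 over the good subgroups, hence finite injective dimension; comparing
   injective resolutions (Schanuel) then shows that the cycles of the complex itself, being
   syzygies of arbitrarily high order of a retract of that product, are injective.

   Otherwise let Z be the cycles of C in degree i, and let J be the complex of additive maps from Z
   to C with the diagonal action. A splitting of C at i is an invariant preimage of the
   invariant cocycle Z -> C(i) of J. On a good subgroup J is equivariantly contractible, and J is
   relatively injective in each degree: there is an averaging operator from functions on the group
   to J. If the group is the union of a well-ordered chain of good subgroups, an invariant preimage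
   is built along the chain; this reduces LH to H by induction on the cardinality of generating
   sets. If the group acts on a contractible CW-complex of dimension N with good stabilizers, cells
   have disjoint equivariant open neighbourhoods in each dimension. Cochains on the singular
   simplices that are small for this cover can be contracted locally, on the neighbourhood of the cell
   of least dimension, up to a term of lower level; after N + 1 steps the given cocycle is the
   coboundary of a finite family, and averaging turns this family into an invariant preimage. *)
theory Submission
  imports Defs "HOL-Homology.Homology"
begin

section \<open>Equivariant complexes and chains of subgroups\<close>

text \<open>Two facts obstruct a direct proof: the complex is unbounded on both sides, so induction
  on the degree has no start, and the preimages found over good subgroups are not unique, so they do
  not fit together. Finiteness has to come from the group. For an action it is the dimension N:
  levels bound the number of corrections, each correction adds at most one component, and so the
  family obtained is finite and can be pushed down to component 0. For \<open>Phi_inj\<close> it is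
  an injective dimension; since the degree in which to compare resolutions depends on that dimension
  and the dimension on the module, all shifts are treated at once. For chains of subgroups the
  well-order provides the induction. Averaging replaces the vanishing of group cohomology with
  coefficients in J: every C(q) is a retract of the functions from G to C(q). Small singular chains
  replace cellular chains: they are free, acyclic in positive degrees, and each small simplex
  determines a cell equivariantly. Torsion-freeness is inherited by subgroups and enters at the
  finite groups.\<close>

lemmas (in abelian_group) abelian_group_simprules
  [algebra abelian_group "ring.zero G" "ring.add G" "a_inv G" "a_minus G"] =
  a_closed zero_closed a_inv_closed minus_closed a_assoc l_zero l_neg a_comm minus_eq
  r_zero r_neg r_neg2 r_neg1 minus_add minus_minus minus_zero a_lcomm

lemma (in abelian_group) minus_self: "x \<in> carrier G \<Longrightarrow> x \<ominus> x = \<zero>"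
  by (simp add: minus_eq r_neg)

text \<open>Left translation makes G a free \<open>H\<close>-set: choosing a point in every right
  coset of \<open>H\<close> writes each g uniquely as an element of \<open>H\<close> times the
  chosen point, and \<kappa> is the first factor. Composition with \<kappa> turns functions on
  \<open>H\<close> into functions on G, so that an average over G also serves every
  subgroup.\<close>

lemma (in Group.group) left_equivariant_retraction:
  assumes H: "subgroup H G"
  obtains \<kappa> where "\<And>g. g \<in> carrier G \<Longrightarrow> \<kappa> g \<in> H"
    and "\<And>h g. h \<in> H \<Longrightarrow> g \<in> carrier G \<Longrightarrow> \<kappa> (h \<otimes> g) = h \<otimes> \<kappa> g"
proof
  interpret H: subgroup H G by (rule H)
  define r where "r g = (SOME x. x \<in> H #> g)" for g
  have r: "r g \<in> H #> g" if "g \<in> carrier G" for g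
    unfolding r_def using rcos_self[OF that H] by (rule someI)
  let ?\<kappa> = "\<lambda>g. g \<otimes> inv (r g)"
  show "?\<kappa> g \<in> H" if g: "g \<in> carrier G" for g
  proof -
    obtain h where h: "h \<in> H" "r g = h \<otimes> g" using r[OF g] by (auto simp: r_coset_def)
    then have "?\<kappa> g = inv h" using g H.mem_carrier by (simp add: inv_mult_group m_assoc[symmetric])
    then show ?thesis using h by simp
  qed
  show "?\<kappa> (h \<otimes> g) = h \<otimes> ?\<kappa> g" if h: "h \<in> H" and g: "g \<in> carrier G" for h g
  proof -
    have "h \<otimes> g \<in> H #> g" using h by (auto simp: r_coset_def)
    then have "H #> (h \<otimes> g) = H #> g"
      using repr_independence[OF _ g H] by metis
    then have "r (h \<otimes> g) = r g" by (simp add: r_def)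
    moreover have "r g \<in> carrier G" using r[OF g] r_coset_subset_G[OF H.subset g] by auto
    ultimately show ?thesis using h g by (simp add: m_assoc)
  qed
qed

text \<open>The operator \<rho> exhibits each \<open>J q\<close> as a retract of the functions from
  G to \<open>J q\<close>, embedded as constants; by \<open>\<rho>_act\<close> the functions carry
  the action that sends u to g |-> h u(h^-1 g). This is relative injectivity, and it is what kills
  group cohomology with coefficients in \<open>J q\<close>. Exactness enters only through
  \<open>contracts\<close>. Premises such as \<open>q' = q + 1\<close> let a degree be written in
  whatever form a later step needs.\<close>

locale equivariant_complex = Group.group G for G :: "'a monoid" (structure) +
  fixes J :: "int \<Rightarrow> 'j ring" and act :: "int \<Rightarrow> 'a \<Rightarrow> 'j \<Rightarrow> 'j"
    and d :: "int \<Rightarrow> 'j \<Rightarrow> 'j" and \<rho> :: "int \<Rightarrow> ('a \<Rightarrow> 'j) \<Rightarrow> 'j"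
  assumes J_abelian_group: "abelian_group (J q)"
    and act_closed [simp]: "\<lbrakk>g \<in> carrier G; x \<in> carrier (J q)\<rbrakk> \<Longrightarrow> act q g x \<in> carrier (J q)"
    and act_add: "\<lbrakk>g \<in> carrier G; x \<in> carrier (J q); y \<in> carrier (J q)\<rbrakk> \<Longrightarrow>
      act q g (x \<oplus>\<^bsub>J q\<^esub> y) = act q g x \<oplus>\<^bsub>J q\<^esub> act q g y"
    and act_one [simp]: "x \<in> carrier (J q) \<Longrightarrow> act q \<one> x = x"
    and act_mult: "\<lbrakk>g \<in> carrier G; h \<in> carrier G; x \<in> carrier (J q)\<rbrakk> \<Longrightarrow>
      act q (g \<otimes> h) x = act q g (act q h x)"
    and d_closed: "\<lbrakk>x \<in> carrier (J q); q' = q + 1\<rbrakk> \<Longrightarrow> d q x \<in> carrier (J q')"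
    and d_add: "\<lbrakk>x \<in> carrier (J q); y \<in> carrier (J q); q' = q + 1\<rbrakk> \<Longrightarrow>
      d q (x \<oplus>\<^bsub>J q\<^esub> y) = d q x \<oplus>\<^bsub>J q'\<^esub> d q y"
    and d_d: "\<lbrakk>x \<in> carrier (J q); q' = q + 1; q'' = q + 2\<rbrakk> \<Longrightarrow> d q' (d q x) = \<zero>\<^bsub>J q''\<^esub>"
    and d_act: "\<lbrakk>g \<in> carrier G; x \<in> carrier (J q); q' = q + 1\<rbrakk> \<Longrightarrow>
      d q (act q g x) = act q' g (d q x)"
    and \<rho>_closed: "(\<And>g. g \<in> carrier G \<Longrightarrow> u g \<in> carrier (J q)) \<Longrightarrow> \<rho> q u \<in> carrier (J q)"
    and \<rho>_cong: "(\<And>g. g \<in> carrier G \<Longrightarrow> u g = v g) \<Longrightarrow> \<rho> q u = \<rho> q v"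
    and \<rho>_add: "\<lbrakk>\<And>g. g \<in> carrier G \<Longrightarrow> u g \<in> carrier (J q);
        \<And>g. g \<in> carrier G \<Longrightarrow> v g \<in> carrier (J q)\<rbrakk> \<Longrightarrow>
      \<rho> q (\<lambda>g. u g \<oplus>\<^bsub>J q\<^esub> v g) = \<rho> q u \<oplus>\<^bsub>J q\<^esub> \<rho> q v"
    and \<rho>_act: "\<lbrakk>h \<in> carrier G; \<And>g. g \<in> carrier G \<Longrightarrow> u g \<in> carrier (J q)\<rbrakk> \<Longrightarrow>
      \<rho> q (\<lambda>g. act q h (u (inv h \<otimes> g))) = act q h (\<rho> q u)"
    and \<rho>_const: "x \<in> carrier (J q) \<Longrightarrow> \<rho> q (\<lambda>_. x) = x"
begin

sublocale J: abelian_group "J q" for q by (rule J_abelian_group)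

text \<open>A contracting homotopy that commutes with the elements of \<open>H\<close>.
  \<open>H\<close> may be any set: a subgroup in the chain argument, a setwise stabilizer for a
  cover, and the empty set when only additivity is asked.\<close>

definition contracts :: "'a set \<Rightarrow> (int \<Rightarrow> 'j \<Rightarrow> 'j) \<Rightarrow> bool" where
  "contracts H s \<longleftrightarrow> (\<forall>q. \<forall>x\<in>carrier (J q). s q x \<in> carrier (J (q - 1)) \<and>
     (\<forall>y\<in>carrier (J q). s q (x \<oplus>\<^bsub>J q\<^esub> y) = s q x \<oplus>\<^bsub>J (q - 1)\<^esub> s q y) \<and>
     (\<forall>g\<in>H. s q (act q g x) = act (q - 1) g (s q x)) \<and>
     d (q - 1) (s q x) \<oplus>\<^bsub>J q\<^esub> s (q + 1) (d q x) = x)"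

lemma contractsD:
  assumes "contracts H s" "x \<in> carrier (J q)"
  shows "q' = q - 1 \<Longrightarrow> s q x \<in> carrier (J q')"
    and "\<lbrakk>y \<in> carrier (J q); q' = q - 1\<rbrakk> \<Longrightarrow> s q (x \<oplus>\<^bsub>J q\<^esub> y) = s q x \<oplus>\<^bsub>J q'\<^esub> s q y"
    and "\<lbrakk>g \<in> H; q' = q - 1\<rbrakk> \<Longrightarrow> s q (act q g x) = act q' g (s q x)"
    and "\<lbrakk>q' = q - 1; q'' = q + 1\<rbrakk> \<Longrightarrow> d q' (s q x) \<oplus>\<^bsub>J q\<^esub> s q'' (d q x) = x"
  using assms unfolding contracts_def by auto

lemma act_inv_act [simp]:
  assumes "g \<in> carrier G" "x \<in> carrier (J q)"
  shows "act q (inv g) (act q g x) = x" "act q g (act q (inv g) x) = x"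
  using assms by (simp_all flip: act_mult)

lemma additive_zero:
  assumes "\<And>x y. x \<in> carrier (J q) \<Longrightarrow> y \<in> carrier (J q) \<Longrightarrow> f (x \<oplus>\<^bsub>J q\<^esub> y) = f x \<oplus>\<^bsub>J q'\<^esub> f y"
    and "\<And>x. x \<in> carrier (J q) \<Longrightarrow> f x \<in> carrier (J q')"
  shows "f \<zero>\<^bsub>J q\<^esub> = \<zero>\<^bsub>J q'\<^esub>"
    and "x \<in> carrier (J q) \<Longrightarrow> f (\<ominus>\<^bsub>J q\<^esub> x) = \<ominus>\<^bsub>J q'\<^esub> f x"
    and "x \<in> carrier (J q) \<Longrightarrow> y \<in> carrier (J q) \<Longrightarrow> f (x \<ominus>\<^bsub>J q\<^esub> y) = f x \<ominus>\<^bsub>J q'\<^esub> f y"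
proof -
  show z: "f \<zero>\<^bsub>J q\<^esub> = \<zero>\<^bsub>J q'\<^esub>"
    using assms(1)[of "\<zero>\<^bsub>J q\<^esub>" "\<zero>\<^bsub>J q\<^esub>"] assms(2)[of "\<zero>\<^bsub>J q\<^esub>"]
    by (metis J.add.l_cancel_one' J.l_zero J.zero_closed)
  show n: "f (\<ominus>\<^bsub>J q\<^esub> x) = \<ominus>\<^bsub>J q'\<^esub> f x" if "x \<in> carrier (J q)" for x
    using assms(1)[of "\<ominus>\<^bsub>J q\<^esub> x" x] assms(2) that z
    by (metis J.a_inv_closed J.l_neg J.minus_equality)
  show "f (x \<ominus>\<^bsub>J q\<^esub> y) = f x \<ominus>\<^bsub>J q'\<^esub> f y" if "x \<in> carrier (J q)" "y \<in> carrier (J q)"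
    using assms(1)[of x "\<ominus>\<^bsub>J q\<^esub> y"] n that by (simp add: J.minus_eq)
qed

lemma act_zero [simp]: "g \<in> carrier G \<Longrightarrow> act q g \<zero>\<^bsub>J q\<^esub> = \<zero>\<^bsub>J q\<^esub>"
  by (rule additive_zero) (auto simp: act_add)

lemma act_minus:
  "\<lbrakk>g \<in> carrier G; x \<in> carrier (J q); y \<in> carrier (J q)\<rbrakk> \<Longrightarrow>
    act q g (x \<ominus>\<^bsub>J q\<^esub> y) = act q g x \<ominus>\<^bsub>J q\<^esub> act q g y"
  by (rule additive_zero) (auto simp: act_add)

lemma d_zero: "q' = q + 1 \<Longrightarrow> d q \<zero>\<^bsub>J q\<^esub> = \<zero>\<^bsub>J q'\<^esub>"
  by (rule additive_zero) (auto simp: d_add d_closed)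

lemma d_minus:
  "\<lbrakk>x \<in> carrier (J q); y \<in> carrier (J q); q' = q + 1\<rbrakk> \<Longrightarrow>
    d q (x \<ominus>\<^bsub>J q\<^esub> y) = d q x \<ominus>\<^bsub>J q'\<^esub> d q y"
  by (rule additive_zero) (auto simp: d_add d_closed)

lemma contracts_zero:
  assumes "contracts H s" "q' = q - 1"
  shows "s q \<zero>\<^bsub>J q\<^esub> = \<zero>\<^bsub>J q'\<^esub>"
  by (rule additive_zero) (use contractsD[OF assms(1)] assms(2) in auto)

lemma contracts_d_zero:
  assumes "contracts H s" "x \<in> carrier (J q)" "d q x = \<zero>\<^bsub>J (q + 1)\<^esub>" "q' = q - 1"
  shows "d q' (s q x) = x"
  using contractsD(4)[OF assms(1,2,4) refl] assms contractsD(1)[OF assms(1,2,4)]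
  by (simp add: contracts_zero[OF assms(1), of q "q + 1"] d_closed[of _ "q - 1" q])

definition invariant :: "int \<Rightarrow> 'a set \<Rightarrow> 'j \<Rightarrow> bool" where
  "invariant q H x \<longleftrightarrow> (\<forall>g\<in>H. act q g x = x)"

lemma invariant_minus:
  assumes "H \<subseteq> carrier G" "invariant q H x" "invariant q H y" "x \<in> carrier (J q)" "y \<in> carrier (J q)"
  shows "invariant q H (x \<ominus>\<^bsub>J q\<^esub> y)"
  using assms by (auto simp: invariant_def act_minus)

lemma invariant_add:
  assumes "H \<subseteq> carrier G" "invariant q H x" "invariant q H y" "x \<in> carrier (J q)" "y \<in> carrier (J q)"
  shows "invariant q H (x \<oplus>\<^bsub>J q\<^esub> y)"
  using assms by (auto simp: invariant_def act_add)

lemma invariant_d: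
  assumes "H \<subseteq> carrier G" "invariant q H x" "x \<in> carrier (J q)" "q' = q + 1"
  shows "invariant q' H (d q x)"
  unfolding invariant_def
proof
  fix g assume g: "g \<in> H"
  then have "act q' g (d q x) = d q (act q g x)"
    using assms d_act[of g x q q'] by auto
  then show "act q' g (d q x) = d q x" using g assms by (simp add: invariant_def)
qed

lemma invariant_contracts:
  assumes "contracts H s" "K \<subseteq> H" "invariant q K x" "x \<in> carrier (J q)" "q' = q - 1"
  shows "invariant q' K (s q x)"
  unfolding invariant_def
proof
  fix g assume g: "g \<in> K"
  then have "act q' g (s q x) = s q (act q g x)"
    using assms contractsD(3)[OF assms(1,4), of g q'] by auto
  then show "act q' g (s q x) = s q x" using g assms by (simp add: invariant_def)
qed

text \<open>Here \<epsilon> is a crossed homomorphism on \<open>U\<close> and the conclusion reads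
  \<epsilon> h = w - h w. The cocycle identity for h and h^-1 \<kappa>(g) gives \<epsilon>(\<kappa>
  g) = \<epsilon> h + h \<epsilon>(\<kappa>(h^-1 g)); applying \<rho> to both sides as functions of
  g yields the claim, since \<rho> fixes constants and commutes with the action.\<close>

lemma first_cohomology_vanishes:
  assumes U: "subgroup U G" and \<epsilon>: "\<And>g. g \<in> U \<Longrightarrow> \<epsilon> g \<in> carrier (J q)"
    and cocycle: "\<And>g h. g \<in> U \<Longrightarrow> h \<in> U \<Longrightarrow> \<epsilon> (g \<otimes> h) = \<epsilon> g \<oplus>\<^bsub>J q\<^esub> act q g (\<epsilon> h)"
  obtains w where "w \<in> carrier (J q)" "\<And>h. h \<in> U \<Longrightarrow> w = \<epsilon> h \<oplus>\<^bsub>J q\<^esub> act q h w"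
proof -
  interpret U: subgroup U G by (rule U)
  obtain \<kappa> where \<kappa>: "\<And>g. g \<in> carrier G \<Longrightarrow> \<kappa> g \<in> U"
    "\<And>h g. h \<in> U \<Longrightarrow> g \<in> carrier G \<Longrightarrow> \<kappa> (h \<otimes> g) = h \<otimes> \<kappa> g"
    using left_equivariant_retraction[OF U] by metis
  let ?w = "\<rho> q (\<lambda>g. \<epsilon> (\<kappa> g))"
  show ?thesis
  proof
    show "?w \<in> carrier (J q)" using \<epsilon> \<kappa> by (intro \<rho>_closed) auto
    fix h assume h: "h \<in> U"
    have "\<epsilon> (\<kappa> g) = \<epsilon> h \<oplus>\<^bsub>J q\<^esub> act q h (\<epsilon> (\<kappa> (inv h \<otimes> g)))" if g: "g \<in> carrier G" for g
    proof -
      have "\<kappa> (inv h \<otimes> g) = inv h \<otimes> \<kappa> g" using \<kappa>(2) h g by simp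
      moreover have "\<kappa> g = h \<otimes> (inv h \<otimes> \<kappa> g)"
        using h \<kappa>(1)[OF g] by (simp add: m_assoc[symmetric])
      ultimately show ?thesis using cocycle[of h "inv h \<otimes> \<kappa> g"] h \<kappa>(1)[OF g] by simp
    qed
    then have "?w = \<rho> q (\<lambda>g. \<epsilon> h \<oplus>\<^bsub>J q\<^esub> act q h (\<epsilon> (\<kappa> (inv h \<otimes> g))))" by (intro \<rho>_cong)
    also have "\<dots> = \<rho> q (\<lambda>g. \<epsilon> h) \<oplus>\<^bsub>J q\<^esub> \<rho> q (\<lambda>g. act q h (\<epsilon> (\<kappa> (inv h \<otimes> g))))"
      using h \<epsilon> \<kappa> by (intro \<rho>_add) auto
    also have "\<dots> = \<epsilon> h \<oplus>\<^bsub>J q\<^esub> act q h ?w"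
      using h \<epsilon> \<kappa> by (simp add: \<rho>_const \<rho>_act[of h "\<lambda>g. \<epsilon> (\<kappa> g)"])
    finally show "?w = \<epsilon> h \<oplus>\<^bsub>J q\<^esub> act q h ?w" .
  qed
qed

text \<open>The element f H - g (f H) does not depend on the member \<open>H\<close> of the chain
  containing g, because f K - f H is fixed by the smaller group. So these elements form a cocycle on
  the union of the chain; if w trivializes it, then w - g w = f H - g (f H), that is, w - f H is
  fixed by \<open>H\<close>.\<close>

lemma coherent_family_limit:
  assumes \<H>: "\<And>H. H \<in> \<H> \<Longrightarrow> subgroup H G"
    and chain: "\<And>H K. H \<in> \<H> \<Longrightarrow> K \<in> \<H> \<Longrightarrow> H \<subseteq> K \<or> K \<subseteq> H"
    and f: "\<And>H. H \<in> \<H> \<Longrightarrow> f H \<in> carrier (J q)"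
    and coh: "\<And>H K. H \<in> \<H> \<Longrightarrow> K \<in> \<H> \<Longrightarrow> H \<subset> K \<Longrightarrow> invariant q H (f K \<ominus>\<^bsub>J q\<^esub> f H)"
  obtains v where "v \<in> carrier (J q)" "\<And>H. H \<in> \<H> \<Longrightarrow> invariant q H (v \<ominus>\<^bsub>J q\<^esub> f H)"
proof (cases "\<H> = {}")
  case True
  then show ?thesis using that[of "\<zero>\<^bsub>J q\<^esub>"] by simp
next
  case False
  have carr: "g \<in> carrier G" if "g \<in> H" "H \<in> \<H>" for g H
    using \<H> that subgroup.mem_carrier by metis
  have U: "subgroup (\<Union>\<H>) G"
  proof (rule subgroupI)
    show "\<Union>\<H> \<subseteq> carrier G" using carr by auto
    show "\<Union>\<H> \<noteq> {}" using False \<H> subgroup.one_closed by blast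
    show "inv a \<in> \<Union>\<H>" if "a \<in> \<Union>\<H>" for a
      using that \<H> subgroup.m_inv_closed by (metis UnionE UnionI)
    show "a \<otimes> b \<in> \<Union>\<H>" if ab: "a \<in> \<Union>\<H>" "b \<in> \<Union>\<H>" for a b
    proof -
      obtain H where "H \<in> \<H>" "a \<in> H" "b \<in> H" using ab chain by blast
      then show ?thesis using \<H> subgroup.m_closed by (metis UnionI)
    qed
  qed
  have same: "f H \<ominus>\<^bsub>J q\<^esub> act q g (f H) = f K \<ominus>\<^bsub>J q\<^esub> act q g (f K)"
    if HK: "H \<in> \<H>" "K \<in> \<H>" "g \<in> H" "g \<in> K" for g H K
  proof -
    have *: "f H \<ominus>\<^bsub>J q\<^esub> act q g (f H) = f K \<ominus>\<^bsub>J q\<^esub> act q g (f K)"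
      if HK: "H \<in> \<H>" "K \<in> \<H>" "g \<in> H" "H \<subset> K" for g H K
    proof -
      have c: "g \<in> carrier G" "f H \<in> carrier (J q)" "f K \<in> carrier (J q)"
        "act q g (f H) \<in> carrier (J q)" "act q g (f K) \<in> carrier (J q)"
        using HK carr f by auto
      have "act q g (f K \<ominus>\<^bsub>J q\<^esub> f H) = f K \<ominus>\<^bsub>J q\<^esub> f H"
        using coh HK by (auto simp: invariant_def)
      then have e: "act q g (f K) \<ominus>\<^bsub>J q\<^esub> act q g (f H) = f K \<ominus>\<^bsub>J q\<^esub> f H"
        using c by (simp add: act_minus)
      have "f K \<ominus>\<^bsub>J q\<^esub> act q g (f K) = (f K \<ominus>\<^bsub>J q\<^esub> f H) \<ominus>\<^bsub>J q\<^esub> (act q g (f K) \<ominus>\<^bsub>J q\<^esub> act q g (f H)) \<oplus>\<^bsub>J q\<^esub> (f H \<ominus>\<^bsub>J q\<^esub> act q g (f H))"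
        using c by algebra
      also have "\<dots> = f H \<ominus>\<^bsub>J q\<^esub> act q g (f H)"
        unfolding e using c by (simp add: J.minus_closed J.minus_self)
      finally show ?thesis by simp
    qed
    consider "H = K" | "H \<subset> K" | "K \<subset> H" using chain[OF HK(1,2)] by blast
    then show ?thesis
    proof cases
      case 1 then show ?thesis by simp
    next
      case 2 then show ?thesis by (rule *[OF HK(1,2,3)])
    next
      case 3 then show ?thesis by (rule *[OF HK(2,1,4), symmetric])
    qed
  qed
  define \<epsilon> where "\<epsilon> g = (let H = SOME H. H \<in> \<H> \<and> g \<in> H in f H \<ominus>\<^bsub>J q\<^esub> act q g (f H))" for g
  have \<epsilon>: "\<epsilon> g = f H \<ominus>\<^bsub>J q\<^esub> act q g (f H)" if "H \<in> \<H>" "g \<in> H" for g H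
  proof -
    let ?K = "SOME H. H \<in> \<H> \<and> g \<in> H"
    have "?K \<in> \<H> \<and> g \<in> ?K" by (rule someI[of _ H]) (use that in simp)
    then show ?thesis unfolding \<epsilon>_def Let_def using same[of ?K H g] that by blast
  qed
  obtain w where w: "w \<in> carrier (J q)" "\<And>h. h \<in> \<Union>\<H> \<Longrightarrow> w = \<epsilon> h \<oplus>\<^bsub>J q\<^esub> act q h w"
  proof (rule first_cohomology_vanishes[OF U, of \<epsilon> q])
    show "\<epsilon> g \<in> carrier (J q)" if "g \<in> \<Union>\<H>" for g
      using that \<epsilon> f carr by (auto simp: J.minus_closed)
    show "\<epsilon> (g \<otimes> h) = \<epsilon> g \<oplus>\<^bsub>J q\<^esub> act q g (\<epsilon> h)" if mem: "g \<in> \<Union>\<H>" "h \<in> \<Union>\<H>" for g h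
    proof -
      obtain H where H: "H \<in> \<H>" "g \<in> H" "h \<in> H" using mem chain by blast
      then have gh: "g \<otimes> h \<in> H" using \<H> subgroup.m_closed by metis
      have c: "g \<in> carrier G" "h \<in> carrier G" "f H \<in> carrier (J q)" using H carr f by auto
      have "f H \<ominus>\<^bsub>J q\<^esub> act q g (act q h (f H)) =
        (f H \<ominus>\<^bsub>J q\<^esub> act q g (f H)) \<oplus>\<^bsub>J q\<^esub> (act q g (f H) \<ominus>\<^bsub>J q\<^esub> act q g (act q h (f H)))"
        using c act_closed[OF c(1,3)] act_closed[OF c(1) act_closed[OF c(2,3)]] by algebra
      then show ?thesis using c by (simp add: \<epsilon>[OF H(1) gh] \<epsilon>[OF H(1,2)] \<epsilon>[OF H(1,3)] act_mult act_minus)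
    qed
  qed blast
  show ?thesis
  proof (rule that[OF w(1)])
    fix H assume H: "H \<in> \<H>"
    show "invariant q H (w \<ominus>\<^bsub>J q\<^esub> f H)"
      unfolding invariant_def
    proof
      fix g assume g: "g \<in> H"
      have c: "g \<in> carrier G" "f H \<in> carrier (J q)" "w \<in> carrier (J q)"
        "act q g (f H) \<in> carrier (J q)" "act q g w \<in> carrier (J q)" using H g carr f w by auto
      have "w = (f H \<ominus>\<^bsub>J q\<^esub> act q g (f H)) \<oplus>\<^bsub>J q\<^esub> act q g w"
        using w(2)[of g] \<epsilon>[OF H g] H g by auto
      then have "w \<ominus>\<^bsub>J q\<^esub> f H = (f H \<ominus>\<^bsub>J q\<^esub> act q g (f H)) \<oplus>\<^bsub>J q\<^esub> act q g w \<ominus>\<^bsub>J q\<^esub> f H" by simp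
      also have "\<dots> = act q g w \<ominus>\<^bsub>J q\<^esub> act q g (f H)" using c by algebra
      finally show "act q g (w \<ominus>\<^bsub>J q\<^esub> f H) = w \<ominus>\<^bsub>J q\<^esub> f H"
        by (rule trans[OF act_minus[OF c(1,3,2)] sym])
    qed
  qed
qed

text \<open>Lifts invariant under the members of the chain are corrected, one member after the other,
  by boundaries of elements of \<^term>\<open>J (i - 2)\<close>. The corrections are coherent up to invariants, so
  at a limit they define a cocycle, which is a coboundary because \<^term>\<open>J (i - 2)\<close> is relatively
  injective.\<close>

lemma invariant_lift_of_chain:
  assumes \<H>: "\<And>H. H \<in> \<H> \<Longrightarrow> subgroup H G" and ne: "\<H> \<noteq> {}"
    and chain: "\<And>H K. H \<in> \<H> \<Longrightarrow> K \<in> \<H> \<Longrightarrow> H \<subseteq> K \<or> K \<subseteq> H"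
    and wf: "wf {(H, K). H \<in> \<H> \<and> K \<in> \<H> \<and> H \<subset> K}" and Un: "\<Union>\<H> = carrier G"
    and contr: "\<And>H. H \<in> \<H> \<Longrightarrow> \<exists>s. contracts H s"
    and z: "z \<in> carrier (J i)" "d i z = \<zero>\<^bsub>J (i + 1)\<^esub>" "invariant i (carrier G) z"
  shows "\<exists>w\<in>carrier (J (i - 1)). d (i - 1) w = z \<and> invariant (i - 1) (carrier G) w"
proof -
  have sub: "H \<subseteq> carrier G" if "H \<in> \<H>" for H using \<H>[OF that] subgroup.subset by auto
  obtain H0 s0 where H0: "H0 \<in> \<H>" "contracts H0 s0" using ne contr by blast
  define w0 where "w0 = s0 i z"
  have w0: "w0 \<in> carrier (J (i - 1))" "d (i - 1) w0 = z"
    using contractsD(1)[OF H0(2) z(1)] contracts_d_zero[OF H0(2) z(1,2)] by (auto simp: w0_def)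
  have dJ: "d (i - 2) y \<in> carrier (J (i - 1))" if "y \<in> carrier (J (i - 2))" for y
    using that by (auto intro: d_closed)
  have dd: "d (i - 1) (w0 \<ominus>\<^bsub>J (i - 1)\<^esub> d (i - 2) y) = z" if "y \<in> carrier (J (i - 2))" for y
    using w0 z(1) by (subst d_minus[OF w0(1) dJ[OF that], of i]) (simp_all add: d_d[OF that, of _ i] J.minus_eq)
  \<comment> \<open>A correction may be changed by an \<open>H\<close>-invariant element without
    losing the \<open>H\<close>-invariance of the corrected lift; this is why coherence up to
    invariants suffices.\<close>
  have shift: "invariant (i - 1) H (w0 \<ominus>\<^bsub>J (i - 1)\<^esub> d (i - 2) v)"
    if H: "H \<in> \<H>" and y: "y \<in> carrier (J (i - 2))" and v: "v \<in> carrier (J (i - 2))"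
      and inv: "invariant (i - 1) H (w0 \<ominus>\<^bsub>J (i - 1)\<^esub> d (i - 2) y)" "invariant (i - 2) H (v \<ominus>\<^bsub>J (i - 2)\<^esub> y)"
    for H y v
  proof -
    have "invariant (i - 1) H (d (i - 2) (v \<ominus>\<^bsub>J (i - 2)\<^esub> y))"
      using invariant_d[OF sub[OF H] inv(2)] v y by (simp add: J.minus_closed)
    then have "invariant (i - 1) H (d (i - 2) v \<ominus>\<^bsub>J (i - 1)\<^esub> d (i - 2) y)"
      using v y by (simp add: d_minus[of _ "i - 2" _ "i - 1"])
    then have "invariant (i - 1) H ((w0 \<ominus>\<^bsub>J (i - 1)\<^esub> d (i - 2) y) \<ominus>\<^bsub>J (i - 1)\<^esub> (d (i - 2) v \<ominus>\<^bsub>J (i - 1)\<^esub> d (i - 2) y))"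
      using invariant_minus[OF sub[OF H] inv(1)] w0 dJ v y by (simp add: J.minus_closed)
    also have "(w0 \<ominus>\<^bsub>J (i - 1)\<^esub> d (i - 2) y) \<ominus>\<^bsub>J (i - 1)\<^esub> (d (i - 2) v \<ominus>\<^bsub>J (i - 1)\<^esub> d (i - 2) y) =
        w0 \<ominus>\<^bsub>J (i - 1)\<^esub> d (i - 2) v"
      using w0(1) dJ[OF v] dJ[OF y] by algebra
    finally show ?thesis .
  qed
  have trans: "invariant q H (x \<ominus>\<^bsub>J q\<^esub> z)"
    if "H \<in> \<H>" "invariant q H (x \<ominus>\<^bsub>J q\<^esub> y)" "invariant q H (y \<ominus>\<^bsub>J q\<^esub> z)"
      "x \<in> carrier (J q)" "y \<in> carrier (J q)" "z \<in> carrier (J q)" for H x y z q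
  proof -
    have "(x \<ominus>\<^bsub>J q\<^esub> y) \<oplus>\<^bsub>J q\<^esub> (y \<ominus>\<^bsub>J q\<^esub> z) = x \<ominus>\<^bsub>J q\<^esub> z" using that(4-6) by algebra
    then show ?thesis using invariant_add[OF sub[OF that(1)] that(2,3)] that(4-6) by (simp add: J.minus_closed)
  qed
  let ?R = "{(H, K). H \<in> \<H> \<and> K \<in> \<H> \<and> H \<subset> K}"
  \<comment> \<open>The conditions on the correction v at \<open>H\<close>: the lift w0 - d v is
    fixed by \<open>H\<close>, and v agrees with the correction of each smaller member K up to a
    K-invariant. They are void outside the chain, so the recursion may run over all sets.\<close>
  define P where "P f H v \<longleftrightarrow> H \<in> \<H> \<longrightarrow> v \<in> carrier (J (i - 2)) \<and>
      invariant (i - 1) H (w0 \<ominus>\<^bsub>J (i - 1)\<^esub> d (i - 2) v) \<and>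
      (\<forall>K\<in>\<H>. K \<subset> H \<longrightarrow> invariant (i - 2) K (v \<ominus>\<^bsub>J (i - 2)\<^esub> f K))" for f H v
  have "\<exists>f. \<forall>H. P f H (f H)"
  proof (rule dependent_wf_choice[OF wf])
    show "P f H r = P g H r" if "\<And>K. (K, H) \<in> ?R \<Longrightarrow> f K = g K" for f g H r
      using that by (auto simp: P_def)
  next
    fix H f assume IH: "\<And>K. (K, H) \<in> ?R \<Longrightarrow> P f K (f K)"
    show "\<exists>v. P f H v"
    proof (cases "H \<in> \<H>")
      case False then show ?thesis by (auto simp: P_def)
    next
      case H: True
      let ?L = "{K \<in> \<H>. K \<subset> H}"
      have fK: "f K \<in> carrier (J (i - 2))" "invariant (i - 1) K (w0 \<ominus>\<^bsub>J (i - 1)\<^esub> d (i - 2) (f K))"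
        "\<And>K'. K' \<in> \<H> \<Longrightarrow> K' \<subset> K \<Longrightarrow> invariant (i - 2) K' (f K \<ominus>\<^bsub>J (i - 2)\<^esub> f K')" if "K \<in> ?L" for K
        using IH[of K] that H by (auto simp: P_def)
      obtain v where v: "v \<in> carrier (J (i - 2))" "\<And>K. K \<in> ?L \<Longrightarrow> invariant (i - 2) K (v \<ominus>\<^bsub>J (i - 2)\<^esub> f K)"
      proof (rule coherent_family_limit[of ?L f "i - 2"])
        show "invariant (i - 2) K (f K' \<ominus>\<^bsub>J (i - 2)\<^esub> f K)" if "K \<in> ?L" "K' \<in> ?L" "K \<subset> K'" for K K'
          using fK(3)[of K' K] that by blast
      qed (use \<H> chain fK(1) in auto)
      obtain s where s: "contracts H s" using contr[OF H] by blast
      define w where "w = w0 \<ominus>\<^bsub>J (i - 1)\<^esub> d (i - 2) v"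
      have w: "w \<in> carrier (J (i - 1))" "d (i - 1) w = z"
        using w0(1) dJ[OF v(1)] dd[OF v(1)] by (auto simp: w_def J.minus_closed)
      have sz: "s i z \<in> carrier (J (i - 1))" "d (i - 1) (s i z) = z" "invariant (i - 1) H (s i z)"
        using contractsD(1)[OF s z(1)] contracts_d_zero[OF s z(1,2)]
          invariant_contracts[OF s order_refl _ z(1)] z(3) sub[OF H] by (auto simp: invariant_def)
      \<comment> \<open>The lift w from the limit is fixed by the earlier subgroups, the lift s(z)
        by \<open>H\<close>. Their difference t is a cycle fixed by the earlier subgroups, and so is
        its primitive y = s(t). Adding y to v replaces w by s(z) without disturbing the coherence
        with the earlier corrections.\<close>
      define t where "t = w \<ominus>\<^bsub>J (i - 1)\<^esub> s i z"
      have t: "t \<in> carrier (J (i - 1))" "d (i - 1) t = \<zero>\<^bsub>J (i - 1 + 1)\<^esub>"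
        using w(1) sz(1,2) z(1) by (auto simp: t_def J.minus_closed d_minus[OF w(1) sz(1), of i] w(2) J.minus_self)
      define y where "y = s (i - 1) t"
      have y: "y \<in> carrier (J (i - 2))" "d (i - 2) y = t"
        using contractsD(1)[OF s t(1)] contracts_d_zero[OF s t] by (auto simp: y_def)
      have vy: "v \<oplus>\<^bsub>J (i - 2)\<^esub> y \<in> carrier (J (i - 2))" using v y by simp
      have "w0 \<ominus>\<^bsub>J (i - 1)\<^esub> d (i - 2) (v \<oplus>\<^bsub>J (i - 2)\<^esub> y) = w0 \<ominus>\<^bsub>J (i - 1)\<^esub> (d (i - 2) v \<oplus>\<^bsub>J (i - 1)\<^esub> (w \<ominus>\<^bsub>J (i - 1)\<^esub> s i z))"
        using v y by (simp add: d_add[of _ "i - 2" _ "i - 1"] t_def)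
      also have "\<dots> = s i z" unfolding w_def using w0(1) dJ[OF v(1)] sz(1) by algebra
      finally have "invariant (i - 1) H (w0 \<ominus>\<^bsub>J (i - 1)\<^esub> d (i - 2) (v \<oplus>\<^bsub>J (i - 2)\<^esub> y))"
        using sz(3) by simp
      moreover have "invariant (i - 2) K ((v \<oplus>\<^bsub>J (i - 2)\<^esub> y) \<ominus>\<^bsub>J (i - 2)\<^esub> f K)" if K: "K \<in> ?L" for K
      proof -
        have "invariant (i - 1) K w"
          unfolding w_def using shift[of K "f K" v] K fK(1,2)[OF K] v by auto
        moreover have "invariant (i - 1) K (s i z)" using sz(3) K by (auto simp: invariant_def)
        ultimately have "invariant (i - 1) K t"
          unfolding t_def using invariant_minus sub w(1) sz(1) K by blast
        then have "invariant (i - 2) K y"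
          unfolding y_def using invariant_contracts[OF s _ _ t(1)] K by auto
        moreover have "(v \<oplus>\<^bsub>J (i - 2)\<^esub> y) \<ominus>\<^bsub>J (i - 2)\<^esub> f K = (v \<ominus>\<^bsub>J (i - 2)\<^esub> f K) \<oplus>\<^bsub>J (i - 2)\<^esub> y"
          using v(1) y(1) fK(1)[OF K] by algebra
        ultimately show ?thesis
          using invariant_add[OF sub v(2)[OF K]] K y(1) v(1) fK(1)[OF K] by (simp add: J.minus_closed)
      qed
      ultimately show ?thesis using vy by (auto simp: P_def)
    qed
  qed
  then obtain f where f: "\<And>H. P f H (f H)" by blast
  \<comment> \<open>One more limit, now over the whole chain, which need not have a largest
    member.\<close>
  obtain v where v: "v \<in> carrier (J (i - 2))" "\<And>H. H \<in> \<H> \<Longrightarrow> invariant (i - 2) H (v \<ominus>\<^bsub>J (i - 2)\<^esub> f H)"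
    by (rule coherent_family_limit[of \<H> f "i - 2"]) (use f \<H> chain in \<open>auto simp: P_def\<close>)
  have "invariant (i - 1) H (w0 \<ominus>\<^bsub>J (i - 1)\<^esub> d (i - 2) v)" if "H \<in> \<H>" for H
    using shift[OF that _ v(1)] f[of H] v(2)[OF that] that by (auto simp: P_def)
  then have "invariant (i - 1) (carrier G) (w0 \<ominus>\<^bsub>J (i - 1)\<^esub> d (i - 2) v)"
    unfolding Un[symmetric] by (auto simp: invariant_def)
  then show ?thesis using dd[OF v(1)] w0(1) dJ[OF v(1)] by (intro bexI[of _ "w0 \<ominus>\<^bsub>J (i - 1)\<^esub> d (i - 2) v"]) (auto simp: J.minus_closed)
qed

end

section \<open>Small singular chains\<close>

definition small_simplices :: "'x topology \<Rightarrow> 'x set set \<Rightarrow> nat \<Rightarrow> ((nat \<Rightarrow> real) \<Rightarrow> 'x) set" where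
  "small_simplices X \<U> p = {f. singular_simplex p X f \<and> (\<exists>U\<in>\<U>. f ` standard_simplex p \<subseteq> U)}"

lemma keys_diff_subset:
  "\<lbrakk>Poly_Mapping.keys a \<subseteq> S; Poly_Mapping.keys b \<subseteq> S\<rbrakk> \<Longrightarrow> Poly_Mapping.keys (a - b) \<subseteq> S"
  using keys_diff[of a b] by blast

lemma small_chain_iff_Union:
  "f \<in> small_simplices X \<U> p \<longleftrightarrow> (\<exists>U\<in>\<U>. singular_simplex p (subtopology X U) f)"
  by (auto simp: small_simplices_def singular_simplex_subtopology)

lemma small_chain_singular:
  "Poly_Mapping.keys c \<subseteq> small_simplices X \<U> p \<Longrightarrow> singular_chain p X c"
  by (auto simp: singular_chain_def small_simplices_def)

lemma singular_chain_subtopology_small: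
  "\<lbrakk>singular_chain p (subtopology X U) c; U \<in> \<U>\<rbrakk> \<Longrightarrow> Poly_Mapping.keys c \<subseteq> small_simplices X \<U> p"
  unfolding singular_chain_def small_chain_iff_Union subset_iff by blast

lemma keys_chain_boundary_of:
  assumes "f' \<in> Poly_Mapping.keys (chain_boundary p (frag_of f))"
  shows "p > 0" "\<exists>k\<le>p. f' = singular_face p k f"
proof -
  show p: "p > 0" using assms by (auto simp: chain_boundary_of split: if_splits)
  have "f' \<in> Poly_Mapping.keys (\<Sum>k\<le>p. frag_cmul ((-1) ^ k) (frag_of (singular_face p k f)))"
    using assms p by (simp add: chain_boundary_of)
  also have "\<dots> \<subseteq> (\<Union>k\<le>p. Poly_Mapping.keys (frag_cmul ((-1) ^ k) (frag_of (singular_face p k f))))"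
    by (rule keys_sum)
  finally show "\<exists>k\<le>p. f' = singular_face p k f" by (auto split: if_splits)
qed

lemma singular_face_image:
  assumes "p > 0" "k \<le> p"
  shows "singular_face p k f ` standard_simplex (p - Suc 0) \<subseteq> f ` standard_simplex p"
  using assms simplical_face_in_standard_simplex[of p k] by (auto simp: singular_face_def)

lemma keys_chain_boundary_of_image:
  assumes "f' \<in> Poly_Mapping.keys (chain_boundary p (frag_of f))" "singular_simplex p X f"
  shows "singular_simplex (p - Suc 0) X f'" "f' ` standard_simplex (p - Suc 0) \<subseteq> f ` standard_simplex p"
proof -
  obtain k where k: "p > 0" "k \<le> p" "f' = singular_face p k f"
    using keys_chain_boundary_of[OF assms(1)] by blast
  show "singular_simplex (p - Suc 0) X f'"
    using k assms(2) by (auto intro: singular_simplex_singular_face)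
  show "f' ` standard_simplex (p - Suc 0) \<subseteq> f ` standard_simplex p"
    unfolding k(3) by (rule singular_face_image[OF k(1,2)])
qed

lemma small_chain_boundary:
  assumes "Poly_Mapping.keys c \<subseteq> small_simplices X \<U> p"
  shows "Poly_Mapping.keys (chain_boundary p c) \<subseteq> small_simplices X \<U> (p - Suc 0)"
  using assms
proof (induction c rule: frag_induction)
  case (one f)
  then obtain U where U: "U \<in> \<U>" "singular_simplex p X f" "f ` standard_simplex p \<subseteq> U"
    by (auto simp: small_simplices_def)
  show ?case
  proof
    fix f' assume f': "f' \<in> Poly_Mapping.keys (chain_boundary p (frag_of f))"
    note keys_chain_boundary_of_image[OF f' U(2)]
    then show "f' \<in> small_simplices X \<U> (p - Suc 0)"
      using U(1,3) unfolding small_simplices_def by blast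
  qed
next
  case (diff a b)
  then show ?case by (simp add: chain_boundary_diff keys_diff_subset)
qed simp

text \<open>A homotopy from the identity to a constant map makes the cycle homologous to its image
  in a one-point space, where cycles of positive degree bound.\<close>

lemma contractible_space_cycle_bounds:
  assumes X: "contractible_space X" and c: "singular_chain p X c" "chain_boundary p c = 0" and p: "p > 0"
  obtains e where "singular_chain (Suc p) X e" "chain_boundary (Suc p) e = c"
proof (cases "topspace X = {}")
  case True
  then have "c = 0" using c singular_chain_empty by blast
  then show ?thesis using that[of 0] by simp
next
  case False
  then obtain a where a: "a \<in> topspace X" "homotopic_with (\<lambda>x. True) X X id (\<lambda>x. a)"
    using X by (auto simp: contractible_space)
  have "homologous_rel p X {} (chain_map p id c) (chain_map p (\<lambda>x. a) c)"
    by (rule homotopic_imp_homologous_rel_chain_maps[where S = X and T = "{}"])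
       (use a c in \<open>simp_all add: singular_cycle\<close>)
  then have 1: "singular_relboundary p X {} (c - chain_map p (\<lambda>x. a) c)"
    using c(1) by (simp add: homologous_rel_def chain_map_ident)
  have sing: "topspace (subtopology X {a}) = {a}" using a by auto
  have "singular_chain p (subtopology X {a}) (chain_map p (\<lambda>x. a) c)"
    by (rule singular_chain_chain_map[OF c(1)]) (use a in auto)
  moreover have "chain_boundary p (chain_map p (\<lambda>x. a) c) = 0"
    using c by (simp add: chain_boundary_chain_map[OF c(1)])
  ultimately have "singular_relcycle p (subtopology X {a}) {} (chain_map p (\<lambda>x. a) c)"
    by (simp add: singular_cycle)
  then have "singular_relboundary p (subtopology X {a}) {} (chain_map p (\<lambda>x. a) c)"
    using singular_boundary_eq_cycle_singleton[OF sing] p by auto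
  then have "singular_relboundary p (subtopology X (topspace X)) {} (chain_map p (\<lambda>x. a) c)"
    by (rule singular_boundary_mono[rotated]) (use a in auto)
  then have "singular_relboundary p X {} (chain_map p (\<lambda>x. a) c)" by simp
  from singular_relboundary_add[OF 1 this] have "singular_relboundary p X {} c" by simp
  then show ?thesis using that by (auto simp: singular_boundary)
qed

text \<open>In degree 0 the same homotopy only shows that each point is homologous to the base
  point, so differences of points are what bounds.\<close>

lemma contractible_space_points_homologous:
  assumes X: "contractible_space X" and f: "singular_simplex 0 X f" "singular_simplex 0 X f'"
  obtains e where "singular_chain 1 X e" "chain_boundary 1 e = frag_of f - frag_of f'"
proof -
  have "topspace X \<noteq> {}" using f singular_simplex_empty by blast
  then obtain a where a: "a \<in> topspace X" "homotopic_with (\<lambda>x. True) X X id (\<lambda>x. a)"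
    using X by (auto simp: contractible_space)
  have *: "singular_relboundary 0 X {} (frag_of f - frag_of (restrict (\<lambda>x. a) (standard_simplex 0)))"
    if f: "singular_simplex 0 X f" for f
  proof -
    have sc: "singular_chain 0 X (frag_of f)" using f by (simp add: singular_chain_of)
    have "homologous_rel 0 X {} (chain_map 0 id (frag_of f)) (chain_map 0 (\<lambda>x. a) (frag_of f))"
      by (rule homotopic_imp_homologous_rel_chain_maps[where S = X and T = "{}"])
         (use a sc in \<open>simp_all add: singular_cycle chain_boundary_def\<close>)
    then show ?thesis
      unfolding chain_map_ident[OF sc] by (simp add: homologous_rel_def simplex_map_def o_def)
  qed
  from singular_relboundary_diff[OF *[OF f(1)] *[OF f(2)]]
  have "singular_relboundary 0 X {} (frag_of f - frag_of f')" by simp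
  then show ?thesis using that by (auto simp: singular_boundary)
qed

context
  fixes X :: "'x topology" and \<U> :: "'x set set"
  assumes X: "contractible_space X" and open_cover: "\<And>U. U \<in> \<U> \<Longrightarrow> openin X U"
    and cover: "topspace X \<subseteq> \<Union>\<U>"
begin

text \<open>Iterated subdivision S makes e small, but it changes the boundary c. The subdivision
  homotopy h corrects this: S e = e + \<partial>(h e) + h c, so S e - h c has boundary c, and h c is
  small because c is.\<close>

lemma small_boundary_bounds_small:
  assumes c: "Poly_Mapping.keys c \<subseteq> small_simplices X \<U> p"
    and e: "singular_chain (Suc p) X e" "chain_boundary (Suc p) e = c"
  obtains e' where "Poly_Mapping.keys e' \<subseteq> small_simplices X \<U> (Suc p)" "chain_boundary (Suc p) e' = c"
proof -
  obtain n where n: "\<And>f. f \<in> Poly_Mapping.keys ((singular_subdivision (Suc p) ^^ n) e) \<Longrightarrow>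
      \<exists>V\<in>\<U>. f \<in> standard_simplex (Suc p) \<rightarrow> V"
    using sufficient_iterated_singular_subdivision_exists[OF open_cover cover e(1)] by (metis order_refl)
  obtain h where h: "\<And>p. h p 0 = (0 :: 'x chain)" "\<And>p c1 c2. h p (c1 - c2) = h p c1 - h p c2"
      "\<And>p X c. singular_chain p X c \<Longrightarrow> singular_chain (Suc p) X (h p c)"
      "\<And>p X c. singular_chain p X c \<Longrightarrow>
        chain_boundary (Suc p) (h p c) + h (p - Suc 0) (chain_boundary p c) = (singular_subdivision p ^^ n) c - c"
    using chain_homotopic_iterated_singular_subdivision[of n] by metis
  let ?s = "(singular_subdivision (Suc p) ^^ n) e"
  have s: "?s = e + chain_boundary (Suc (Suc p)) (h (Suc p) e) + h p c"
    using h(4)[OF e(1)] e(2) by (simp add: algebra_simps)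
  \<comment> \<open>\<open>h\<close> sends chains of any space to chains of the same space. Applied
    to the subspace \<open>U\<close> that contains a simplex, this keeps the value at the simplex
    inside \<open>U\<close>.\<close>
  have hpc: "Poly_Mapping.keys (h p c) \<subseteq> small_simplices X \<U> (Suc p)"
    using c
  proof (induction c rule: frag_induction)
    case (one f)
    then obtain U where U: "U \<in> \<U>" "singular_simplex p (subtopology X U) f"
      by (auto simp: small_chain_iff_Union)
    then have "singular_chain (Suc p) (subtopology X U) (h p (frag_of f))"
      by (intro h(3)) (simp add: singular_chain_of)
    then show ?case using U(1) by (rule singular_chain_subtopology_small)
  next
    case (diff a b)
    then show ?case by (simp add: h(2) keys_diff_subset)
  qed (simp add: h(1))
  have hee: "singular_chain (Suc (Suc p)) X (h (Suc p) e)" by (rule h(3)[OF e(1)])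
  have "singular_chain (Suc p) X ?s"
    unfolding s
    using e(1) singular_chain_boundary_alt[OF hee] small_chain_singular[OF hpc]
    by (intro singular_chain_add) auto
  then have ss: "Poly_Mapping.keys ?s \<subseteq> singular_simplex_set (Suc p) X"
    by (simp only: singular_chain_def)
  have sk: "Poly_Mapping.keys ?s \<subseteq> small_simplices X \<U> (Suc p)"
  proof
    fix f assume f: "f \<in> Poly_Mapping.keys ?s"
    then obtain V where "V \<in> \<U>" "f ` standard_simplex (Suc p) \<subseteq> V"
      using n[OF f] by (auto simp: image_subset_iff_funcset)
    then show "f \<in> small_simplices X \<U> (Suc p)"
      using subsetD[OF ss f] by (auto simp: small_simplices_def)
  qed
  show ?thesis
  proof
    show "Poly_Mapping.keys (?s - h p c) \<subseteq> small_simplices X \<U> (Suc p)"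
      using sk hpc by (rule keys_diff_subset)
    show "chain_boundary (Suc p) (?s - h p c) = c"
      by (simp add: s chain_boundary_add e(2) chain_boundary_boundary_alt[OF hee])
  qed
qed

lemma small_cycle_bounds:
  assumes "Poly_Mapping.keys c \<subseteq> small_simplices X \<U> (Suc p)" "chain_boundary (Suc p) c = 0"
  shows "\<exists>e. Poly_Mapping.keys e \<subseteq> small_simplices X \<U> (Suc (Suc p)) \<and> chain_boundary (Suc (Suc p)) e = c"
proof -
  obtain e where e: "singular_chain (Suc (Suc p)) X e" "chain_boundary (Suc (Suc p)) e = c"
    by (rule contractible_space_cycle_bounds[OF X small_chain_singular[OF assms(1)] assms(2)]) simp
  show ?thesis by (rule small_boundary_bounds_small[OF assms(1) e]) blast
qed

lemma small_points_homologous: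
  assumes "f \<in> small_simplices X \<U> 0" "f' \<in> small_simplices X \<U> 0"
  shows "\<exists>e. Poly_Mapping.keys e \<subseteq> small_simplices X \<U> 1 \<and> chain_boundary 1 e = frag_of f - frag_of f'"
proof -
  obtain e where e: "singular_chain 1 X e" "chain_boundary 1 e = frag_of f - frag_of f'"
    using contractible_space_points_homologous[OF X, of f f'] assms by (auto simp: small_simplices_def)
  have "Poly_Mapping.keys (frag_of f - frag_of f') \<subseteq> small_simplices X \<U> 0"
    using keys_diff[of "frag_of f" "frag_of f'"] assms by auto
  then obtain e' where "Poly_Mapping.keys e' \<subseteq> small_simplices X \<U> (Suc 0)"
    "chain_boundary (Suc 0) e' = frag_of f - frag_of f'"
    by (rule small_boundary_bounds_small[of _ 0 e]) (use e in simp_all)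
  then show ?thesis by auto
qed

text \<open>On a simplex f of positive degree the value of \<open>h\<close> is a chosen small chain
  bounding f - h(\<partial> f), which is a cycle by the identity one degree below; the extension to
  chains is additive. Such choices ignore any group action; equivariance is restored later by
  averaging.\<close>

lemma small_chain_contraction:
  obtains h where "\<And>p x y. h p (x - y) = h p x - h p y"
    and "\<And>p x. Poly_Mapping.keys x \<subseteq> small_simplices X \<U> p \<Longrightarrow>
           Poly_Mapping.keys (h p x) \<subseteq> small_simplices X \<U> (Suc p)"
    and "\<And>p x. Poly_Mapping.keys x \<subseteq> small_simplices X \<U> (Suc p) \<Longrightarrow>
           chain_boundary (Suc (Suc p)) (h (Suc p) x) + h p (chain_boundary (Suc p) x) = x"
proof -
  let ?S = "small_simplices X \<U>"
  define f0 where "f0 = (SOME f. f \<in> ?S 0)"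
  define k0 where "k0 f = (SOME e. Poly_Mapping.keys e \<subseteq> ?S 1 \<and> chain_boundary 1 e = frag_of f - frag_of f0)" for f
  have f0: "f0 \<in> ?S 0" if "f \<in> ?S 0" for f unfolding f0_def by (rule someI[where P = "\<lambda>f. f \<in> ?S 0", OF that])
  have k0: "Poly_Mapping.keys (k0 f) \<subseteq> ?S 1 \<and> chain_boundary 1 (k0 f) = frag_of f - frag_of f0"
    if "f \<in> ?S 0" for f
    unfolding k0_def by (rule someI_ex[OF small_points_homologous[OF that f0[OF that]]])
  define step where "step p hp = frag_extend (\<lambda>f. SOME e. Poly_Mapping.keys e \<subseteq> ?S (Suc (Suc p)) \<and>
      chain_boundary (Suc (Suc p)) e = frag_of f - hp (chain_boundary (Suc p) (frag_of f)))" for p and hp :: "'x chain \<Rightarrow> 'x chain"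
  define h where "h = rec_nat (frag_extend k0) step"
  have h0: "h 0 = frag_extend k0" and hS: "h (Suc p) = step p (h p)" for p by (simp_all add: h_def)
  have hdiff: "h p (x - y) = h p x - h p y" for p x y
    by (cases p) (simp_all add: h0 hS step_def frag_extend_diff)
  have hzero: "h p 0 = 0" for p using hdiff[of p 0 0] by simp
  have small_ext: "Poly_Mapping.keys (h p x) \<subseteq> ?S (Suc p)"
    if "\<And>f. f \<in> ?S p \<Longrightarrow> Poly_Mapping.keys (h p (frag_of f)) \<subseteq> ?S (Suc p)" "Poly_Mapping.keys x \<subseteq> ?S p" for p x
    using that(2)
  proof (induction x rule: frag_induction)
    case (diff a b)
    then show ?case by (simp add: hdiff keys_diff_subset)
  qed (auto simp: hzero that(1)[THEN subsetD])
  \<comment> \<open>\<open>?B p\<close>, that is \<partial> h \<partial> = \<partial>, is exactly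
    what makes f - h(\<partial> f) a cycle. It starts in degree 0, where h f only bounds f - f0: the
    base points f0 cancel in a boundary.\<close>
  have main: "(\<forall>x. Poly_Mapping.keys x \<subseteq> ?S p \<longrightarrow> Poly_Mapping.keys (h p x) \<subseteq> ?S (Suc p)) \<and>
      (\<forall>x. Poly_Mapping.keys x \<subseteq> ?S (Suc p) \<longrightarrow>
         chain_boundary (Suc p) (h p (chain_boundary (Suc p) x)) = chain_boundary (Suc p) x)" (is "?A p \<and> ?B p")
    and ident: "\<And>x. Poly_Mapping.keys x \<subseteq> ?S (Suc p) \<Longrightarrow>
         chain_boundary (Suc (Suc p)) (h (Suc p) x) + h p (chain_boundary (Suc p) x) = x" for p
  proof -
    have step: "?A (Suc p)" "Poly_Mapping.keys x \<subseteq> ?S (Suc p) \<Longrightarrow>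
         chain_boundary (Suc (Suc p)) (h (Suc p) x) + h p (chain_boundary (Suc p) x) = x"
      if AB: "?A p" "?B p" for p x
    proof -
      have *: "Poly_Mapping.keys (h (Suc p) (frag_of f)) \<subseteq> ?S (Suc (Suc p)) \<and>
          chain_boundary (Suc (Suc p)) (h (Suc p) (frag_of f)) = frag_of f - h p (chain_boundary (Suc p) (frag_of f))"
        if f: "f \<in> ?S (Suc p)" for f
      proof -
        have kf: "Poly_Mapping.keys (frag_of f) \<subseteq> ?S (Suc p)" using f by simp
        have kb: "Poly_Mapping.keys (chain_boundary (Suc p) (frag_of f)) \<subseteq> ?S p"
          using small_chain_boundary[OF kf] by simp
        let ?c = "frag_of f - h p (chain_boundary (Suc p) (frag_of f))"
        have "Poly_Mapping.keys ?c \<subseteq> ?S (Suc p)"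
          by (intro keys_diff_subset kf AB(1)[rule_format] kb)
        moreover have "chain_boundary (Suc p) ?c = 0"
          using AB(2)[rule_format, OF kf] by (simp add: chain_boundary_diff)
        ultimately have "\<exists>e. Poly_Mapping.keys e \<subseteq> ?S (Suc (Suc p)) \<and> chain_boundary (Suc (Suc p)) e = ?c"
          by (rule small_cycle_bounds)
        then show ?thesis unfolding hS step_def frag_extend_of by (rule someI_ex)
      qed
      show "?A (Suc p)" using small_ext[of "Suc p", OF conjunct1[OF *]] by simp
      show "chain_boundary (Suc (Suc p)) (h (Suc p) x) + h p (chain_boundary (Suc p) x) = x"
        if "Poly_Mapping.keys x \<subseteq> ?S (Suc p)"
        using that
      proof (induction x rule: frag_induction)
        case (one f)
        then show ?case using * by simp
      next
        case (diff a b)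
        have "chain_boundary (Suc (Suc p)) (h (Suc p) (a - b)) + h p (chain_boundary (Suc p) (a - b)) =
          (chain_boundary (Suc (Suc p)) (h (Suc p) a) + h p (chain_boundary (Suc p) a)) -
          (chain_boundary (Suc (Suc p)) (h (Suc p) b) + h p (chain_boundary (Suc p) b))"
          by (simp add: hdiff chain_boundary_diff)
        then show ?case by (simp only: diff)
      qed (simp add: hzero)
    qed
    show main: "?A p \<and> ?B p" for p
    proof (induction p)
      case 0
      have "Poly_Mapping.keys (h 0 (frag_of f)) \<subseteq> ?S (Suc 0)" if "f \<in> ?S 0" for f
        using k0[OF that] by (simp add: h0)
      then have A: "?A 0" using small_ext[of 0] by simp
      have eq: "chain_boundary (Suc 0) (h 0 (chain_boundary (Suc 0) x)) = chain_boundary (Suc 0) x"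
        if "Poly_Mapping.keys x \<subseteq> ?S (Suc 0)" for x
        using that
      proof (induction x rule: frag_induction)
        case (one f)
        then obtain U where U: "U \<in> \<U>" "singular_simplex (Suc 0) (subtopology X U) f"
          by (auto simp: small_chain_iff_Union)
        have face: "singular_face (Suc 0) k f \<in> ?S 0" if "k \<le> Suc 0" for k
          using singular_simplex_singular_face[OF U(2), of k] that U(1) by (auto simp: small_chain_iff_Union)
        have "chain_boundary (Suc 0) (frag_of f) = frag_of (singular_face (Suc 0) 0 f) - frag_of (singular_face (Suc 0) (Suc 0) f)"
          by (simp add: chain_boundary_of)
        then show ?case
          using k0[OF face[of 0]] k0[OF face[of "Suc 0"]]
          by (simp add: h0 frag_extend_diff chain_boundary_diff)
      next
        case (diff a b)
        then show ?case by (simp add: hdiff chain_boundary_diff)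
      qed (simp add: hzero)
      show ?case using A eq by blast
    next
      case (Suc p)
      have "chain_boundary (Suc (Suc p)) (h (Suc p) (chain_boundary (Suc (Suc p)) x)) = chain_boundary (Suc (Suc p)) x"
        if x: "Poly_Mapping.keys x \<subseteq> ?S (Suc (Suc p))" for x
      proof -
        have "Poly_Mapping.keys (chain_boundary (Suc (Suc p)) x) \<subseteq> ?S (Suc p)"
          using small_chain_boundary[OF x] by simp
        moreover have "chain_boundary (Suc p) (chain_boundary (Suc (Suc p)) x) = 0"
          using chain_boundary_boundary_alt[OF small_chain_singular[OF x]] .
        ultimately show ?thesis using step(2)[of p "chain_boundary (Suc (Suc p)) x"] Suc hzero by simp
      qed
      then show ?case using step(1)[of p] Suc by simp
    qed
    show "chain_boundary (Suc (Suc p)) (h (Suc p) x) + h p (chain_boundary (Suc p) x) = x"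
      if "Poly_Mapping.keys x \<subseteq> ?S (Suc p)" for p x
      by (rule step(2)[OF conjunct1[OF main] conjunct2[OF main] that])
  qed
  show ?thesis
    by (rule that[OF hdiff main[THEN conjunct1, rule_format] ident])
qed

end

section \<open>Equivariant cochains on an open cover\<close>

text \<open>What the argument retains of a finite dimensional contractible G-CW-complex: for each n
  a G-stable family of pairwise disjoint open sets, those with n at most N covering the space, and
  for each set a contraction of \<open>J\<close> that is equivariant under its setwise stabilizer. N
  will bound the number of corrections.\<close>

locale equivariant_cover = equivariant_complex G J act d \<rho>
  for G :: "'a monoid" (structure) and J :: "int \<Rightarrow> 'j ring" and act d \<rho> +
  fixes X :: "'x topology" and \<phi> :: "'a \<Rightarrow> 'x \<Rightarrow> 'x" and \<V> :: "nat \<Rightarrow> 'x set set" and N :: nat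
  assumes space_action: "group_action G (topspace X) \<phi>"
    and \<phi>_continuous: "g \<in> carrier G \<Longrightarrow> continuous_map X X (\<phi> g)"
    and X_contractible: "contractible_space X" and X_nonempty: "topspace X \<noteq> {}"
    and \<V>_open: "U \<in> \<V> n \<Longrightarrow> openin X U"
    and \<V>_disjoint: "\<lbrakk>U \<in> \<V> n; U' \<in> \<V> n; U \<inter> U' \<noteq> {}\<rbrakk> \<Longrightarrow> U = U'"
    and \<V>_cover: "topspace X \<subseteq> (\<Union>n\<le>N. \<Union>(\<V> n))"
    and \<V>_image: "\<lbrakk>g \<in> carrier G; U \<in> \<V> n\<rbrakk> \<Longrightarrow> \<phi> g ` U \<in> \<V> n"
    and \<V>_contracts: "U \<in> \<V> n \<Longrightarrow> \<exists>s. contracts {g \<in> carrier G. \<phi> g ` U = U} s"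
begin

interpretation act: group_action G "topspace X" \<phi> by (rule space_action)

lemma \<phi>_one: "x \<in> topspace X \<Longrightarrow> \<phi> \<one> x = x"
  using act.id_eq_one by (metis restrict_apply')

lemma image_one: "A \<subseteq> topspace X \<Longrightarrow> \<phi> \<one> ` A = A"
  using \<phi>_one by (auto simp: subset_iff image_iff)

lemma image_mult:
  assumes "A \<subseteq> topspace X" "g \<in> carrier G" "h \<in> carrier G"
  shows "\<phi> (g \<otimes> h) ` A = \<phi> g ` \<phi> h ` A"
  unfolding image_image
  by (rule image_cong[OF refl]) (use act.composition_rule assms in blast)

lemma image_closed: "\<lbrakk>A \<subseteq> topspace X; g \<in> carrier G\<rbrakk> \<Longrightarrow> \<phi> g ` A \<subseteq> topspace X"
  using act.surj_prop by blast

lemma \<V>_subset: "U \<in> \<V> n \<Longrightarrow> U \<subseteq> topspace X"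
  using \<V>_open openin_subset by blast

text \<open>Choose a contraction for one set in each orbit and conjugate it to the others by a
  chosen group element. Another choice of that element differs by the stabilizer of the
  representative, with which the contraction commutes, so the whole family is equivariant.\<close>

lemma equivariant_contractions:
  obtains \<kappa> where "\<And>U n. U \<in> \<V> n \<Longrightarrow> contracts {} (\<kappa> U)"
    and "\<And>U n g q x. \<lbrakk>U \<in> \<V> n; g \<in> carrier G; x \<in> carrier (J q)\<rbrakk> \<Longrightarrow>
           \<kappa> (\<phi> g ` U) q (act q g x) = act (q - 1) g (\<kappa> U q x)"
proof -
  define orb where "orb U = {\<phi> g ` U | g. g \<in> carrier G}" for U
  define r where "r U = (SOME W. W \<in> orb U)" for U
  define t where "t U = (SOME g. g \<in> carrier G \<and> \<phi> g ` r U = U)" for U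
  define \<sigma> where "\<sigma> U = (SOME s. contracts {g \<in> carrier G. \<phi> g ` U = U} s)" for U
  define \<kappa> where "\<kappa> U q x = act (q - 1) (t U) (\<sigma> (r U) q (act q (inv (t U)) x))" for U q x
  have r: "r U \<in> orb U" if "U \<in> \<V> n" for U n
  proof -
    have "U \<in> orb U" using image_one[OF \<V>_subset[OF that]] by (auto simp: orb_def intro!: exI[of _ \<one>])
    then show ?thesis unfolding r_def by (rule someI)
  qed
  have rV: "r U \<in> \<V> n" if "U \<in> \<V> n" for U n
    using r[OF that] \<V>_image that by (auto simp: orb_def)
  have t: "t U \<in> carrier G" "\<phi> (t U) ` r U = U" if U: "U \<in> \<V> n" for U n
  proof -
    obtain g where g: "g \<in> carrier G" "r U = \<phi> g ` U" using r[OF U] by (auto simp: orb_def)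
    have "\<phi> (inv g) ` r U = U"
      using g image_mult[OF \<V>_subset[OF U], of "inv g" g] image_one[OF \<V>_subset[OF U]] by simp
    then have "inv g \<in> carrier G \<and> \<phi> (inv g) ` r U = U" using g by simp
    then have "t U \<in> carrier G \<and> \<phi> (t U) ` r U = U" unfolding t_def by (rule someI)
    then show "t U \<in> carrier G" "\<phi> (t U) ` r U = U" by auto
  qed
  have \<sigma>: "contracts {g \<in> carrier G. \<phi> g ` U = U} (\<sigma> U)" if "U \<in> \<V> n" for U n
    unfolding \<sigma>_def by (rule someI_ex[OF \<V>_contracts[OF that]])
  have r_eq: "r (\<phi> g ` U) = r U" if "U \<in> \<V> n" "g \<in> carrier G" for U n g
  proof -
    have "orb (\<phi> g ` U) = orb U"
    proof (intro equalityI subsetI)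
      fix W assume "W \<in> orb (\<phi> g ` U)"
      then obtain h where "h \<in> carrier G" "W = \<phi> h ` \<phi> g ` U" by (auto simp: orb_def)
      then show "W \<in> orb U"
        using image_mult[OF \<V>_subset[OF that(1)], of h g] that by (auto simp: orb_def intro!: exI[of _ "h \<otimes> g"])
    next
      fix W assume "W \<in> orb U"
      then obtain h where h: "h \<in> carrier G" "W = \<phi> h ` U" by (auto simp: orb_def)
      have "\<phi> (h \<otimes> inv g) ` \<phi> g ` U = \<phi> (h \<otimes> inv g \<otimes> g) ` U"
        using image_mult[OF \<V>_subset[OF that(1)], of "h \<otimes> inv g" g] h that by simp
      also have "\<dots> = W" using h that by (simp add: m_assoc)
      finally show "W \<in> orb (\<phi> g ` U)" using h that by (auto simp: orb_def intro!: exI[of _ "h \<otimes> inv g"])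
    qed
    then show ?thesis by (simp add: r_def)
  qed
  have contr: "contracts {} (\<kappa> U)" if U: "U \<in> \<V> n" for U n
    unfolding contracts_def
  proof (intro allI ballI conjI)
    note s = \<sigma>[OF rV[OF U]] and tU = t[OF U]
    fix q x assume x: "x \<in> carrier (J q)"
    then have x': "act q (inv (t U)) x \<in> carrier (J q)" using tU by simp
    show c: "\<kappa> U q x \<in> carrier (J (q - 1))"
      unfolding \<kappa>_def using contractsD(1)[OF s x'] tU by simp
    show "\<kappa> U q (x \<oplus>\<^bsub>J q\<^esub> y) = \<kappa> U q x \<oplus>\<^bsub>J (q - 1)\<^esub> \<kappa> U q y" if y: "y \<in> carrier (J q)" for y
    proof -
      have y': "act q (inv (t U)) y \<in> carrier (J q)" using tU y by simp
      show ?thesis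
        unfolding \<kappa>_def using contractsD(1)[OF s x'] contractsD(1)[OF s y'] x y tU
        by (simp add: act_add contractsD(2)[OF s x' y'])
    qed
    have dx': "act (q + 1) (inv (t U)) (d q x) = d q (act q (inv (t U)) x)"
      using d_act[of "inv (t U)" x q "q + 1"] x tU by simp
    have "d (q - 1) (\<kappa> U q x) \<oplus>\<^bsub>J q\<^esub> \<kappa> U (q + 1) (d q x) =
        act q (t U) (d (q - 1) (\<sigma> (r U) q (act q (inv (t U)) x)) \<oplus>\<^bsub>J q\<^esub> \<sigma> (r U) (q + 1) (d q (act q (inv (t U)) x)))"
      unfolding \<kappa>_def dx'
      using contractsD(1)[OF s x'] contractsD(1)[OF s d_closed[OF x' refl]] tU
      by (simp add: act_add d_closed[of _ "q - 1" q] d_act[of _ _ "q - 1" q])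
    also have "\<dots> = x" using contractsD(4)[OF s x' refl refl] x tU by simp
    finally show "d (q - 1) (\<kappa> U q x) \<oplus>\<^bsub>J q\<^esub> \<kappa> U (q + 1) (d q x) = x" .
  qed auto
  have equiv: "\<kappa> (\<phi> g ` U) q (act q g x) = act (q - 1) g (\<kappa> U q x)"
    if U: "U \<in> \<V> n" and g: "g \<in> carrier G" and x: "x \<in> carrier (J q)" for U n g q x
  proof -
    note tU = t[OF U] and tU' = t[OF \<V>_image[OF g U]] and s = \<sigma>[OF rV[OF U]]
    let ?t' = "t (\<phi> g ` U)"
    \<comment> \<open>Both g t(U) and t(g U) carry the representative to the same set. The element k
      compares them; it preserves the representative and hence commutes with its
      contraction.\<close>
    define k where "k = inv ?t' \<otimes> g \<otimes> t U"
    have k: "k \<in> carrier G" using tU tU' g by (simp add: k_def)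
    have RX: "r U \<subseteq> topspace X" using \<V>_subset[OF rV[OF U]] .
    have "\<phi> k ` r U = \<phi> (inv ?t') ` \<phi> g ` \<phi> (t U) ` r U"
      unfolding k_def using tU(1) tU'(1) g RX by (simp add: image_mult image_closed)
    also have "\<dots> = \<phi> (inv ?t') ` \<phi> ?t' ` r U" using tU(2) tU'(2) r_eq[OF U g] by simp
    also have "\<dots> = r U" using image_mult[OF RX, of "inv ?t'" ?t'] tU' RX by (simp add: image_one)
    finally have kst: "k \<in> {g \<in> carrier G. \<phi> g ` r U = r U}" using k by simp
    let ?y = "act q (inv (t U)) x"
    have y: "?y \<in> carrier (J q)" using tU x by simp
    have "act q (inv ?t') (act q g x) = act q k ?y"
      unfolding k_def using tU tU' g x by (simp add: act_mult)
    then have "\<kappa> (\<phi> g ` U) q (act q g x) = act (q - 1) ?t' (act (q - 1) k (\<sigma> (r U) q ?y))"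
      unfolding \<kappa>_def r_eq[OF U g] by (simp only: contractsD(3)[OF s y kst refl])
    also have "\<dots> = act (q - 1) (?t' \<otimes> k) (\<sigma> (r U) q ?y)"
      using k tU' contractsD(1)[OF s y refl] by (simp add: act_mult)
    also have "?t' \<otimes> k = g \<otimes> t U" using tU tU' g by (simp add: k_def m_assoc[symmetric])
    also have "act (q - 1) (g \<otimes> t U) (\<sigma> (r U) q ?y) = act (q - 1) g (\<kappa> U q x)"
      unfolding \<kappa>_def using g tU contractsD(1)[OF s y refl] by (simp add: act_mult)
    finally show ?thesis .
  qed
  show ?thesis by (rule that[OF contr equiv])
qed

section \<open>The level of a small set and the neighbourhood attached to it\<close>

definition covered :: "'x set \<Rightarrow> bool" where
  "covered A \<longleftrightarrow> A \<noteq> {} \<and> A \<subseteq> topspace X \<and> (\<exists>n\<le>N. \<exists>U\<in>\<V> n. A \<subseteq> U)"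

text \<open>Small sets are graded by the least dimension of a neighbourhood that contains them.
  Within that dimension the neighbourhoods are disjoint, so for a nonempty set the containing one is
  unique and \<open>cell\<close> involves no real choice; this makes both notions
  equivariant.\<close>

definition level :: "'x set \<Rightarrow> nat" where
  "level A = (LEAST n. n \<le> N \<and> (\<exists>U\<in>\<V> n. A \<subseteq> U))"

definition cell :: "'x set \<Rightarrow> 'x set" where
  "cell A = (SOME U. U \<in> \<V> (level A) \<and> A \<subseteq> U)"

lemma level_cell:
  assumes "covered A"
  shows "level A \<le> N" "cell A \<in> \<V> (level A)" "A \<subseteq> cell A"
proof -
  have "\<exists>n. n \<le> N \<and> (\<exists>U\<in>\<V> n. A \<subseteq> U)" using assms by (auto simp: covered_def)
  from LeastI_ex[OF this] have L: "level A \<le> N \<and> (\<exists>U\<in>\<V> (level A). A \<subseteq> U)" by (simp add: level_def)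
  then show "level A \<le> N" by simp
  from L have "\<exists>U. U \<in> \<V> (level A) \<and> A \<subseteq> U" by blast
  from someI_ex[OF this] show "cell A \<in> \<V> (level A)" "A \<subseteq> cell A" by (auto simp: cell_def)
qed

lemma cell_eqI:
  assumes "covered A" "U \<in> \<V> (level A)" "A \<subseteq> U"
  shows "cell A = U"
proof (rule \<V>_disjoint[OF level_cell(2)[OF assms(1)] assms(2)])
  show "cell A \<inter> U \<noteq> {}" using level_cell(3)[OF assms(1)] assms by (auto simp: covered_def)
qed

lemma level_le: "\<lbrakk>n \<le> N; U \<in> \<V> n; A \<subseteq> U\<rbrakk> \<Longrightarrow> level A \<le> n"
  unfolding level_def by (rule Least_le) blast

text \<open>A face of a simplex has level at most that of the simplex, and at equal level it has the
  same neighbourhood, hence the same contraction. This dichotomy drives the level by level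
  correction of cocycles.\<close>

lemma level_cell_mono:
  assumes "covered B" "A \<subseteq> B" "A \<noteq> {}"
  shows "covered A" "level A \<le> level B" "level A = level B \<Longrightarrow> cell A = cell B"
proof -
  show A: "covered A" using assms unfolding covered_def by (meson order_trans)
  have AB: "A \<subseteq> cell B" using level_cell(3)[OF assms(1)] assms(2) by auto
  show "level A \<le> level B" using level_le[OF level_cell(1,2)[OF assms(1)] AB] .
  show "cell A = cell B" if "level A = level B"
    using cell_eqI[OF A, of "cell B"] AB level_cell(2)[OF assms(1)] that by simp
qed

lemma level_cell_image:
  assumes A: "covered A" and g: "g \<in> carrier G"
  shows "covered (\<phi> g ` A)" "level (\<phi> g ` A) = level A" "cell (\<phi> g ` A) = \<phi> g ` cell A"
proof -
  have *: "covered (\<phi> g ` A) \<and> level (\<phi> g ` A) \<le> level A" if A: "covered A" and g: "g \<in> carrier G" for A g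
  proof -
    have sub: "\<phi> g ` A \<subseteq> \<phi> g ` cell A" using level_cell(3)[OF A] by auto
    note V = \<V>_image[OF g level_cell(2)[OF A]]
    show ?thesis
      using level_le[OF level_cell(1)[OF A] V sub] sub V level_cell(1)[OF A] A g image_closed
      unfolding covered_def by blast
  qed
  show c: "covered (\<phi> g ` A)" using * A g by simp
  have "\<phi> (inv g) ` \<phi> g ` A = A"
    using image_mult[of A "inv g" g] g A by (simp add: covered_def image_one)
  then show l: "level (\<phi> g ` A) = level A"
    using *[OF A g] *[of "\<phi> g ` A" "inv g"] g by simp
  show "cell (\<phi> g ` A) = \<phi> g ` cell A"
    using level_cell(3)[OF A] by (intro cell_eqI[OF c]) (auto simp: l intro: \<V>_image[OF g level_cell(2)[OF A]])
qed

section \<open>Additive and equivariant cochains on small chains\<close>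

abbreviation sm :: "nat \<Rightarrow> ((nat \<Rightarrow> real) \<Rightarrow> 'x) set" where
  "sm \<equiv> small_simplices X (\<Union>n\<le>N. \<V> n)"

abbreviation smc :: "nat \<Rightarrow> 'x chain \<Rightarrow> bool" where
  "smc p x \<equiv> Poly_Mapping.keys x \<subseteq> sm p"

abbreviation gs :: "nat \<Rightarrow> 'a \<Rightarrow> ((nat \<Rightarrow> real) \<Rightarrow> 'x) \<Rightarrow> (nat \<Rightarrow> real) \<Rightarrow> 'x" where
  "gs p g f \<equiv> simplex_map p (\<phi> g) f"

abbreviation gc :: "nat \<Rightarrow> 'a \<Rightarrow> 'x chain \<Rightarrow> 'x chain" where
  "gc p g x \<equiv> chain_map p (\<phi> g) x"

abbreviation im :: "nat \<Rightarrow> ((nat \<Rightarrow> real) \<Rightarrow> 'x) \<Rightarrow> 'x set" where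
  "im p f \<equiv> f ` standard_simplex p"

lemma sm_iff: "f \<in> sm p \<longleftrightarrow> singular_simplex p X f \<and> covered (im p f)"
proof
  assume f: "f \<in> sm p"
  then have s: "singular_simplex p X f" by (simp add: small_simplices_def)
  then have "im p f \<subseteq> topspace X"
    by (auto simp: singular_simplex_def continuous_map_def topspace_standard_simplex Pi_iff)
  then show "singular_simplex p X f \<and> covered (im p f)"
    using f s nonempty_standard_simplex by (auto simp: small_simplices_def covered_def)
qed (auto simp: small_simplices_def covered_def)

lemma im_gs: "im p (gs p g f) = \<phi> g ` im p f"
  by (auto simp: simplex_map_def)

lemma gs_sm: "\<lbrakk>f \<in> sm p; g \<in> carrier G\<rbrakk> \<Longrightarrow> gs p g f \<in> sm p"
  using \<phi>_continuous[of g] level_cell_image(1)[of "im p f" g]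
  unfolding sm_iff im_gs by (auto intro: singular_simplex_simplex_map)

lemma gc_smc:
  assumes "smc p x" "g \<in> carrier G"
  shows "smc p (gc p g x)"
  using assms(1)
proof (induction x rule: frag_induction)
  case (one f)
  then show ?case using gs_sm[OF _ assms(2)] by simp
qed (simp_all add: chain_map_diff keys_diff_subset)

lemma gc_mult:
  assumes "smc p x" "g \<in> carrier G" "h \<in> carrier G"
  shows "gc p (g \<otimes> h) x = gc p g (gc p h x)"
proof -
  have "gc p (g \<otimes> h) x = chain_map p (\<phi> g \<circ> \<phi> h) x"
    by (rule chain_map_eq[OF small_chain_singular[OF assms(1)]]) (use act.composition_rule assms in auto)
  then show ?thesis by (simp add: chain_map_compose)
qed

lemma smc_boundary: "smc (Suc p) x \<Longrightarrow> smc p (chain_boundary (Suc p) x)"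
  using small_chain_boundary[of x X _ "Suc p"] by simp

lemma gc_boundary: "smc (Suc p) x \<Longrightarrow> chain_boundary (Suc p) (gc (Suc p) g x) = gc p g (chain_boundary (Suc p) x)"
  using chain_boundary_chain_map[OF small_chain_singular, of x X _ "Suc p" "\<phi> g"] by simp

lemma sm_nonempty: "\<exists>f. f \<in> sm 0"
proof -
  obtain a where a: "a \<in> topspace X" using X_nonempty by blast
  then obtain n U where "n \<le> N" "U \<in> \<V> n" "a \<in> U" using \<V>_cover by fastforce
  then have "restrict (\<lambda>_. a) (standard_simplex 0) \<in> sm 0"
    using a by (auto simp: small_simplices_def singular_simplex_def intro!: bexI[of _ U] continuous_map_eq[where f = "\<lambda>_. a"])
  then show ?thesis by blast
qed

text \<open>Formulated with differences to match \<open>frag_induction\<close>, which builds chains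
  from simplices by subtraction; preservation of 0 is then a consequence.\<close>

definition additive_on :: "int \<Rightarrow> nat \<Rightarrow> ('x chain \<Rightarrow> 'j) \<Rightarrow> bool" where
  "additive_on q p h \<longleftrightarrow> (\<forall>x. smc p x \<longrightarrow> h x \<in> carrier (J q)) \<and>
     (\<forall>x y. smc p x \<longrightarrow> smc p y \<longrightarrow> h (x - y) = h x \<ominus>\<^bsub>J q\<^esub> h y)"

lemma additive_onD:
  assumes "additive_on q p h" "smc p x"
  shows "h x \<in> carrier (J q)" "smc p y \<Longrightarrow> h (x - y) = h x \<ominus>\<^bsub>J q\<^esub> h y" "h 0 = \<zero>\<^bsub>J q\<^esub>"
proof -
  show 1: "h x \<in> carrier (J q)" "smc p y \<Longrightarrow> h (x - y) = h x \<ominus>\<^bsub>J q\<^esub> h y"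
    using assms by (auto simp: additive_on_def)
  have z: "smc p 0" by simp
  have "h (0 - 0) = h 0 \<ominus>\<^bsub>J q\<^esub> h 0" "h 0 \<in> carrier (J q)"
    using assms(1) z unfolding additive_on_def by blast+
  then show "h 0 = \<zero>\<^bsub>J q\<^esub>" by (simp add: J.minus_self)
qed

lemma additive_on_eqI:
  assumes "additive_on q p h" "additive_on q p h'" "\<And>f. f \<in> sm p \<Longrightarrow> h (frag_of f) = h' (frag_of f)" "smc p x"
  shows "h x = h' x"
proof -
  have "smc p x \<and> h x = h' x"
    using assms(4)
  proof (induction x rule: frag_induction)
    case zero
    show ?case using additive_onD(3)[OF assms(1), of 0] additive_onD(3)[OF assms(2), of 0] by simp
  next
    case (one f)
    then show ?case by (simp add: assms(3))
  next
    case (diff a b)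
    then show ?case
      using additive_onD(2)[OF assms(1), of a b] additive_onD(2)[OF assms(2), of a b]
      by (simp add: keys_diff_subset)
  qed
  then show ?thesis by simp
qed

text \<open>Small chains are the free abelian group on the small simplices. Nothing is said about
  chains that are not small, and therefore all later identities are restricted to small
  chains.\<close>

lemma additive_on_extension:
  assumes b: "\<And>f. f \<in> sm p \<Longrightarrow> b f \<in> carrier (J q)"
  obtains h where "additive_on q p h" "\<And>f. f \<in> sm p \<Longrightarrow> h (frag_of f) = b f"
proof -
  obtain h where h: "h \<in> hom (free_Abelian_group (sm p)) (add_monoid (J q))" "\<And>f. f \<in> sm p \<Longrightarrow> h (frag_of f) = b f"
    by (rule comm_group.free_Abelian_group_universal[OF J.a_comm_group, of b "sm p"]) (use b in auto)
  have cl: "h x \<in> carrier (J q)" if "smc p x" for x using h(1) that by (auto simp: hom_def)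
  have add: "h (x + y) = h x \<oplus>\<^bsub>J q\<^esub> h y" if "smc p x" "smc p y" for x y
    using h(1) that by (auto simp: hom_def)
  have "h (x - y) = h x \<ominus>\<^bsub>J q\<^esub> h y" if "smc p x" "smc p y" for x y
  proof -
    have xy: "smc p (x - y)" using that by (rule keys_diff_subset)
    have "h x = h (x - y) \<oplus>\<^bsub>J q\<^esub> h y" using add[OF xy that(2)] by simp
    then have "h x \<ominus>\<^bsub>J q\<^esub> h y = h (x - y) \<oplus>\<^bsub>J q\<^esub> h y \<ominus>\<^bsub>J q\<^esub> h y" by simp
    also have "\<dots> = h (x - y)" using cl[OF xy] cl[OF that(2)] by algebra
    finally show ?thesis by simp
  qed
  then show ?thesis using that[of h] h(2) cl by (auto simp: additive_on_def)
qed

lemma additive_on_add: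
  assumes "additive_on q p h" "additive_on q p h'"
  shows "additive_on q p (\<lambda>x. h x \<oplus>\<^bsub>J q\<^esub> h' x)"
  unfolding additive_on_def
proof (intro conjI allI impI)
  fix x y assume x: "smc p x" and y: "smc p y"
  note c = additive_onD(1)[OF assms(1) x] additive_onD(1)[OF assms(1) y]
    additive_onD(1)[OF assms(2) x] additive_onD(1)[OF assms(2) y]
  show "h (x - y) \<oplus>\<^bsub>J q\<^esub> h' (x - y) = h x \<oplus>\<^bsub>J q\<^esub> h' x \<ominus>\<^bsub>J q\<^esub> (h y \<oplus>\<^bsub>J q\<^esub> h' y)"
    unfolding additive_onD(2)[OF assms(1) x y] additive_onD(2)[OF assms(2) x y]
    using c by algebra
qed (use assms in \<open>auto simp: additive_on_def\<close>)

lemma additive_on_minus: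
  assumes "additive_on q p h" "additive_on q p h'"
  shows "additive_on q p (\<lambda>x. h x \<ominus>\<^bsub>J q\<^esub> h' x)"
  unfolding additive_on_def
proof (intro conjI allI impI)
  fix x y assume x: "smc p x" and y: "smc p y"
  note c = additive_onD(1)[OF assms(1) x] additive_onD(1)[OF assms(1) y]
    additive_onD(1)[OF assms(2) x] additive_onD(1)[OF assms(2) y]
  show "h (x - y) \<ominus>\<^bsub>J q\<^esub> h' (x - y) = h x \<ominus>\<^bsub>J q\<^esub> h' x \<ominus>\<^bsub>J q\<^esub> (h y \<ominus>\<^bsub>J q\<^esub> h' y)"
    unfolding additive_onD(2)[OF assms(1) x y] additive_onD(2)[OF assms(2) x y]
    using c by algebra
qed (use assms in \<open>auto simp: additive_on_def J.minus_closed\<close>)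

lemma additive_on_zero: "additive_on q p (\<lambda>x. \<zero>\<^bsub>J q\<^esub>)"
  by (auto simp: additive_on_def J.minus_self)

lemma additive_on_d:
  assumes "additive_on q p h" "q' = q + 1"
  shows "additive_on q' p (\<lambda>x. d q (h x))"
  using assms by (auto simp: additive_on_def d_minus d_closed)

lemma additive_on_boundary:
  assumes "additive_on q p h"
  shows "additive_on q (Suc p) (\<lambda>x. h (chain_boundary (Suc p) x))"
  unfolding additive_on_def chain_boundary_diff
  using additive_onD(1,2)[OF assms smc_boundary] smc_boundary by blast

lemma additive_on_act:
  assumes "additive_on q p h" "g \<in> carrier G"
  shows "additive_on q p (\<lambda>x. act q g (h x))"
  using assms by (auto simp: additive_on_def act_minus)

lemma additive_on_gc:
  assumes "additive_on q p h" "g \<in> carrier G"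
  shows "additive_on q p (\<lambda>x. h (gc p g x))"
  unfolding additive_on_def chain_map_diff
  using additive_onD(1,2)[OF assms(1) gc_smc[OF _ assms(2)]] gc_smc[OF _ assms(2)] by blast

lemma additive_on_contracts:
  assumes "additive_on q p h" "contracts H s" "q' = q - 1"
  shows "additive_on q' p (\<lambda>x. s q (h x))"
proof -
  have "s q (x \<ominus>\<^bsub>J q\<^esub> y) = s q x \<ominus>\<^bsub>J q'\<^esub> s q y" if "x \<in> carrier (J q)" "y \<in> carrier (J q)" for x y
    by (rule additive_zero(3)) (use contractsD[OF assms(2)] assms(3) that in auto)
  then show ?thesis
    using assms(1) contractsD(1)[OF assms(2) _ assms(3)] by (auto simp: additive_on_def)
qed

definition equivariant_on :: "int \<Rightarrow> nat \<Rightarrow> ('x chain \<Rightarrow> 'j) \<Rightarrow> bool" where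
  "equivariant_on q p h \<longleftrightarrow> additive_on q p h \<and>
     (\<forall>g\<in>carrier G. \<forall>x. smc p x \<longrightarrow> h (gc p g x) = act q g (h x))"

lemma equivariant_onI:
  assumes "additive_on q p h"
    and "\<And>g f. \<lbrakk>g \<in> carrier G; f \<in> sm p\<rbrakk> \<Longrightarrow> h (frag_of (gs p g f)) = act q g (h (frag_of f))"
  shows "equivariant_on q p h"
  unfolding equivariant_on_def
proof (intro conjI ballI allI impI assms(1))
  fix g x assume g: "g \<in> carrier G" and x: "smc p x"
  show "h (gc p g x) = act q g (h x)"
    by (rule additive_on_eqI[OF additive_on_gc[OF assms(1) g] additive_on_act[OF assms(1) g] _ x])
       (simp add: assms(2) g)
qed

lemma equivariant_onD:
  assumes "equivariant_on q p h"
  shows "additive_on q p h" "\<lbrakk>g \<in> carrier G; smc p x\<rbrakk> \<Longrightarrow> h (gc p g x) = act q g (h x)"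
    "smc p x \<Longrightarrow> h x \<in> carrier (J q)"
  using assms by (auto simp: equivariant_on_def additive_on_def)

lemma equivariant_on_add:
  assumes "equivariant_on q p h" "equivariant_on q p h'"
  shows "equivariant_on q p (\<lambda>x. h x \<oplus>\<^bsub>J q\<^esub> h' x)"
  unfolding equivariant_on_def
  using additive_on_add[OF assms[THEN equivariant_onD(1)]] equivariant_onD(2,3)[OF assms(1)]
    equivariant_onD(2,3)[OF assms(2)] by (simp add: act_add)

lemma equivariant_on_minus:
  assumes "equivariant_on q p h" "equivariant_on q p h'"
  shows "equivariant_on q p (\<lambda>x. h x \<ominus>\<^bsub>J q\<^esub> h' x)"
  unfolding equivariant_on_def
  using additive_on_minus[OF assms[THEN equivariant_onD(1)]] equivariant_onD(2,3)[OF assms(1)]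
    equivariant_onD(2,3)[OF assms(2)] by (simp add: act_minus)

lemma equivariant_on_zero: "equivariant_on q p (\<lambda>x. \<zero>\<^bsub>J q\<^esub>)"
  by (simp add: equivariant_on_def additive_on_zero)

lemma equivariant_on_d:
  assumes "equivariant_on q p h" "q' = q + 1"
  shows "equivariant_on q' p (\<lambda>x. d q (h x))"
  unfolding equivariant_on_def
  using additive_on_d[OF equivariant_onD(1)[OF assms(1)] assms(2)] equivariant_onD(2,3)[OF assms(1)]
  by (simp add: d_act[OF _ _ assms(2)])

lemma equivariant_on_boundary:
  assumes "equivariant_on q p h"
  shows "equivariant_on q (Suc p) (\<lambda>x. h (chain_boundary (Suc p) x))"
  unfolding equivariant_on_def
  using additive_on_boundary[OF equivariant_onD(1)[OF assms]] equivariant_onD(2)[OF assms] smc_boundary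
  by (simp add: gc_boundary)

end

lemma (in abelian_group) eq_if_minus_eq_zero:
  assumes "x \<in> carrier G" "y \<in> carrier G" "x \<ominus> y = \<zero>"
  shows "x = y"
proof -
  have "x = (x \<ominus> y) \<oplus> y" using assms(1,2) by algebra
  then show ?thesis using assms by simp
qed

context equivariant_complex
begin

lemma \<rho>_minus:
  assumes u: "\<And>g. g \<in> carrier G \<Longrightarrow> u g \<in> carrier (J q)" and v: "\<And>g. g \<in> carrier G \<Longrightarrow> v g \<in> carrier (J q)"
  shows "\<rho> q (\<lambda>g. u g \<ominus>\<^bsub>J q\<^esub> v g) = \<rho> q u \<ominus>\<^bsub>J q\<^esub> \<rho> q v"
proof -
  have c: "u g \<ominus>\<^bsub>J q\<^esub> v g \<in> carrier (J q)" if "g \<in> carrier G" for g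
    using u v that by (simp add: J.minus_closed)
  have "u g = (u g \<ominus>\<^bsub>J q\<^esub> v g) \<oplus>\<^bsub>J q\<^esub> v g" if "g \<in> carrier G" for g
    using u[OF that] v[OF that] by algebra
  then have "\<rho> q u = \<rho> q (\<lambda>g. (u g \<ominus>\<^bsub>J q\<^esub> v g) \<oplus>\<^bsub>J q\<^esub> v g)" by (rule \<rho>_cong)
  also have "\<dots> = \<rho> q (\<lambda>g. u g \<ominus>\<^bsub>J q\<^esub> v g) \<oplus>\<^bsub>J q\<^esub> \<rho> q v" using c v by (rule \<rho>_add)
  finally have eq: "\<rho> q u = \<rho> q (\<lambda>g. u g \<ominus>\<^bsub>J q\<^esub> v g) \<oplus>\<^bsub>J q\<^esub> \<rho> q v" .
  have "x \<oplus>\<^bsub>J q\<^esub> y \<ominus>\<^bsub>J q\<^esub> y = x" if "x \<in> carrier (J q)" "y \<in> carrier (J q)" for x y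
    using that by algebra
  then show ?thesis unfolding eq using \<rho>_closed[of _ q, OF c] \<rho>_closed[of v q, OF v] by simp
qed

end

context equivariant_cover
begin

lemma additive_on_eq_on:
  assumes "additive_on q p h" "additive_on q p h'" "F \<subseteq> sm p"
    and eq: "\<And>f. f \<in> F \<Longrightarrow> h (frag_of f) = h' (frag_of f)" and x: "Poly_Mapping.keys x \<subseteq> F"
  shows "h x = h' x"
proof -
  have "smc p x \<and> h x = h' x"
    using x
  proof (induction x rule: frag_induction)
    case zero
    show ?case using additive_onD(3)[OF assms(1), of 0] additive_onD(3)[OF assms(2), of 0] by simp
  next
    case (one f)
    then show ?case using assms(3) by (auto simp: eq)
  next
    case (diff a b)
    then show ?case
      using additive_onD(2)[OF assms(1), of a b] additive_onD(2)[OF assms(2), of a b]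
      by (simp add: keys_diff_subset)
  qed
  then show ?thesis by simp
qed

section \<open>The total complex of cochains with values in \<open>J\<close>\<close>

definition dg :: "int \<Rightarrow> nat \<Rightarrow> int" where
  "dg i p = i - int p"

lemma dg_simps: "dg i 0 = i" "dg i p = dg i (Suc p) + 1" "dg i (Suc p) = dg i p - 1"
  by (auto simp: dg_def)

text \<open>An equivariant cochain of total degree \<open>i - k\<close> has its component on \<open>p\<close>-chains in degree
  \<^term>\<open>dg i (p + k)\<close>.\<close>

definition cochain :: "int \<Rightarrow> nat \<Rightarrow> (nat \<Rightarrow> 'x chain \<Rightarrow> 'j) \<Rightarrow> bool" where
  "cochain i k c \<longleftrightarrow> (\<forall>p. equivariant_on (dg i (p + k)) p (c p))"

lemma cochainD:
  assumes "cochain i k c"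
  shows "equivariant_on (dg i (p + k)) p (c p)" "additive_on (dg i (p + k)) p (c p)"
    "smc p x \<Longrightarrow> c p x \<in> carrier (J (dg i (p + k)))"
  using assms equivariant_onD(1,3)[of "dg i (p + k)" p "c p"] by (auto simp: cochain_def)

definition bounded_cochain :: "int \<Rightarrow> nat \<Rightarrow> (nat \<Rightarrow> 'x chain \<Rightarrow> 'j) \<Rightarrow> bool" where
  "bounded_cochain i k c \<longleftrightarrow> cochain i k c \<and>
     (\<exists>P. \<forall>p>P. \<forall>x. smc p x \<longrightarrow> c p x = \<zero>\<^bsub>J (dg i (p + k))\<^esub>)"

text \<open>The total differential of a double complex, taken in one total degree only: the minus
  sign here and the plus sign in \<open>cocycle\<close> are chosen so that the mixed terms cancel,
  which avoids signs alternating with p. For p = 0 there is no boundary term.\<close>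

definition cobdry :: "int \<Rightarrow> (nat \<Rightarrow> 'x chain \<Rightarrow> 'j) \<Rightarrow> nat \<Rightarrow> 'x chain \<Rightarrow> 'j" where
  "cobdry i b p x = (case p of 0 \<Rightarrow> d (dg i 1) (b 0 x)
     | Suc p' \<Rightarrow> d (dg i (Suc p)) (b p x) \<ominus>\<^bsub>J (dg i p)\<^esub> b p' (chain_boundary p x))"

definition cocycle :: "int \<Rightarrow> (nat \<Rightarrow> 'x chain \<Rightarrow> 'j) \<Rightarrow> bool" where
  "cocycle i c \<longleftrightarrow> (\<forall>x. smc 0 x \<longrightarrow> d i (c 0 x) = \<zero>\<^bsub>J (i + 1)\<^esub>) \<and>
     (\<forall>p x. smc (Suc p) x \<longrightarrow>
        d (dg i (Suc p)) (c (Suc p) x) \<oplus>\<^bsub>J (dg i p)\<^esub> c p (chain_boundary (Suc p) x) = \<zero>\<^bsub>J (dg i p)\<^esub>)"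

lemma cobdry_0: "cobdry i b 0 = (\<lambda>x. d (dg i 1) (b 0 x))"
  and cobdry_Suc: "cobdry i b (Suc p) = (\<lambda>x. d (dg i (Suc (Suc p))) (b (Suc p) x)
        \<ominus>\<^bsub>J (dg i (Suc p))\<^esub> b p (chain_boundary (Suc p) x))"
  by (auto simp: cobdry_def)

lemma cochain_1_closed:
  assumes "cochain i 1 b" "smc p x"
  shows "b p x \<in> carrier (J (dg i (Suc p)))" "d (dg i (Suc p)) (b p x) \<in> carrier (J (dg i p))"
  using cochainD(3)[OF assms] d_closed[of _ "dg i (Suc p)" "dg i p"] by (auto simp: dg_simps(2)[of i p])

lemma cobdry_equivariant:
  assumes "cochain i 1 b"
  shows "equivariant_on (dg i p) p (cobdry i b p)"
proof -
  have *: "equivariant_on (dg i p) p (\<lambda>x. d (dg i (Suc p)) (b p x))" for p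
    using cochainD(1)[OF assms, of p] by (intro equivariant_on_d) (auto simp: dg_simps(2)[of i p])
  show ?thesis
  proof (cases p)
    case 0
    then show ?thesis using *[of 0] by (simp add: cobdry_0)
  next
    case (Suc p')
    have "equivariant_on (dg i (Suc p')) p' (b p')" using cochainD(1)[OF assms, of p'] by simp
    then show ?thesis
      unfolding Suc cobdry_Suc by (intro equivariant_on_minus * equivariant_on_boundary)
  qed
qed

lemma cobdry_add:
  assumes b: "cochain i 1 b" and b': "cochain i 1 b'" and x: "smc p x"
  shows "cobdry i (\<lambda>p x. b p x \<oplus>\<^bsub>J (dg i (Suc p))\<^esub> b' p x) p x =
    cobdry i b p x \<oplus>\<^bsub>J (dg i p)\<^esub> cobdry i b' p x"
proof (cases p)
  case 0
  then show ?thesis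
    using cochain_1_closed[OF b x] cochain_1_closed[OF b' x]
    by (simp add: cobdry_0 d_add[of _ "dg i (Suc 0)" _ "dg i 0"] dg_simps(2)[of i 0])
next
  case (Suc p')
  note c = cochain_1_closed[OF b x] cochain_1_closed[OF b' x]
  have bd: "smc p' (chain_boundary p x)" using smc_boundary x Suc by simp
  note c' = cochain_1_closed(1)[OF b bd] cochain_1_closed(1)[OF b' bd]
  have "d (dg i (Suc p)) (b p x \<oplus>\<^bsub>J (dg i (Suc p))\<^esub> b' p x) =
      d (dg i (Suc p)) (b p x) \<oplus>\<^bsub>J (dg i p)\<^esub> d (dg i (Suc p)) (b' p x)"
    using c by (intro d_add) (auto simp: dg_simps(2)[of i p])
  then show ?thesis
    using c(2,4) c'[folded Suc] unfolding Suc cobdry_Suc by (simp only:) algebra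
qed

text \<open>The terms with d d and with the boundary of a boundary vanish, and the mixed term
  d(b(\<partial> x)) occurs once with each sign.\<close>

lemma cocycle_minus_cobdry:
  assumes c: "cochain i 0 c" "cocycle i c" and b: "cochain i 1 b"
  shows "cocycle i (\<lambda>p x. c p x \<ominus>\<^bsub>J (dg i p)\<^esub> cobdry i b p x)"
  unfolding cocycle_def
proof (intro conjI allI impI)
  fix x assume x: "smc 0 x"
  have cx: "c 0 x \<in> carrier (J i)" using cochainD(3)[OF c(1) x] by (simp add: dg_simps(1))
  have bx: "b 0 x \<in> carrier (J (i - 1))" using cochain_1_closed(1)[OF b x] by (simp add: dg_def)
  have dbx: "d (i - 1) (b 0 x) \<in> carrier (J i)" using bx by (auto intro: d_closed)
  show "d i (c 0 x \<ominus>\<^bsub>J (dg i 0)\<^esub> cobdry i b 0 x) = \<zero>\<^bsub>J (i + 1)\<^esub>"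
    using c(2) x d_minus[OF cx dbx, of "i + 1"] d_d[OF bx, of i "i + 1"]
    by (simp add: cocycle_def cobdry_0 dg_def J.minus_self)
next
  fix p x assume x: "smc (Suc p) x"
  let ?bd = "chain_boundary (Suc p) x"
  have y: "smc p ?bd" using smc_boundary[OF x] .
  define A where "A = d (dg i (Suc p)) (c (Suc p) x)"
  define B where "B = d (dg i (Suc p)) (b p ?bd)"
  have cx: "c (Suc p) x \<in> carrier (J (dg i (Suc p)))" "c p ?bd \<in> carrier (J (dg i p))"
    using cochainD(3)[OF c(1) x] cochainD(3)[OF c(1) y] by auto
  note bx = cochain_1_closed[OF b x] and by' = cochain_1_closed[OF b y]
  have AB: "A \<in> carrier (J (dg i p))" "B \<in> carrier (J (dg i p))"
    using cx by' d_closed[OF cx(1), of "dg i p"] by (auto simp: A_def B_def dg_simps(2)[of i p])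
  have AC: "A \<oplus>\<^bsub>J (dg i p)\<^esub> c p ?bd = \<zero>\<^bsub>J (dg i p)\<^esub>"
    using c(2) x by (simp add: cocycle_def A_def)
  have dd: "d (dg i (Suc p)) (d (dg i (Suc (Suc p))) (b (Suc p) x)) = \<zero>\<^bsub>J (dg i p)\<^esub>"
    using bx(1) by (intro d_d) (auto simp: dg_def)
  have eq1: "d (dg i (Suc p)) (cobdry i b (Suc p) x) = \<zero>\<^bsub>J (dg i p)\<^esub> \<ominus>\<^bsub>J (dg i p)\<^esub> B"
    unfolding cobdry_Suc B_def using bx by'
    by (subst d_minus[of _ "dg i (Suc p)" _ "dg i p"]) (auto simp: dd dg_simps(2)[of i p])
  have eq2: "cobdry i b p ?bd = B"
  proof (cases p)
    case 0 then show ?thesis by (simp add: cobdry_0 B_def)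
  next
    case (Suc p')
    have "chain_boundary p ?bd = 0"
      unfolding Suc using chain_boundary_boundary_alt[OF small_chain_singular[OF x[unfolded Suc]]] .
    moreover have "b p' 0 = \<zero>\<^bsub>J (dg i p)\<^esub>"
      using additive_onD(3)[OF cochainD(2)[OF b, of p'], of 0] Suc by simp
    ultimately show ?thesis
      using by'(2) unfolding Suc cobdry_Suc B_def by (simp add: J.minus_eq)
  qed
  have "cobdry i b (Suc p) x \<in> carrier (J (dg i (Suc p)))"
    using equivariant_onD(3)[OF cobdry_equivariant[OF b] x] .
  then have eq3: "d (dg i (Suc p)) (c (Suc p) x \<ominus>\<^bsub>J (dg i (Suc p))\<^esub> cobdry i b (Suc p) x) =
      A \<ominus>\<^bsub>J (dg i p)\<^esub> (\<zero>\<^bsub>J (dg i p)\<^esub> \<ominus>\<^bsub>J (dg i p)\<^esub> B)"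
    unfolding A_def eq1[symmetric] using cx(1) by (intro d_minus) (auto simp: dg_simps(2)[of i p])
  have "A \<ominus>\<^bsub>J (dg i p)\<^esub> (\<zero>\<^bsub>J (dg i p)\<^esub> \<ominus>\<^bsub>J (dg i p)\<^esub> B) \<oplus>\<^bsub>J (dg i p)\<^esub> (c p ?bd \<ominus>\<^bsub>J (dg i p)\<^esub> B)
      = (A \<oplus>\<^bsub>J (dg i p)\<^esub> c p ?bd) \<oplus>\<^bsub>J (dg i p)\<^esub> (B \<ominus>\<^bsub>J (dg i p)\<^esub> B)"
    using AB cx(2) J.zero_closed[of "dg i p"] by algebra
  then show "d (dg i (Suc p)) (c (Suc p) x \<ominus>\<^bsub>J (dg i (Suc p))\<^esub> cobdry i b (Suc p) x) \<oplus>\<^bsub>J (dg i p)\<^esub>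
      (c p ?bd \<ominus>\<^bsub>J (dg i p)\<^esub> cobdry i b p ?bd) = \<zero>\<^bsub>J (dg i p)\<^esub>"
    unfolding eq3 eq2 using AC AB by (simp add: J.minus_self)
qed

text \<open>Contracting the value on each small simplex by the homotopy of its cell is a homotopy up to a
  term that only sees faces of strictly smaller level. So a cocycle becomes a coboundary after at
  most \<^term>\<open>N + 1\<close> corrections, and the number of nonzero components stays finite.\<close>

lemma cocycle_is_coboundary:
  assumes "bounded_cochain i 0 c" "cocycle i c"
    and "\<And>p f. \<lbrakk>f \<in> sm p; level (im p f) + k \<le> N\<rbrakk> \<Longrightarrow> c p (frag_of f) = \<zero>\<^bsub>J (dg i p)\<^esub>"
  shows "\<exists>b. bounded_cochain i 1 b \<and> (\<forall>p x. smc p x \<longrightarrow> c p x = cobdry i b p x)"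
  using assms
proof (induction k arbitrary: c)
  \<comment> \<open>Every small simplex has level at most N, so for k = 0 the condition on the
    support covers all of them and c itself vanishes.\<close>
  case 0
  let ?b = "\<lambda>p x. \<zero>\<^bsub>J (dg i (p + 1))\<^esub>"
  have b: "bounded_cochain i 1 ?b" by (simp add: bounded_cochain_def cochain_def equivariant_on_zero)
  have c: "cochain i 0 c" using 0(1) by (simp add: bounded_cochain_def)
  have "c p x = \<zero>\<^bsub>J (dg i p)\<^esub>" if x: "smc p x" for p x
  proof (rule additive_on_eqI[OF _ additive_on_zero _ x])
    show "additive_on (dg i p) p (c p)" using cochainD(2)[OF c, of p] by simp
    show "c p (frag_of f) = \<zero>\<^bsub>J (dg i p)\<^esub>" if "f \<in> sm p" for f
      using 0(3)[OF that] level_cell(1)[of "im p f"] that by (simp add: sm_iff)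
  qed
  moreover have "cobdry i ?b p x = \<zero>\<^bsub>J (dg i p)\<^esub>" for p x
  proof -
    have "d (dg i (Suc p)) \<zero>\<^bsub>J (dg i (Suc p))\<^esub> = \<zero>\<^bsub>J (dg i p)\<^esub>" for p by (rule d_zero) (rule dg_simps(2))
    then show ?thesis by (cases p) (simp_all add: cobdry_0 cobdry_Suc J.minus_self)
  qed
  ultimately show ?case using b by auto
next
  case (Suc k)
  have c: "cochain i 0 c" using Suc.prems(1) by (simp add: bounded_cochain_def)
  have cadd: "additive_on (dg i p) p (c p)" for p using cochainD(2)[OF c, of p] by simp
  have cf: "c p (frag_of f) \<in> carrier (J (dg i p))" if "f \<in> sm p" for p f
    using additive_onD(1)[OF cadd] that by simp
  obtain \<kappa> where \<kappa>: "\<And>U n. U \<in> \<V> n \<Longrightarrow> contracts {} (\<kappa> U)"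
    "\<And>U n g q x. \<lbrakk>U \<in> \<V> n; g \<in> carrier G; x \<in> carrier (J q)\<rbrakk> \<Longrightarrow>
       \<kappa> (\<phi> g ` U) q (act q g x) = act (q - 1) g (\<kappa> U q x)"
    using equivariant_contractions by metis
  \<comment> \<open>Each simplex uses the contraction attached to its own neighbourhood. This is not
    a single homotopy of the cochain complex, since faces of f may use other contractions; the
    resulting error is what the induction removes.\<close>
  define K where "K p f = \<kappa> (cell (im p f))" for p and f :: "(nat \<Rightarrow> real) \<Rightarrow> 'x"
  have K: "contracts {} (K p f)" if "f \<in> sm p" for p f
    using \<kappa>(1) level_cell(2)[of "im p f"] that by (auto simp: K_def sm_iff)
  have K_closed: "K p f (dg i p) x \<in> carrier (J (dg i (Suc p)))" if "f \<in> sm p" "x \<in> carrier (J (dg i p))" for p f x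
    using contractsD(1)[OF K[OF that(1)] that(2) dg_simps(3)] .
  have K_equiv: "K p (gs p g f) (dg i p) (act (dg i p) g x) = act (dg i (Suc p)) g (K p f (dg i p) x)"
    if "f \<in> sm p" "g \<in> carrier G" "x \<in> carrier (J (dg i p))" for p f g x
    using \<kappa>(2)[OF level_cell(2) that(2,3), of "im p f"] that(1) level_cell_image(3)[OF _ that(2), of "im p f"]
    by (simp add: K_def im_gs sm_iff dg_simps(3))
  have "\<exists>h. additive_on (dg i (Suc p)) p h \<and> (\<forall>f\<in>sm p. h (frag_of f) = K p f (dg i p) (c p (frag_of f)))" for p
    using additive_on_extension[of p "\<lambda>f. K p f (dg i p) (c p (frag_of f))" "dg i (Suc p)"] K_closed cf by metis
  then obtain b0 where b0: "\<And>p. additive_on (dg i (Suc p)) p (b0 p)"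
    "\<And>p f. f \<in> sm p \<Longrightarrow> b0 p (frag_of f) = K p f (dg i p) (c p (frag_of f))" by metis
  have b0c: "cochain i 1 b0"
    unfolding cochain_def
  proof
    fix p
    have "b0 p (frag_of (gs p g f)) = act (dg i (Suc p)) g (b0 p (frag_of f))"
      if g: "g \<in> carrier G" and f: "f \<in> sm p" for g f
    proof -
      have "c p (frag_of (gs p g f)) = act (dg i p) g (c p (frag_of f))"
        using equivariant_onD(2)[OF cochainD(1)[OF c, of p] g, of "frag_of f"] f by simp
      then show ?thesis
        using b0(2)[OF gs_sm[OF f g]] b0(2)[OF f] K_equiv[OF f g cf[OF f]] by simp
    qed
    then show "equivariant_on (dg i (p + 1)) p (b0 p)" using b0(1)[of p] by (auto intro: equivariant_onI)
  qed
  obtain P where P: "\<And>p x. p > P \<Longrightarrow> smc p x \<Longrightarrow> c p x = \<zero>\<^bsub>J (dg i p)\<^esub>"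
    using Suc.prems(1) by (auto simp: bounded_cochain_def)
  have b0_zero: "b0 p x = \<zero>\<^bsub>J (dg i (Suc p))\<^esub>" if "p > P" "smc p x" for p x
  proof (rule additive_on_eqI[OF b0(1) additive_on_zero _ that(2)])
    show "b0 p (frag_of f) = \<zero>\<^bsub>J (dg i (Suc p))\<^esub>" if "f \<in> sm p" for f
      using b0(2)[OF that] P[OF \<open>p > P\<close>, of "frag_of f"] contracts_zero[OF K[OF that], of "dg i (Suc p)" "dg i p"] that
      by (simp add: dg_simps(3))
  qed
  have b0b: "bounded_cochain i 1 b0" using b0c b0_zero by (auto simp: bounded_cochain_def)
  define c' where "c' p x = c p x \<ominus>\<^bsub>J (dg i p)\<^esub> cobdry i b0 p x" for p x
  have c': "cochain i 0 c'"
    unfolding cochain_def c'_def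
    using cochainD(1)[OF c] cobdry_equivariant[OF b0c] equivariant_on_minus by simp
  \<comment> \<open>The boundary term reaches one degree higher, so each correction may add one
    nonzero component.\<close>
  have "c' p x = \<zero>\<^bsub>J (dg i p)\<^esub>" if p: "p > Suc P" and x: "smc p x" for p x
  proof -
    obtain p' where p': "p = Suc p'" "p' > P" using p by (cases p) auto
    have "d (dg i (Suc p)) \<zero>\<^bsub>J (dg i (Suc p))\<^esub> = \<zero>\<^bsub>J (dg i p)\<^esub>" by (rule d_zero) (rule dg_simps(2))
    then have "cobdry i b0 p x = \<zero>\<^bsub>J (dg i p)\<^esub>"
      using b0_zero[of p x] b0_zero[of p' "chain_boundary p x"] p x p' smc_boundary[of x p']
      by (simp add: cobdry_Suc J.minus_self)
    then show ?thesis using P[of p x] p x by (simp add: c'_def J.minus_self)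
  qed
  then have c'b: "bounded_cochain i 0 c'" using c' by (auto simp: bounded_cochain_def)
  have "c' p (frag_of f) = \<zero>\<^bsub>J (dg i p)\<^esub>" if f: "f \<in> sm p" and lev: "level (im p f) + k \<le> N" for p f
  proof -
    have x: "smc p (frag_of f)" using f by simp
    let ?x = "frag_of f"
    note hom = contractsD(4)[OF K[OF f] cf[OF f] dg_simps(3), of "dg i p + 1"]
    have "c p ?x = cobdry i b0 p ?x"
    proof (cases p)
      case 0
      have "d (dg i p) (c p ?x) = \<zero>\<^bsub>J (dg i p + 1)\<^esub>"
        using Suc.prems(2) x 0 by (simp add: cocycle_def dg_simps(1))
      then have "d (dg i (Suc p)) (K p f (dg i p) (c p ?x)) = c p ?x"
        using contracts_d_zero[OF K[OF f] cf[OF f] _ dg_simps(3)] by simp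
      then show ?thesis using b0(2)[OF f] 0 by (simp add: cobdry_0)
    next
      case p: (Suc p')
      let ?bd = "chain_boundary p ?x"
      have y: "smc p' ?bd" using smc_boundary x p by simp
      have fc: "singular_simplex p X f" "covered (im p f)" using f by (auto simp: sm_iff)
      \<comment> \<open>For every face of f the contraction of f may be used in place of that of the
        face: at equal level the two coincide, and at lower level c vanishes on the face by the
        hypothesis for k + 1. Hence K(c(\<partial> f)) = b0(\<partial> f), and the homotopy identity
        at c(f) together with the cocycle condition gives c(f) = d(b0 f) - b0(\<partial> f).\<close>
      define F where "F = {f' \<in> sm p'. K p f (dg i p') (c p' (frag_of f')) = b0 p' (frag_of f')}"
      have keysF: "Poly_Mapping.keys ?bd \<subseteq> F"
      proof
        fix f' assume f': "f' \<in> Poly_Mapping.keys ?bd"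
        have sub: "im p' f' \<subseteq> im p f" using keys_chain_boundary_of_image[OF f' fc(1)] p by simp
        have f's: "f' \<in> sm p'" using y f' by auto
        have ne: "im p' f' \<noteq> {}" using nonempty_standard_simplex by blast
        note mono = level_cell_mono[OF fc(2) sub ne]
        have "K p f (dg i p') (c p' (frag_of f')) = b0 p' (frag_of f')"
        proof (cases "level (im p' f') = level (im p f)")
          case True
          then show ?thesis using mono(3) b0(2)[OF f's] by (simp add: K_def)
        next
          case False
          then have "level (im p' f') + Suc k \<le> N" using mono(2) lev by simp
          then have "c p' (frag_of f') = \<zero>\<^bsub>J (dg i p')\<^esub>" by (rule Suc.prems(3)[OF f's])
          then show ?thesis
            using b0(2)[OF f's] contracts_zero[OF K[OF f's], of _ "dg i p'"] contracts_zero[OF K[OF f], of _ "dg i p'"]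
            by (metis dg_simps(3))
        qed
        then show "f' \<in> F" using f's by (simp add: F_def)
      qed
      have Kbd: "K p f (dg i p') (c p' ?bd) = b0 p' ?bd"
      proof (rule additive_on_eq_on[OF _ b0(1) _ _ keysF])
        show "additive_on (dg i (Suc p')) p' (\<lambda>x. K p f (dg i p') (c p' x))"
          by (rule additive_on_contracts[OF cadd K[OF f] dg_simps(3)])
        show "F \<subseteq> sm p'" unfolding F_def by blast
        show "K p f (dg i p') (c p' (frag_of f')) = b0 p' (frag_of f')" if "f' \<in> F" for f'
          using that unfolding F_def by blast
      qed
      have cbd: "c p' ?bd \<in> carrier (J (dg i p'))" using additive_onD(1)[OF cadd y] .
      have dc: "d (dg i p) (c p ?x) \<in> carrier (J (dg i p'))"
        using cf[OF f] by (rule d_closed) (simp add: p dg_def)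
      have "d (dg i p) (c p ?x) \<oplus>\<^bsub>J (dg i p')\<^esub> c p' ?bd = \<zero>\<^bsub>J (dg i p')\<^esub>"
        using Suc.prems(2) x p by (simp add: cocycle_def)
      then have "K p f (dg i p') (d (dg i p) (c p ?x) \<oplus>\<^bsub>J (dg i p')\<^esub> c p' ?bd) = \<zero>\<^bsub>J (dg i p)\<^esub>"
        using contracts_zero[OF K[OF f], of "dg i p" "dg i p'"] p by (simp add: dg_simps(3))
      then have sum: "K p f (dg i p') (d (dg i p) (c p ?x)) \<oplus>\<^bsub>J (dg i p)\<^esub> b0 p' ?bd = \<zero>\<^bsub>J (dg i p)\<^esub>"
        using contractsD(2)[OF K[OF f] dc cbd, of "dg i p"] Kbd p by (simp add: dg_simps(3))
      have e: "d (dg i (Suc p)) (b0 p ?x) \<oplus>\<^bsub>J (dg i p)\<^esub> K p f (dg i p') (d (dg i p) (c p ?x)) = c p ?x"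
        using hom b0(2)[OF f] p by (simp add: dg_def)
      note cl = cochain_1_closed(2)[OF b0c x] cochain_1_closed(1)[OF b0c y, folded p]
        contractsD(1)[OF K[OF f] dc, of "dg i p"]
      have Kc: "K p f (dg i p') (d (dg i p) (c p ?x)) \<in> carrier (J (dg i p))"
        using cl(3) p by (simp add: dg_simps(3))
      have aux: "u \<oplus>\<^bsub>J (dg i p)\<^esub> v = u \<oplus>\<^bsub>J (dg i p)\<^esub> (v \<oplus>\<^bsub>J (dg i p)\<^esub> w) \<ominus>\<^bsub>J (dg i p)\<^esub> w"
        if "u \<in> carrier (J (dg i p))" "v \<in> carrier (J (dg i p))" "w \<in> carrier (J (dg i p))" for u v w
        using that by algebra
      have "c p ?x = d (dg i (Suc p)) (b0 p ?x) \<oplus>\<^bsub>J (dg i p)\<^esub> K p f (dg i p') (d (dg i p) (c p ?x))"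
        by (rule e[symmetric])
      also have "\<dots> = d (dg i (Suc p)) (b0 p ?x) \<ominus>\<^bsub>J (dg i p)\<^esub> b0 p' ?bd"
        unfolding aux[OF cl(1) Kc cl(2)] sum using cl(1) by simp
      finally show ?thesis by (simp add: p cobdry_Suc)
    qed
    then show ?thesis using cf[OF f] by (simp add: c'_def J.minus_self)
  qed
  note supp = this
  have "cocycle i c'"
    using cocycle_minus_cobdry[OF c Suc.prems(2) b0c] unfolding c'_def[abs_def] .
  from Suc.IH[OF c'b this supp] obtain b1 where b1: "bounded_cochain i 1 b1"
    "\<And>p x. smc p x \<Longrightarrow> c' p x = cobdry i b1 p x"
    by blast
  have b1c: "cochain i 1 b1" using b1(1) by (simp add: bounded_cochain_def)
  let ?b = "\<lambda>p x. b0 p x \<oplus>\<^bsub>J (dg i (Suc p))\<^esub> b1 p x"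
  have "bounded_cochain i 1 ?b"
  proof -
    obtain P1 where P1: "\<And>p x. p > P1 \<Longrightarrow> smc p x \<Longrightarrow> b1 p x = \<zero>\<^bsub>J (dg i (Suc p))\<^esub>"
      using b1(1) by (auto simp: bounded_cochain_def)
    have "cochain i 1 ?b"
      unfolding cochain_def
      using equivariant_on_add[OF cochainD(1)[OF b0c] cochainD(1)[OF b1c]] by simp
    then show ?thesis
      unfolding bounded_cochain_def using b0_zero P1
      by (auto intro!: exI[of _ "max P P1"])
  qed
  moreover have "c p x = cobdry i ?b p x" if x: "smc p x" for p x
  proof -
    have cl: "c p x \<in> carrier (J (dg i p))" "cobdry i b0 p x \<in> carrier (J (dg i p))"
      using additive_onD(1)[OF cadd x] equivariant_onD(3)[OF cobdry_equivariant[OF b0c] x] by auto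
    have "c p x = cobdry i b0 p x \<oplus>\<^bsub>J (dg i p)\<^esub> c' p x"
      unfolding c'_def using cl by algebra
    then show ?thesis using b1(2)[OF x] cobdry_add[OF b0c b1c x] by simp
  qed
  ultimately show ?case by blast
qed

end

section \<open>From a bounded family of cochains to an invariant preimage\<close>

context equivariant_cover
begin

lemma small_contraction:
  obtains h where "\<And>p x y. h p (x - y) = h p x - h p y" "\<And>p x. smc p x \<Longrightarrow> smc (Suc p) (h p x)"
    "\<And>p x. smc (Suc p) x \<Longrightarrow> chain_boundary (Suc (Suc p)) (h (Suc p) x) + h p (chain_boundary (Suc p) x) = x"
proof (rule small_chain_contraction[OF X_contractible])
  show "openin X U" if "U \<in> (\<Union>n\<le>N. \<V> n)" for U using that \<V>_open by blast
  show "topspace X \<subseteq> \<Union>(\<Union>n\<le>N. \<V> n)" using \<V>_cover by blast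
qed (rule that)

lemma additive_on_sum:
  assumes "additive_on q p h" "smc p x" "smc p y"
  shows "h (x + y) = h x \<oplus>\<^bsub>J q\<^esub> h y"
proof -
  have z: "smc p 0" by simp
  have ny: "smc p (0 - y)" using keys_diff_subset[OF z assms(3)] .
  have "h (x - (0 - y)) = h x \<ominus>\<^bsub>J q\<^esub> h (0 - y)" using additive_onD(2)[OF assms(1,2) ny] .
  also have "h (0 - y) = h 0 \<ominus>\<^bsub>J q\<^esub> h y" using additive_onD(2)[OF assms(1) z assms(3)] .
  also have "h 0 = \<zero>\<^bsub>J q\<^esub>" using additive_onD(3)[OF assms(1,2)] .
  finally show ?thesis
    using additive_onD(1)[OF assms(1,2)] additive_onD(1)[OF assms(1,3)] by (simp add: J.minus_eq)
qed

text \<open>A sum over all g of the conjugates g a0(g^-1 x), with \<rho> in place of the sum;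
  replacing g by h^-1 g, which \<open>\<rho>_act\<close> permits, shows equivariance.\<close>

lemma additive_on_average:
  assumes a0: "additive_on q p a0"
  shows "equivariant_on q p (\<lambda>x. \<rho> q (\<lambda>g. act q g (a0 (gc p (inv g) x))))"
  unfolding equivariant_on_def
proof (intro conjI ballI allI impI)
  have cl: "act q g (a0 (gc p (inv g) x)) \<in> carrier (J q)" if "smc p x" "g \<in> carrier G" for x g
    using additive_onD(1)[OF a0 gc_smc[OF that(1)]] that(2) by simp
  show "additive_on q p (\<lambda>x. \<rho> q (\<lambda>g. act q g (a0 (gc p (inv g) x))))"
    unfolding additive_on_def
  proof (intro conjI allI impI)
    show "\<rho> q (\<lambda>g. act q g (a0 (gc p (inv g) x))) \<in> carrier (J q)" if "smc p x" for x
      using cl[OF that] by (rule \<rho>_closed)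
    fix x y assume x: "smc p x" and y: "smc p y"
    have "act q g (a0 (gc p (inv g) (x - y))) = act q g (a0 (gc p (inv g) x)) \<ominus>\<^bsub>J q\<^esub> act q g (a0 (gc p (inv g) y))"
      if g: "g \<in> carrier G" for g
      using gc_smc[OF x, of "inv g"] gc_smc[OF y, of "inv g"] g
      by (simp add: chain_map_diff additive_onD(2)[OF a0] act_minus additive_onD(1)[OF a0])
    then have "\<rho> q (\<lambda>g. act q g (a0 (gc p (inv g) (x - y)))) =
        \<rho> q (\<lambda>g. act q g (a0 (gc p (inv g) x)) \<ominus>\<^bsub>J q\<^esub> act q g (a0 (gc p (inv g) y)))"
      by (rule \<rho>_cong)
    also have "\<dots> = \<rho> q (\<lambda>g. act q g (a0 (gc p (inv g) x))) \<ominus>\<^bsub>J q\<^esub> \<rho> q (\<lambda>g. act q g (a0 (gc p (inv g) y)))"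
      by (rule \<rho>_minus[OF cl[OF x] cl[OF y]])
    finally show "\<rho> q (\<lambda>g. act q g (a0 (gc p (inv g) (x - y)))) =
      \<rho> q (\<lambda>g. act q g (a0 (gc p (inv g) x))) \<ominus>\<^bsub>J q\<^esub> \<rho> q (\<lambda>g. act q g (a0 (gc p (inv g) y)))" .
  qed
  fix h x assume h: "h \<in> carrier G" and x: "smc p x"
  have "act q g (a0 (gc p (inv g) (gc p h x))) =
      act q h (act q (inv h \<otimes> g) (a0 (gc p (inv (inv h \<otimes> g)) x)))" if g: "g \<in> carrier G" for g
  proof -
    have "gc p (inv (inv h \<otimes> g)) x = gc p (inv g) (gc p h x)"
      using gc_mult[OF x, of "inv g" h] g h by (simp add: inv_mult_group)
    moreover have "act q h (act q (inv h \<otimes> g) y) = act q g y" if "y \<in> carrier (J q)" for y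
      using act_mult[of h "inv h \<otimes> g" y q] that g h by (simp add: m_assoc[symmetric])
    ultimately show ?thesis
      using additive_onD(1)[OF a0 gc_smc[OF gc_smc[OF x h], of "inv g"]] g by simp
  qed
  then have "\<rho> q (\<lambda>g. act q g (a0 (gc p (inv g) (gc p h x)))) =
      \<rho> q (\<lambda>g. act q h (act q (inv h \<otimes> g) (a0 (gc p (inv (inv h \<otimes> g)) x))))"
    by (rule \<rho>_cong)
  also have "\<dots> = act q h (\<rho> q (\<lambda>g. act q g (a0 (gc p (inv g) x))))"
    by (rule \<rho>_act[OF h cl[OF x]])
  finally show "\<rho> q (\<lambda>g. act q g (a0 (gc p (inv g) (gc p h x)))) = act q h (\<rho> q (\<lambda>g. act q g (a0 (gc p (inv g) x))))" .
qed

text \<open>Contract non-equivariantly, then average over the group.\<close>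

lemma equivariant_on_coboundary:
  assumes b: "equivariant_on q (Suc p) b"
    and zero: "\<And>x. smc (Suc (Suc p)) x \<Longrightarrow> b (chain_boundary (Suc (Suc p)) x) = \<zero>\<^bsub>J q\<^esub>"
  obtains a where "equivariant_on q p a" "\<And>x. smc (Suc p) x \<Longrightarrow> a (chain_boundary (Suc p) x) = b x"
proof -
  obtain h where h: "\<And>p x y. h p (x - y) = h p x - h p y" "\<And>p x. smc p x \<Longrightarrow> smc (Suc p) (h p x)"
    "\<And>p x. smc (Suc p) x \<Longrightarrow> chain_boundary (Suc (Suc p)) (h (Suc p) x) + h p (chain_boundary (Suc p) x) = x"
    using small_contraction by metis
  note badd = equivariant_onD(1)[OF b]
  \<comment> \<open>Composing b with the contraction of small chains gives b(h(\<partial> x)) = b(x)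
    - b(\<partial>(h x)), and the last term is zero by assumption.\<close>
  define a0 where "a0 x = b (h p x)" for x
  have a0: "additive_on q p a0"
    unfolding additive_on_def a0_def h(1)
    using additive_onD(1,2)[OF badd h(2)] h(2) by blast
  have a0_bd: "a0 (chain_boundary (Suc p) x) = b x" if x: "smc (Suc p) x" for x
  proof -
    let ?y = "chain_boundary (Suc (Suc p)) (h (Suc p) x)" and ?z = "h p (chain_boundary (Suc p) x)"
    have hx: "smc (Suc (Suc p)) (h (Suc p) x)" by (rule h(2)[OF x])
    have z: "smc (Suc p) ?z" by (rule h(2)[OF smc_boundary[OF x]])
    have "b (?y + ?z) = b ?y \<oplus>\<^bsub>J q\<^esub> b ?z" by (rule additive_on_sum[OF badd smc_boundary[OF hx] z])
    then show ?thesis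
      unfolding h(3)[OF x] zero[OF hx] a0_def using additive_onD(1)[OF badd z] by simp
  qed
  let ?a = "\<lambda>x. \<rho> q (\<lambda>g. act q g (a0 (gc p (inv g) x)))"
  show ?thesis
  proof (rule that[OF additive_on_average[OF a0]])
    fix x assume x: "smc (Suc p) x"
    have bx: "b x \<in> carrier (J q)" by (rule additive_onD(1)[OF badd x])
    \<comment> \<open>On boundaries all conjugates of a0 already take the value b(x), because b is
      equivariant; \<rho> fixes this constant.\<close>
    have "act q g (a0 (gc p (inv g) (chain_boundary (Suc p) x))) = b x" if g: "g \<in> carrier G" for g
    proof -
      have "a0 (gc p (inv g) (chain_boundary (Suc p) x)) = b (gc (Suc p) (inv g) x)"
        using a0_bd[OF gc_smc[OF x, of "inv g"]] gc_boundary[OF x, of "inv g"] g by simp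
      also have "\<dots> = act q (inv g) (b x)" using equivariant_onD(2)[OF b _ x] g by simp
      finally show ?thesis using g bx by simp
    qed
    then have "?a (chain_boundary (Suc p) x) = \<rho> q (\<lambda>_. b x)" by (rule \<rho>_cong)
    then show "?a (chain_boundary (Suc p) x) = b x" by (simp add: \<rho>_const[OF bx])
  qed
qed

text \<open>Downward induction on the last nonzero component. Its composite with the boundary is d
  of the next component and hence zero, so it is the composite of the boundary with some equivariant
  a, and subtracting d a from the component below allows it to be removed. If only component 0 is
  left, it vanishes on boundaries and so takes the same value at all points; that value is invariant
  and is mapped to z.\<close>

lemma invariant_lift_of_cochain:
  assumes "cochain i 1 b" and "\<And>p x. p > k \<Longrightarrow> smc p x \<Longrightarrow> b p x = \<zero>\<^bsub>J (dg i (Suc p))\<^esub>"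
    and "\<And>f. f \<in> sm 0 \<Longrightarrow> d (dg i 1) (b 0 (frag_of f)) = z"
    and "\<And>p x. smc (Suc p) x \<Longrightarrow> d (dg i (Suc (Suc p))) (b (Suc p) x) = b p (chain_boundary (Suc p) x)"
  shows "\<exists>w\<in>carrier (J (i - 1)). d (i - 1) w = z \<and> invariant (i - 1) (carrier G) w"
  using assms
proof (induction k arbitrary: b)
  case 0
  have deg1: "dg i 1 = i - 1" by (simp add: dg_def)
  obtain f0 where f0: "f0 \<in> sm 0" using sm_nonempty by blast
  have badd: "additive_on (i - 1) 0 (b 0)" using cochainD(2)[OF 0(1), of 0] deg1 by simp
  have bcl: "b 0 (frag_of f) \<in> carrier (J (i - 1))" if "f \<in> sm 0" for f
    using additive_onD(1)[OF badd, of "frag_of f"] that by simp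
  have same: "b 0 (frag_of f) = b 0 (frag_of f0)" if f: "f \<in> sm 0" for f
  proof -
    obtain e where e: "smc 1 e" "chain_boundary 1 e = frag_of f - frag_of f0"
      using small_points_homologous[OF X_contractible _ _ f f0] \<V>_open \<V>_cover by fastforce
    have "d (dg i (Suc (Suc 0))) \<zero>\<^bsub>J (dg i (Suc (Suc 0)))\<^esub> = \<zero>\<^bsub>J (dg i (Suc 0))\<^esub>" by (rule d_zero) (rule dg_simps(2))
    then have "b 0 (chain_boundary 1 e) = \<zero>\<^bsub>J (i - 1)\<^esub>"
      using 0(4)[of e 0] 0(2)[of 1 e] e(1) deg1 by simp
    then have "b 0 (frag_of f) \<ominus>\<^bsub>J (i - 1)\<^esub> b 0 (frag_of f0) = \<zero>\<^bsub>J (i - 1)\<^esub>"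
      using additive_onD(2)[OF badd, of "frag_of f" "frag_of f0"] f f0 e(2) by simp
    then show ?thesis by (rule J.eq_if_minus_eq_zero[OF bcl[OF f] bcl[OF f0]])
  qed
  show ?case
  proof (rule bexI[OF _ bcl[OF f0]], rule conjI)
    show "d (i - 1) (b 0 (frag_of f0)) = z" using 0(3)[OF f0] deg1 by simp
    show "invariant (i - 1) (carrier G) (b 0 (frag_of f0))"
      unfolding invariant_def
    proof
      fix g assume g: "g \<in> carrier G"
      have "act (i - 1) g (b 0 (frag_of f0)) = b 0 (frag_of (gs 0 g f0))"
        using equivariant_onD(2)[OF cochainD(1)[OF 0(1), of 0] g, of "frag_of f0"] f0 deg1 by simp
      then show "act (i - 1) g (b 0 (frag_of f0)) = b 0 (frag_of f0)" using same[OF gs_sm[OF f0 g]] by simp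
    qed
  qed
next
  case (Suc k)
  note b = Suc.prems(1)
  have d0: "d (dg i (Suc p)) \<zero>\<^bsub>J (dg i (Suc p))\<^esub> = \<zero>\<^bsub>J (dg i p)\<^esub>" for p by (rule d_zero) (rule dg_simps(2))
  have beq: "equivariant_on (dg i (Suc (Suc k))) (Suc k) (b (Suc k))" using cochainD(1)[OF b, of "Suc k"] by simp
  obtain a where a: "equivariant_on (dg i (Suc (Suc k))) k a"
    "\<And>x. smc (Suc k) x \<Longrightarrow> a (chain_boundary (Suc k) x) = b (Suc k) x"
  proof (rule equivariant_on_coboundary[OF beq])
    fix x assume x: "smc (Suc (Suc k)) x"
    show "b (Suc k) (chain_boundary (Suc (Suc k)) x) = \<zero>\<^bsub>J (dg i (Suc (Suc k)))\<^esub>"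
      using Suc.prems(4)[OF x, symmetric] Suc.prems(2)[of "Suc (Suc k)" x] x d0[of "Suc (Suc k)"] by simp
  qed blast
  let ?da = "\<lambda>x. d (dg i (Suc (Suc k))) (a x)"
  have da: "equivariant_on (dg i (Suc k)) k ?da" using a(1) by (rule equivariant_on_d) (rule dg_simps(2))
  have dda: "d (dg i (Suc k)) (?da x) = \<zero>\<^bsub>J (dg i k)\<^esub>" if "smc k x" for x
    using equivariant_onD(3)[OF a(1) that] by (rule d_d) (simp_all add: dg_def)
  \<comment> \<open>Only components k and k + 1 change. The equations below k survive because d(d a)
    = 0, and the equation between k and k + 1 becomes 0 = 0 by the choice of a.\<close>
  define b' where "b' p = (if p = k then \<lambda>x. b k x \<ominus>\<^bsub>J (dg i (Suc k))\<^esub> ?da x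
      else if p = Suc k then \<lambda>x. \<zero>\<^bsub>J (dg i (Suc (Suc k)))\<^esub> else b p)" for p
  have b'c: "cochain i 1 b'"
    unfolding cochain_def
  proof
    fix p
    show "equivariant_on (dg i (p + 1)) p (b' p)"
      using equivariant_on_minus[OF _ da, of "b k"] cochainD(1)[OF b, of k] cochainD(1)[OF b, of p]
        equivariant_on_zero[of "dg i (Suc (Suc k))" "Suc k"]
      by (auto simp: b'_def)
  qed
  have d_b'k: "d (dg i (Suc k)) (b' k x) = d (dg i (Suc k)) (b k x)" if x: "smc k x" for x
  proof -
    have cl: "b k x \<in> carrier (J (dg i (Suc k)))" "?da x \<in> carrier (J (dg i (Suc k)))"
      using cochain_1_closed(1)[OF b x] equivariant_onD(3)[OF da x] by auto
    have "d (dg i (Suc k)) (b k x \<ominus>\<^bsub>J (dg i (Suc k))\<^esub> ?da x) = d (dg i (Suc k)) (b k x) \<ominus>\<^bsub>J (dg i k)\<^esub> \<zero>\<^bsub>J (dg i k)\<^esub>"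
      using d_minus[OF cl dg_simps(2)] dda[OF x] by simp
    then show ?thesis using cochain_1_closed(2)[OF b x] by (simp add: b'_def J.minus_eq)
  qed
  show ?case
  proof (rule Suc.IH[OF b'c])
    show "b' p x = \<zero>\<^bsub>J (dg i (Suc p))\<^esub>" if "p > k" "smc p x" for p x
      using Suc.prems(2)[of p x] that by (cases "p = Suc k") (auto simp: b'_def)
    show "d (dg i 1) (b' 0 (frag_of f)) = z" if f: "f \<in> sm 0" for f
      using d_b'k[of "frag_of f"] Suc.prems(3)[OF f] f by (cases "k = 0") (auto simp: b'_def)
    fix p x assume x: "smc (Suc p) x"
    have y: "smc p (chain_boundary (Suc p) x)" by (rule smc_boundary[OF x])
    consider "Suc p = k" | "p = k" | "p = Suc k" | "Suc p \<noteq> k" "p \<noteq> k" "p \<noteq> Suc k" by blast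
    then show "d (dg i (Suc (Suc p))) (b' (Suc p) x) = b' p (chain_boundary (Suc p) x)"
    proof cases
      case 1
      then show ?thesis using d_b'k[of x] x Suc.prems(4)[OF x] by (auto simp: b'_def)
    next
      case 2
      have "b k (chain_boundary (Suc k) x) = ?da (chain_boundary (Suc k) x)"
        using Suc.prems(4)[of x k] a(2)[of x] x 2 by simp
      moreover have "?da (chain_boundary (Suc k) x) \<in> carrier (J (dg i (Suc k)))"
        using equivariant_onD(3)[OF da, of "chain_boundary (Suc k) x"] y 2 by simp
      ultimately show ?thesis using 2 d0[of "Suc k"] by (simp add: b'_def J.minus_self)
    next
      case 3
      then show ?thesis using Suc.prems(2)[of "Suc p" x] x d0[of "Suc p"] by (simp add: b'_def)
    next
      case 4
      then show ?thesis using Suc.prems(4)[OF x] by (simp add: b'_def)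
    qed
  qed
qed

text \<open>Start from the constant cochain with value z on points, placed in component 0; it is
  equivariant since z is invariant, and a cocycle since the two ends of a path get the same value
  and d z = 0. Writing it as a coboundary gives d(b 0) = z on points and the vanishing of all higher
  components, which are the hypotheses of \<open>invariant_lift_of_cochain\<close>.\<close>

theorem invariant_lift_of_cover:
  assumes z: "z \<in> carrier (J i)" "d i z = \<zero>\<^bsub>J (i + 1)\<^esub>" "invariant i (carrier G) z"
  shows "\<exists>w\<in>carrier (J (i - 1)). d (i - 1) w = z \<and> invariant (i - 1) (carrier G) w"
proof -
  obtain h where h: "additive_on i 0 h" "\<And>f. f \<in> sm 0 \<Longrightarrow> h (frag_of f) = z"
    using additive_on_extension[of 0 "\<lambda>_. z" i] z(1) by metis
  have heq: "equivariant_on i 0 h"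
    using h z(3) gs_sm by (intro equivariant_onI) (auto simp: invariant_def)
  define c where "c p = (if p = 0 then h else (\<lambda>_. \<zero>\<^bsub>J (dg i p)\<^esub>))" for p :: nat
  have cc: "cochain i 0 c"
    unfolding cochain_def c_def using heq equivariant_on_zero by (auto simp: dg_def)
  then have cb: "bounded_cochain i 0 c" by (auto simp: bounded_cochain_def c_def intro!: exI[of _ 0])
  have d0: "d (dg i (Suc p)) \<zero>\<^bsub>J (dg i (Suc p))\<^esub> = \<zero>\<^bsub>J (dg i p)\<^esub>" for p by (rule d_zero) (rule dg_simps(2))
  have dh: "d i (h x) = \<zero>\<^bsub>J (i + 1)\<^esub>" if "smc 0 x" for x
    using additive_on_eqI[OF additive_on_d[OF h(1) refl] additive_on_zero _ that] h(2) z(2) by simp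
  have hbd: "h (chain_boundary (Suc 0) x) = \<zero>\<^bsub>J i\<^esub>" if x: "smc (Suc 0) x" for x
  proof (rule additive_on_eqI[OF additive_on_boundary[OF h(1)] additive_on_zero _ x])
    fix f assume f: "f \<in> sm (Suc 0)"
    then obtain U where U: "U \<in> (\<Union>n\<le>N. \<V> n)" "singular_simplex (Suc 0) (subtopology X U) f"
      by (auto simp: small_chain_iff_Union)
    have face: "singular_face (Suc 0) k f \<in> sm 0" if "k \<le> Suc 0" for k
      using singular_simplex_singular_face[OF U(2), of k] that U(1) by (auto simp: small_chain_iff_Union)
    have "chain_boundary (Suc 0) (frag_of f) = frag_of (singular_face (Suc 0) 0 f) - frag_of (singular_face (Suc 0) (Suc 0) f)"
      by (simp add: chain_boundary_of)
    then show "h (chain_boundary (Suc 0) (frag_of f)) = \<zero>\<^bsub>J i\<^esub>"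
      using additive_onD(2)[OF h(1), of "frag_of (singular_face (Suc 0) 0 f)" "frag_of (singular_face (Suc 0) (Suc 0) f)"]
        face h(2) z(1) by (simp add: J.minus_self)
  qed
  have cyc: "cocycle i c"
    unfolding cocycle_def
  proof (intro conjI allI impI)
    show "d i (c 0 x) = \<zero>\<^bsub>J (i + 1)\<^esub>" if "smc 0 x" for x using dh[OF that] by (simp add: c_def)
    fix p x assume x: "smc (Suc p) x"
    show "d (dg i (Suc p)) (c (Suc p) x) \<oplus>\<^bsub>J (dg i p)\<^esub> c p (chain_boundary (Suc p) x) = \<zero>\<^bsub>J (dg i p)\<^esub>"
      using d0[of p] hbd[of x] x by (cases p) (simp_all add: c_def dg_simps(1))
  qed
  \<comment> \<open>With k = \<open>Suc N\<close> the condition on the support is void, since no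
    level satisfies it.\<close>
  have "\<exists>b. bounded_cochain i 1 b \<and> (\<forall>p x. smc p x \<longrightarrow> c p x = cobdry i b p x)"
    by (rule cocycle_is_coboundary[OF cb cyc, of "Suc N"]) simp
  then obtain b where b: "bounded_cochain i 1 b" "\<And>p x. smc p x \<Longrightarrow> c p x = cobdry i b p x" by blast
  have P1: "cochain i 1 b" using b(1) by (simp add: bounded_cochain_def)
  have "\<exists>P. \<forall>p>P. \<forall>x. smc p x \<longrightarrow> b p x = \<zero>\<^bsub>J (dg i (Suc p))\<^esub>"
    using b(1) by (simp add: bounded_cochain_def)
  then obtain P where P2: "\<And>p x. p > P \<Longrightarrow> smc p x \<Longrightarrow> b p x = \<zero>\<^bsub>J (dg i (Suc p))\<^esub>"
    by blast
  note P = P1 P2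
  show ?thesis
  proof (rule invariant_lift_of_cochain[OF P])
    show "d (dg i 1) (b 0 (frag_of f)) = z" if "f \<in> sm 0" for f
      using b(2)[of "frag_of f" 0] h(2)[OF that] that by (simp add: c_def cobdry_0)
    show "d (dg i (Suc (Suc p))) (b (Suc p) x) = b p (chain_boundary (Suc p) x)" if x: "smc (Suc p) x" for p x
    proof (rule J.eq_if_minus_eq_zero)
      show "d (dg i (Suc (Suc p))) (b (Suc p) x) \<in> carrier (J (dg i (Suc p)))"
        by (rule cochain_1_closed(2)[OF P(1) x])
      show "b p (chain_boundary (Suc p) x) \<in> carrier (J (dg i (Suc p)))"
        by (rule cochain_1_closed(1)[OF P(1) smc_boundary[OF x]])
      show "d (dg i (Suc (Suc p))) (b (Suc p) x) \<ominus>\<^bsub>J (dg i (Suc p))\<^esub> b p (chain_boundary (Suc p) x) = \<zero>\<^bsub>J (dg i (Suc p))\<^esub>"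
        using b(2)[OF x] by (simp add: c_def cobdry_Suc)
    qed
  qed
qed

end

section \<open>Neighbourhoods of cells\<close>

definition sq_norm :: "nat \<Rightarrow> (nat \<Rightarrow> real) \<Rightarrow> real" where
  "sq_norm n x = (\<Sum>i<n. (x i)\<^sup>2)"

definition disc :: "nat \<Rightarrow> (nat \<Rightarrow> real) set" where
  "disc n = {x. (\<forall>i\<ge>n. x i = 0) \<and> sq_norm n x \<le> 1}"

definition open_disc :: "nat \<Rightarrow> (nat \<Rightarrow> real) set" where
  "open_disc n = {x. (\<forall>i\<ge>n. x i = 0) \<and> sq_norm n x < 1}"

text \<open>Radial projection to the unit sphere. At the origin it takes the value 0 because of
  division by zero, so the origin is excluded wherever the value matters.\<close>

definition direction :: "nat \<Rightarrow> (nat \<Rightarrow> real) \<Rightarrow> nat \<Rightarrow> real" where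
  "direction n y = (\<lambda>i. y i / sqrt (sq_norm n y))"

lemma unit_disc_eq: "unit_disc n = top_of_set (disc n)"
  unfolding unit_disc_def Euclidean_space_def subtopology_subtopology euclidean_product_topology disc_def sq_norm_def
  by (rule arg_cong[where f = "subtopology euclidean"]) auto

lemma open_unit_disc_eq: "open_unit_disc n = top_of_set (open_disc n)"
  unfolding open_unit_disc_def Euclidean_space_def subtopology_subtopology euclidean_product_topology open_disc_def sq_norm_def
  by (rule arg_cong[where f = "subtopology euclidean"]) auto

lemma continuous_on_sq_norm: "continuous_on A (sq_norm n)"
  unfolding sq_norm_def
  by (intro continuous_intros continuous_on_subset[OF continuous_on_product_coordinates]) auto

lemma sq_norm_nonneg: "sq_norm n x \<ge> 0"
  by (simp add: sq_norm_def sum_nonneg)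

lemma sq_norm_eq_0: "sq_norm n x = 0 \<longleftrightarrow> (\<forall>i<n. x i = 0)"
  by (auto simp: sq_norm_def sum_nonneg_eq_0_iff)

lemma disc_eq_0_iff: "x \<in> disc n \<Longrightarrow> sq_norm n x = 0 \<longleftrightarrow> x = (\<lambda>_. 0)"
  using not_le_imp_less by (auto simp: sq_norm_eq_0 disc_def fun_eq_iff)

lemma open_disc_subset: "open_disc n \<subseteq> disc n"
  by (auto simp: disc_def open_disc_def)

lemma zero_in_open_disc: "(\<lambda>_. 0) \<in> open_disc n"
  by (simp add: open_disc_def sq_norm_def)

lemma compact_disc: "compact (disc n)"
proof -
  have "disc n \<subseteq> Pi\<^sub>E UNIV (\<lambda>_. {-1..1})"
  proof
    fix x assume x: "x \<in> disc n"
    have "\<bar>x i\<bar> \<le> 1" for i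
    proof (cases "i < n")
      case True
      have "(x i)\<^sup>2 \<le> sq_norm n x"
        unfolding sq_norm_def using True by (intro member_le_sum) auto
      then have "(x i)\<^sup>2 \<le> 1" using x by (simp add: disc_def)
      then show ?thesis by (simp add: abs_square_le_1)
    qed (use x in \<open>simp add: disc_def\<close>)
    then show "x \<in> Pi\<^sub>E UNIV (\<lambda>_. {-1..1})" by (auto simp: abs_le_iff minus_le_iff)
  qed
  moreover have "compact (Pi\<^sub>E UNIV (\<lambda>_::nat. {-1..1::real}))"
  proof -
    have "compactin (product_topology (\<lambda>_. euclideanreal) UNIV) (Pi\<^sub>E UNIV (\<lambda>_::nat. {-1..1::real}))"
      by (simp add: compactin_PiE)
    then show ?thesis by (simp add: euclidean_product_topology)
  qed
  moreover have "closed (disc n)"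
  proof -
    have "closed {x :: nat \<Rightarrow> real. x i = 0}" for i
      by (rule closed_Collect_eq[OF continuous_on_product_coordinates continuous_on_const])
    then have "closed (\<Inter>i\<in>{n..}. {x :: nat \<Rightarrow> real. x i = 0})" by blast
    moreover have "closed {x. sq_norm n x \<le> 1}"
      by (rule closed_Collect_le[OF continuous_on_sq_norm continuous_on_const])
    ultimately have "closed ((\<Inter>i\<in>{n..}. {x. x i = 0}) \<inter> {x. sq_norm n x \<le> 1})" by (rule closed_Int)
    also have "(\<Inter>i\<in>{n..}. {x. x i = 0}) \<inter> {x. sq_norm n x \<le> 1} = disc n" by (auto simp: disc_def)
    finally show ?thesis .
  qed
  ultimately show ?thesis by (metis compact_Int_closed inf.absorb_iff2)
qed

lemma direction_sphere:
  assumes "y \<in> disc n" "y \<noteq> (\<lambda>_. 0)"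
  shows "direction n y \<in> disc n - open_disc n"
proof -
  have pos: "sq_norm n y > 0" using assms disc_eq_0_iff sq_norm_nonneg[of n y] by fastforce
  have "sq_norm n (direction n y) = (\<Sum>i<n. (y i / sqrt (sq_norm n y))\<^sup>2)"
    by (subst sq_norm_def) (simp add: direction_def)
  also have "\<dots> = (\<Sum>i<n. (y i)\<^sup>2 / sq_norm n y)"
    using pos by (intro sum.cong) (auto simp: power_divide)
  also have "\<dots> = (\<Sum>i<n. (y i)\<^sup>2) / sq_norm n y" by (rule sum_divide_distrib[symmetric])
  also have "\<dots> = sq_norm n y / sq_norm n y" by (simp only: sq_norm_def)
  finally have "sq_norm n (direction n y) = 1" using pos by simp
  then show ?thesis using assms by (auto simp: disc_def open_disc_def direction_def)
qed

lemma direction_of_sphere: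
  assumes "y \<in> disc n - open_disc n"
  shows "direction n y = y" "y \<noteq> (\<lambda>_. 0)"
proof -
  have "sq_norm n y = 1" using assms by (auto simp: disc_def open_disc_def)
  then show "direction n y = y" by (simp add: direction_def)
  show "y \<noteq> (\<lambda>_. 0)" using assms zero_in_open_disc by auto
qed

lemma continuous_on_direction: "continuous_on (disc n - {\<lambda>_. 0}) (direction n)"
  unfolding direction_def
proof (rule continuous_on_coordinatewise_then_product)
  fix i
  show "continuous_on (disc n - {\<lambda>_. 0}) (\<lambda>y. y i / sqrt (sq_norm n y))"
    using disc_eq_0_iff
    by (intro continuous_on_divide continuous_on_real_sqrt continuous_on_sq_norm
        continuous_on_subset[OF continuous_on_product_coordinates]) auto
qed

text \<open>The local shape of a cell neighbourhood: the part of the disc lying radially over an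
  open part of the sphere. The apex is left out because the projection is continuous only away from
  it.\<close>

lemma open_cone:
  assumes "closed K"
  shows "openin (top_of_set (disc n)) {y \<in> disc n. y \<noteq> (\<lambda>_. 0) \<and> direction n y \<notin> K}"
proof -
  let ?D = "disc n - {\<lambda>_. 0}"
  have "openin (top_of_set ?D) (?D \<inter> direction n -` (- K))"
    using continuous_on_direction assms by (auto simp: continuous_on_open_gen intro: continuous_openin_preimage_gen)
  moreover have "openin (top_of_set (disc n)) ?D"
    by (auto simp: openin_open intro!: exI[of _ "- {\<lambda>_. 0}"])
  ultimately have "openin (top_of_set (disc n)) (?D \<inter> direction n -` (- K))"
    using openin_trans by blast
  also have "?D \<inter> direction n -` (- K) = {y \<in> disc n. y \<noteq> (\<lambda>_. 0) \<and> direction n y \<notin> K}" by auto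
  finally show ?thesis .
qed

text \<open>Every point of the closed disc is the limit of the points before it on its radius, which
  lie in the open disc, and limits in a Hausdorff space are unique.\<close>

lemma equal_on_disc:
  assumes X: "Hausdorff_space X" and f: "continuous_map (unit_disc n) X f" and g: "continuous_map (unit_disc n) X g"
    and eq: "\<And>y. y \<in> open_disc n \<Longrightarrow> f y = g y" and y: "y \<in> disc n"
  shows "f y = g y"
proof -
  define p where "p t = (\<lambda>i. t * y i)" for t :: real
  have sq: "sq_norm n (p t) = t\<^sup>2 * sq_norm n y" for t
    by (simp add: p_def sq_norm_def sum_distrib_left power_mult_distrib)
  have pD: "p t \<in> disc n" if "t \<in> {0..1}" for t
  proof -
    have "t\<^sup>2 \<le> 1" using that by (simp add: power_le_one)
    then have "t\<^sup>2 * sq_norm n y \<le> 1"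
      using y sq_norm_nonneg[of n y] by (auto simp: disc_def intro!: mult_le_one)
    then show ?thesis using y unfolding disc_def by (simp add: sq) (simp add: p_def)
  qed
  have pB: "p t \<in> open_disc n" if "t \<in> {0..<1}" for t
  proof -
    have "t\<^sup>2 < 1" using that by (simp add: power_less_one_iff)
    moreover have "t\<^sup>2 * sq_norm n y \<le> t\<^sup>2 * 1"
      using y by (intro mult_left_mono) (auto simp: disc_def)
    ultimately have "t\<^sup>2 * sq_norm n y < 1" by simp
    then show ?thesis using y unfolding disc_def open_disc_def by (simp add: sq) (simp add: p_def)
  qed
  have "continuous_on {0..1} p"
    unfolding p_def by (rule continuous_on_coordinatewise_then_product) (intro continuous_intros)
  then have p: "continuous_map (top_of_set {0..1}) (unit_disc n) p"
    unfolding unit_disc_eq using pD by (auto simp: continuous_map_in_subtopology)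
  have "(f \<circ> p) 1 = (g \<circ> p) 1"
  proof (rule forall_in_closure_of_eq[OF _ X continuous_map_compose[OF p f] continuous_map_compose[OF p g]])
    have "closure {0..<1} = {0..1::real}" by (rule closure_atLeastLessThan) simp
    moreover have "{0..1} \<inter> {0..<1} = {0..<1::real}" by auto
    ultimately show "1 \<in> top_of_set {0..1} closure_of {0..<1::real}"
      by (simp add: closure_of_subtopology)
    show "(f \<circ> p) t = (g \<circ> p) t" if "t \<in> {0..<1}" for t using eq[OF pB[OF that]] by simp
  qed
  moreover have "p 1 = y" by (simp add: p_def)
  ultimately show ?thesis by simp
qed

text \<open>The characteristic maps belong to the data because they have to be compatible with the
  action for the radially constructed neighbourhoods to be permuted by it;
  \<open>equivariant_characteristic_maps\<close> provides such a choice. On open discs only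
  bijectivity is kept.\<close>

locale equivariant_CW =
  fixes G :: "'a monoid" (structure) and X :: "'x topology" and E :: "nat \<Rightarrow> 'x set set" and \<phi> :: "'a \<Rightarrow> 'x \<Rightarrow> 'x"
    and \<psi> :: "nat \<Rightarrow> 'x set \<Rightarrow> (nat \<Rightarrow> real) \<Rightarrow> 'x"
  assumes group: "Group.group G" and action: "group_action G (topspace X) \<phi>"
    and Hausdorff: "Hausdorff_space X"
    and cells: "(\<Union>n. \<Union>(E n)) = topspace X"
    and cells_disjoint: "\<lbrakk>e \<in> E m; e' \<in> E n; e \<inter> e' \<noteq> {}\<rbrakk> \<Longrightarrow> m = n \<and> e = e'"
    and weak: "\<lbrakk>A \<subseteq> topspace X; \<And>n e. e \<in> E n \<Longrightarrow> closedin X (A \<inter> X closure_of e)\<rbrakk> \<Longrightarrow> closedin X A"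
    and cell_image: "\<lbrakk>g \<in> carrier G; e \<in> E n\<rbrakk> \<Longrightarrow> \<phi> g ` e \<in> E n"
    and pointwise: "\<lbrakk>g \<in> carrier G; e \<in> E n; \<phi> g ` e = e; x \<in> e\<rbrakk> \<Longrightarrow> \<phi> g x = x"
    and \<psi>_continuous: "e \<in> E n \<Longrightarrow> continuous_map (unit_disc n) X (\<psi> n e)"
    and \<psi>_bij: "e \<in> E n \<Longrightarrow> bij_betw (\<psi> n e) (open_disc n) e"
    and \<psi>_boundary: "e \<in> E n \<Longrightarrow> \<exists>F. finite F \<and> F \<subseteq> (\<Union>m<n. E m) \<and> \<psi> n e ` (disc n - open_disc n) \<subseteq> \<Union>F"
    and \<psi>_equivariant: "\<lbrakk>g \<in> carrier G; e \<in> E n; y \<in> disc n\<rbrakk> \<Longrightarrow> \<psi> n (\<phi> g ` e) y = \<phi> g (\<psi> n e y)"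
begin

interpretation Group.group G by (rule group)
interpretation act: group_action G "topspace X" \<phi> by (rule action)

text \<open>An open neighbourhood of a cell, thickened radially into the cells of higher dimension.\<close>

inductive_set nbhd :: "'x set \<Rightarrow> 'x set" for f :: "'x set" where
  base: "x \<in> f \<Longrightarrow> x \<in> nbhd f"
| step: "\<lbrakk>e \<in> E n; y \<in> open_disc n; y \<noteq> (\<lambda>_. 0); \<psi> n e (direction n y) \<in> nbhd f\<rbrakk> \<Longrightarrow> \<psi> n e y \<in> nbhd f"

lemma cell_subset: "e \<in> E n \<Longrightarrow> e \<subseteq> topspace X"
  using cells by blast

lemma \<psi>_in: "\<lbrakk>e \<in> E n; y \<in> open_disc n\<rbrakk> \<Longrightarrow> \<psi> n e y \<in> e"
  using \<psi>_bij bij_betwE by blast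

lemma \<psi>_topspace: "\<lbrakk>e \<in> E n; y \<in> disc n\<rbrakk> \<Longrightarrow> \<psi> n e y \<in> topspace X"
  using \<psi>_continuous[of e n] by (auto simp: continuous_map_def unit_disc_eq)

lemma \<psi>_sphere:
  assumes "e \<in> E n" "y \<in> disc n - open_disc n"
  obtains m e' where "m < n" "e' \<in> E m" "\<psi> n e y \<in> e'"
  using \<psi>_boundary[OF assms(1)] assms(2) by blast

text \<open>Each radial step leads from the boundary of a cell into its interior, so the dimension
  strictly increases along the construction.\<close>

lemma nbhd_dim:
  assumes "x \<in> nbhd f" "f \<in> E k" "x \<in> e" "e \<in> E n"
  shows "n = k \<and> e = f \<or> n > k"
  using assms
proof (induction x arbitrary: e n rule: nbhd.induct)
  case (base x)
  then show ?case using cells_disjoint[of f k e n] by blast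
next
  case (step e' n' y)
  have "\<psi> n' e' y \<in> e'" using step \<psi>_in by blast
  then have eq: "n' = n" using cells_disjoint[of e' n' e n] step by blast
  obtain m e'' where m: "m < n'" "e'' \<in> E m" "\<psi> n' e' (direction n' y) \<in> e''"
    using \<psi>_sphere[OF step(1) direction_sphere] step(2,3) open_disc_subset by blast
  then show ?case using step.IH[OF step(6) m(3,2)] eq by auto
qed

text \<open>A point in an open cell determines the cell and its disc coordinate, so the last step of
  the inductive construction can be read off.\<close>

lemma nbhd_iff:
  assumes f: "f \<in> E k" and e: "e \<in> E n" "e \<noteq> f \<or> n \<noteq> k" and y: "y \<in> open_disc n"
  shows "\<psi> n e y \<in> nbhd f \<longleftrightarrow> y \<noteq> (\<lambda>_. 0) \<and> \<psi> n e (direction n y) \<in> nbhd f"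
proof
  assume "\<psi> n e y \<in> nbhd f"
  then show "y \<noteq> (\<lambda>_. 0) \<and> \<psi> n e (direction n y) \<in> nbhd f"
  proof cases
    case base
    then show ?thesis using cells_disjoint[OF e(1) f] \<psi>_in[OF e(1) y] e(2) by blast
  next
    case (step e' n' y')
    have "n' = n \<and> e' = e"
      using cells_disjoint[OF step(2) e(1)] \<psi>_in[OF e(1) y] \<psi>_in[OF step(2,3)] step(1) by auto
    moreover from this have "y' = y"
      using step(1,3) y \<psi>_bij[OF e(1)] by (auto simp: bij_betw_def inj_on_def)
    ultimately show ?thesis using step by simp
  qed
qed (use e y nbhd.step in blast)

text \<open>Projecting a common point radially to the boundary keeps it in both neighbourhoods until
  it lies in f itself; by \<open>nbhd_dim\<close> the neighbourhood of another cell of the same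
  dimension does not meet f.\<close>

lemma nbhd_disjoint:
  assumes "x \<in> nbhd f" "x \<in> nbhd f'" "f \<in> E k" "f' \<in> E k"
  shows "f = f'"
  using assms
proof (induction x rule: nbhd.induct)
  case (base x)
  then show ?case using nbhd_dim[of x f' k f k] by auto
next
  case (step e n y)
  have "n > k"
  proof -
    obtain m e'' where m: "m < n" "e'' \<in> E m" "\<psi> n e (direction n y) \<in> e''"
      using \<psi>_sphere[OF step(1) direction_sphere] step(2,3) open_disc_subset by blast
    then show ?thesis using nbhd_dim[OF step(4) step(7) m(3,2)] by auto
  qed
  then have "\<psi> n e (direction n y) \<in> nbhd f'"
    using nbhd_iff[OF step(8) step(1) _ step(2)] step(6) by blast
  then show ?case using step by blast
qed

lemma nbhd_subset: "f \<in> E k \<Longrightarrow> nbhd f \<subseteq> topspace X"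
proof
  fix x assume "f \<in> E k" "x \<in> nbhd f"
  from this(2,1) show "x \<in> topspace X"
    by cases (use cell_subset \<psi>_topspace open_disc_subset in blast)+
qed

lemma closed_cell: "\<lbrakk>e \<in> E n; closedin (unit_disc n) C\<rbrakk> \<Longrightarrow> closedin X (\<psi> n e ` C)"
proof -
  assume e: "e \<in> E n" and C: "closedin (unit_disc n) C"
  have "compact_space (unit_disc n)" using compact_disc by (simp add: unit_disc_eq compact_space_subtopology)
  then have "compactin (unit_disc n) C" using C by (rule closedin_compact_space)
  then have "compactin X (\<psi> n e ` C)" using \<psi>_continuous[OF e] by (rule image_compactin)
  then show ?thesis by (rule compactin_imp_closedin[OF Hausdorff])
qed

text \<open>Induction on the dimension of the cell. On the boundary sphere the complement is the
  preimage of finitely many pieces in lower cells, closed by induction; on the disc the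
  neighbourhood is the cone over the remaining open part of the sphere. Compactness of the disc
  carries closedness over to X.\<close>

lemma closedin_nbhd_complement:
  assumes f: "f \<in> E k" and e: "e \<in> E n"
  shows "closedin X ((topspace X - nbhd f) \<inter> \<psi> n e ` disc n)"
  using e
proof (induction n arbitrary: e rule: less_induct)
  case (less n)
  let ?A = "topspace X - nbhd f" and ?S = "disc n - open_disc n"
  let ?O = "{y \<in> disc n. \<psi> n e y \<in> nbhd f}"
  have S_closed: "closed ?S"
  proof -
    have "?S = disc n \<inter> {x. 1 \<le> sq_norm n x}" by (auto simp: disc_def open_disc_def)
    moreover have "closed {x. 1 \<le> sq_norm n x}"
      by (rule closed_Collect_le[OF continuous_on_const continuous_on_sq_norm])
    ultimately show ?thesis using compact_disc[of n] by (simp add: compact_imp_closed closed_Int)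
  qed
  have "openin (unit_disc n) ?O"
  proof (cases "e = f \<and> n = k")
    case True
    \<comment> \<open>In f itself the neighbourhood is the open cell, since the boundary lies in
      cells of lower dimension, which the neighbourhood does not meet.\<close>
    have "?O = disc n - ?S"
    proof (intro equalityI subsetI)
      fix y assume y: "y \<in> ?O"
      have "y \<notin> ?S"
      proof
        assume "y \<in> ?S"
        then obtain m e' where "m < n" "e' \<in> E m" "\<psi> n e y \<in> e'" using \<psi>_sphere[OF less.prems] by blast
        then show False using nbhd_dim[OF _ f, of "\<psi> n e y" e' m] y True by auto
      qed
      then show "y \<in> disc n - ?S" using y by auto
    next
      fix y assume "y \<in> disc n - ?S"
      then show "y \<in> ?O" using \<psi>_in[OF less.prems] True nbhd.base by auto
    qed
    moreover have "disc n - ?S = disc n \<inter> - ?S" by auto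
    ultimately show ?thesis using S_closed by (auto simp: unit_disc_eq openin_open)
  next
    case False
    obtain F where F: "finite F" "F \<subseteq> (\<Union>m<n. E m)" "\<psi> n e ` ?S \<subseteq> \<Union>F" using \<psi>_boundary[OF less.prems] by blast
    have "\<forall>e'\<in>F. \<exists>m<n. e' \<in> E m" using F(2) by blast
    then obtain dm where dm: "\<And>e'. e' \<in> F \<Longrightarrow> dm e' < n \<and> e' \<in> E (dm e')" by metis
    \<comment> \<open>Finiteness of \<open>F\<close>, the closure-finiteness of the complex, makes
      this union of closed sets closed.\<close>
    define T where "T = (\<Union>e'\<in>F. ?A \<inter> \<psi> (dm e') e' ` disc (dm e'))"
    have T: "closedin X T"
      unfolding T_def using F(1) dm less.IH by (intro closedin_Union) auto
    define K where "K = {y \<in> ?S. \<psi> n e y \<notin> nbhd f}"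
    have K_eq: "K = ?S \<inter> {y \<in> topspace (unit_disc n). \<psi> n e y \<in> T}"
    proof (intro equalityI subsetI)
      fix y assume y: "y \<in> K"
      then obtain e' where e': "e' \<in> F" "\<psi> n e y \<in> e'" using F(3) by (auto simp: K_def)
      have "e' = \<psi> (dm e') e' ` open_disc (dm e')" using \<psi>_bij dm[OF e'(1)] by (simp add: bij_betw_def)
      then have "\<psi> n e y \<in> \<psi> (dm e') e' ` disc (dm e')" using e'(2) open_disc_subset by blast
      then have "\<psi> n e y \<in> T"
        using y e'(1) \<psi>_topspace[OF less.prems, of y] unfolding T_def K_def by blast
      then show "y \<in> ?S \<inter> {y \<in> topspace (unit_disc n). \<psi> n e y \<in> T}" using y by (auto simp: K_def unit_disc_eq)
    qed (auto simp: K_def T_def)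
    have "closedin (unit_disc n) {y \<in> topspace (unit_disc n). \<psi> n e y \<in> T}"
      by (rule closedin_continuous_map_preimage[OF \<psi>_continuous[OF less.prems] T])
    then have "closed {y \<in> topspace (unit_disc n). \<psi> n e y \<in> T}"
      using compact_disc[of n] by (metis compact_imp_closed closedin_closed_trans unit_disc_eq)
    then have "closed K" unfolding K_eq using S_closed by (intro closed_Int)
    moreover have "?O = {y \<in> disc n. y \<noteq> (\<lambda>_. 0) \<and> direction n y \<notin> K}"
    proof (intro equalityI subsetI)
      fix y assume y: "y \<in> ?O"
      show "y \<in> {y \<in> disc n. y \<noteq> (\<lambda>_. 0) \<and> direction n y \<notin> K}"
      proof (cases "y \<in> open_disc n")
        case True
        then show ?thesis using y nbhd_iff[OF f less.prems _ True] False by (auto simp: K_def)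
      next
        case F: False
        then show ?thesis using y direction_of_sphere[of y n] by (auto simp: K_def)
      qed
    next
      fix y assume y: "y \<in> {y \<in> disc n. y \<noteq> (\<lambda>_. 0) \<and> direction n y \<notin> K}"
      then have dir: "\<psi> n e (direction n y) \<in> nbhd f"
        using direction_sphere[of y n] by (auto simp: K_def)
      show "y \<in> ?O"
      proof (cases "y \<in> open_disc n")
        case True
        then show ?thesis using y dir nbhd_iff[OF f less.prems _ True] False by auto
      next
        case F: False
        then show ?thesis using y dir direction_of_sphere[of y n] by auto
      qed
    qed
    ultimately show ?thesis using open_cone[of K n] by (simp add: unit_disc_eq)
  qed
  then have "closedin (unit_disc n) (topspace (unit_disc n) - ?O)" by blast
  from closed_cell[OF less.prems this]
  have "closedin X (\<psi> n e ` (topspace (unit_disc n) - ?O))" .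
  also have "\<psi> n e ` (topspace (unit_disc n) - ?O) = ?A \<inter> \<psi> n e ` disc n"
    using \<psi>_topspace[OF less.prems] by (auto simp: unit_disc_eq)
  finally show ?case .
qed

lemma open_nbhd:
  assumes f: "f \<in> E k"
  shows "openin X (nbhd f)"
proof -
  have "closedin X (topspace X - nbhd f)"
  proof (rule weak)
    fix n e assume e: "e \<in> E n"
    have "e \<subseteq> \<psi> n e ` disc n" by (metis \<psi>_bij[OF e] bij_betw_imp_surj_on image_mono open_disc_subset)
    moreover have "closedin X (\<psi> n e ` disc n)"
      using closed_cell[OF e, of "disc n"] by (simp add: unit_disc_eq)
    ultimately have "X closure_of e \<subseteq> \<psi> n e ` disc n" by (rule closure_of_minimal)
    then have "(topspace X - nbhd f) \<inter> X closure_of e = ((topspace X - nbhd f) \<inter> \<psi> n e ` disc n) \<inter> X closure_of e"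
      by blast
    then show "closedin X ((topspace X - nbhd f) \<inter> X closure_of e)"
      using closedin_nbhd_complement[OF f e] by (simp add: closedin_Int)
  qed simp
  then show ?thesis using nbhd_subset[OF f] by (simp add: openin_closedin)
qed

lemma nbhd_image:
  assumes g: "g \<in> carrier G" and f: "f \<in> E k"
  shows "\<phi> g ` nbhd f = nbhd (\<phi> g ` f)"
proof -
  have *: "\<phi> g x \<in> nbhd (\<phi> g ` f)" if g: "g \<in> carrier G" and f: "f \<in> E k" and x: "x \<in> nbhd f" for g x f
    using x
  proof induction
    case (base x)
    then show ?case by (auto intro: nbhd.base)
  next
    case (step e n y)
    have "y \<in> disc n" "direction n y \<in> disc n"
      using step(2,3) open_disc_subset direction_sphere by blast+
    then show ?case
      using nbhd.step[OF cell_image[OF g step(1)] step(2,3)] step.IH \<psi>_equivariant[OF g step(1)] by simp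
  qed
  show ?thesis
  proof (intro equalityI subsetI)
    fix x assume "x \<in> \<phi> g ` nbhd f"
    then show "x \<in> nbhd (\<phi> g ` f)" using * g f by blast
  next
    fix x assume x: "x \<in> nbhd (\<phi> g ` f)"
    have xX: "x \<in> topspace X" using nbhd_subset[OF cell_image[OF g f]] x by blast
    have inv: "\<phi> (inv g) (\<phi> g z) = z" "\<phi> g (\<phi> (inv g) z) = z" if "z \<in> topspace X" for z
      using act.composition_rule[OF that, of "inv g" g] act.composition_rule[OF that, of g "inv g"]
        act.id_eq_one that g by (simp_all, metis restrict_apply', metis restrict_apply')
    have "\<phi> (inv g) ` \<phi> g ` f = f"
      using cell_subset[OF f] inv(1) by (force simp: image_iff)
    then have "\<phi> (inv g) x \<in> nbhd f" using *[OF _ cell_image[OF g f] x, of "inv g"] g by simp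
    then show "x \<in> \<phi> g ` nbhd f" using inv(2)[OF xX] by (metis imageI)
  qed
qed

text \<open>The centre of the cell detects the stabilizer: by disjointness an element preserving the
  neighbourhood maps f to itself, hence fixes it pointwise; conversely an element fixing the centre
  preserves the cell. In this way hypotheses on isotropy groups of points become available for
  neighbourhoods.\<close>

lemma nbhd_stabilizer:
  assumes f: "f \<in> E k"
  shows "\<exists>x\<in>topspace X. {g \<in> carrier G. \<phi> g ` nbhd f = nbhd f} = stabilizer G \<phi> x"
proof -
  have x: "\<psi> k f (\<lambda>_. 0) \<in> f" (is "?x \<in> f") using \<psi>_in[OF f zero_in_open_disc] .
  have "\<phi> g ` nbhd f = nbhd f \<longleftrightarrow> \<phi> g ?x = ?x" if g: "g \<in> carrier G" for g
  proof
    assume "\<phi> g ` nbhd f = nbhd f"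
    then have "\<phi> g ?x \<in> nbhd (\<phi> g ` f)" "\<phi> g ?x \<in> nbhd f"
      using nbhd_image[OF g f] nbhd.base[OF x] by auto
    then have "\<phi> g ` f = f" using nbhd_disjoint cell_image[OF g f] f by blast
    then show "\<phi> g ?x = ?x" using pointwise[OF g f _ x] by blast
  next
    assume "\<phi> g ?x = ?x"
    then have "\<phi> g ` f \<inter> f \<noteq> {}" using x by (metis IntI empty_iff imageI)
    then have "\<phi> g ` f = f" using cells_disjoint[OF cell_image[OF g f] f] by blast
    then show "\<phi> g ` nbhd f = nbhd f" using nbhd_image[OF g f] by simp
  qed
  then show ?thesis using x cell_subset[OF f] by (intro bexI[of _ ?x]) (auto simp: stabilizer_def)
qed

end

text \<open>Choose a characteristic map for one cell in each orbit and move it by group elements.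
  Two choices of the moving element differ by a stabilizer of the representative; it fixes the open
  cell pointwise, and by \<open>equal_on_disc\<close> also the image of the closed disc, so the
  choice has no influence.\<close>

lemma equivariant_characteristic_maps:
  fixes G :: "'a monoid" (structure)
  assumes group: "Group.group G" and GCW: "G_CW_complex G X E \<phi>"
  obtains \<psi> where "equivariant_CW G X E \<phi> \<psi>"
proof -
  interpret Group.group G by (rule group)
  note GCW' = GCW[unfolded G_CW_complex_def]
  have CW: "CW_complex X E" and action: "group_action G (topspace X) \<phi>"
    using GCW' by simp_all
  have homeo: "homeomorphic_map X X (\<phi> g)" if "g \<in> carrier G" for g using GCW' that by simp
  have image: "\<phi> g ` e \<in> E n" if "g \<in> carrier G" "e \<in> E n" for g n e using GCW' that by simp
  have pfix: "\<phi> g x = x" if "g \<in> carrier G" "e \<in> E n" "\<phi> g ` e = e" "x \<in> e" for g n e x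
    using GCW' that by (elim conjE) blast
  interpret act: group_action G "topspace X" \<phi> by (rule action)
  note CW' = CW[unfolded CW_complex_def]
  have Haus: "Hausdorff_space X" and cells: "(\<Union>n. \<Union>(E n)) = topspace X"
    using CW' by simp_all
  have disj: "e \<inter> e' = {}" if "e \<in> E m" "e' \<in> E n" "(m, e) \<noteq> (n, e')" for m n e e'
    using CW' that by (elim conjE) blast
  have char: "\<exists>h. characteristic_map X E n e h" if "e \<in> E n" for n e
    using CW' that by simp
  have weak: "closedin X A" if "A \<subseteq> topspace X" "\<forall>n. \<forall>e\<in>E n. closedin X (A \<inter> X closure_of e)" for A
    using CW' that by simp
  have sub: "e \<subseteq> topspace X" if "e \<in> E n" for e n using cells that by blast
  have cont: "continuous_map X X (\<phi> g)" if "g \<in> carrier G" for g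
    using homeo[OF that] by (rule homeomorphic_imp_continuous_map)
  have one: "\<phi> \<one> x = x" if "x \<in> topspace X" for x
    using act.id_eq_one that by (metis restrict_apply')
  have image_mult: "\<phi> (g \<otimes> h) ` e = \<phi> g ` \<phi> h ` e" if "e \<in> E n" "g \<in> carrier G" "h \<in> carrier G" for e n g h
    unfolding image_image by (rule image_cong[OF refl]) (use act.composition_rule sub that in blast)
  have image_one: "\<phi> \<one> ` e = e" if "e \<in> E n" for e n
    using sub[OF that] one by (force simp: image_iff subset_iff)
  define orb where "orb e = {\<phi> g ` e | g. g \<in> carrier G}" for e
  define r where "r e = (SOME e'. e' \<in> orb e)" for e
  define t where "t e = (SOME g. g \<in> carrier G \<and> \<phi> g ` r e = e)" for e
  define \<psi>0 where "\<psi>0 n e = (SOME h. characteristic_map X E n e h)" for n e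
  define \<psi> where "\<psi> n e y = \<phi> (t e) (\<psi>0 n (r e) y)" for n e y
  have r: "r e \<in> orb e" if "e \<in> E n" for e n
  proof -
    have "e \<in> orb e" using image_one[OF that] by (auto simp: orb_def intro!: exI[of _ \<one>])
    then show ?thesis unfolding r_def by (rule someI)
  qed
  have rE: "r e \<in> E n" if "e \<in> E n" for e n
    using r[OF that] image that by (auto simp: orb_def)
  have t: "t e \<in> carrier G" "\<phi> (t e) ` r e = e" if e: "e \<in> E n" for e n
  proof -
    obtain g where g: "g \<in> carrier G" "r e = \<phi> g ` e" using r[OF e] by (auto simp: orb_def)
    have "\<phi> (inv g) ` r e = e"
      using g image_mult[OF e, of "inv g" g] image_one[OF e] by simp
    then have "inv g \<in> carrier G \<and> \<phi> (inv g) ` r e = e" using g by simp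
    then have "t e \<in> carrier G \<and> \<phi> (t e) ` r e = e" unfolding t_def by (rule someI)
    then show "t e \<in> carrier G" "\<phi> (t e) ` r e = e" by auto
  qed
  have r_eq: "r (\<phi> g ` e) = r e" if e: "e \<in> E n" and g: "g \<in> carrier G" for e n g
  proof -
    have "orb (\<phi> g ` e) = orb e"
    proof (intro equalityI subsetI)
      fix W assume "W \<in> orb (\<phi> g ` e)"
      then obtain h where "h \<in> carrier G" "W = \<phi> h ` \<phi> g ` e" by (auto simp: orb_def)
      then show "W \<in> orb e"
        using image_mult[OF e, of h g] g by (auto simp: orb_def intro!: exI[of _ "h \<otimes> g"])
    next
      fix W assume "W \<in> orb e"
      then obtain h where h: "h \<in> carrier G" "W = \<phi> h ` e" by (auto simp: orb_def)
      have "\<phi> (h \<otimes> inv g) ` \<phi> g ` e = \<phi> (h \<otimes> inv g \<otimes> g) ` e"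
        using image_mult[OF e, of "h \<otimes> inv g" g] h g by simp
      also have "\<dots> = W" using h g by (simp add: m_assoc)
      finally show "W \<in> orb (\<phi> g ` e)" using h g by (auto simp: orb_def intro!: exI[of _ "h \<otimes> inv g"])
    qed
    then show ?thesis by (simp add: r_def)
  qed
  have \<psi>0: "characteristic_map X E n e (\<psi>0 n e)" if "e \<in> E n" for n e
    unfolding \<psi>0_def by (rule someI_ex[OF char[OF that]])
  have \<psi>0_cont: "continuous_map (unit_disc n) X (\<psi>0 n e)"
    and \<psi>0_bij: "bij_betw (\<psi>0 n e) (open_disc n) e"
    and \<psi>0_bd: "\<exists>F. finite F \<and> F \<subseteq> (\<Union>m<n. E m) \<and> \<psi>0 n e ` (disc n - open_disc n) \<subseteq> \<Union>F"
    if e: "e \<in> E n" for n e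
  proof -
    have "homeomorphic_map (open_unit_disc n) (subtopology X e) (\<psi>0 n e)"
      using \<psi>0[OF e] by (simp add: characteristic_map_def)
    then have "bij_betw (\<psi>0 n e) (topspace (open_unit_disc n)) (topspace (subtopology X e))"
      by (simp add: homeomorphic_eq_everything_map bij_betw_def)
    then show "bij_betw (\<psi>0 n e) (open_disc n) e"
      using sub[OF e] by (simp add: open_unit_disc_eq Int_absorb1)
    show "continuous_map (unit_disc n) X (\<psi>0 n e)"
      "\<exists>F. finite F \<and> F \<subseteq> (\<Union>m<n. E m) \<and> \<psi>0 n e ` (disc n - open_disc n) \<subseteq> \<Union>F"
      using \<psi>0[OF e] by (simp_all add: characteristic_map_def unit_disc_eq open_unit_disc_eq)
  qed
  have \<psi>0_top: "\<psi>0 n e y \<in> topspace X" if "e \<in> E n" "y \<in> disc n" for n e y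
    using \<psi>0_cont[OF that(1)] that(2) by (auto simp: continuous_map_def unit_disc_eq)
  have "equivariant_CW G X E \<phi> \<psi>"
  proof
    show "\<lbrakk>e \<in> E m; e' \<in> E n; e \<inter> e' \<noteq> {}\<rbrakk> \<Longrightarrow> m = n \<and> e = e'" for e m e' n
      using disj by blast
    show "closedin X A" if "A \<subseteq> topspace X" "\<And>n e. e \<in> E n \<Longrightarrow> closedin X (A \<inter> X closure_of e)" for A
      using weak that by blast
    show "continuous_map (unit_disc n) X (\<psi> n e)" if e: "e \<in> E n" for e n
      using continuous_map_compose[OF \<psi>0_cont[OF rE[OF e]] cont[OF t(1)[OF e]]]
      by (simp add: \<psi>_def[abs_def] o_def)
    show "bij_betw (\<psi> n e) (open_disc n) e" if e: "e \<in> E n" for e n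
    proof -
      have "inj_on (\<phi> (t e)) (r e)"
        using act.inj_prop[OF t(1)[OF e]] sub[OF rE[OF e]] by (rule inj_on_subset)
      then have "bij_betw (\<phi> (t e)) (r e) e" using t(2)[OF e] by (simp add: bij_betw_def)
      from bij_betw_trans[OF \<psi>0_bij[OF rE[OF e]] this] show ?thesis
        by (simp add: \<psi>_def[abs_def] o_def)
    qed
    show "\<exists>F. finite F \<and> F \<subseteq> (\<Union>m<n. E m) \<and> \<psi> n e ` (disc n - open_disc n) \<subseteq> \<Union>F" if e: "e \<in> E n" for e n
    proof -
      obtain F where F: "finite F" "F \<subseteq> (\<Union>m<n. E m)" "\<psi>0 n (r e) ` (disc n - open_disc n) \<subseteq> \<Union>F"
        using \<psi>0_bd[OF rE[OF e]] by blast
      show ?thesis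
      proof (intro exI conjI)
        show "finite ((`) (\<phi> (t e)) ` F)" using F(1) by simp
        show "(`) (\<phi> (t e)) ` F \<subseteq> (\<Union>m<n. E m)" using F(2) image[OF t(1)[OF e]] by blast
        show "\<psi> n e ` (disc n - open_disc n) \<subseteq> \<Union>((`) (\<phi> (t e)) ` F)" using F(3) by (auto simp: \<psi>_def)
      qed
    qed
    show "\<psi> n (\<phi> g ` e) y = \<phi> g (\<psi> n e y)" if g: "g \<in> carrier G" and e: "e \<in> E n" and y: "y \<in> disc n" for g e n y
    proof -
      note te = t[OF e] and te' = t[OF image[OF g e]]
      let ?t' = "t (\<phi> g ` e)"
      \<comment> \<open>The two ways of moving the representative to the translate of e by g differ
        by k, which preserves the representative.\<close>
      define k where "k = inv ?t' \<otimes> (g \<otimes> t e)"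
      have k: "k \<in> carrier G" using te te' g by (simp add: k_def)
      have "\<phi> k ` r e = \<phi> (inv ?t') ` \<phi> g ` \<phi> (t e) ` r e"
        unfolding k_def using te(1) te'(1) g by (simp add: image_mult[OF rE[OF e]])
      also have "\<dots> = \<phi> (inv ?t') ` \<phi> ?t' ` r e" using te(2) te'(2) r_eq[OF e g] by simp
      also have "\<dots> = r e" using image_mult[OF rE[OF e], of "inv ?t'" ?t'] te' image_one[OF rE[OF e]] by simp
      finally have kr: "\<phi> k ` r e = r e" .
      have "(\<phi> k \<circ> \<psi>0 n (r e)) y = \<psi>0 n (r e) y"
      proof (rule equal_on_disc[OF Haus continuous_map_compose[OF \<psi>0_cont[OF rE[OF e]] cont[OF k]] \<psi>0_cont[OF rE[OF e]] _ y])
        fix y assume "y \<in> open_disc n"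
        then have "\<psi>0 n (r e) y \<in> r e" using \<psi>0_bij[OF rE[OF e]] by (rule bij_betwE[rule_format, rotated])
        then show "(\<phi> k \<circ> \<psi>0 n (r e)) y = \<psi>0 n (r e) y" using pfix[OF k rE[OF e] kr] by simp
      qed
      then have ky: "\<phi> k (\<psi>0 n (r e) y) = \<psi>0 n (r e) y" by simp
      have "?t' \<otimes> k = g \<otimes> t e" using te te' g by (simp add: k_def m_assoc[symmetric])
      then have "\<phi> (g \<otimes> t e) (\<psi>0 n (r e) y) = \<phi> ?t' (\<psi>0 n (r e) y)"
        using act.composition_rule[OF \<psi>0_top[OF rE[OF e] y] te'(1) k] ky by simp
      then show ?thesis
        using act.composition_rule[OF \<psi>0_top[OF rE[OF e] y] g te(1)] by (simp add: \<psi>_def r_eq[OF e g])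
    qed
    show "\<phi> g ` e \<in> E n" if "g \<in> carrier G" "e \<in> E n" for g e n using that by (rule image)
    show "\<phi> g x = x" if "g \<in> carrier G" "e \<in> E n" "\<phi> g ` e = e" "x \<in> e" for g e n x using that by (rule pfix)
  qed (rule group action Haus cells)+
  then show ?thesis by (rule that)
qed

lemma G_CW_complex_cover:
  fixes G :: "'a monoid" (structure)
  assumes "Group.group G" "G_CW_complex G X E \<phi>" "\<forall>n>N. E n = {}"
  obtains \<V> :: "nat \<Rightarrow> 'x set set" where "\<And>U n. U \<in> \<V> n \<Longrightarrow> openin X U"
    "\<And>U U' n. \<lbrakk>U \<in> \<V> n; U' \<in> \<V> n; U \<inter> U' \<noteq> {}\<rbrakk> \<Longrightarrow> U = U'"
    "topspace X \<subseteq> (\<Union>n\<le>N. \<Union>(\<V> n))"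
    "\<And>g U n. \<lbrakk>g \<in> carrier G; U \<in> \<V> n\<rbrakk> \<Longrightarrow> \<phi> g ` U \<in> \<V> n"
    "\<And>U n. U \<in> \<V> n \<Longrightarrow> \<exists>x\<in>topspace X. {g \<in> carrier G. \<phi> g ` U = U} = stabilizer G \<phi> x"
proof -
  obtain \<psi> where "equivariant_CW G X E \<phi> \<psi>" using equivariant_characteristic_maps[OF assms(1,2)] .
  then interpret equivariant_CW G X E \<phi> \<psi> .
  show ?thesis
  proof (rule that[of "\<lambda>n. nbhd ` E n"])
    show "openin X U" if "U \<in> nbhd ` E n" for U n using that open_nbhd by blast
    show "U = U'" if "U \<in> nbhd ` E n" "U' \<in> nbhd ` E n" "U \<inter> U' \<noteq> {}" for U U' n
      using that nbhd_disjoint by blast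
    show "topspace X \<subseteq> (\<Union>n\<le>N. \<Union>(nbhd ` E n))"
    proof
      fix x assume "x \<in> topspace X"
      then obtain n e where e: "e \<in> E n" "x \<in> e" using cells by blast
      moreover have "n \<le> N" using e(1) assms(3) not_le_imp_less by blast
      ultimately show "x \<in> (\<Union>n\<le>N. \<Union>(nbhd ` E n))" using nbhd.base by blast
    qed
    show "\<phi> g ` U \<in> nbhd ` E n" if "g \<in> carrier G" "U \<in> nbhd ` E n" for g U n
      using that nbhd_image cell_image by auto
    show "\<exists>x\<in>topspace X. {g \<in> carrier G. \<phi> g ` U = U} = stabilizer G \<phi> x" if "U \<in> nbhd ` E n" for U n
      using that nbhd_stabilizer by auto
  qed
qed

section \<open>Modules\<close>

lemma infinite_universe: "infinite (UNIV :: ('r + nat + 'u) set)"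
proof
  assume fin: "finite (UNIV :: ('r + nat + 'u) set)"
  have "inj (\<lambda>n::nat. Inr (Inl n) :: 'r + nat + 'u)" by (auto intro: injI)
  from finite_imageD[OF finite_subset[OF _ fin] this] show False by simp
qed

text \<open>A family of subsets indexed by i is coded by the set of all pairs (i, v) with v in the
  i-th subset, and pairs are coded by single elements because the underlying type is infinite. With
  this the coinduced modules and countable products have copies in the universe.\<close>

lemma inj_function_universe:
  fixes j :: "'i \<Rightarrow> 'r + nat + 'u"
  assumes j: "inj j"
  obtains e :: "('i \<Rightarrow> ('r, 'u) universe) \<Rightarrow> ('r, 'u) universe" where "inj e"
proof -
  have "|(UNIV :: ('r + nat + 'u) set) \<times> (UNIV :: ('r + nat + 'u) set)| =o |UNIV :: ('r + nat + 'u) set|"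
    by (rule card_of_Times_same_infinite[OF infinite_universe])
  then obtain k :: "('r + nat + 'u) \<times> ('r + nat + 'u) \<Rightarrow> 'r + nat + 'u" where k: "inj k"
    using card_of_ordIso[of "(UNIV :: ('r + nat + 'u) set) \<times> (UNIV :: ('r + nat + 'u) set)" "UNIV :: ('r + nat + 'u) set"]
    by (auto simp: bij_betw_def)
  let ?e = "\<lambda>F :: 'i \<Rightarrow> ('r, 'u) universe. {k (j i, v) | i v. v \<in> F i}"
  have mem: "k (j i, v) \<in> ?e F \<longleftrightarrow> v \<in> F i" for i v F
    by (simp add: inj_eq[OF k] inj_eq[OF j])
  have "inj ?e"
  proof (rule injI)
    fix F F' assume eq: "?e F = ?e F'"
    have "v \<in> F i \<longleftrightarrow> v \<in> F' i" for i v using mem[of i v F] mem[of i v F'] eq by simp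
    then show "F = F'" by blast
  qed
  then show ?thesis by (rule that)
qed

section \<open>Modules, transport into the universe and injectivity\<close>

lemma left_moduleI:
  fixes R :: "'r ring" and M :: "('r, 'm) Module.module"
  assumes "Ring.ring R"
    and "\<And>x y. \<lbrakk>x \<in> carrier M; y \<in> carrier M\<rbrakk> \<Longrightarrow> x \<oplus>\<^bsub>M\<^esub> y \<in> carrier M"
    and "\<zero>\<^bsub>M\<^esub> \<in> carrier M"
    and "\<And>x y z. \<lbrakk>x \<in> carrier M; y \<in> carrier M; z \<in> carrier M\<rbrakk> \<Longrightarrow> (x \<oplus>\<^bsub>M\<^esub> y) \<oplus>\<^bsub>M\<^esub> z = x \<oplus>\<^bsub>M\<^esub> (y \<oplus>\<^bsub>M\<^esub> z)"
    and "\<And>x y. \<lbrakk>x \<in> carrier M; y \<in> carrier M\<rbrakk> \<Longrightarrow> x \<oplus>\<^bsub>M\<^esub> y = y \<oplus>\<^bsub>M\<^esub> x"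
    and "\<And>x. x \<in> carrier M \<Longrightarrow> \<zero>\<^bsub>M\<^esub> \<oplus>\<^bsub>M\<^esub> x = x"
    and "\<And>x. x \<in> carrier M \<Longrightarrow> \<exists>y\<in>carrier M. y \<oplus>\<^bsub>M\<^esub> x = \<zero>\<^bsub>M\<^esub>"
    and "\<And>a x. \<lbrakk>a \<in> carrier R; x \<in> carrier M\<rbrakk> \<Longrightarrow> a \<odot>\<^bsub>M\<^esub> x \<in> carrier M"
    and "\<And>a b x. \<lbrakk>a \<in> carrier R; b \<in> carrier R; x \<in> carrier M\<rbrakk> \<Longrightarrow>
      (a \<oplus>\<^bsub>R\<^esub> b) \<odot>\<^bsub>M\<^esub> x = a \<odot>\<^bsub>M\<^esub> x \<oplus>\<^bsub>M\<^esub> b \<odot>\<^bsub>M\<^esub> x"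
    and "\<And>a x y. \<lbrakk>a \<in> carrier R; x \<in> carrier M; y \<in> carrier M\<rbrakk> \<Longrightarrow>
      a \<odot>\<^bsub>M\<^esub> (x \<oplus>\<^bsub>M\<^esub> y) = a \<odot>\<^bsub>M\<^esub> x \<oplus>\<^bsub>M\<^esub> a \<odot>\<^bsub>M\<^esub> y"
    and "\<And>a b x. \<lbrakk>a \<in> carrier R; b \<in> carrier R; x \<in> carrier M\<rbrakk> \<Longrightarrow>
      (a \<otimes>\<^bsub>R\<^esub> b) \<odot>\<^bsub>M\<^esub> x = a \<odot>\<^bsub>M\<^esub> (b \<odot>\<^bsub>M\<^esub> x)"
    and "\<And>x. x \<in> carrier M \<Longrightarrow> \<one>\<^bsub>R\<^esub> \<odot>\<^bsub>M\<^esub> x = x"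
  shows "left_module R M"
  using assms
  by (intro left_module.intro left_module_axioms.intro abelian_groupI) auto

context left_module
begin

lemma smult_zero: "a \<in> carrier R \<Longrightarrow> a \<odot>\<^bsub>M\<^esub> \<zero>\<^bsub>M\<^esub> = \<zero>\<^bsub>M\<^esub>"
  using smult_r_distr[of a "\<zero>\<^bsub>M\<^esub>" "\<zero>\<^bsub>M\<^esub>"] smult_closed[of a "\<zero>\<^bsub>M\<^esub>"]
  by (metis M.add.l_cancel_one' M.l_zero M.zero_closed)

lemma zero_smult: "x \<in> carrier M \<Longrightarrow> \<zero>\<^bsub>R\<^esub> \<odot>\<^bsub>M\<^esub> x = \<zero>\<^bsub>M\<^esub>"
  using smult_l_distr[of "\<zero>\<^bsub>R\<^esub>" "\<zero>\<^bsub>R\<^esub>" x] smult_closed[of "\<zero>\<^bsub>R\<^esub>" x]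
  by (metis M.add.l_cancel_one' R.l_zero R.zero_closed)

lemma smult_minus: "\<lbrakk>a \<in> carrier R; x \<in> carrier M\<rbrakk> \<Longrightarrow> (\<ominus>\<^bsub>R\<^esub> a) \<odot>\<^bsub>M\<^esub> x = \<ominus>\<^bsub>M\<^esub> (a \<odot>\<^bsub>M\<^esub> x)"
  using smult_l_distr[of "\<ominus>\<^bsub>R\<^esub> a" a x] smult_closed[of a x] smult_closed[of "\<ominus>\<^bsub>R\<^esub> a" x]
  by (metis M.minus_equality R.a_inv_closed R.l_neg zero_smult)

lemma submodule:
  assumes "K \<subseteq> carrier M" "\<zero>\<^bsub>M\<^esub> \<in> K" "\<And>x y. \<lbrakk>x \<in> K; y \<in> K\<rbrakk> \<Longrightarrow> x \<oplus>\<^bsub>M\<^esub> y \<in> K"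
    and "\<And>a x. \<lbrakk>a \<in> carrier R; x \<in> K\<rbrakk> \<Longrightarrow> a \<odot>\<^bsub>M\<^esub> x \<in> K"
  shows "left_module R (M\<lparr>carrier := K\<rparr>)"
proof (rule left_moduleI)
  fix x assume x: "x \<in> carrier (M\<lparr>carrier := K\<rparr>)"
  then have "\<ominus>\<^bsub>M\<^esub> x = (\<ominus>\<^bsub>R\<^esub> \<one>\<^bsub>R\<^esub>) \<odot>\<^bsub>M\<^esub> x"
    using assms(1) by (simp add: smult_minus smult_one subset_iff)
  then have "\<ominus>\<^bsub>M\<^esub> x \<in> K" using assms(4)[of "\<ominus>\<^bsub>R\<^esub> \<one>\<^bsub>R\<^esub>" x] x by simp
  then show "\<exists>y\<in>carrier (M\<lparr>carrier := K\<rparr>). y \<oplus>\<^bsub>M\<lparr>carrier := K\<rparr>\<^esub> x = \<zero>\<^bsub>M\<lparr>carrier := K\<rparr>\<^esub>"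
    using x assms(1) by (intro bexI[of _ "\<ominus>\<^bsub>M\<^esub> x"]) (auto simp: M.l_neg)
qed (use assms in \<open>auto simp: subset_iff M.a_assoc M.a_comm M.a_lcomm smult_l_distr smult_r_distr smult_assoc smult_one intro: R.ring_axioms\<close>)

end

lemma lmod_homD:
  assumes "f \<in> lmod_hom R M N"
  shows "x \<in> carrier M \<Longrightarrow> f x \<in> carrier N"
    and "\<lbrakk>x \<in> carrier M; y \<in> carrier M\<rbrakk> \<Longrightarrow> f (x \<oplus>\<^bsub>M\<^esub> y) = f x \<oplus>\<^bsub>N\<^esub> f y"
    and "\<lbrakk>a \<in> carrier R; x \<in> carrier M\<rbrakk> \<Longrightarrow> f (a \<odot>\<^bsub>M\<^esub> x) = a \<odot>\<^bsub>N\<^esub> f x"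
  using assms by (auto simp: lmod_hom_def)

lemma lmod_homI:
  assumes "\<And>x. x \<in> carrier M \<Longrightarrow> f x \<in> carrier N"
    and "\<And>x y. \<lbrakk>x \<in> carrier M; y \<in> carrier M\<rbrakk> \<Longrightarrow> f (x \<oplus>\<^bsub>M\<^esub> y) = f x \<oplus>\<^bsub>N\<^esub> f y"
    and "\<And>a x. \<lbrakk>a \<in> carrier R; x \<in> carrier M\<rbrakk> \<Longrightarrow> f (a \<odot>\<^bsub>M\<^esub> x) = a \<odot>\<^bsub>N\<^esub> f x"
  shows "f \<in> lmod_hom R M N"
  using assms by (auto simp: lmod_hom_def)

lemma additive_map_facts:
  assumes M: "abelian_group M" and N: "abelian_group N"
    and cl: "\<And>x. x \<in> carrier M \<Longrightarrow> f x \<in> carrier N"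
    and add: "\<And>x y. \<lbrakk>x \<in> carrier M; y \<in> carrier M\<rbrakk> \<Longrightarrow> f (x \<oplus>\<^bsub>M\<^esub> y) = f x \<oplus>\<^bsub>N\<^esub> f y"
  shows "f \<zero>\<^bsub>M\<^esub> = \<zero>\<^bsub>N\<^esub>" and "x \<in> carrier M \<Longrightarrow> f (\<ominus>\<^bsub>M\<^esub> x) = \<ominus>\<^bsub>N\<^esub> f x"
    and "\<lbrakk>x \<in> carrier M; y \<in> carrier M\<rbrakk> \<Longrightarrow> f (x \<ominus>\<^bsub>M\<^esub> y) = f x \<ominus>\<^bsub>N\<^esub> f y"
proof -
  interpret M: abelian_group M by (rule M)
  interpret N: abelian_group N by (rule N)
  show z: "f \<zero>\<^bsub>M\<^esub> = \<zero>\<^bsub>N\<^esub>"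
    using add[of "\<zero>\<^bsub>M\<^esub>" "\<zero>\<^bsub>M\<^esub>"] cl[of "\<zero>\<^bsub>M\<^esub>"] by (metis N.add.l_cancel_one' M.l_zero M.zero_closed)
  show n: "f (\<ominus>\<^bsub>M\<^esub> x) = \<ominus>\<^bsub>N\<^esub> f x" if "x \<in> carrier M" for x
    using add[of "\<ominus>\<^bsub>M\<^esub> x" x] cl that z by (metis M.a_inv_closed M.l_neg N.minus_equality)
  show "f (x \<ominus>\<^bsub>M\<^esub> y) = f x \<ominus>\<^bsub>N\<^esub> f y" if "x \<in> carrier M" "y \<in> carrier M"
    using add[of x "\<ominus>\<^bsub>M\<^esub> y"] n that by (simp add: M.minus_eq N.minus_eq)
qed

lemma lmod_hom_facts:
  assumes "left_module R M" "left_module R N" "f \<in> lmod_hom R M N"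
  shows "f \<zero>\<^bsub>M\<^esub> = \<zero>\<^bsub>N\<^esub>" and "x \<in> carrier M \<Longrightarrow> f (\<ominus>\<^bsub>M\<^esub> x) = \<ominus>\<^bsub>N\<^esub> f x"
    and "\<lbrakk>x \<in> carrier M; y \<in> carrier M\<rbrakk> \<Longrightarrow> f (x \<ominus>\<^bsub>M\<^esub> y) = f x \<ominus>\<^bsub>N\<^esub> f y"
  using additive_map_facts[of M N f] lmod_homD[OF assms(3)] assms(1,2) by (auto simp: left_module_def)

lemma lmod_hom_compose:
  "\<lbrakk>f \<in> lmod_hom R M N; g \<in> lmod_hom R N P\<rbrakk> \<Longrightarrow> (\<lambda>x. g (f x)) \<in> lmod_hom R M P"
  by (rule lmod_homI) (auto simp: lmod_homD)

lemma lmod_hom_id: "(\<lambda>x. x) \<in> lmod_hom R M M"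
  by (rule lmod_homI) auto

lemma lmod_hom_subring: "\<lbrakk>f \<in> lmod_hom R M N; carrier S \<subseteq> carrier R\<rbrakk> \<Longrightarrow> f \<in> lmod_hom S M N"
  by (auto simp: lmod_hom_def)

lemma left_module_ker:
  assumes M: "left_module R M" and N: "left_module R N" and f: "f \<in> lmod_hom R M N"
  shows "left_module R (M\<lparr>carrier := lmod_ker M N f\<rparr>)"
proof -
  interpret M: left_module R M by (rule M)
  interpret N: left_module R N by (rule N)
  show ?thesis
    using lmod_hom_facts(1)[OF M N f] lmod_homD[OF f]
    by (intro M.submodule) (auto simp: lmod_ker_def M.smult_closed N.smult_zero)
qed

text \<open>Injectivity only tests modules whose elements lie in the universe. Modules built from
  functions are first copied there along an injection, and \<open>inv_into\<close> carries the
  operations over.\<close>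

definition transport :: "('m \<Rightarrow> 'n) \<Rightarrow> ('r, 'm) Module.module \<Rightarrow> ('r, 'n) Module.module" where
  "transport e M =
     \<lparr>carrier = e ` carrier M, monoid.mult = (\<lambda>x y. x), monoid.one = e \<zero>\<^bsub>M\<^esub>, ring.zero = e \<zero>\<^bsub>M\<^esub>,
      ring.add = (\<lambda>x y. e (inv_into (carrier M) e x \<oplus>\<^bsub>M\<^esub> inv_into (carrier M) e y)),
      smult = (\<lambda>a x. e (a \<odot>\<^bsub>M\<^esub> inv_into (carrier M) e x))\<rparr>"

lemma transport_module:
  assumes M: "left_module R M" and e: "inj_on e (carrier M)"
  shows "left_module R (transport e M)" "e \<in> lmod_hom R M (transport e M)"
    "inv_into (carrier M) e \<in> lmod_hom R (transport e M) M"
    "inj_on (inv_into (carrier M) e) (carrier (transport e M))"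
proof -
  interpret M: left_module R M by (rule M)
  note [simp] = inv_into_f_f[OF e]
  show "left_module R (transport e M)"
  proof (rule left_moduleI)
    fix x assume "x \<in> carrier (transport e M)"
    then obtain m where m: "m \<in> carrier M" "x = e m" by (auto simp: transport_def)
    then show "\<exists>y\<in>carrier (transport e M). y \<oplus>\<^bsub>transport e M\<^esub> x = \<zero>\<^bsub>transport e M\<^esub>"
      by (intro bexI[of _ "e (\<ominus>\<^bsub>M\<^esub> m)"]) (auto simp: transport_def M.M.l_neg)
  qed (auto simp: transport_def M.M.a_assoc M.M.a_comm M.M.a_lcomm M.smult_closed M.smult_l_distr M.smult_r_distr
        M.smult_assoc M.smult_one intro!: M.R.ring_axioms)
  show "e \<in> lmod_hom R M (transport e M)" "inv_into (carrier M) e \<in> lmod_hom R (transport e M) M"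
    by (auto simp: lmod_hom_def transport_def M.smult_closed)
  show "inj_on (inv_into (carrier M) e) (carrier (transport e M))"
    by (auto simp: transport_def inj_on_inv_into)
qed

lemma injective_moduleD:
  fixes I :: "('r, 'u) lmod" and A :: "('r, 'u) lmod" and B :: "('r, 'u) lmod"
  assumes "injective_module R I" "left_module R A" "left_module R B" "i \<in> lmod_hom R A B"
    "inj_on i (carrier A)" "f \<in> lmod_hom R A I"
  obtains g where "g \<in> lmod_hom R B I" "\<And>x. x \<in> carrier A \<Longrightarrow> g (i x) = f x"
  using assms unfolding injective_module_def by metis

lemma injective_module_left_module: "injective_module R I \<Longrightarrow> left_module R I"
  by (simp add: injective_module_def)

text \<open>Lets an injective module be used against modules on other types, as soon as their
  carriers embed into the universe.\<close>

lemma injective_extend: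
  fixes I :: "('r, 'u) lmod" and A :: "('r, 'm) Module.module" and B :: "('r, 'n) Module.module"
    and eA :: "'m \<Rightarrow> ('r, 'u) universe" and eB :: "'n \<Rightarrow> ('r, 'u) universe"
  assumes I: "injective_module R I" and A: "left_module R A" and B: "left_module R B"
    and i: "i \<in> lmod_hom R A B" "inj_on i (carrier A)" and f: "f \<in> lmod_hom R A I"
    and eA: "inj_on eA (carrier A)" and eB: "inj_on eB (carrier B)"
  obtains g where "g \<in> lmod_hom R B I" "\<And>x. x \<in> carrier A \<Longrightarrow> g (i x) = f x"
proof -
  note tA = transport_module[OF A eA] and tB = transport_module[OF B eB]
  let ?vA = "inv_into (carrier A) eA"
  have i': "(\<lambda>x. eB (i (?vA x))) \<in> lmod_hom R (transport eA A) (transport eB B)"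
    by (rule lmod_hom_compose[OF lmod_hom_compose[OF tA(3) i(1)] tB(2)])
  have inj: "inj_on (\<lambda>x. eB (i (?vA x))) (carrier (transport eA A))"
  proof (rule inj_onI)
    fix x y assume xy: "x \<in> carrier (transport eA A)" "y \<in> carrier (transport eA A)"
      and eq: "eB (i (?vA x)) = eB (i (?vA y))"
    have v: "?vA x \<in> carrier A" "?vA y \<in> carrier A" using lmod_homD(1)[OF tA(3)] xy by auto
    have "i (?vA x) = i (?vA y)" using inj_onD[OF eB eq] lmod_homD(1)[OF i(1)] v by blast
    then have "?vA x = ?vA y" using inj_onD[OF i(2)] v by blast
    then show "x = y" using inj_onD[OF tA(4)] xy by blast
  qed
  obtain g where g: "g \<in> lmod_hom R (transport eB B) I"
    "\<And>x. x \<in> carrier (transport eA A) \<Longrightarrow> g (eB (i (?vA x))) = f (?vA x)"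
    using injective_moduleD[OF I tA(1) tB(1) i' inj lmod_hom_compose[OF tA(3) f]] by metis
  show ?thesis
  proof (rule that[OF lmod_hom_compose[OF tB(2) g(1)]])
    fix x assume x: "x \<in> carrier A"
    then show "g (eB (i x)) = f x"
      using g(2)[of "eA x"] lmod_homD(1)[OF tA(2)] inv_into_f_f[OF eA x] by simp
  qed
qed

lemma injective_module_retract:
  fixes I M :: "('r, 'u) lmod"
  assumes I: "injective_module R I" and M: "left_module R M"
    and a: "a \<in> lmod_hom R M I" and b: "b \<in> lmod_hom R I M"
    and ba: "\<And>x. x \<in> carrier M \<Longrightarrow> b (a x) = x"
  shows "injective_module R M"
  unfolding injective_module_def
proof (intro conjI allI impI M, elim conjE)
  fix A B :: "('r, 'u) lmod" and i f
  assume *: "left_module R A" "left_module R B" "i \<in> lmod_hom R A B" "inj_on i (carrier A)" "f \<in> lmod_hom R A M"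
  obtain g where g: "g \<in> lmod_hom R B I" "\<And>x. x \<in> carrier A \<Longrightarrow> g (i x) = a (f x)"
    using injective_moduleD[OF I *(1-4) lmod_hom_compose[OF *(5) a]] by metis
  show "\<exists>g\<in>lmod_hom R B M. \<forall>x\<in>carrier A. g (i x) = f x"
    using lmod_hom_compose[OF g(1) b] g(2) ba lmod_homD(1)[OF *(5)] by (intro bexI) auto
qed

section \<open>Coinduction along a subring\<close>

definition regular_module :: "'r ring \<Rightarrow> ('r, 'r) Module.module" where
  "regular_module R = \<lparr>carrier = carrier R, monoid.mult = monoid.mult R, monoid.one = monoid.one R,
     ring.zero = ring.zero R, ring.add = ring.add R, smult = monoid.mult R\<rparr>"

lemma left_module_regular: "Ring.ring R \<Longrightarrow> left_module R (regular_module R)"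
proof -
  assume R: "Ring.ring R"
  interpret R: Ring.ring R by (rule R)
  show ?thesis
    by (rule left_moduleI)
       (auto simp: regular_module_def R.a_assoc R.a_comm R.a_lcomm R.l_distr R.r_distr R.m_assoc
         intro!: R bexI[of _ "\<ominus>\<^bsub>R\<^esub> _"] R.l_neg)
qed

definition zero_module :: "('r, 'm) Module.module \<Rightarrow> ('r, 'm) Module.module" where
  "zero_module M = M\<lparr>carrier := {\<zero>\<^bsub>M\<^esub>}\<rparr>"

lemma left_module_zero: "left_module R M \<Longrightarrow> left_module R (zero_module M)"
proof -
  assume M: "left_module R M"
  interpret M: left_module R M by (rule M)
  show ?thesis unfolding zero_module_def by (rule M.submodule) (auto simp: M.smult_zero)
qed

lemma injective_zero_module:
  fixes I :: "('r, 'u) lmod"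
  assumes "injective_module R I"
  shows "injective_module R (zero_module I)"
proof -
  interpret I: left_module R I by (rule injective_module_left_module[OF assms])
  show ?thesis
  proof (rule injective_module_retract[OF assms left_module_zero[OF I.left_module_axioms], of "\<lambda>x. x" "\<lambda>x. \<zero>\<^bsub>I\<^esub>"])
    show "(\<lambda>x. x) \<in> lmod_hom R (zero_module I) I" "(\<lambda>x. \<zero>\<^bsub>I\<^esub>) \<in> lmod_hom R I (zero_module I)"
      by (auto simp: lmod_hom_def zero_module_def I.smult_zero)
  qed (auto simp: zero_module_def)
qed

text \<open>The S-linear maps from R to M, on which a in R acts through right multiplication of the
  argument. The functions vanish outside R, so that equality of functions is equality of
  elements.\<close>

definition coinduced :: "'r ring \<Rightarrow> 'r ring \<Rightarrow> ('r, 'm) Module.module \<Rightarrow> ('r, 'r \<Rightarrow> 'm) Module.module" where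
  "coinduced R S M =
     \<lparr>carrier = {F \<in> lmod_hom S (regular_module R) M. \<forall>r. r \<notin> carrier R \<longrightarrow> F r = \<zero>\<^bsub>M\<^esub>},
      monoid.mult = (\<lambda>F F'. F), monoid.one = (\<lambda>_. \<zero>\<^bsub>M\<^esub>), ring.zero = (\<lambda>_. \<zero>\<^bsub>M\<^esub>),
      ring.add = (\<lambda>F F' r. F r \<oplus>\<^bsub>M\<^esub> F' r),
      smult = (\<lambda>a F r. if r \<in> carrier R then F (r \<otimes>\<^bsub>R\<^esub> a) else \<zero>\<^bsub>M\<^esub>)\<rparr>"

text \<open>That the operations of S agree with those of R is encoded by
  \<open>regular_restrict\<close>, which makes R an S-module under its own multiplication.\<close>

locale restriction =
  fixes R S :: "'r ring"
  assumes ring: "Ring.ring R" and subring: "Ring.ring S" "carrier S \<subseteq> carrier R"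
    and regular_restrict: "left_module S (regular_module R)"
begin

interpretation R: Ring.ring R by (rule ring)

lemma mem_carrier: "a \<in> carrier S \<Longrightarrow> a \<in> carrier R"
  using subring(2) by blast

lemma coinduced_carrier:
  assumes "F \<in> carrier (coinduced R S M)"
  shows "r \<in> carrier R \<Longrightarrow> F r \<in> carrier M"
    "\<lbrakk>r \<in> carrier R; r' \<in> carrier R\<rbrakk> \<Longrightarrow> F (r \<oplus>\<^bsub>R\<^esub> r') = F r \<oplus>\<^bsub>M\<^esub> F r'"
    "\<lbrakk>a \<in> carrier S; r \<in> carrier R\<rbrakk> \<Longrightarrow> F (a \<otimes>\<^bsub>R\<^esub> r) = a \<odot>\<^bsub>M\<^esub> F r"
    "r \<notin> carrier R \<Longrightarrow> F r = \<zero>\<^bsub>M\<^esub>"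
  using assms lmod_homD[of F S "regular_module R" M] by (auto simp: coinduced_def regular_module_def)

lemma coinduced_carrierI:
  assumes "\<And>r. r \<in> carrier R \<Longrightarrow> F r \<in> carrier M"
    "\<And>r r'. \<lbrakk>r \<in> carrier R; r' \<in> carrier R\<rbrakk> \<Longrightarrow> F (r \<oplus>\<^bsub>R\<^esub> r') = F r \<oplus>\<^bsub>M\<^esub> F r'"
    "\<And>a r. \<lbrakk>a \<in> carrier S; r \<in> carrier R\<rbrakk> \<Longrightarrow> F (a \<otimes>\<^bsub>R\<^esub> r) = a \<odot>\<^bsub>M\<^esub> F r"
    "\<And>r. r \<notin> carrier R \<Longrightarrow> F r = \<zero>\<^bsub>M\<^esub>"
  shows "F \<in> carrier (coinduced R S M)"
  using assms by (auto simp: coinduced_def regular_module_def lmod_hom_def)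

lemma left_module_coinduced:
  assumes M: "left_module S M"
  shows "left_module R (coinduced R S M)"
proof -
  interpret M: left_module S M by (rule M)
  note C = coinduced_carrier
  have z: "\<zero>\<^bsub>coinduced R S M\<^esub> = (\<lambda>_. \<zero>\<^bsub>M\<^esub>)"
    and add: "F \<oplus>\<^bsub>coinduced R S M\<^esub> F' = (\<lambda>r. F r \<oplus>\<^bsub>M\<^esub> F' r)"
    and sm: "a \<odot>\<^bsub>coinduced R S M\<^esub> F = (\<lambda>r. if r \<in> carrier R then F (r \<otimes>\<^bsub>R\<^esub> a) else \<zero>\<^bsub>M\<^esub>)" for F F' a
    by (simp_all add: coinduced_def)
  have cl: "F r \<in> carrier M" if "F \<in> carrier (coinduced R S M)" for F r
    using C(1)[OF that, of r] C(4)[OF that, of r] by (cases "r \<in> carrier R") auto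
  have add_cl: "F \<oplus>\<^bsub>coinduced R S M\<^esub> F' \<in> carrier (coinduced R S M)"
    if F: "F \<in> carrier (coinduced R S M)" and F': "F' \<in> carrier (coinduced R S M)" for F F'
    unfolding add
  proof (rule coinduced_carrierI)
    fix r r' assume r: "r \<in> carrier R" "r' \<in> carrier R"
    have "a \<oplus>\<^bsub>M\<^esub> b \<oplus>\<^bsub>M\<^esub> (c \<oplus>\<^bsub>M\<^esub> e) = a \<oplus>\<^bsub>M\<^esub> c \<oplus>\<^bsub>M\<^esub> (b \<oplus>\<^bsub>M\<^esub> e)"
      if "a \<in> carrier M" "b \<in> carrier M" "c \<in> carrier M" "e \<in> carrier M" for a b c e
      using that by algebra
    then show "F (r \<oplus>\<^bsub>R\<^esub> r') \<oplus>\<^bsub>M\<^esub> F' (r \<oplus>\<^bsub>R\<^esub> r') = F r \<oplus>\<^bsub>M\<^esub> F' r \<oplus>\<^bsub>M\<^esub> (F r' \<oplus>\<^bsub>M\<^esub> F' r')"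
      using C(2)[OF F r] C(2)[OF F' r] cl[OF F] cl[OF F'] by simp
  qed (use C[OF F] C[OF F'] cl[OF F] cl[OF F'] in \<open>auto simp: M.smult_r_distr\<close>)
  show ?thesis
  proof (rule left_moduleI)
    show "Ring.ring R" by (rule ring)
    show "\<zero>\<^bsub>coinduced R S M\<^esub> \<in> carrier (coinduced R S M)"
      unfolding z by (rule coinduced_carrierI) (auto simp: M.smult_zero)
    show "a \<odot>\<^bsub>coinduced R S M\<^esub> F \<in> carrier (coinduced R S M)"
      if a: "a \<in> carrier R" and F: "F \<in> carrier (coinduced R S M)" for a F
      unfolding sm
    proof (rule coinduced_carrierI)
      fix s r assume s: "s \<in> carrier S" and r: "r \<in> carrier R"
      have "s \<otimes>\<^bsub>R\<^esub> r \<otimes>\<^bsub>R\<^esub> a = s \<otimes>\<^bsub>R\<^esub> (r \<otimes>\<^bsub>R\<^esub> a)" using mem_carrier[OF s] r a by (rule R.m_assoc)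
      then show "(if s \<otimes>\<^bsub>R\<^esub> r \<in> carrier R then F (s \<otimes>\<^bsub>R\<^esub> r \<otimes>\<^bsub>R\<^esub> a) else \<zero>\<^bsub>M\<^esub>) =
          s \<odot>\<^bsub>M\<^esub> (if r \<in> carrier R then F (r \<otimes>\<^bsub>R\<^esub> a) else \<zero>\<^bsub>M\<^esub>)"
        using mem_carrier[OF s] r a C(3)[OF F s, of "r \<otimes>\<^bsub>R\<^esub> a"] by simp
    qed (use a cl[OF F] C(2)[OF F] in \<open>auto simp: R.l_distr\<close>)
    show "\<exists>F'\<in>carrier (coinduced R S M). F' \<oplus>\<^bsub>coinduced R S M\<^esub> F = \<zero>\<^bsub>coinduced R S M\<^esub>"
      if F: "F \<in> carrier (coinduced R S M)" for F
    proof (rule bexI[of _ "\<lambda>r. \<ominus>\<^bsub>M\<^esub> F r"])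
      show "(\<lambda>r. \<ominus>\<^bsub>M\<^esub> F r) \<in> carrier (coinduced R S M)"
      proof (rule coinduced_carrierI)
        fix s r assume s: "s \<in> carrier S" and r: "r \<in> carrier R"
        have "\<ominus>\<^bsub>M\<^esub> (s \<odot>\<^bsub>M\<^esub> F r) = s \<odot>\<^bsub>M\<^esub> (\<ominus>\<^bsub>M\<^esub> F r)"
          using M.smult_r_distr[OF s, of "\<ominus>\<^bsub>M\<^esub> F r" "F r"] cl[OF F, of r] s
          by (metis M.M.a_inv_closed M.M.l_neg M.M.minus_equality M.smult_closed M.smult_zero)
        then show "\<ominus>\<^bsub>M\<^esub> F (s \<otimes>\<^bsub>R\<^esub> r) = s \<odot>\<^bsub>M\<^esub> (\<ominus>\<^bsub>M\<^esub> F r)" using C(3)[OF F s r] by simp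
      qed (use C(2,4)[OF F] cl[OF F] in \<open>auto simp: M.M.minus_add\<close>)
      show "(\<lambda>r. \<ominus>\<^bsub>M\<^esub> F r) \<oplus>\<^bsub>coinduced R S M\<^esub> F = \<zero>\<^bsub>coinduced R S M\<^esub>"
        unfolding add z using cl[OF F] by (auto simp: M.M.l_neg)
    qed
  next
    fix a b F assume *: "a \<in> carrier R" "b \<in> carrier R" "F \<in> carrier (coinduced R S M)"
    show "(a \<oplus>\<^bsub>R\<^esub> b) \<odot>\<^bsub>coinduced R S M\<^esub> F = a \<odot>\<^bsub>coinduced R S M\<^esub> F \<oplus>\<^bsub>coinduced R S M\<^esub> b \<odot>\<^bsub>coinduced R S M\<^esub> F"
      unfolding sm add using * C(2)[OF *(3)] by (auto simp: R.r_distr)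
    show "(a \<otimes>\<^bsub>R\<^esub> b) \<odot>\<^bsub>coinduced R S M\<^esub> F = a \<odot>\<^bsub>coinduced R S M\<^esub> (b \<odot>\<^bsub>coinduced R S M\<^esub> F)"
      unfolding sm using * by (auto simp: R.m_assoc)
  next
    fix F assume *: "F \<in> carrier (coinduced R S M)"
    show "\<one>\<^bsub>R\<^esub> \<odot>\<^bsub>coinduced R S M\<^esub> F = F"
      unfolding sm using C(4)[OF *] by auto
  qed (use add_cl cl in \<open>auto simp: add z sm M.M.a_assoc M.M.a_comm M.M.a_lcomm\<close>)
qed

text \<open>One direction of the adjunction between restriction and coinduction. For g the identity
  it is the embedding of a module into the coinduction of its restriction.\<close>

lemma coinduced_adjoint:
  assumes "left_module R B" "left_module S B" "g \<in> lmod_hom S B M" "left_module S M"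
  shows "(\<lambda>b r. if r \<in> carrier R then g (r \<odot>\<^bsub>B\<^esub> b) else \<zero>\<^bsub>M\<^esub>) \<in> lmod_hom R B (coinduced R S M)"
proof -
  interpret B: left_module R B by (rule assms(1))
  interpret BS: left_module S B by (rule assms(2))
  interpret M: left_module S M by (rule assms(4))
  note g = lmod_homD[OF assms(3)]
  have reg: "s \<otimes>\<^bsub>R\<^esub> r \<odot>\<^bsub>B\<^esub> b = s \<odot>\<^bsub>B\<^esub> (r \<odot>\<^bsub>B\<^esub> b)" if "s \<in> carrier S" "r \<in> carrier R" "b \<in> carrier B" for s r b
    using B.smult_assoc[of s r b] that mem_carrier by blast
  show ?thesis
  proof (rule lmod_homI)
    fix b assume b: "b \<in> carrier B"
    show "(\<lambda>r. if r \<in> carrier R then g (r \<odot>\<^bsub>B\<^esub> b) else \<zero>\<^bsub>M\<^esub>) \<in> carrier (coinduced R S M)"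
    proof (rule coinduced_carrierI)
      fix s r assume s: "s \<in> carrier S" and r: "r \<in> carrier R"
      have "g (s \<otimes>\<^bsub>R\<^esub> r \<odot>\<^bsub>B\<^esub> b) = s \<odot>\<^bsub>M\<^esub> g (r \<odot>\<^bsub>B\<^esub> b)"
        using g(3)[OF s B.smult_closed[OF r b]] reg[OF s r b] by simp
      then show "(if s \<otimes>\<^bsub>R\<^esub> r \<in> carrier R then g (s \<otimes>\<^bsub>R\<^esub> r \<odot>\<^bsub>B\<^esub> b) else \<zero>\<^bsub>M\<^esub>) =
          s \<odot>\<^bsub>M\<^esub> (if r \<in> carrier R then g (r \<odot>\<^bsub>B\<^esub> b) else \<zero>\<^bsub>M\<^esub>)"
        using mem_carrier[OF s] r by simp
    qed (use b g B.smult_closed in \<open>simp_all add: B.smult_l_distr\<close>)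
  qed (auto simp: coinduced_def g B.smult_closed B.smult_r_distr B.smult_assoc)
qed

text \<open>Coinduction is right adjoint to restriction, and restriction keeps injective maps
  injective: compose with evaluation at 1, extend over S, and pass to the adjoint map.\<close>

lemma injective_coinduced:
  fixes M :: "('r, 'u) lmod"
  assumes M: "injective_module S M" and restr: "\<And>A :: ('r, 'u) lmod. left_module R A \<Longrightarrow> left_module S A"
    and e: "inj_on e (carrier (coinduced R S M))"
  shows "injective_module R (transport e (coinduced R S M) :: ('r, 'u) lmod)"
  unfolding injective_module_def
proof (intro conjI allI impI)
  have MS: "left_module S M" by (rule injective_module_left_module[OF M])
  note t = transport_module[OF left_module_coinduced[OF MS] e]
  show "left_module R (transport e (coinduced R S M))" by (rule t(1))
  fix A B :: "('r, 'u) lmod" and i f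
  assume "left_module R A \<and> left_module R B \<and> i \<in> lmod_hom R A B \<and> inj_on i (carrier A) \<and>
    f \<in> lmod_hom R A (transport e (coinduced R S M))"
  then have A: "left_module R A" and B: "left_module R B" and i: "i \<in> lmod_hom R A B" "inj_on i (carrier A)"
    and f: "f \<in> lmod_hom R A (transport e (coinduced R S M))" by auto
  interpret A: left_module R A by (rule A)
  interpret B: left_module R B by (rule B)
  define f' where "f' x = inv_into (carrier (coinduced R S M)) e (f x)" for x
  have f': "f' \<in> lmod_hom R A (coinduced R S M)" unfolding f'_def by (rule lmod_hom_compose[OF f t(3)])
  note f'D = lmod_homD[OF f'] and fC = coinduced_carrier[OF lmod_homD(1)[OF f']]
  have f1: "(\<lambda>x. f' x \<one>\<^bsub>R\<^esub>) \<in> lmod_hom S A M"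
  proof (rule lmod_homI)
    fix s x assume s: "s \<in> carrier S" and x: "x \<in> carrier A"
    have "f' (s \<odot>\<^bsub>A\<^esub> x) \<one>\<^bsub>R\<^esub> = f' x (\<one>\<^bsub>R\<^esub> \<otimes>\<^bsub>R\<^esub> s)"
      using f'D(3)[OF mem_carrier[OF s] x] by (simp add: coinduced_def)
    also have "\<dots> = f' x (s \<otimes>\<^bsub>R\<^esub> \<one>\<^bsub>R\<^esub>)" using mem_carrier[OF s] by simp
    finally show "f' (s \<odot>\<^bsub>A\<^esub> x) \<one>\<^bsub>R\<^esub> = s \<odot>\<^bsub>M\<^esub> f' x \<one>\<^bsub>R\<^esub>" using fC(3)[OF x s] by simp
  next
    fix x assume x: "x \<in> carrier A"
    show "f' x \<one>\<^bsub>R\<^esub> \<in> carrier M" using fC(1)[OF x] by simp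
    fix y assume y: "y \<in> carrier A"
    show "f' (x \<oplus>\<^bsub>A\<^esub> y) \<one>\<^bsub>R\<^esub> = f' x \<one>\<^bsub>R\<^esub> \<oplus>\<^bsub>M\<^esub> f' y \<one>\<^bsub>R\<^esub>"
      unfolding f'D(2)[OF x y] by (simp add: coinduced_def)
  qed
  obtain g where g: "g \<in> lmod_hom S B M" "\<And>x. x \<in> carrier A \<Longrightarrow> g (i x) = f' x \<one>\<^bsub>R\<^esub>"
    using injective_moduleD[OF M restr[OF A] restr[OF B] lmod_hom_subring[OF i(1) subring(2)] i(2) f1] by metis
  define h where "h b = (\<lambda>r. if r \<in> carrier R then g (r \<odot>\<^bsub>B\<^esub> b) else \<zero>\<^bsub>M\<^esub>)" for b
  have h: "h \<in> lmod_hom R B (coinduced R S M)"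
    unfolding h_def[abs_def] by (rule coinduced_adjoint[OF B restr[OF B] g(1) MS])
  have hi: "h (i x) = f' x" if x: "x \<in> carrier A" for x
  proof
    fix r
    show "h (i x) r = f' x r"
    proof (cases "r \<in> carrier R")
      case True
      have "g (r \<odot>\<^bsub>B\<^esub> i x) = f' (r \<odot>\<^bsub>A\<^esub> x) \<one>\<^bsub>R\<^esub>"
        using lmod_homD(3)[OF i(1) True x, symmetric] g(2)[OF A.smult_closed[OF True x]] by simp
      also have "\<dots> = f' x r" using f'D(3)[OF True x] True by (simp add: coinduced_def)
      finally show ?thesis using True by (simp add: h_def)
    next
      case False
      then show ?thesis using fC(4)[OF x] by (simp add: h_def)
    qed
  qed
  show "\<exists>g\<in>lmod_hom R B (transport e (coinduced R S M)). \<forall>x\<in>carrier A. g (i x) = f x"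
  proof (rule bexI[OF _ lmod_hom_compose[OF h t(2)]], rule ballI)
    fix x assume x: "x \<in> carrier A"
    have "f x \<in> e ` carrier (coinduced R S M)" using lmod_homD(1)[OF f x] by (simp add: transport_def)
    then show "e (h (i x)) = f x" unfolding hi[OF x] f'_def by (rule f_inv_into_f)
  qed
qed

end

section \<open>Integral group rings\<close>

text \<open>Baer's argument for divisible groups, run by Zorn's lemma on graphs. Only the integers
  act, through \<iota>: A is an additive subgroup and the extension is merely additive, because
  linearity over the group ring is obtained afterwards by averaging.\<close>

lemma divisible_extension:
  fixes R :: "'r ring" and B :: "('r, 'b) Module.module" and D :: "('r, 'd) Module.module" and \<iota> :: "int \<Rightarrow> 'r"
  assumes B: "left_module R B" and D: "left_module R D"
    and \<iota>: "\<And>k. \<iota> k \<in> carrier R" "\<And>k l. \<iota> (k + l) = \<iota> k \<oplus>\<^bsub>R\<^esub> \<iota> l" "\<And>k l. \<iota> (k * l) = \<iota> k \<otimes>\<^bsub>R\<^esub> \<iota> l" "\<iota> 1 = \<one>\<^bsub>R\<^esub>"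
    and divisible: "\<And>n x. n > 0 \<Longrightarrow> x \<in> carrier D \<Longrightarrow> \<exists>y\<in>carrier D. \<iota> n \<odot>\<^bsub>D\<^esub> y = x"
    and A: "A \<subseteq> carrier B" "\<zero>\<^bsub>B\<^esub> \<in> A" "\<And>x y. x \<in> A \<Longrightarrow> y \<in> A \<Longrightarrow> x \<oplus>\<^bsub>B\<^esub> y \<in> A" "\<And>k x. x \<in> A \<Longrightarrow> \<iota> k \<odot>\<^bsub>B\<^esub> x \<in> A"
    and f: "\<And>x. x \<in> A \<Longrightarrow> f x \<in> carrier D" "\<And>x y. x \<in> A \<Longrightarrow> y \<in> A \<Longrightarrow> f (x \<oplus>\<^bsub>B\<^esub> y) = f x \<oplus>\<^bsub>D\<^esub> f y"
      "\<And>k x. x \<in> A \<Longrightarrow> f (\<iota> k \<odot>\<^bsub>B\<^esub> x) = \<iota> k \<odot>\<^bsub>D\<^esub> f x"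
  obtains g where "\<And>x. x \<in> carrier B \<Longrightarrow> g x \<in> carrier D"
    "\<And>x y. x \<in> carrier B \<Longrightarrow> y \<in> carrier B \<Longrightarrow> g (x \<oplus>\<^bsub>B\<^esub> y) = g x \<oplus>\<^bsub>D\<^esub> g y" "\<And>x. x \<in> A \<Longrightarrow> g x = f x"
proof -
  interpret B: left_module R B by (rule B)
  interpret D: left_module R D by (rule D)
  have \<iota>0: "\<iota> 0 = \<zero>\<^bsub>R\<^esub>"
    using \<iota>(2)[of 0 0] \<iota>(1)[of 0] by (metis B.R.add.l_cancel_one' add_0)
  \<comment> \<open>Graphs of partial additive maps extending f. The last clause makes them single
    valued, since differences of related pairs stay in the graph.\<close>
  define good where "good \<Gamma> \<longleftrightarrow> \<Gamma> \<subseteq> carrier B \<times> carrier D \<and> (\<lambda>x. (x, f x)) ` A \<subseteq> \<Gamma> \<and>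
     (\<forall>b y b' y'. (b, y) \<in> \<Gamma> \<longrightarrow> (b', y') \<in> \<Gamma> \<longrightarrow> (b \<oplus>\<^bsub>B\<^esub> b', y \<oplus>\<^bsub>D\<^esub> y') \<in> \<Gamma>) \<and>
     (\<forall>k b y. (b, y) \<in> \<Gamma> \<longrightarrow> (\<iota> k \<odot>\<^bsub>B\<^esub> b, \<iota> k \<odot>\<^bsub>D\<^esub> y) \<in> \<Gamma>) \<and> (\<forall>y. (\<zero>\<^bsub>B\<^esub>, y) \<in> \<Gamma> \<longrightarrow> y = \<zero>\<^bsub>D\<^esub>)" for \<Gamma>
  have goodD: "\<And>b y. (b, y) \<in> \<Gamma> \<Longrightarrow> b \<in> carrier B \<and> y \<in> carrier D"
    "\<And>x. x \<in> A \<Longrightarrow> (x, f x) \<in> \<Gamma>"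
    "\<And>b y b' y'. (b, y) \<in> \<Gamma> \<Longrightarrow> (b', y') \<in> \<Gamma> \<Longrightarrow> (b \<oplus>\<^bsub>B\<^esub> b', y \<oplus>\<^bsub>D\<^esub> y') \<in> \<Gamma>"
    "\<And>k b y. (b, y) \<in> \<Gamma> \<Longrightarrow> (\<iota> k \<odot>\<^bsub>B\<^esub> b, \<iota> k \<odot>\<^bsub>D\<^esub> y) \<in> \<Gamma>"
    "\<And>y. (\<zero>\<^bsub>B\<^esub>, y) \<in> \<Gamma> \<Longrightarrow> y = \<zero>\<^bsub>D\<^esub>" if "good \<Gamma>" for \<Gamma>
    using that unfolding good_def by blast+
  have neg: "\<iota> (- 1) \<odot>\<^bsub>B\<^esub> b = \<ominus>\<^bsub>B\<^esub> b" if "b \<in> carrier B" for b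
  proof -
    have "\<iota> (- 1) \<odot>\<^bsub>B\<^esub> b \<oplus>\<^bsub>B\<^esub> b = (\<iota> (- 1) \<oplus>\<^bsub>R\<^esub> \<iota> 1) \<odot>\<^bsub>B\<^esub> b"
      using that \<iota>(1) by (simp add: B.smult_l_distr \<iota>(4) B.smult_one)
    also have "\<dots> = \<zero>\<^bsub>B\<^esub>" using that by (simp add: \<iota>(2)[symmetric] \<iota>0 B.zero_smult)
    finally show ?thesis using that \<iota>(1) by (metis B.M.minus_equality B.smult_closed)
  qed
  have neg': "\<iota> (- 1) \<odot>\<^bsub>D\<^esub> b = \<ominus>\<^bsub>D\<^esub> b" if "b \<in> carrier D" for b
  proof -
    have "\<iota> (- 1) \<odot>\<^bsub>D\<^esub> b \<oplus>\<^bsub>D\<^esub> b = (\<iota> (- 1) \<oplus>\<^bsub>R\<^esub> \<iota> 1) \<odot>\<^bsub>D\<^esub> b"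
      using that \<iota>(1) by (simp add: D.smult_l_distr \<iota>(4) D.smult_one)
    also have "\<dots> = \<zero>\<^bsub>D\<^esub>" using that by (simp add: \<iota>(2)[symmetric] \<iota>0 D.zero_smult)
    finally show ?thesis using that \<iota>(1) by (metis D.M.minus_equality D.smult_closed)
  qed
  have single: "y = y'" if "good \<Gamma>" "(b, y) \<in> \<Gamma>" "(b, y') \<in> \<Gamma>" for \<Gamma> b y y'
  proof -
    note c = goodD(1)[OF that(1,2)] goodD(1)[OF that(1,3)]
    have "(b \<oplus>\<^bsub>B\<^esub> \<ominus>\<^bsub>B\<^esub> b, y \<oplus>\<^bsub>D\<^esub> \<ominus>\<^bsub>D\<^esub> y') \<in> \<Gamma>"
      using goodD(3)[OF that(1,2) goodD(4)[OF that(1,3), of "- 1"]] c by (simp add: neg neg')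
    then have "y \<ominus>\<^bsub>D\<^esub> y' = \<zero>\<^bsub>D\<^esub>" using goodD(5)[OF that(1)] c by (simp add: B.M.r_neg D.M.minus_eq)
    then show ?thesis using D.M.eq_if_minus_eq_zero c by blast
  qed
  have base: "good ((\<lambda>x. (x, f x)) ` A)"
  proof -
    have "f \<zero>\<^bsub>B\<^esub> = \<zero>\<^bsub>D\<^esub>"
      using f(3)[OF A(2), of 0] f(1)[OF A(2)] A(1,2) by (simp add: \<iota>0 B.zero_smult D.zero_smult)
    then show ?thesis unfolding good_def using A f by auto
  qed
  have "\<exists>M\<in>Collect good. \<forall>X\<in>Collect good. M \<subseteq> X \<longrightarrow> X = M"
  proof (rule subset_Zorn_nonempty)
    show "Collect good \<noteq> {}" using base by blast
    fix \<C> assume ne: "\<C> \<noteq> {}" and chain: "subset.chain (Collect good) \<C>"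
    have g: "good \<Gamma>" if "\<Gamma> \<in> \<C>" for \<Gamma> using chain that by (auto simp: subset.chain_def)
    have tot: "\<Gamma> \<subseteq> \<Gamma>' \<or> \<Gamma>' \<subseteq> \<Gamma>" if "\<Gamma> \<in> \<C>" "\<Gamma>' \<in> \<C>" for \<Gamma> \<Gamma>'
      using chain that by (auto simp: subset.chain_def)
    have "good (\<Union>\<C>)"
      unfolding good_def
    proof (intro conjI allI impI)
      show "\<Union>\<C> \<subseteq> carrier B \<times> carrier D" using g unfolding good_def by blast
      show "(\<lambda>x. (x, f x)) ` A \<subseteq> \<Union>\<C>" using g ne unfolding good_def by blast
      show "y = \<zero>\<^bsub>D\<^esub>" if "(\<zero>\<^bsub>B\<^esub>, y) \<in> \<Union>\<C>" for y using goodD(5)[OF g] that by blast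
      show "(\<iota> k \<odot>\<^bsub>B\<^esub> b, \<iota> k \<odot>\<^bsub>D\<^esub> y) \<in> \<Union>\<C>" if "(b, y) \<in> \<Union>\<C>" for k b y using goodD(4)[OF g] that by blast
      show "(b \<oplus>\<^bsub>B\<^esub> b', y \<oplus>\<^bsub>D\<^esub> y') \<in> \<Union>\<C>" if by': "(b, y) \<in> \<Union>\<C>" "(b', y') \<in> \<Union>\<C>" for b y b' y'
      proof -
        obtain \<Gamma> where "\<Gamma> \<in> \<C>" "(b, y) \<in> \<Gamma>" "(b', y') \<in> \<Gamma>" using by' tot by blast
        then show ?thesis using goodD(3)[OF g] by blast
      qed
    qed
    then show "\<Union>\<C> \<in> Collect good" by simp
  qed
  then obtain M where M: "good M" "\<And>X. good X \<Longrightarrow> M \<subseteq> X \<Longrightarrow> X = M" by blast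
  note MD = goodD[OF M(1)]
  have M0: "(\<zero>\<^bsub>B\<^esub>, \<zero>\<^bsub>D\<^esub>) \<in> M"
    using MD(4)[OF MD(2)[OF A(2)], of 0] f(1)[OF A(2)] A(1,2) by (simp add: \<iota>0 B.zero_smult D.zero_smult)
  have total: "\<exists>y. (b, y) \<in> M" if b: "b \<in> carrier B" for b
  proof -
    let ?S = "\<lambda>k. \<exists>v. (\<iota> k \<odot>\<^bsub>B\<^esub> b, v) \<in> M"
    \<comment> \<open>A value y for b is admissible if it agrees with M on all integer multiples of
      b in the domain of M. If no k b with k > 0 lies there, y = 0 does; otherwise the least
      positive n with n b in the domain decides, and y is the value at n b divided by n. Division
      with remainder settles the other multiples.\<close>
    have key: "\<exists>y\<in>carrier D. \<forall>k v. (\<iota> k \<odot>\<^bsub>B\<^esub> b, v) \<in> M \<longrightarrow> v = \<iota> k \<odot>\<^bsub>D\<^esub> y"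
    proof (cases "\<exists>k>0. ?S k")
      case False
      have "v = \<iota> k \<odot>\<^bsub>D\<^esub> \<zero>\<^bsub>D\<^esub>" if kv: "(\<iota> k \<odot>\<^bsub>B\<^esub> b, v) \<in> M" for k v
      proof -
        have "(\<iota> (- k) \<odot>\<^bsub>B\<^esub> b, \<iota> (- 1) \<odot>\<^bsub>D\<^esub> v) \<in> M"
          using MD(4)[OF kv, of "- 1"] b \<iota>(1) \<iota>(3)[of "- 1" k] by (simp add: B.smult_assoc[symmetric])
        then have "k = 0" using False kv by (metis linorder_neqE neg_0_less_iff_less)
        moreover from this have "v = \<zero>\<^bsub>D\<^esub>" using kv b by (intro MD(5)) (simp add: \<iota>0 B.zero_smult)
        ultimately show ?thesis by (simp add: \<iota>0 D.zero_smult)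
      qed
      then show ?thesis by blast
    next
      case True
      define n where "n = (LEAST n::nat. n > 0 \<and> ?S (int n))"
      obtain k0 where k0: "k0 > 0" "?S k0" using True by blast
      have "nat k0 > 0 \<and> ?S (int (nat k0))" using k0 by simp
      then have n: "n > 0 \<and> ?S (int n)" unfolding n_def by (rule LeastI)
      have n_min: "m \<ge> n" if "m > 0" "?S (int m)" for m unfolding n_def by (rule Least_le) (use that in blast)
      obtain v where v: "(\<iota> (int n) \<odot>\<^bsub>B\<^esub> b, v) \<in> M" using n by blast
      obtain y where y: "y \<in> carrier D" "\<iota> (int n) \<odot>\<^bsub>D\<^esub> y = v" using divisible[of "int n" v] n MD(1)[OF v] by auto
      have "w = \<iota> k \<odot>\<^bsub>D\<^esub> y" if kw: "(\<iota> k \<odot>\<^bsub>B\<^esub> b, w) \<in> M" for k w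
      proof -
        let ?q = "k div int n" and ?r = "k mod int n"
        have q: "(\<iota> (q * int n) \<odot>\<^bsub>B\<^esub> b, \<iota> (q * int n) \<odot>\<^bsub>D\<^esub> y) \<in> M" for q
          using MD(4)[OF v, of q] b y \<iota>(1) by (simp add: \<iota>(3) B.smult_assoc D.smult_assoc)
        have "?r = k + (- ?q) * int n" by (simp add: minus_div_mult_eq_mod)
        then have "(\<iota> ?r \<odot>\<^bsub>B\<^esub> b, w \<oplus>\<^bsub>D\<^esub> \<iota> ((- ?q) * int n) \<odot>\<^bsub>D\<^esub> y) \<in> M"
          using MD(3)[OF kw q[of "- ?q"]] b \<iota>(1) \<iota>(2)[of k "(- ?q) * int n"] by (simp add: B.smult_l_distr)
        then have "?S ?r" by blast
        moreover have "0 \<le> ?r" "?r < int n" using n by simp_all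
        ultimately have "?r = 0" using n_min[of "nat ?r"] by (cases "?r = 0") auto
        then have "k = ?q * int n" by (metis add.right_neutral div_mult_mod_eq)
        then show ?thesis using single[OF M(1) kw] q[of ?q] by metis
      qed
      then show ?thesis using y(1) by blast
    qed
    then obtain y where y: "y \<in> carrier D" "\<And>k v. (\<iota> k \<odot>\<^bsub>B\<^esub> b, v) \<in> M \<Longrightarrow> v = \<iota> k \<odot>\<^bsub>D\<^esub> y" by blast
    \<comment> \<open>The graph obtained by adjoining b |-> y. Its single-valuedness is the
      admissibility of y, and maximality forces it to equal M.\<close>
    define X where "X = {(m \<oplus>\<^bsub>B\<^esub> \<iota> k \<odot>\<^bsub>B\<^esub> b, v \<oplus>\<^bsub>D\<^esub> \<iota> k \<odot>\<^bsub>D\<^esub> y) | m v k. (m, v) \<in> M}"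
    have XI: "(m \<oplus>\<^bsub>B\<^esub> \<iota> k \<odot>\<^bsub>B\<^esub> b, v \<oplus>\<^bsub>D\<^esub> \<iota> k \<odot>\<^bsub>D\<^esub> y) \<in> X" if "(m, v) \<in> M" for m v k
      using that unfolding X_def by blast
    have sc: "\<iota> k \<odot>\<^bsub>B\<^esub> b \<in> carrier B" "\<iota> k \<odot>\<^bsub>D\<^esub> y \<in> carrier D" for k
      using \<iota>(1) b y(1) by (simp_all add: B.smult_closed D.smult_closed)
    have MX: "M \<subseteq> X"
    proof
      fix p assume "p \<in> M"
      then show "p \<in> X" using XI[of "fst p" "snd p" 0] MD(1)[of "fst p" "snd p"] b y(1)
        by (simp add: \<iota>0 B.zero_smult D.zero_smult)
    qed
    have "good X"
      unfolding good_def
    proof (intro conjI allI impI)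
      show "X \<subseteq> carrier B \<times> carrier D" unfolding X_def using MD(1) sc by auto
      show "(\<lambda>x. (x, f x)) ` A \<subseteq> X" using MX MD(2) by blast
    next
      fix b1 y1 b2 y2 assume "(b1, y1) \<in> X" "(b2, y2) \<in> X"
      then obtain m v k m' v' k' where *: "(m, v) \<in> M" "(m', v') \<in> M"
        "b1 = m \<oplus>\<^bsub>B\<^esub> \<iota> k \<odot>\<^bsub>B\<^esub> b" "y1 = v \<oplus>\<^bsub>D\<^esub> \<iota> k \<odot>\<^bsub>D\<^esub> y"
        "b2 = m' \<oplus>\<^bsub>B\<^esub> \<iota> k' \<odot>\<^bsub>B\<^esub> b" "y2 = v' \<oplus>\<^bsub>D\<^esub> \<iota> k' \<odot>\<^bsub>D\<^esub> y" unfolding X_def by blast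
      note c = MD(1)[OF *(1)] MD(1)[OF *(2)]
      have "b1 \<oplus>\<^bsub>B\<^esub> b2 = (m \<oplus>\<^bsub>B\<^esub> m') \<oplus>\<^bsub>B\<^esub> \<iota> (k + k') \<odot>\<^bsub>B\<^esub> b"
        using c sc \<iota>(1) b by (simp add: * \<iota>(2) B.smult_l_distr B.M.a_assoc B.M.a_lcomm B.M.a_comm)
      moreover have "y1 \<oplus>\<^bsub>D\<^esub> y2 = (v \<oplus>\<^bsub>D\<^esub> v') \<oplus>\<^bsub>D\<^esub> \<iota> (k + k') \<odot>\<^bsub>D\<^esub> y"
        using c sc \<iota>(1) y(1) by (simp add: * \<iota>(2) D.smult_l_distr D.M.a_assoc D.M.a_lcomm D.M.a_comm)
      ultimately show "(b1 \<oplus>\<^bsub>B\<^esub> b2, y1 \<oplus>\<^bsub>D\<^esub> y2) \<in> X" using XI[OF MD(3)[OF *(1,2)]] by simp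
    next
      fix l b1 y1 assume "(b1, y1) \<in> X"
      then obtain m v k where *: "(m, v) \<in> M" "b1 = m \<oplus>\<^bsub>B\<^esub> \<iota> k \<odot>\<^bsub>B\<^esub> b" "y1 = v \<oplus>\<^bsub>D\<^esub> \<iota> k \<odot>\<^bsub>D\<^esub> y"
        unfolding X_def by blast
      note c = MD(1)[OF *(1)]
      have "\<iota> l \<odot>\<^bsub>B\<^esub> b1 = \<iota> l \<odot>\<^bsub>B\<^esub> m \<oplus>\<^bsub>B\<^esub> \<iota> (l * k) \<odot>\<^bsub>B\<^esub> b"
        using c sc \<iota>(1) b by (simp add: * \<iota>(3) B.smult_r_distr B.smult_assoc)
      moreover have "\<iota> l \<odot>\<^bsub>D\<^esub> y1 = \<iota> l \<odot>\<^bsub>D\<^esub> v \<oplus>\<^bsub>D\<^esub> \<iota> (l * k) \<odot>\<^bsub>D\<^esub> y"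
        using c sc \<iota>(1) y(1) by (simp add: * \<iota>(3) D.smult_r_distr D.smult_assoc)
      ultimately show "(\<iota> l \<odot>\<^bsub>B\<^esub> b1, \<iota> l \<odot>\<^bsub>D\<^esub> y1) \<in> X" using XI[OF MD(4)[OF *(1)]] by simp
    next
      fix w assume "(\<zero>\<^bsub>B\<^esub>, w) \<in> X"
      then obtain m v k where *: "(m, v) \<in> M" "\<zero>\<^bsub>B\<^esub> = m \<oplus>\<^bsub>B\<^esub> \<iota> k \<odot>\<^bsub>B\<^esub> b" "w = v \<oplus>\<^bsub>D\<^esub> \<iota> k \<odot>\<^bsub>D\<^esub> y"
        unfolding X_def by blast
      note c = MD(1)[OF *(1)]
      have eq: "\<iota> (- k) = \<iota> (- 1) \<otimes>\<^bsub>R\<^esub> \<iota> k" using \<iota>(3)[of "- 1" k] by simp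
      have negk: "\<iota> (- k) \<odot>\<^bsub>B\<^esub> b = \<ominus>\<^bsub>B\<^esub> (\<iota> k \<odot>\<^bsub>B\<^esub> b)"
        using sc b \<iota>(1) by (simp add: eq B.smult_assoc neg)
      have negk': "\<iota> (- k) \<odot>\<^bsub>D\<^esub> y = \<ominus>\<^bsub>D\<^esub> (\<iota> k \<odot>\<^bsub>D\<^esub> y)"
        using sc y(1) \<iota>(1) by (simp add: eq D.smult_assoc neg')
      have "m = \<iota> (- k) \<odot>\<^bsub>B\<^esub> b"
        unfolding negk using *(2) c sc by (metis B.M.minus_equality)
      then have "v = \<iota> (- k) \<odot>\<^bsub>D\<^esub> y" using y(2) *(1) by blast
      then show "w = \<zero>\<^bsub>D\<^esub>" using negk' sc by (simp add: *(3) D.M.l_neg)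
    qed
    then have "X = M" using M(2) MX by blast
    moreover have "(b, y) \<in> X" using XI[OF M0, of 1] b y(1) by (simp add: \<iota>(4) B.smult_one D.smult_one)
    ultimately show ?thesis by blast
  qed
  define g where "g b = (SOME y. (b, y) \<in> M)" for b
  have g: "(b, g b) \<in> M" if "b \<in> carrier B" for b unfolding g_def by (rule someI_ex[OF total[OF that]])
  show ?thesis
  proof (rule that[of g])
    show "g x \<in> carrier D" if "x \<in> carrier B" for x using MD(1)[OF g[OF that]] by simp
    show "g (x \<oplus>\<^bsub>B\<^esub> y) = g x \<oplus>\<^bsub>D\<^esub> g y" if "x \<in> carrier B" "y \<in> carrier B" for x y
      using single[OF M(1) g MD(3)[OF g[OF that(1)] g[OF that(2)]]] that by simp
    show "g x = f x" if "x \<in> A" for x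
      using single[OF M(1) g MD(2)[OF that]] A(1) that by blast
  qed
qed

section \<open>Elements of the integral group ring and additive maps on it\<close>

abbreviation (input) integral_group_ring :: "'a monoid \<Rightarrow> ('a \<Rightarrow> int) ring" ("\<int>\<langle>_\<rangle>") where
  "\<int>\<langle>G\<rangle> \<equiv> group_ring \<Z> G"

definition basis_elt :: "'a \<Rightarrow> 'a \<Rightarrow> int" where
  "basis_elt g = (\<lambda>x. if x = g then 1 else 0)"

context
  fixes G :: "'a monoid" (structure)
  assumes G: "Group.group G"
begin

interpretation G: Group.group G by (rule G)


lemma ring_RG: "Ring.ring \<int>\<langle>G\<rangle>"
  by (rule ring_group_ring[OF int_is_cring G])

interpretation R: Ring.ring "\<int>\<langle>G\<rangle>" by (rule ring_RG)

lemma RG_carrier: "r \<in> carrier \<int>\<langle>G\<rangle> \<longleftrightarrow> finite {x. r x \<noteq> 0} \<and> (\<forall>x. x \<notin> carrier G \<longrightarrow> r x = 0)"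
  by (simp add: group_ring_def)

lemma RG_add: "r \<oplus>\<^bsub>\<int>\<langle>G\<rangle>\<^esub> s = (\<lambda>x. r x + s x)"
  and RG_zero: "\<zero>\<^bsub>\<int>\<langle>G\<rangle>\<^esub> = (\<lambda>_. 0)"
  and RG_one: "\<one>\<^bsub>\<int>\<langle>G\<rangle>\<^esub> = basis_elt \<one>"
  by (auto simp: group_ring_def basis_elt_def fun_eq_iff)

lemma scalar_closed: "(\<lambda>x. if x = \<one> then n else 0) \<in> carrier \<int>\<langle>G\<rangle>"
  by (auto simp: RG_carrier intro: finite_subset[of _ "{\<one>}"])

lemma basis_elt_closed: "g \<in> carrier G \<Longrightarrow> basis_elt g \<in> carrier \<int>\<langle>G\<rangle>"
  by (auto simp: RG_carrier basis_elt_def)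

lemma RG_minus:
  assumes "r \<in> carrier \<int>\<langle>G\<rangle>" "s \<in> carrier \<int>\<langle>G\<rangle>"
  shows "r \<ominus>\<^bsub>\<int>\<langle>G\<rangle>\<^esub> s = (\<lambda>x. r x - s x)"
proof -
  have s: "(\<lambda>x. - s x) \<in> carrier \<int>\<langle>G\<rangle>" using assms(2) by (simp add: RG_carrier)
  have "(\<lambda>x. - s x) \<oplus>\<^bsub>\<int>\<langle>G\<rangle>\<^esub> s = \<zero>\<^bsub>\<int>\<langle>G\<rangle>\<^esub>" by (simp add: RG_add RG_zero)
  then have "\<ominus>\<^bsub>\<int>\<langle>G\<rangle>\<^esub> s = (\<lambda>x. - s x)" using R.minus_equality assms(2) s by blast
  then show ?thesis by (simp add: R.minus_eq RG_add)
qed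

text \<open>Finitely supported functions are the elements of the free abelian group on G, so
  \<open>frag_induction\<close> carries over.\<close>

lemma group_ring_induct [consumes 1, case_names zero basis diff]:
  assumes r: "r \<in> carrier \<int>\<langle>G\<rangle>" and zero: "P \<zero>\<^bsub>\<int>\<langle>G\<rangle>\<^esub>" and basis: "\<And>g. g \<in> carrier G \<Longrightarrow> P (basis_elt g)"
    and diff: "\<And>r s. \<lbrakk>r \<in> carrier \<int>\<langle>G\<rangle>; s \<in> carrier \<int>\<langle>G\<rangle>; P r; P s\<rbrakk> \<Longrightarrow> P (r \<ominus>\<^bsub>\<int>\<langle>G\<rangle>\<^esub> s)"
  shows "P r"
proof -
  have lookup: "poly_mapping.lookup (Abs_poly_mapping r) = r"
    using r by (intro Abs_poly_mapping_inverse) (simp add: RG_carrier)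
  have keys: "Poly_Mapping.keys (Abs_poly_mapping r) \<subseteq> carrier G"
    using r by (auto simp: in_keys_iff lookup RG_carrier)
  have "poly_mapping.lookup c \<in> carrier \<int>\<langle>G\<rangle> \<and> P (poly_mapping.lookup c)" if "Poly_Mapping.keys c \<subseteq> carrier G" for c
    using that
  proof (induction c rule: frag_induction)
    case zero
    then show ?case using assms(2) R.zero_closed by (simp add: RG_zero zero_poly_mapping.rep_eq)
  next
    case (one g)
    have "poly_mapping.lookup (frag_of g) = basis_elt g" by (auto simp: basis_elt_def fun_eq_iff)
    then show ?case using basis[OF one] basis_elt_closed[OF one] by simp
  next
    case (diff a b)
    have "poly_mapping.lookup (a - b) = poly_mapping.lookup a \<ominus>\<^bsub>\<int>\<langle>G\<rangle>\<^esub> poly_mapping.lookup b"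
      using diff by (simp add: RG_minus lookup_minus fun_eq_iff)
    then show ?case using diff assms(4) by (simp add: R.minus_closed)
  qed
  from this[OF keys] show ?thesis by (simp add: lookup)
qed

lemma basis_elt_mult_left:
  assumes g: "g \<in> carrier G" and r: "r \<in> carrier \<int>\<langle>G\<rangle>"
  shows "basis_elt g \<otimes>\<^bsub>\<int>\<langle>G\<rangle>\<^esub> r = (\<lambda>x. if x \<in> carrier G then r (inv g \<otimes> x) else 0)"
proof
  fix x
  show "(basis_elt g \<otimes>\<^bsub>\<int>\<langle>G\<rangle>\<^esub> r) x = (if x \<in> carrier G then r (inv g \<otimes> x) else 0)"
  proof (cases "x \<in> carrier G")
    case True
    have "(basis_elt g \<otimes>\<^bsub>\<int>\<langle>G\<rangle>\<^esub> r) x = (\<Oplus>\<^bsub>\<Z>\<^esub>y\<in>{g}. basis_elt g y \<otimes>\<^bsub>\<Z>\<^esub> r (inv y \<otimes> x))"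
      using g True by (intro group_ring_mult_eq[OF int_is_cring G basis_elt_closed[OF g] r]) (auto simp: basis_elt_def)
    moreover have "(\<Oplus>\<^bsub>\<Z>\<^esub>y\<in>{g}. f y) = f g" for f :: "'a \<Rightarrow> int"
    proof -
      have Z: "abelian_monoid \<Z>"
        using int_is_cring by (simp add: cring_def ring_def abelian_group_def)
      show ?thesis using abelian_monoid.finsum_insert[OF Z, of "{}" g f] abelian_monoid.finsum_empty[OF Z] by simp
    qed
    ultimately have "(basis_elt g \<otimes>\<^bsub>\<int>\<langle>G\<rangle>\<^esub> r) x = basis_elt g g \<otimes>\<^bsub>\<Z>\<^esub> r (inv g \<otimes> x)" by (simp only:)
    then show ?thesis using True by (simp add: basis_elt_def)
  qed (simp add: group_ring_def)
qed

lemma basis_elt_mult: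
  assumes "g \<in> carrier G" "h \<in> carrier G"
  shows "basis_elt g \<otimes>\<^bsub>\<int>\<langle>G\<rangle>\<^esub> basis_elt h = basis_elt (g \<otimes> h)"
proof -
  have "inv g \<otimes> x = h \<longleftrightarrow> x = g \<otimes> h" if "x \<in> carrier G" for x
    using that assms by (metis G.inv_solve_left')
  then show ?thesis
    using assms unfolding basis_elt_mult_left[OF assms(1) basis_elt_closed[OF assms(2)]]
    by (auto simp: basis_elt_def fun_eq_iff)
qed

text \<open>The function with value n at the identity and 0 elsewhere is the integer n in the group
  ring. It multiplies all coefficients, so for n > 0 multiplication by it is injective, and on this
  the divisibility of injective modules rests.\<close>

lemma mult_scalar:
  assumes "r \<in> carrier \<int>\<langle>G\<rangle>"
  shows "r \<otimes>\<^bsub>\<int>\<langle>G\<rangle>\<^esub> (\<lambda>x. if x = \<one> then n else 0) = (\<lambda>x. n * r x)"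
  using assms
proof (induction r rule: group_ring_induct)
  case zero
  then show ?case using R.l_null[OF scalar_closed] by (simp add: RG_zero)
next
  case (basis g)
  have "inv g \<otimes> x = \<one> \<longleftrightarrow> x = g" if "x \<in> carrier G" for x
    using that basis by (metis G.inv_closed G.inv_equality G.inv_inv G.l_inv)
  then show ?case
    using basis unfolding basis_elt_mult_left[OF basis scalar_closed] by (auto simp: basis_elt_def fun_eq_iff)
next
  case (diff r s)
  let ?n = "\<lambda>x. if x = \<one> then n else 0"
  have "(r \<ominus>\<^bsub>\<int>\<langle>G\<rangle>\<^esub> s) \<otimes>\<^bsub>\<int>\<langle>G\<rangle>\<^esub> ?n = r \<otimes>\<^bsub>\<int>\<langle>G\<rangle>\<^esub> ?n \<ominus>\<^bsub>\<int>\<langle>G\<rangle>\<^esub> s \<otimes>\<^bsub>\<int>\<langle>G\<rangle>\<^esub> ?n"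
  proof -
    have "(a \<ominus>\<^bsub>\<int>\<langle>G\<rangle>\<^esub> b) \<otimes>\<^bsub>\<int>\<langle>G\<rangle>\<^esub> c = a \<otimes>\<^bsub>\<int>\<langle>G\<rangle>\<^esub> c \<ominus>\<^bsub>\<int>\<langle>G\<rangle>\<^esub> b \<otimes>\<^bsub>\<int>\<langle>G\<rangle>\<^esub> c"
      if "a \<in> carrier \<int>\<langle>G\<rangle>" "b \<in> carrier \<int>\<langle>G\<rangle>" "c \<in> carrier \<int>\<langle>G\<rangle>" for a b c
      using that by (simp add: R.minus_eq R.l_distr R.l_minus)
    then show ?thesis using diff(1,2) scalar_closed by blast
  qed
  moreover have "r \<otimes>\<^bsub>\<int>\<langle>G\<rangle>\<^esub> ?n \<ominus>\<^bsub>\<int>\<langle>G\<rangle>\<^esub> s \<otimes>\<^bsub>\<int>\<langle>G\<rangle>\<^esub> ?n = (\<lambda>x. (r \<otimes>\<^bsub>\<int>\<langle>G\<rangle>\<^esub> ?n) x - (s \<otimes>\<^bsub>\<int>\<langle>G\<rangle>\<^esub> ?n) x)"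
    using diff(1,2) scalar_closed[of n] by (intro RG_minus R.m_closed)
  ultimately show ?case using diff by (simp add: RG_minus algebra_simps)
qed

lemma scalar_embedding:
  shows "(\<lambda>x. if x = \<one> then k + l else 0) = (\<lambda>x. if x = \<one> then k else 0) \<oplus>\<^bsub>\<int>\<langle>G\<rangle>\<^esub> (\<lambda>x. if x = \<one> then l else 0)"
    and "(\<lambda>x. if x = \<one> then k * l else 0) = (\<lambda>x. if x = \<one> then k else 0) \<otimes>\<^bsub>\<int>\<langle>G\<rangle>\<^esub> (\<lambda>x. if x = \<one> then l else 0)"
  unfolding mult_scalar[OF scalar_closed] by (auto simp: RG_add fun_eq_iff)

lemma additive_eq_on_RG:
  assumes M: "abelian_group M"
    and f: "\<And>r. r \<in> carrier \<int>\<langle>G\<rangle> \<Longrightarrow> f r \<in> carrier M" "\<And>r s. \<lbrakk>r \<in> carrier \<int>\<langle>G\<rangle>; s \<in> carrier \<int>\<langle>G\<rangle>\<rbrakk> \<Longrightarrow> f (r \<oplus>\<^bsub>\<int>\<langle>G\<rangle>\<^esub> s) = f r \<oplus>\<^bsub>M\<^esub> f s"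
    and f': "\<And>r. r \<in> carrier \<int>\<langle>G\<rangle> \<Longrightarrow> f' r \<in> carrier M" "\<And>r s. \<lbrakk>r \<in> carrier \<int>\<langle>G\<rangle>; s \<in> carrier \<int>\<langle>G\<rangle>\<rbrakk> \<Longrightarrow> f' (r \<oplus>\<^bsub>\<int>\<langle>G\<rangle>\<^esub> s) = f' r \<oplus>\<^bsub>M\<^esub> f' s"
    and eq: "\<And>g. g \<in> carrier G \<Longrightarrow> f (basis_elt g) = f' (basis_elt g)" and r: "r \<in> carrier \<int>\<langle>G\<rangle>"
  shows "f r = f' r"
  using r
proof (induction r rule: group_ring_induct)
  case zero
  show ?case
    using additive_map_facts(1)[where f = f, OF R.abelian_group_axioms M f] additive_map_facts(1)[where f = f', OF R.abelian_group_axioms M f'] by simp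
next
  case (basis g) then show ?case by (rule eq)
next
  case (diff r s)
  then show ?case
    using additive_map_facts(3)[where f = f, OF R.abelian_group_axioms M f diff(1,2)] additive_map_facts(3)[where f = f', OF R.abelian_group_axioms M f' diff(1,2)] by simp
qed

text \<open>Reduces linearity over the group ring to additivity and equivariance, which is the form
  in which averaging produces maps.\<close>

lemma lmod_hom_equivariant:
  assumes M: "left_module \<int>\<langle>G\<rangle> M" and N: "left_module \<int>\<langle>G\<rangle> N"
    and cl: "\<And>x. x \<in> carrier M \<Longrightarrow> f x \<in> carrier N"
    and add: "\<And>x y. \<lbrakk>x \<in> carrier M; y \<in> carrier M\<rbrakk> \<Longrightarrow> f (x \<oplus>\<^bsub>M\<^esub> y) = f x \<oplus>\<^bsub>N\<^esub> f y"
    and eq: "\<And>g x. \<lbrakk>g \<in> carrier G; x \<in> carrier M\<rbrakk> \<Longrightarrow> f (basis_elt g \<odot>\<^bsub>M\<^esub> x) = basis_elt g \<odot>\<^bsub>N\<^esub> f x"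
  shows "f \<in> lmod_hom \<int>\<langle>G\<rangle> M N"
proof (rule lmod_homI[OF cl add])
  interpret M: left_module "\<int>\<langle>G\<rangle>" M by (rule M)
  interpret N: left_module "\<int>\<langle>G\<rangle>" N by (rule N)
  fix r x assume r: "r \<in> carrier \<int>\<langle>G\<rangle>" and x: "x \<in> carrier M"
  show "f (r \<odot>\<^bsub>M\<^esub> x) = r \<odot>\<^bsub>N\<^esub> f x"
  proof (rule additive_eq_on_RG[where f = "\<lambda>r. f (r \<odot>\<^bsub>M\<^esub> x)" and f' = "\<lambda>r. r \<odot>\<^bsub>N\<^esub> f x" and M = N, OF N.M.abelian_group_axioms _ _ _ _ _ r])
    fix r s assume "r \<in> carrier \<int>\<langle>G\<rangle>" "s \<in> carrier \<int>\<langle>G\<rangle>"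
    then show "f ((r \<oplus>\<^bsub>\<int>\<langle>G\<rangle>\<^esub> s) \<odot>\<^bsub>M\<^esub> x) = f (r \<odot>\<^bsub>M\<^esub> x) \<oplus>\<^bsub>N\<^esub> f (s \<odot>\<^bsub>M\<^esub> x)"
      "(r \<oplus>\<^bsub>\<int>\<langle>G\<rangle>\<^esub> s) \<odot>\<^bsub>N\<^esub> f x = r \<odot>\<^bsub>N\<^esub> f x \<oplus>\<^bsub>N\<^esub> s \<odot>\<^bsub>N\<^esub> f x"
      using x by (simp_all add: cl add M.smult_closed M.smult_l_distr N.smult_l_distr)
  qed (use x in \<open>simp_all add: cl eq M.smult_closed N.smult_closed\<close>)
qed

lemma additive_extension_RG:
  assumes M: "abelian_group M" and t: "\<And>g. g \<in> carrier G \<Longrightarrow> t g \<in> carrier M"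
  obtains F where "\<And>r. r \<in> carrier \<int>\<langle>G\<rangle> \<Longrightarrow> F r \<in> carrier M"
    "\<And>r s. \<lbrakk>r \<in> carrier \<int>\<langle>G\<rangle>; s \<in> carrier \<int>\<langle>G\<rangle>\<rbrakk> \<Longrightarrow> F (r \<oplus>\<^bsub>\<int>\<langle>G\<rangle>\<^esub> s) = F r \<oplus>\<^bsub>M\<^esub> F s"
    "\<And>g. g \<in> carrier G \<Longrightarrow> F (basis_elt g) = t g"
proof -
  interpret M: abelian_group M by (rule M)
  obtain h where h: "h \<in> hom (free_Abelian_group (carrier G)) (add_monoid M)" "\<And>g. g \<in> carrier G \<Longrightarrow> h (frag_of g) = t g"
    by (rule comm_group.free_Abelian_group_universal[OF M.a_comm_group, of t "carrier G"]) (use t in auto)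
  have lookup: "poly_mapping.lookup (Abs_poly_mapping r) = r" if "r \<in> carrier \<int>\<langle>G\<rangle>" for r
    using that by (intro Abs_poly_mapping_inverse) (simp add: RG_carrier)
  have keys: "Poly_Mapping.keys (Abs_poly_mapping r) \<subseteq> carrier G" if "r \<in> carrier \<int>\<langle>G\<rangle>" for r
    using that by (auto simp: in_keys_iff lookup RG_carrier)
  show ?thesis
  proof (rule that[of "\<lambda>r. h (Abs_poly_mapping r)"])
    show "h (Abs_poly_mapping r) \<in> carrier M" if "r \<in> carrier \<int>\<langle>G\<rangle>" for r
      using h(1) keys[OF that] by (auto simp: hom_def)
    show "h (Abs_poly_mapping (r \<oplus>\<^bsub>\<int>\<langle>G\<rangle>\<^esub> s)) = h (Abs_poly_mapping r) \<oplus>\<^bsub>M\<^esub> h (Abs_poly_mapping s)"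
      if "r \<in> carrier \<int>\<langle>G\<rangle>" "s \<in> carrier \<int>\<langle>G\<rangle>" for r s
    proof -
      have "Abs_poly_mapping (r \<oplus>\<^bsub>\<int>\<langle>G\<rangle>\<^esub> s) = Abs_poly_mapping r + Abs_poly_mapping s"
        using lookup[OF that(1)] lookup[OF that(2)] lookup[OF R.a_closed[OF that]]
        by (intro poly_mapping_eqI) (simp add: lookup_add RG_add)
      then show ?thesis using h(1) keys[OF that(1)] keys[OF that(2)] by (auto simp: hom_def)
    qed
    show "h (Abs_poly_mapping (basis_elt g)) = t g" if "g \<in> carrier G" for g
    proof -
      have "Abs_poly_mapping (basis_elt g) = frag_of g"
        by (intro poly_mapping_eqI) (simp add: lookup[OF basis_elt_closed[OF that]], simp add: basis_elt_def)
      then show ?thesis using h(2)[OF that] by simp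
    qed
  qed
qed

end

text \<open>Relative injectivity with respect to sequences that split over the integers, in the form of a
  retraction from the functions on the group onto the constants.\<close>

definition averaging :: "'a monoid \<Rightarrow> ('a \<Rightarrow> int, 'm) Module.module \<Rightarrow> (('a \<Rightarrow> 'm) \<Rightarrow> 'm) \<Rightarrow> bool" where
  "averaging G M \<rho> \<longleftrightarrow>
     (\<forall>u. (\<forall>g\<in>carrier G. u g \<in> carrier M) \<longrightarrow> \<rho> u \<in> carrier M) \<and>
     (\<forall>u v. (\<forall>g\<in>carrier G. u g = v g) \<longrightarrow> \<rho> u = \<rho> v) \<and>
     (\<forall>u v. (\<forall>g\<in>carrier G. u g \<in> carrier M) \<and> (\<forall>g\<in>carrier G. v g \<in> carrier M) \<longrightarrow>
        \<rho> (\<lambda>g. u g \<oplus>\<^bsub>M\<^esub> v g) = \<rho> u \<oplus>\<^bsub>M\<^esub> \<rho> v) \<and>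
     (\<forall>h\<in>carrier G. \<forall>u. (\<forall>g\<in>carrier G. u g \<in> carrier M) \<longrightarrow>
        \<rho> (\<lambda>g. basis_elt h \<odot>\<^bsub>M\<^esub> u (inv\<^bsub>G\<^esub> h \<otimes>\<^bsub>G\<^esub> g)) = basis_elt h \<odot>\<^bsub>M\<^esub> \<rho> u) \<and>
     (\<forall>x\<in>carrier M. \<rho> (\<lambda>_. x) = x)"

lemma averagingD:
  assumes "averaging G M \<rho>"
  shows "(\<And>g. g \<in> carrier G \<Longrightarrow> u g \<in> carrier M) \<Longrightarrow> \<rho> u \<in> carrier M"
    and "(\<And>g. g \<in> carrier G \<Longrightarrow> u g = v g) \<Longrightarrow> \<rho> u = \<rho> v"
    and "\<lbrakk>\<And>g. g \<in> carrier G \<Longrightarrow> u g \<in> carrier M; \<And>g. g \<in> carrier G \<Longrightarrow> v g \<in> carrier M\<rbrakk> \<Longrightarrow>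
      \<rho> (\<lambda>g. u g \<oplus>\<^bsub>M\<^esub> v g) = \<rho> u \<oplus>\<^bsub>M\<^esub> \<rho> v"
    and "\<lbrakk>h \<in> carrier G; \<And>g. g \<in> carrier G \<Longrightarrow> u g \<in> carrier M\<rbrakk> \<Longrightarrow>
      \<rho> (\<lambda>g. basis_elt h \<odot>\<^bsub>M\<^esub> u (inv\<^bsub>G\<^esub> h \<otimes>\<^bsub>G\<^esub> g)) = basis_elt h \<odot>\<^bsub>M\<^esub> \<rho> u"
    and "x \<in> carrier M \<Longrightarrow> \<rho> (\<lambda>_. x) = x"
  using assms unfolding averaging_def by blast+

definition divisible_module :: "'a monoid \<Rightarrow> ('a \<Rightarrow> int, 'm) Module.module \<Rightarrow> bool" where
  "divisible_module G M \<longleftrightarrow>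
     (\<forall>n>0. \<forall>x\<in>carrier M. \<exists>y\<in>carrier M. (\<lambda>g. if g = \<one>\<^bsub>G\<^esub> then n else 0) \<odot>\<^bsub>M\<^esub> y = x)"

context
  fixes G :: "'a monoid" (structure)
  assumes G: "Group.group G"
begin

interpretation G: Group.group G by (rule G)

lemma basis_elt_act:
  assumes M: "left_module \<int>\<langle>G\<rangle> M" and x: "x \<in> carrier M"
  shows "g \<in> carrier G \<Longrightarrow> basis_elt g \<odot>\<^bsub>M\<^esub> x \<in> carrier M"
    and "basis_elt \<one> \<odot>\<^bsub>M\<^esub> x = x"
    and "\<lbrakk>g \<in> carrier G; h \<in> carrier G\<rbrakk> \<Longrightarrow> basis_elt (g \<otimes> h) \<odot>\<^bsub>M\<^esub> x = basis_elt g \<odot>\<^bsub>M\<^esub> (basis_elt h \<odot>\<^bsub>M\<^esub> x)"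
    and "\<lbrakk>g \<in> carrier G; y \<in> carrier M\<rbrakk> \<Longrightarrow>
      basis_elt g \<odot>\<^bsub>M\<^esub> (x \<oplus>\<^bsub>M\<^esub> y) = basis_elt g \<odot>\<^bsub>M\<^esub> x \<oplus>\<^bsub>M\<^esub> basis_elt g \<odot>\<^bsub>M\<^esub> y"
proof -
  interpret M: left_module "\<int>\<langle>G\<rangle>" M by (rule M)
  show "g \<in> carrier G \<Longrightarrow> basis_elt g \<odot>\<^bsub>M\<^esub> x \<in> carrier M"
    using x basis_elt_closed[OF G] by (simp add: M.smult_closed)
  show "basis_elt \<one> \<odot>\<^bsub>M\<^esub> x = x" using M.smult_one[OF x] by (simp add: RG_one[OF G])
  show "basis_elt (g \<otimes> h) \<odot>\<^bsub>M\<^esub> x = basis_elt g \<odot>\<^bsub>M\<^esub> (basis_elt h \<odot>\<^bsub>M\<^esub> x)" if "g \<in> carrier G" "h \<in> carrier G"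
    using M.smult_assoc[OF basis_elt_closed[OF G that(1)] basis_elt_closed[OF G that(2)] x] basis_elt_mult[OF G that] by simp
  show "basis_elt g \<odot>\<^bsub>M\<^esub> (x \<oplus>\<^bsub>M\<^esub> y) = basis_elt g \<odot>\<^bsub>M\<^esub> x \<oplus>\<^bsub>M\<^esub> basis_elt g \<odot>\<^bsub>M\<^esub> y" if "g \<in> carrier G" "y \<in> carrier M"
    using M.smult_r_distr[OF basis_elt_closed[OF G that(1)] x that(2)] .
qed

end

section \<open>Injective modules: divisibility, averaging and restriction to subgroups\<close>

context
  fixes G :: "'a monoid" (structure)
  assumes G: "Group.group G"
begin

interpretation G: Group.group G by (rule G)


interpretation R: Ring.ring "\<int>\<langle>G\<rangle>" by (rule ring_RG[OF G])

lemma left_module_subgroup: "\<lbrakk>left_module \<int>\<langle>G\<rangle> M; subgroup H G\<rbrakk> \<Longrightarrow> left_module (\<int>\<langle>G\<lparr>carrier := H\<rparr>\<rangle>) M"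
  by (rule left_module_restrict[OF int_is_cring G])

lemma carrier_RS: "subgroup H G \<Longrightarrow> carrier (\<int>\<langle>G\<lparr>carrier := H\<rparr>\<rangle>) \<subseteq> carrier \<int>\<langle>G\<rangle>"
  using subgroup.subset[of H G] by (auto simp: group_ring_def subset_iff)

lemma restriction_subgroup:
  assumes H: "subgroup H G"
  shows "restriction \<int>\<langle>G\<rangle> (\<int>\<langle>G\<lparr>carrier := H\<rparr>\<rangle>)"
proof (rule restriction.intro)
  show "Ring.ring \<int>\<langle>G\<rangle>" by (rule ring_RG[OF G])
  show "Ring.ring (\<int>\<langle>G\<lparr>carrier := H\<rparr>\<rangle>)" by (rule ring_RG[OF G.subgroup_imp_group[OF H]])
  show "carrier (\<int>\<langle>G\<lparr>carrier := H\<rparr>\<rangle>) \<subseteq> carrier \<int>\<langle>G\<rangle>" by (rule carrier_RS[OF H])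
  show "left_module (\<int>\<langle>G\<lparr>carrier := H\<rparr>\<rangle>) (regular_module \<int>\<langle>G\<rangle>)"
    by (rule left_module_subgroup[OF left_module_regular[OF ring_RG[OF G]] H])
qed

text \<open>Multiplication by n on the group ring is injective, so the map r |-> r x extends along
  it; the value y of the extension at 1 satisfies n y = x. The two sides from which n can multiply
  agree at 1.\<close>

lemma injective_divisible:
  fixes I :: "('a \<Rightarrow> int, 'u) lmod"
  assumes I: "injective_module \<int>\<langle>G\<rangle> I"
  shows "divisible_module G I"
  unfolding divisible_module_def
proof (intro allI impI ballI)
  fix n :: int and x assume n: "n > 0" and x: "x \<in> carrier I"
  interpret I: left_module "\<int>\<langle>G\<rangle>" I by (rule injective_module_left_module[OF I])
  let ?n = "\<lambda>g. if g = \<one> then n else 0" and ?M = "regular_module \<int>\<langle>G\<rangle>"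
  have nc: "?n \<in> carrier \<int>\<langle>G\<rangle>" by (rule scalar_closed[OF G])
  have M: "left_module \<int>\<langle>G\<rangle> ?M" by (rule left_module_regular[OF ring_RG[OF G]])
  let ?e = "\<lambda>r. {Inl r} :: ('a \<Rightarrow> int, 'u) universe"
  have i: "(\<lambda>r. r \<otimes>\<^bsub>\<int>\<langle>G\<rangle>\<^esub> ?n) \<in> lmod_hom \<int>\<langle>G\<rangle> ?M ?M"
    using nc by (intro lmod_homI) (simp_all add: regular_module_def R.l_distr R.m_assoc)
  have inj: "inj_on (\<lambda>r. r \<otimes>\<^bsub>\<int>\<langle>G\<rangle>\<^esub> ?n) (carrier ?M)"
    using n by (auto simp: inj_on_def regular_module_def mult_scalar[OF G] fun_eq_iff)
  have f: "(\<lambda>r. r \<odot>\<^bsub>I\<^esub> x) \<in> lmod_hom \<int>\<langle>G\<rangle> ?M I"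
    using x by (intro lmod_homI) (simp_all add: regular_module_def I.smult_closed I.smult_l_distr I.smult_assoc)
  have e: "inj_on ?e (carrier ?M)" by (auto simp: inj_on_def)
  obtain g where g: "g \<in> lmod_hom \<int>\<langle>G\<rangle> ?M I" "\<And>r. r \<in> carrier ?M \<Longrightarrow> g (r \<otimes>\<^bsub>\<int>\<langle>G\<rangle>\<^esub> ?n) = r \<odot>\<^bsub>I\<^esub> x"
    using injective_extend[OF I M M i inj f e e] by metis
  have one: "\<one>\<^bsub>\<int>\<langle>G\<rangle>\<^esub> \<in> carrier ?M" by (simp add: regular_module_def)
  have "?n \<odot>\<^bsub>I\<^esub> g \<one>\<^bsub>\<int>\<langle>G\<rangle>\<^esub> = g (?n \<otimes>\<^bsub>\<int>\<langle>G\<rangle>\<^esub> \<one>\<^bsub>\<int>\<langle>G\<rangle>\<^esub>)"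
    using lmod_homD(3)[OF g(1) nc one] by (simp add: regular_module_def)
  also have "?n \<otimes>\<^bsub>\<int>\<langle>G\<rangle>\<^esub> \<one>\<^bsub>\<int>\<langle>G\<rangle>\<^esub> = \<one>\<^bsub>\<int>\<langle>G\<rangle>\<^esub> \<otimes>\<^bsub>\<int>\<langle>G\<rangle>\<^esub> ?n" using nc by simp
  also have "g \<dots> = x" using g(2)[OF one] I.smult_one[OF x] by simp
  finally have "?n \<odot>\<^bsub>I\<^esub> g \<one>\<^bsub>\<int>\<langle>G\<rangle>\<^esub> = x" .
  then show "\<exists>y\<in>carrier I. ?n \<odot>\<^bsub>I\<^esub> y = x" using lmod_homD(1)[OF g(1) one] by blast
qed

lemma trivial_subgroup: "subgroup {\<one>} G"
  by (rule G.triv_subgroup)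

text \<open>An injective module is a retract of the module coinduced from the trivial subgroup, into
  which it embeds by x |-> (r |-> r x). A change of variables identifies the elements of that module
  with functions on G, and \<rho> is the retraction.\<close>

lemma injective_averaging:
  fixes I :: "('a \<Rightarrow> int, 'u) lmod"
  assumes I: "injective_module \<int>\<langle>G\<rangle> I"
  obtains \<rho> where "averaging G I \<rho>"
proof -
  have IR: "left_module \<int>\<langle>G\<rangle> I" by (rule injective_module_left_module[OF I])
  interpret I: left_module "\<int>\<langle>G\<rangle>" I by (rule IR)
  let ?T = "G\<lparr>carrier := {\<one>}\<rparr>"
  have T: "Group.group ?T" by (rule G.subgroup_imp_group[OF trivial_subgroup])
  have IS: "left_module (\<int>\<langle>G\<lparr>carrier := {\<one>}\<rparr>\<rangle>) I" by (rule left_module_subgroup[OF IR trivial_subgroup])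
  interpret RS: restriction "\<int>\<langle>G\<rangle>" "\<int>\<langle>G\<lparr>carrier := {\<one>}\<rparr>\<rangle>" by (rule restriction_subgroup[OF trivial_subgroup])
  let ?C = "coinduced \<int>\<langle>G\<rangle> (\<int>\<langle>G\<lparr>carrier := {\<one>}\<rparr>\<rangle>) I"
  have C: "left_module \<int>\<langle>G\<rangle> ?C" by (rule RS.left_module_coinduced[OF IS])
  interpret C: left_module "\<int>\<langle>G\<rangle>" ?C by (rule C)
  define j where "j x = (\<lambda>r. if r \<in> carrier \<int>\<langle>G\<rangle> then r \<odot>\<^bsub>I\<^esub> x else \<zero>\<^bsub>I\<^esub>)" for x
  have j: "j \<in> lmod_hom \<int>\<langle>G\<rangle> I ?C"
    unfolding j_def[abs_def] using RS.coinduced_adjoint[OF IR IS lmod_hom_id IS] .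
  have jinj: "inj_on j (carrier I)"
  proof (rule inj_onI)
    fix x y assume xy: "x \<in> carrier I" "y \<in> carrier I" "j x = j y"
    then have "j x \<one>\<^bsub>\<int>\<langle>G\<rangle>\<^esub> = j y \<one>\<^bsub>\<int>\<langle>G\<rangle>\<^esub>" by simp
    then show "x = y" using xy by (simp add: j_def I.smult_one)
  qed
  have "inj (Inl :: ('a \<Rightarrow> int) \<Rightarrow> ('a \<Rightarrow> int) + nat + 'u)" by simp
  then obtain e :: "(('a \<Rightarrow> int) \<Rightarrow> ('a \<Rightarrow> int, 'u) universe) \<Rightarrow> ('a \<Rightarrow> int, 'u) universe" where e: "inj e"
    by (rule inj_function_universe)
  obtain \<pi> where \<pi>: "\<pi> \<in> lmod_hom \<int>\<langle>G\<rangle> ?C I" "\<And>x. x \<in> carrier I \<Longrightarrow> \<pi> (j x) = x"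
    using injective_extend[OF I IR C j jinj lmod_hom_id inj_on_id2 inj_on_subset[OF e subset_UNIV]] by metis
  \<comment> \<open>The function u corresponds to the additive map F with F(g) = g u(g^-1). Under
    this the action on the coinduced module becomes (h u)(g) = h u(h^-1 g), and constant functions
    become the embedded copy of the module.\<close>
  define F where "F u = (SOME F. F \<in> carrier ?C \<and> (\<forall>g\<in>carrier G. F (basis_elt g) = basis_elt g \<odot>\<^bsub>I\<^esub> u (inv g)))" for u
  have F: "F u \<in> carrier ?C" "\<And>g. g \<in> carrier G \<Longrightarrow> F u (basis_elt g) = basis_elt g \<odot>\<^bsub>I\<^esub> u (inv g)"
    if u: "\<And>g. g \<in> carrier G \<Longrightarrow> u g \<in> carrier I" for u
  proof -
    obtain F0 where F0: "\<And>r. r \<in> carrier \<int>\<langle>G\<rangle> \<Longrightarrow> F0 r \<in> carrier I"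
      "\<And>r s. \<lbrakk>r \<in> carrier \<int>\<langle>G\<rangle>; s \<in> carrier \<int>\<langle>G\<rangle>\<rbrakk> \<Longrightarrow> F0 (r \<oplus>\<^bsub>\<int>\<langle>G\<rangle>\<^esub> s) = F0 r \<oplus>\<^bsub>I\<^esub> F0 s"
      "\<And>g. g \<in> carrier G \<Longrightarrow> F0 (basis_elt g) = basis_elt g \<odot>\<^bsub>I\<^esub> u (inv g)"
      by (rule additive_extension_RG[OF G I.M.abelian_group_axioms, of "\<lambda>g. basis_elt g \<odot>\<^bsub>I\<^esub> u (inv g)"])
         (use u basis_elt_act(1)[OF G IR] in auto)
    define F1 where "F1 r = (if r \<in> carrier \<int>\<langle>G\<rangle> then F0 r else \<zero>\<^bsub>I\<^esub>)" for r
    have "F1 \<in> lmod_hom (\<int>\<langle>G\<lparr>carrier := {\<one>}\<rparr>\<rangle>) (regular_module \<int>\<langle>G\<rangle>) I"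
    proof (rule lmod_hom_equivariant[OF T RS.regular_restrict IS])
      fix g x assume "g \<in> carrier ?T" and x: "x \<in> carrier (regular_module \<int>\<langle>G\<rangle>)"
      then have g: "g = \<one>" by simp
      have x': "x \<in> carrier \<int>\<langle>G\<rangle>" using x by (simp add: regular_module_def)
      show "F1 (basis_elt g \<odot>\<^bsub>regular_module \<int>\<langle>G\<rangle>\<^esub> x) = basis_elt g \<odot>\<^bsub>I\<^esub> F1 x"
        using x' F0(1)[OF x'] I.smult_one[of "F0 x"] by (simp add: g regular_module_def RG_one[OF G, symmetric] F1_def)
    qed (use F0 in \<open>auto simp: regular_module_def F1_def\<close>)
    then have "F1 \<in> carrier ?C" by (simp add: coinduced_def F1_def)
    moreover have "\<forall>g\<in>carrier G. F1 (basis_elt g) = basis_elt g \<odot>\<^bsub>I\<^esub> u (inv g)"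
      using F0(3) basis_elt_closed[OF G] by (simp add: F1_def)
    ultimately have "\<exists>F. F \<in> carrier ?C \<and> (\<forall>g\<in>carrier G. F (basis_elt g) = basis_elt g \<odot>\<^bsub>I\<^esub> u (inv g))" by blast
    from someI_ex[OF this] show "F u \<in> carrier ?C" "\<And>g. g \<in> carrier G \<Longrightarrow> F u (basis_elt g) = basis_elt g \<odot>\<^bsub>I\<^esub> u (inv g)"
      unfolding F_def by blast+
  qed
  have Ceq: "F1 = F2" if F12: "F1 \<in> carrier ?C" "F2 \<in> carrier ?C" "\<And>g. g \<in> carrier G \<Longrightarrow> F1 (basis_elt g) = F2 (basis_elt g)" for F1 F2
  proof
    fix r
    show "F1 r = F2 r"
    proof (cases "r \<in> carrier \<int>\<langle>G\<rangle>")
      case True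
      show ?thesis
        by (rule additive_eq_on_RG[where f = F1 and f' = F2 and M = I, OF G I.M.abelian_group_axioms
              RS.coinduced_carrier(1)[OF F12(1)] RS.coinduced_carrier(2)[OF F12(1)]
              RS.coinduced_carrier(1)[OF F12(2)] RS.coinduced_carrier(2)[OF F12(2)] F12(3) True])
    next
      case False
      then show ?thesis using RS.coinduced_carrier(4)[OF F12(1)] RS.coinduced_carrier(4)[OF F12(2)] by simp
    qed
  qed
  have Cadd: "(F1 \<oplus>\<^bsub>?C\<^esub> F2) r = F1 r \<oplus>\<^bsub>I\<^esub> F2 r" for F1 F2 r by (simp add: coinduced_def)
  define \<rho> where "\<rho> u = \<pi> (F u)" for u
  have "averaging G I \<rho>"
    unfolding averaging_def
  proof (intro conjI allI impI ballI)
    fix u assume u: "\<forall>g\<in>carrier G. u g \<in> carrier I"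
    show "\<rho> u \<in> carrier I" unfolding \<rho>_def using lmod_homD(1)[OF \<pi>(1) F(1)] u by blast
  next
    fix u v :: "'a \<Rightarrow> ('a \<Rightarrow> int, 'u) universe" assume "\<forall>g\<in>carrier G. u g = v g"
    then have "F u = F v" unfolding F_def by simp
    then show "\<rho> u = \<rho> v" by (simp add: \<rho>_def)
  next
    fix u v assume "(\<forall>g\<in>carrier G. u g \<in> carrier I) \<and> (\<forall>g\<in>carrier G. v g \<in> carrier I)"
    then have u: "\<And>g. g \<in> carrier G \<Longrightarrow> u g \<in> carrier I" and v: "\<And>g. g \<in> carrier G \<Longrightarrow> v g \<in> carrier I"
      by auto
    have uv: "u g \<oplus>\<^bsub>I\<^esub> v g \<in> carrier I" if "g \<in> carrier G" for g using u v that by simp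
    have "F (\<lambda>g. u g \<oplus>\<^bsub>I\<^esub> v g) = F u \<oplus>\<^bsub>?C\<^esub> F v"
    proof (rule Ceq)
      show "F (\<lambda>g. u g \<oplus>\<^bsub>I\<^esub> v g) \<in> carrier ?C" by (rule F(1)[OF uv])
      show "F u \<oplus>\<^bsub>?C\<^esub> F v \<in> carrier ?C" by (rule C.M.a_closed[OF F(1)[OF u] F(1)[OF v]])
      fix g assume g: "g \<in> carrier G"
      have ug: "u (inv g) \<in> carrier I" and vg: "v (inv g) \<in> carrier I" using u v g by auto
      show "F (\<lambda>g. u g \<oplus>\<^bsub>I\<^esub> v g) (basis_elt g) = (F u \<oplus>\<^bsub>?C\<^esub> F v) (basis_elt g)"
      proof -
        have "F (\<lambda>g. u g \<oplus>\<^bsub>I\<^esub> v g) (basis_elt g) = basis_elt g \<odot>\<^bsub>I\<^esub> (u (inv g) \<oplus>\<^bsub>I\<^esub> v (inv g))"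
          by (rule F(2)[OF uv g])
        also have "\<dots> = basis_elt g \<odot>\<^bsub>I\<^esub> u (inv g) \<oplus>\<^bsub>I\<^esub> basis_elt g \<odot>\<^bsub>I\<^esub> v (inv g)"
          by (rule basis_elt_act(4)[OF G IR ug g vg])
        also have "basis_elt g \<odot>\<^bsub>I\<^esub> u (inv g) = F u (basis_elt g)" by (rule F(2)[OF u g, symmetric])
        also have "basis_elt g \<odot>\<^bsub>I\<^esub> v (inv g) = F v (basis_elt g)" by (rule F(2)[OF v g, symmetric])
        finally show ?thesis unfolding Cadd .
      qed
    qed
    then show "\<rho> (\<lambda>g. u g \<oplus>\<^bsub>I\<^esub> v g) = \<rho> u \<oplus>\<^bsub>I\<^esub> \<rho> v"
      unfolding \<rho>_def using lmod_homD(2)[OF \<pi>(1) F(1)[OF u] F(1)[OF v]] by simp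
  next
    fix h u assume h: "h \<in> carrier G" and "\<forall>g\<in>carrier G. u g \<in> carrier I"
    then have u: "\<And>g. g \<in> carrier G \<Longrightarrow> u g \<in> carrier I" by auto
    let ?u = "\<lambda>g. basis_elt h \<odot>\<^bsub>I\<^esub> u (inv h \<otimes> g)"
    have hu: "?u g \<in> carrier I" if "g \<in> carrier G" for g using basis_elt_act(1)[OF G IR u h] h that by simp
    have hc: "basis_elt h \<in> carrier \<int>\<langle>G\<rangle>" by (rule basis_elt_closed[OF G h])
    have "F ?u = basis_elt h \<odot>\<^bsub>?C\<^esub> F u"
    proof (rule Ceq)
      show "F ?u \<in> carrier ?C" by (rule F(1)[OF hu])
      show "basis_elt h \<odot>\<^bsub>?C\<^esub> F u \<in> carrier ?C" by (rule C.smult_closed[OF hc F(1)[OF u]])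
      fix g assume g: "g \<in> carrier G"
      have "(basis_elt h \<odot>\<^bsub>?C\<^esub> F u) (basis_elt g) = F u (basis_elt (g \<otimes> h))"
        using basis_elt_closed[OF G g] basis_elt_mult[OF G g h] by (simp add: coinduced_def)
      also have "\<dots> = basis_elt (g \<otimes> h) \<odot>\<^bsub>I\<^esub> u (inv (g \<otimes> h))" using F(2)[OF u] g h by simp
      also have "\<dots> = basis_elt g \<odot>\<^bsub>I\<^esub> (basis_elt h \<odot>\<^bsub>I\<^esub> u (inv h \<otimes> inv g))"
        using basis_elt_act(3)[OF G IR u[of "inv (g \<otimes> h)"] g h] g h by (simp add: G.inv_mult_group)
      also have "\<dots> = F ?u (basis_elt g)" using F(2)[of ?u, OF hu g] by simp
      finally show "F ?u (basis_elt g) = (basis_elt h \<odot>\<^bsub>?C\<^esub> F u) (basis_elt g)" by simp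
    qed
    then show "\<rho> ?u = basis_elt h \<odot>\<^bsub>I\<^esub> \<rho> u"
      unfolding \<rho>_def using lmod_homD(3)[OF \<pi>(1) hc F(1)[OF u]] by simp
  next
    fix x assume x: "x \<in> carrier I"
    have "F (\<lambda>_. x) = j x"
    proof (rule Ceq)
      show "F (\<lambda>_. x) \<in> carrier ?C" using F(1)[of "\<lambda>_. x"] x by simp
      show "j x \<in> carrier ?C" by (rule lmod_homD(1)[OF j x])
      show "F (\<lambda>_. x) (basis_elt g) = j x (basis_elt g)" if "g \<in> carrier G" for g
        using F(2)[of "\<lambda>_. x" g] x that basis_elt_closed[OF G that] by (simp add: j_def)
    qed
    then show "\<rho> (\<lambda>_. x) = x" unfolding \<rho>_def using \<pi>(2)[OF x] by simp
  qed
  then show ?thesis by (rule that)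
qed

text \<open>Extend additively by divisibility, then average the translates over the group.\<close>

lemma injective_subgroup_if_averaging:
  fixes I :: "('a \<Rightarrow> int, 'u) lmod"
  assumes I: "left_module \<int>\<langle>G\<rangle> I" and \<rho>: "averaging G I \<rho>" and div: "divisible_module G I" and H: "subgroup H G"
  shows "injective_module (\<int>\<langle>G\<lparr>carrier := H\<rparr>\<rangle>) I"
  unfolding injective_module_def
proof (intro conjI allI impI)
  let ?H = "G\<lparr>carrier := H\<rparr>"
  interpret H: subgroup H G by (rule H)
  have gH: "Group.group ?H" by (rule G.subgroup_imp_group[OF H])
  show IS: "left_module (\<int>\<langle>G\<lparr>carrier := H\<rparr>\<rangle>) I" by (rule left_module_subgroup[OF I H])
  fix A B :: "('a \<Rightarrow> int, 'u) lmod" and i f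
  assume "left_module (\<int>\<langle>G\<lparr>carrier := H\<rparr>\<rangle>) A \<and> left_module (\<int>\<langle>G\<lparr>carrier := H\<rparr>\<rangle>) B \<and> i \<in> lmod_hom (\<int>\<langle>G\<lparr>carrier := H\<rparr>\<rangle>) A B \<and> inj_on i (carrier A) \<and>
    f \<in> lmod_hom (\<int>\<langle>G\<lparr>carrier := H\<rparr>\<rangle>) A I"
  then have A: "left_module (\<int>\<langle>G\<lparr>carrier := H\<rparr>\<rangle>) A" and B: "left_module (\<int>\<langle>G\<lparr>carrier := H\<rparr>\<rangle>) B" and i: "i \<in> lmod_hom (\<int>\<langle>G\<lparr>carrier := H\<rparr>\<rangle>) A B" "inj_on i (carrier A)"
    and f: "f \<in> lmod_hom (\<int>\<langle>G\<lparr>carrier := H\<rparr>\<rangle>) A I" by auto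
  interpret A: left_module "\<int>\<langle>G\<lparr>carrier := H\<rparr>\<rangle>" A by (rule A)
  interpret B: left_module "\<int>\<langle>G\<lparr>carrier := H\<rparr>\<rangle>" B by (rule B)
  interpret I: left_module "\<int>\<langle>G\<rangle>" I by (rule I)
  interpret IS: left_module "\<int>\<langle>G\<lparr>carrier := H\<rparr>\<rangle>" I by (rule IS)
  let ?\<iota> = "\<lambda>n g. if g = \<one>\<^bsub>?H\<^esub> then n else (0::int)"
  have \<iota>c: "?\<iota> n \<in> carrier (\<int>\<langle>G\<lparr>carrier := H\<rparr>\<rangle>)" for n by (rule scalar_closed[OF gH])
  define f0 where "f0 b = f (inv_into (carrier A) i b)" for b
  have f0: "f0 (i a) = f a" if "a \<in> carrier A" for a unfolding f0_def using inv_into_f_f[OF i(2) that] by simp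
  obtain f' where f': "\<And>x. x \<in> carrier B \<Longrightarrow> f' x \<in> carrier I"
    "\<And>x y. x \<in> carrier B \<Longrightarrow> y \<in> carrier B \<Longrightarrow> f' (x \<oplus>\<^bsub>B\<^esub> y) = f' x \<oplus>\<^bsub>I\<^esub> f' y"
    "\<And>x. x \<in> i ` carrier A \<Longrightarrow> f' x = f0 x"
  proof (rule divisible_extension[OF B IS, of ?\<iota> "i ` carrier A" f0])
    show "?\<iota> (k + l) = ?\<iota> k \<oplus>\<^bsub>\<int>\<langle>G\<lparr>carrier := H\<rparr>\<rangle>\<^esub> ?\<iota> l" "?\<iota> (k * l) = ?\<iota> k \<otimes>\<^bsub>\<int>\<langle>G\<lparr>carrier := H\<rparr>\<rangle>\<^esub> ?\<iota> l" for k l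
      by (rule scalar_embedding[OF gH])+
    show "?\<iota> 1 = \<one>\<^bsub>\<int>\<langle>G\<lparr>carrier := H\<rparr>\<rangle>\<^esub>" by (simp add: RG_one[OF gH] basis_elt_def)
    show "\<exists>y\<in>carrier I. ?\<iota> n \<odot>\<^bsub>I\<^esub> y = x" if "n > 0" "x \<in> carrier I" for n x
      using div that by (simp add: divisible_module_def)
    show "i ` carrier A \<subseteq> carrier B" using lmod_homD(1)[OF i(1)] by blast
    show "\<zero>\<^bsub>B\<^esub> \<in> i ` carrier A" using lmod_hom_facts(1)[OF A B i(1)] by (metis A.M.zero_closed imageI)
    show "x \<oplus>\<^bsub>B\<^esub> y \<in> i ` carrier A" if "x \<in> i ` carrier A" "y \<in> i ` carrier A" for x y
      using that lmod_homD(2)[OF i(1)] by (metis (no_types, lifting) A.M.a_closed imageE imageI)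
    show "?\<iota> k \<odot>\<^bsub>B\<^esub> x \<in> i ` carrier A" if x: "x \<in> i ` carrier A" for k x
    proof -
      obtain a where a: "a \<in> carrier A" "x = i a" using x by blast
      then have "?\<iota> k \<odot>\<^bsub>B\<^esub> x = i (?\<iota> k \<odot>\<^bsub>A\<^esub> a)" using lmod_homD(3)[OF i(1) \<iota>c] by simp
      then show ?thesis using A.smult_closed[OF \<iota>c a(1)] by blast
    qed
    show "f0 x \<in> carrier I" if "x \<in> i ` carrier A" for x using that f0 lmod_homD(1)[OF f] by auto
    show "f0 (x \<oplus>\<^bsub>B\<^esub> y) = f0 x \<oplus>\<^bsub>I\<^esub> f0 y" if xy: "x \<in> i ` carrier A" "y \<in> i ` carrier A" for x y
    proof -
      obtain a b where ab: "a \<in> carrier A" "b \<in> carrier A" "x = i a" "y = i b" using xy by blast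
      then have "x \<oplus>\<^bsub>B\<^esub> y = i (a \<oplus>\<^bsub>A\<^esub> b)" using lmod_homD(2)[OF i(1)] by simp
      then show ?thesis using ab f0 lmod_homD(2)[OF f ab(1,2)] by simp
    qed
    show "f0 (?\<iota> k \<odot>\<^bsub>B\<^esub> x) = ?\<iota> k \<odot>\<^bsub>I\<^esub> f0 x" if x: "x \<in> i ` carrier A" for k x
    proof -
      obtain a where a: "a \<in> carrier A" "x = i a" using x by blast
      then have "?\<iota> k \<odot>\<^bsub>B\<^esub> x = i (?\<iota> k \<odot>\<^bsub>A\<^esub> a)" using lmod_homD(3)[OF i(1) \<iota>c] by simp
      then show ?thesis using a f0 A.smult_closed[OF \<iota>c] lmod_homD(3)[OF f \<iota>c a(1)] by simp
    qed
  qed (use \<iota>c that in auto)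
  obtain \<kappa> where \<kappa>: "\<And>g. g \<in> carrier G \<Longrightarrow> \<kappa> g \<in> H"
    "\<And>h g. h \<in> H \<Longrightarrow> g \<in> carrier G \<Longrightarrow> \<kappa> (h \<otimes> g) = h \<otimes> \<kappa> g"
    using G.left_equivariant_retraction[OF H] by metis
  have Bact: "basis_elt h \<odot>\<^bsub>B\<^esub> b \<in> carrier B" if "h \<in> H" "b \<in> carrier B" for h b
    using basis_elt_act(1)[OF gH B that(2), of h] that(1) by simp
  have Bact2: "basis_elt (g \<otimes> h) \<odot>\<^bsub>B\<^esub> b = basis_elt g \<odot>\<^bsub>B\<^esub> (basis_elt h \<odot>\<^bsub>B\<^esub> b)" if "g \<in> H" "h \<in> H" "b \<in> carrier B" for g h b
    using basis_elt_act(3)[OF gH B that(3), of g h] that by simp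
  define u where "u b g = basis_elt (\<kappa> g) \<odot>\<^bsub>I\<^esub> f' (basis_elt (inv (\<kappa> g)) \<odot>\<^bsub>B\<^esub> b)" for b g
  have u_cl: "u b g \<in> carrier I" if "b \<in> carrier B" "g \<in> carrier G" for b g
    unfolding u_def using basis_elt_act(1)[OF G I f'(1)[OF Bact[OF _ that(1)]]] \<kappa>(1)[OF that(2)] by simp
  define F where "F b = \<rho> (u b)" for b
  have F: "F \<in> lmod_hom (\<int>\<langle>G\<lparr>carrier := H\<rparr>\<rangle>) B I"
  proof (rule lmod_hom_equivariant[OF gH B IS])
    show "F b \<in> carrier I" if "b \<in> carrier B" for b unfolding F_def by (rule averagingD(1)[OF \<rho> u_cl[OF that]])
    show "F (b \<oplus>\<^bsub>B\<^esub> b') = F b \<oplus>\<^bsub>I\<^esub> F b'" if b: "b \<in> carrier B" "b' \<in> carrier B" for b b'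
    proof -
      have "u (b \<oplus>\<^bsub>B\<^esub> b') g = u b g \<oplus>\<^bsub>I\<^esub> u b' g" if g: "g \<in> carrier G" for g
      proof -
        have k: "inv (\<kappa> g) \<in> H" "\<kappa> g \<in> carrier G" using \<kappa>(1)[OF g] by auto
        have "basis_elt (inv (\<kappa> g)) \<odot>\<^bsub>B\<^esub> (b \<oplus>\<^bsub>B\<^esub> b') = basis_elt (inv (\<kappa> g)) \<odot>\<^bsub>B\<^esub> b \<oplus>\<^bsub>B\<^esub> basis_elt (inv (\<kappa> g)) \<odot>\<^bsub>B\<^esub> b'"
          using basis_elt_act(4)[OF gH B b(1) _ b(2)] k(1) by simp
        then show ?thesis
          unfolding u_def
          using f'(2)[OF Bact[OF k(1) b(1)] Bact[OF k(1) b(2)]]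
            basis_elt_act(4)[OF G I f'(1)[OF Bact[OF k(1) b(1)]] k(2) f'(1)[OF Bact[OF k(1) b(2)]]] by simp
      qed
      then have "\<rho> (u (b \<oplus>\<^bsub>B\<^esub> b')) = \<rho> (\<lambda>g. u b g \<oplus>\<^bsub>I\<^esub> u b' g)" by (rule averagingD(2)[OF \<rho>])
      then show ?thesis unfolding F_def using averagingD(3)[OF \<rho> u_cl[OF b(1)] u_cl[OF b(2)]] by simp
    qed
    show "F (basis_elt h \<odot>\<^bsub>B\<^esub> b) = basis_elt h \<odot>\<^bsub>I\<^esub> F b" if "h \<in> carrier ?H" and b: "b \<in> carrier B" for h b
    proof -
      have h: "h \<in> H" "h \<in> carrier G" using that(1) by auto
      have "u (basis_elt h \<odot>\<^bsub>B\<^esub> b) g = basis_elt h \<odot>\<^bsub>I\<^esub> u b (inv h \<otimes> g)" if g: "g \<in> carrier G" for g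
      proof -
        let ?k = "\<kappa> g"
        have k: "?k \<in> H" "?k \<in> carrier G" "inv ?k \<in> H" using \<kappa>(1)[OF g] by auto
        have k': "\<kappa> (inv h \<otimes> g) = inv h \<otimes> ?k" using \<kappa>(2)[of "inv h" g] h g by simp
        have "basis_elt (inv (inv h \<otimes> ?k)) \<odot>\<^bsub>B\<^esub> b = basis_elt (inv ?k) \<odot>\<^bsub>B\<^esub> (basis_elt h \<odot>\<^bsub>B\<^esub> b)"
          using Bact2[OF k(3) h(1) b] k h by (simp add: G.inv_mult_group)
        moreover have "basis_elt h \<odot>\<^bsub>I\<^esub> (basis_elt (inv h \<otimes> ?k) \<odot>\<^bsub>I\<^esub> x) = basis_elt ?k \<odot>\<^bsub>I\<^esub> x" if "x \<in> carrier I" for x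
          using basis_elt_act(3)[OF G I that h(2), of "inv h \<otimes> ?k"] k h by (simp add: G.m_assoc[symmetric])
        ultimately show ?thesis
          unfolding u_def k' using f'(1)[OF Bact[OF k(3) Bact[OF h(1) b]]] by simp
      qed
      then have "\<rho> (u (basis_elt h \<odot>\<^bsub>B\<^esub> b)) = \<rho> (\<lambda>g. basis_elt h \<odot>\<^bsub>I\<^esub> u b (inv h \<otimes> g))" by (rule averagingD(2)[OF \<rho>])
      then show ?thesis unfolding F_def using averagingD(4)[OF \<rho> h(2) u_cl[OF b]] by simp
    qed
  qed
  have "F (i a) = f a" if a: "a \<in> carrier A" for a
  proof -
    have "u (i a) g = f a" if g: "g \<in> carrier G" for g
    proof -
      have k: "\<kappa> g \<in> H" "inv (\<kappa> g) \<in> H" "\<kappa> g \<in> carrier G" using \<kappa>(1)[OF g] by auto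
      have kc: "basis_elt (inv (\<kappa> g)) \<in> carrier (\<int>\<langle>G\<lparr>carrier := H\<rparr>\<rangle>)" using basis_elt_closed[OF gH, of "inv (\<kappa> g)"] k(2) by simp
      have "f' (basis_elt (inv (\<kappa> g)) \<odot>\<^bsub>B\<^esub> i a) = f (basis_elt (inv (\<kappa> g)) \<odot>\<^bsub>A\<^esub> a)"
        using f'(3) f0 A.smult_closed[OF kc a] lmod_homD(3)[OF i(1) kc a] by (metis imageI)
      also have "\<dots> = basis_elt (inv (\<kappa> g)) \<odot>\<^bsub>I\<^esub> f a" by (rule lmod_homD(3)[OF f kc a])
      finally show ?thesis
        unfolding u_def
        using basis_elt_act(3)[OF G I lmod_homD(1)[OF f a], of "\<kappa> g" "inv (\<kappa> g)"] basis_elt_act(2)[OF G I lmod_homD(1)[OF f a]] k by simp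
    qed
    then have "\<rho> (u (i a)) = \<rho> (\<lambda>_. f a)" by (rule averagingD(2)[OF \<rho>])
    then show ?thesis unfolding F_def using averagingD(5)[OF \<rho> lmod_homD(1)[OF f a]] by simp
  qed
  then show "\<exists>g\<in>lmod_hom (\<int>\<langle>G\<lparr>carrier := H\<rparr>\<rangle>) B I. \<forall>x\<in>carrier A. g (i x) = f x" using F by blast
qed

lemma injective_subgroup:
  fixes I :: "('a \<Rightarrow> int, 'u) lmod"
  assumes "injective_module \<int>\<langle>G\<rangle> I" "subgroup H G"
  shows "injective_module (\<int>\<langle>G\<lparr>carrier := H\<rparr>\<rangle>) I"
  using injective_averaging[OF assms(1)] injective_subgroup_if_averaging[OF injective_module_left_module[OF assms(1)] _ injective_divisible[OF assms(1)] assms(2)]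
  by metis

text \<open>For the trivial group evaluation at the identity is an averaging operator, so
  divisibility is all that has to be supplied.\<close>

lemma injective_if_trivial_group:
  fixes I :: "('a \<Rightarrow> int, 'u) lmod"
  assumes "carrier G = {\<one>}" "left_module \<int>\<langle>G\<rangle> I" "divisible_module G I"
  shows "injective_module \<int>\<langle>G\<rangle> I"
proof -
  have "averaging G I (\<lambda>u. u \<one>)"
    using assms(1) basis_elt_act(2)[OF G assms(2)] by (auto simp: averaging_def)
  from injective_subgroup_if_averaging[OF assms(2) this assms(3) G.subgroup_self] show ?thesis by simp
qed

end

section \<open>Contractible complexes and splittings\<close>

context left_module
begin

lemma smult_diff: "\<lbrakk>a \<in> carrier R; x \<in> carrier M; y \<in> carrier M\<rbrakk> \<Longrightarrow> a \<odot>\<^bsub>M\<^esub> (x \<ominus>\<^bsub>M\<^esub> y) = a \<odot>\<^bsub>M\<^esub> x \<ominus>\<^bsub>M\<^esub> a \<odot>\<^bsub>M\<^esub> y"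
  using additive_map_facts(3)[of M M "\<lambda>x. a \<odot>\<^bsub>M\<^esub> x" x y] M.abelian_group_axioms
  by (auto simp: smult_closed smult_r_distr)

lemma diff_add_diff:
  "\<lbrakk>x \<in> carrier M; y \<in> carrier M; x' \<in> carrier M; y' \<in> carrier M\<rbrakk> \<Longrightarrow>
    (x \<oplus>\<^bsub>M\<^esub> x') \<ominus>\<^bsub>M\<^esub> (y \<oplus>\<^bsub>M\<^esub> y') = (x \<ominus>\<^bsub>M\<^esub> y) \<oplus>\<^bsub>M\<^esub> (x' \<ominus>\<^bsub>M\<^esub> y')"
  by (simp add: M.minus_eq M.minus_add M.a_ac)

end

lemma lmod_hom_diff:
  assumes N: "left_module R N" and f: "f \<in> lmod_hom R M N" and g: "g \<in> lmod_hom R M N"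
  shows "(\<lambda>x. f x \<ominus>\<^bsub>N\<^esub> g x) \<in> lmod_hom R M N"
proof -
  interpret N: left_module R N by (rule N)
  note fD = lmod_homD[OF f] and gD = lmod_homD[OF g]
  show ?thesis
    by (rule lmod_homI) (simp_all add: fD gD N.smult_diff N.diff_add_diff)
qed

lemma lmod_hom_factor:
  assumes M: "left_module R M" and P: "left_module R P" and f: "f \<in> lmod_hom R M N" and surj: "f ` carrier M = carrier N"
    and N: "left_module R N" and g: "g \<in> lmod_hom R M P"
    and ker: "\<And>x. \<lbrakk>x \<in> carrier M; f x = \<zero>\<^bsub>N\<^esub>\<rbrakk> \<Longrightarrow> g x = \<zero>\<^bsub>P\<^esub>"
  obtains g' where "g' \<in> lmod_hom R N P" "\<And>x. x \<in> carrier M \<Longrightarrow> g' (f x) = g x"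
proof -
  interpret M: left_module R M by (rule M)
  interpret N: left_module R N by (rule N)
  interpret P: left_module R P by (rule P)
  have eq: "g x = g y" if x: "x \<in> carrier M" and y: "y \<in> carrier M" and xy: "f x = f y" for x y
  proof -
    have "f (x \<ominus>\<^bsub>M\<^esub> y) = \<zero>\<^bsub>N\<^esub>"
      using lmod_hom_facts(3)[OF M N f x y] xy lmod_homD(1)[OF f y] by (simp add: N.M.minus_eq N.M.r_neg)
    then have "g x \<ominus>\<^bsub>P\<^esub> g y = \<zero>\<^bsub>P\<^esub>" using ker[of "x \<ominus>\<^bsub>M\<^esub> y"] lmod_hom_facts(3)[OF M P g x y] x y by simp
    then show ?thesis by (rule P.M.eq_if_minus_eq_zero[OF lmod_homD(1)[OF g x] lmod_homD(1)[OF g y]])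
  qed
  define g' where "g' z = g (inv_into (carrier M) f z)" for z
  have g': "g' (f x) = g x" if x: "x \<in> carrier M" for x
    unfolding g'_def
    by (rule eq[OF inv_into_into[of "f x" f "carrier M"] x f_inv_into_f[of "f x" f "carrier M"]]) (use x in auto)
  have "g' \<in> lmod_hom R N P"
  proof (rule lmod_homI)
    fix z assume "z \<in> carrier N"
    then have "z \<in> f ` carrier M" unfolding surj .
    then obtain x where x: "x \<in> carrier M" "z = f x" by blast
    show "g' z \<in> carrier P" using x lmod_homD(1)[OF g x(1)] g' by simp
    fix a assume a: "a \<in> carrier R"
    have "g' (f (a \<odot>\<^bsub>M\<^esub> x)) = a \<odot>\<^bsub>P\<^esub> g' (f x)"
      unfolding g'[OF x(1)] g'[OF M.smult_closed[OF a x(1)]] by (rule lmod_homD(3)[OF g a x(1)])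
    then show "g' (a \<odot>\<^bsub>N\<^esub> z) = a \<odot>\<^bsub>P\<^esub> g' z" using lmod_homD(3)[OF f a x(1)] x(2) by simp
  next
    fix z z' assume "z \<in> carrier N" "z' \<in> carrier N"
    then have "z \<in> f ` carrier M" "z' \<in> f ` carrier M" unfolding surj .
    then obtain x x' where x: "x \<in> carrier M" "z = f x" "x' \<in> carrier M" "z' = f x'" by blast
    have "g' (f (x \<oplus>\<^bsub>M\<^esub> x')) = g' (f x) \<oplus>\<^bsub>P\<^esub> g' (f x')"
      unfolding g'[OF x(1)] g'[OF x(3)] g'[OF M.M.a_closed[OF x(1,3)]] by (rule lmod_homD(2)[OF g x(1,3)])
    then show "g' (z \<oplus>\<^bsub>N\<^esub> z') = g' z \<oplus>\<^bsub>P\<^esub> g' z'" using lmod_homD(2)[OF f x(1,3)] x(2,4) by simp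
  qed
  then show ?thesis using g' by (rule that)
qed

lemma lmod_hom_inverse:
  assumes M: "left_module R M" and N: "left_module R N" and f: "f \<in> lmod_hom R M N" and bij: "bij_betw f (carrier M) (carrier N)"
  obtains g where "g \<in> lmod_hom R N M" "\<And>x. x \<in> carrier M \<Longrightarrow> g (f x) = x"
proof (rule lmod_hom_factor[OF M M f _ N lmod_hom_id])
  show "f ` carrier M = carrier N" using bij by (simp add: bij_betw_def)
  interpret M: left_module R M by (rule M)
  show "x = \<zero>\<^bsub>M\<^esub>" if "x \<in> carrier M" "f x = \<zero>\<^bsub>N\<^esub>" for x
    using bij that lmod_hom_facts(1)[OF M N f] M.M.zero_closed by (auto simp: bij_betw_def inj_on_def)
qed (use that in auto)

section \<open>Cycles and splittings degree by degree\<close>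

definition cycles :: "(int \<Rightarrow> ('r, 'm) Module.module) \<Rightarrow> (int \<Rightarrow> 'm \<Rightarrow> 'm) \<Rightarrow> int \<Rightarrow> ('r, 'm) Module.module" where
  "cycles C d i = C i\<lparr>carrier := lmod_ker (C i) (C (i + 1)) (d i)\<rparr>"

lemma cycles_simps [simp]:
  "carrier (cycles C d i) = {x \<in> carrier (C i). d i x = \<zero>\<^bsub>C (i + 1)\<^esub>}"
  "ring.zero (cycles C d i) = ring.zero (C i)" "ring.add (cycles C d i) = ring.add (C i)"
  "smult (cycles C d i) = smult (C i)"
  by (simp_all add: cycles_def lmod_ker_def)

lemma module_complexD:
  assumes "module_complex R C d"
  shows "left_module R (C i)" "d i \<in> lmod_hom R (C i) (C (i + 1))" "d (i - 1) \<in> lmod_hom R (C (i - 1)) (C i)"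
    "x \<in> carrier (C i) \<Longrightarrow> d (i + 1) (d i x) = \<zero>\<^bsub>C (i + 2)\<^esub>"
    "x \<in> carrier (C (i - 1)) \<Longrightarrow> d i (d (i - 1) x) = \<zero>\<^bsub>C (i + 1)\<^esub>"
    "left_module R (cycles C d i)"
    "d (i - 1) \<in> lmod_hom R (C (i - 1)) (cycles C d i)"
    "f \<in> lmod_hom R M (cycles C d i) \<Longrightarrow> f \<in> lmod_hom R M (C i)"
proof -
  show m: "left_module R (C i)" for i using assms by (simp add: module_complex_def)
  show h: "d i \<in> lmod_hom R (C i) (C (i + 1))" for i using assms by (simp add: module_complex_def)
  show h': "d (i - 1) \<in> lmod_hom R (C (i - 1)) (C i)" using h[of "i - 1"] by simp
  show dd: "d (i + 1) (d i x) = \<zero>\<^bsub>C (i + 2)\<^esub>" if "x \<in> carrier (C i)" for x i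
    using assms that by (simp add: module_complex_def)
  have i2: "i - 1 + 2 = i + 1" by simp
  show dd': "d i (d (i - 1) x) = \<zero>\<^bsub>C (i + 1)\<^esub>" if "x \<in> carrier (C (i - 1))" for x
    using dd[of x "i - 1"] that by (simp only: i2 diff_add_cancel)
  show "left_module R (cycles C d i)" unfolding cycles_def by (rule left_module_ker[OF m m h])
  show "d (i - 1) \<in> lmod_hom R (C (i - 1)) (cycles C d i)"
    using h' dd' by (auto simp: lmod_hom_def)
  show "f \<in> lmod_hom R M (C i)" if "f \<in> lmod_hom R M (cycles C d i)"
    using that by (auto simp: lmod_hom_def)
qed

lemma acyclic_complexD:
  assumes "acyclic_complex R C d"
  shows "module_complex R C d"
    and "\<lbrakk>x \<in> carrier (C i); d i x = \<zero>\<^bsub>C (i + 1)\<^esub>\<rbrakk> \<Longrightarrow> \<exists>y\<in>carrier (C (i - 1)). d (i - 1) y = x"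
proof -
  show "module_complex R C d" using assms by (simp add: acyclic_complex_def)
  assume x: "x \<in> carrier (C i)" "d i x = \<zero>\<^bsub>C (i + 1)\<^esub>"
  have i2: "i - 1 + 2 = i + 1" by simp
  have "d (i - 1) ` carrier (C (i - 1)) = lmod_ker (C (i - 1 + 1)) (C (i - 1 + 2)) (d (i - 1 + 1))"
    using assms by (simp only: acyclic_complex_def)
  then have "d (i - 1) ` carrier (C (i - 1)) = lmod_ker (C i) (C (i + 1)) (d i)"
    by (simp only: i2 diff_add_cancel)
  moreover have "x \<in> lmod_ker (C i) (C (i + 1)) (d i)" using x by (simp add: lmod_ker_def)
  ultimately have "x \<in> d (i - 1) ` carrier (C (i - 1))" by (simp only:)
  then show "\<exists>y\<in>carrier (C (i - 1)). d (i - 1) y = x" by blast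
qed

lemma acyclic_complexI:
  assumes C: "module_complex R C d"
    and ex: "\<And>i x. \<lbrakk>x \<in> carrier (C (i + 1)); d (i + 1) x = \<zero>\<^bsub>C (i + 2)\<^esub>\<rbrakk> \<Longrightarrow> \<exists>y\<in>carrier (C i). d i y = x"
  shows "acyclic_complex R C d"
  unfolding acyclic_complex_def
proof (intro conjI allI C)
  fix i show "d i ` carrier (C i) = lmod_ker (C (i + 1)) (C (i + 2)) (d (i + 1))"
  proof (intro equalityI subsetI)
    fix x assume "x \<in> d i ` carrier (C i)"
    then show "x \<in> lmod_ker (C (i + 1)) (C (i + 2)) (d (i + 1))"
      using lmod_homD(1)[OF module_complexD(2)[OF C, of i]] module_complexD(4)[OF C, of _ i] by (auto simp: lmod_ker_def)
  next
    fix x assume "x \<in> lmod_ker (C (i + 1)) (C (i + 2)) (d (i + 1))"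
    then have "\<exists>y\<in>carrier (C i). d i y = x" by (intro ex) (simp_all add: lmod_ker_def)
    then show "x \<in> d i ` carrier (C i)" by blast
  qed
qed

text \<open>A section of the differential onto the cycles. Contractibility is handled in this form
  because each degree can be treated alone and amounts to lifting a single map.\<close>

definition splits_at :: "'r ring \<Rightarrow> (int \<Rightarrow> ('r, 'm) Module.module) \<Rightarrow> (int \<Rightarrow> 'm \<Rightarrow> 'm) \<Rightarrow> int \<Rightarrow> bool" where
  "splits_at R C d i \<longleftrightarrow>
     (\<exists>\<sigma>\<in>lmod_hom R (cycles C d i) (C (i - 1)). \<forall>z\<in>carrier (cycles C d i). d (i - 1) (\<sigma> z) = z)"

text \<open>Given sections \<sigma>, the element x - \<sigma>(d x) is a cycle, and s(x) = \<sigma>(x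
  - \<sigma>(d x)) is a contraction; here s(d x) = \<sigma>(d x) because d d = 0. Conversely a
  contraction restricts to sections on the cycles.\<close>

lemma contractible_iff_splits:
  assumes C: "module_complex R C d"
  shows "contractible_complex R C d \<longleftrightarrow> (\<forall>i. splits_at R C d i)"
proof
  note CD = module_complexD[OF C]
  assume "contractible_complex R C d"
  then obtain s where s: "\<And>i. s i \<in> lmod_hom R (C i) (C (i - 1))"
    "\<And>i x. x \<in> carrier (C i) \<Longrightarrow> d (i - 1) (s i x) \<oplus>\<^bsub>C i\<^esub> s (i + 1) (d i x) = x"
    by (auto simp: contractible_complex_def)
  show "\<forall>i. splits_at R C d i"
  proof
    fix i
    interpret Ci: left_module R "C i" by (rule CD(1))
    have s': "s (i + 1) \<in> lmod_hom R (C (i + 1)) (C i)" using s(1)[of "i + 1"] by simp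
    have h: "s i \<in> lmod_hom R (cycles C d i) (C (i - 1))" using s(1)[of i] by (auto simp: lmod_hom_def)
    have "d (i - 1) (s i z) = z" if z: "z \<in> carrier (C i)" "d i z = \<zero>\<^bsub>C (i + 1)\<^esub>" for z
      using s(2)[OF z(1)] lmod_hom_facts(1)[OF CD(1) CD(1) s'] z lmod_homD(1)[OF CD(3) lmod_homD(1)[OF s(1) z(1)]]
      by simp
    then show "splits_at R C d i" unfolding splits_at_def using h by (intro bexI[of _ "s i"]) auto
  qed
next
  note CD = module_complexD[OF C]
  assume "\<forall>i. splits_at R C d i"
  then obtain \<sigma> where \<sigma>: "\<And>i. \<sigma> i \<in> lmod_hom R (cycles C d i) (C (i - 1))"
    "\<And>i z. z \<in> carrier (cycles C d i) \<Longrightarrow> d (i - 1) (\<sigma> i z) = z"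
    unfolding splits_at_def by metis
  define s where "s i x = \<sigma> i (x \<ominus>\<^bsub>C i\<^esub> \<sigma> (i + 1) (d i x))" for i x
  have \<sigma>': "\<sigma> (i + 1) \<in> lmod_hom R (cycles C d (i + 1)) (C i)" for i using \<sigma>(1)[of "i + 1"] by simp
  have d': "d i \<in> lmod_hom R (C i) (cycles C d (i + 1))" for i using CD(7)[of "i + 1"] by simp
  have sd: "d i (\<sigma> (i + 1) z) = z" if "z \<in> carrier (cycles C d (i + 1))" for i z using \<sigma>(2)[OF that] by simp
  have t: "(\<lambda>x. x \<ominus>\<^bsub>C i\<^esub> \<sigma> (i + 1) (d i x)) \<in> lmod_hom R (C i) (C i)" for i
    by (rule lmod_hom_diff[OF CD(1) lmod_hom_id lmod_hom_compose[OF d' \<sigma>']])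
  have dx: "d i x \<in> carrier (cycles C d (i + 1))" if "x \<in> carrier (C i)" for i x by (rule lmod_homD(1)[OF d' that])
  have \<sigma>dx: "\<sigma> (i + 1) (d i x) \<in> carrier (C i)" if "x \<in> carrier (C i)" for i x by (rule lmod_homD(1)[OF \<sigma>' dx[OF that]])
  have tz: "x \<ominus>\<^bsub>C i\<^esub> \<sigma> (i + 1) (d i x) \<in> carrier (cycles C d i)" if x: "x \<in> carrier (C i)" for i x
  proof -
    interpret Cj: left_module R "C (i + 1)" by (rule CD(1))
    have "d i (x \<ominus>\<^bsub>C i\<^esub> \<sigma> (i + 1) (d i x)) = \<zero>\<^bsub>C (i + 1)\<^esub>"
      using lmod_hom_facts(3)[OF CD(1) CD(1) CD(2) x \<sigma>dx[OF x]] sd[OF dx[OF x]] lmod_homD(1)[OF CD(2) x]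
      by (simp add: Cj.M.minus_eq Cj.M.r_neg)
    then show ?thesis using lmod_homD(1)[OF t x] by simp
  qed
  have t': "(\<lambda>x. x \<ominus>\<^bsub>C i\<^esub> \<sigma> (i + 1) (d i x)) \<in> lmod_hom R (C i) (cycles C d i)" for i
    using lmod_homD[OF t[of i]] tz by (intro lmod_homI) auto
  have s1: "s i \<in> lmod_hom R (C i) (C (i - 1))" for i
    unfolding s_def[abs_def] by (rule lmod_hom_compose[OF t' \<sigma>(1)])
  have "d (i - 1) (s i x) \<oplus>\<^bsub>C i\<^esub> s (i + 1) (d i x) = x" if x: "x \<in> carrier (C i)" for i x
  proof -
    interpret Ci: left_module R "C i" by (rule CD(1))
    interpret Cj: left_module R "C (i + 1)" by (rule CD(1))
    have i2: "i + 1 + 1 = i + 2" by simp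
    have \<sigma>0: "\<sigma> (i + 1 + 1) \<zero>\<^bsub>C (i + 2)\<^esub> = \<zero>\<^bsub>C (i + 1)\<^esub>"
      using lmod_hom_facts(1)[OF CD(6) CD(1) \<sigma>'[of "i + 1"]] by (simp only: cycles_simps i2)
    have n0: "\<ominus>\<^bsub>C (i + 1)\<^esub> \<zero>\<^bsub>C (i + 1)\<^esub> = \<zero>\<^bsub>C (i + 1)\<^esub>"
      by (metis Cj.M.minus_equality Cj.M.l_zero Cj.M.zero_closed)
    have "s (i + 1) (d i x) = \<sigma> (i + 1) (d i x)"
      unfolding s_def CD(4)[OF x] \<sigma>0 using lmod_homD(1)[OF CD(2) x] by (simp add: Cj.M.minus_eq n0)
    moreover have "d (i - 1) (s i x) = x \<ominus>\<^bsub>C i\<^esub> \<sigma> (i + 1) (d i x)"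
      unfolding s_def by (rule \<sigma>(2)[OF tz[OF x]])
    ultimately show ?thesis using x \<sigma>dx[OF x] by (simp add: Ci.M.minus_eq Ci.M.a_assoc Ci.M.l_neg)
  qed
  then show "contractible_complex R C d" unfolding contractible_complex_def using C s1 by blast
qed

text \<open>The section makes the cycles a retract of the injective module one degree below.\<close>

lemma injective_cycles_if_splits:
  fixes C :: "int \<Rightarrow> ('r, 'u) lmod"
  assumes C: "module_complex R C d" and inj: "injective_module R (C (i - 1))" and s: "splits_at R C d i"
  shows "injective_module R (cycles C d i)"
proof -
  obtain \<sigma> where \<sigma>: "\<sigma> \<in> lmod_hom R (cycles C d i) (C (i - 1))" "\<And>z. z \<in> carrier (cycles C d i) \<Longrightarrow> d (i - 1) (\<sigma> z) = z"
    using s unfolding splits_at_def by blast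
  show ?thesis by (rule injective_module_retract[OF inj module_complexD(6)[OF C] \<sigma>(1) module_complexD(7)[OF C] \<sigma>(2)])
qed

text \<open>The cycles in degree i - 1 are the kernel of the differential onto the cycles in degree
  i. If p is a retraction onto that kernel, 1 - p vanishes on it and factors through d, which gives
  the section.\<close>

lemma splits_if_injective_cycles:
  fixes C :: "int \<Rightarrow> ('r, 'u) lmod"
  assumes A: "acyclic_complex R C d" and inj: "injective_module R (cycles C d (i - 1))"
  shows "splits_at R C d i"
proof -
  note C = acyclic_complexD(1)[OF A]
  note CD = module_complexD[OF C]
  interpret Ci: left_module R "C i" by (rule CD(1))
  interpret Ch: left_module R "C (i - 1)" by (rule CD(1))
  let ?Z = "cycles C d (i - 1)"
  have "(\<lambda>x. x) \<in> lmod_hom R ?Z (C (i - 1))" by (auto simp: lmod_hom_def)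
  moreover have "inj_on (\<lambda>x. x) (carrier ?Z)" by simp
  ultimately obtain p where p: "p \<in> lmod_hom R (C (i - 1)) ?Z" "\<And>x. x \<in> carrier ?Z \<Longrightarrow> p x = x"
    using injective_moduleD[OF inj CD(6) CD(1) _ _ lmod_hom_id] by metis
  have p': "p \<in> lmod_hom R (C (i - 1)) (C (i - 1))" by (rule CD(8)[OF p(1)])
  define q where "q x = x \<ominus>\<^bsub>C (i - 1)\<^esub> p x" for x
  have q: "q \<in> lmod_hom R (C (i - 1)) (C (i - 1))"
    unfolding q_def[abs_def] by (rule lmod_hom_diff[OF CD(1) lmod_hom_id p'])
  have q0: "q x = \<zero>\<^bsub>C (i - 1)\<^esub>" if "x \<in> carrier ?Z" for x
    using p(2)[OF that] that by (simp add: q_def Ch.M.minus_eq Ch.M.r_neg)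
  have dq: "d (i - 1) (q x) = d (i - 1) x" if x: "x \<in> carrier (C (i - 1))" for x
    using lmod_hom_facts(3)[OF CD(1) CD(1) CD(3) x lmod_homD(1)[OF p' x]] lmod_homD(1)[OF p(1) x] lmod_homD(1)[OF CD(3) x]
    by (simp add: q_def Ci.M.minus_eq)
  have surj: "\<exists>x\<in>carrier (C (i - 1)). d (i - 1) x = z" if "z \<in> carrier (cycles C d i)" for z
    using acyclic_complexD(2)[OF A, of z i] that by auto
  obtain \<sigma> where \<sigma>: "\<sigma> \<in> lmod_hom R (cycles C d i) (C (i - 1))"
    "\<And>x. x \<in> carrier (C (i - 1)) \<Longrightarrow> \<sigma> (d (i - 1) x) = q x"
  proof (rule lmod_hom_factor[OF CD(1) CD(1) CD(7) _ CD(6) q])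
    show "d (i - 1) ` carrier (C (i - 1)) = carrier (cycles C d i)"
      using surj lmod_homD(1)[OF CD(7)] by (intro equalityI subsetI) (auto simp del: cycles_simps)
    show "q x = \<zero>\<^bsub>C (i - 1)\<^esub>" if "x \<in> carrier (C (i - 1))" "d (i - 1) x = \<zero>\<^bsub>cycles C d i\<^esub>" for x
      using that by (intro q0) simp
  qed (use that in auto)
  have "d (i - 1) (\<sigma> z) = z" if z: "z \<in> carrier (cycles C d i)" for z
  proof -
    obtain x where x: "x \<in> carrier (C (i - 1))" "z = d (i - 1) x" using surj[OF z] by metis
    then show ?thesis using \<sigma>(2) dq by simp
  qed
  then show ?thesis unfolding splits_at_def using \<sigma>(1) by blast
qed

lemma acyclic_kernels_eq_Inj:
  fixes R :: "'r ring"
  assumes all: "\<And>(C :: int \<Rightarrow> ('r, 'u) lmod) d. \<lbrakk>acyclic_complex R C d; \<And>i. injective_module R (C i)\<rbrakk> \<Longrightarrow> contractible_complex R C d"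
  shows "acyclic_kernels R = (Inj R :: ('r, 'u) lmod set)"
proof (intro equalityI subsetI)
  fix M :: "('r, 'u) lmod" assume "M \<in> acyclic_kernels R"
  then obtain C :: "int \<Rightarrow> ('r, 'u) lmod" and d i h where M: "left_module R M" and A: "acyclic_complex R C d"
    and inj: "\<And>j. injective_module R (C j)" and h: "h \<in> lmod_hom R M (C i)"
    and bij: "bij_betw h (carrier M) (lmod_ker (C i) (C (i + 1)) (d i))"
    unfolding acyclic_kernels_def by blast
  interpret M: left_module R M by (rule M)
  note C = acyclic_complexD(1)[OF A]
  have Z: "injective_module R (cycles C d i)"
    using injective_cycles_if_splits[OF C inj] all[OF A inj] contractible_iff_splits[OF C] by blast
  have im: "h ` carrier M = carrier (cycles C d i)" and hi: "inj_on h (carrier M)"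
    using bij by (auto simp: bij_betw_def lmod_ker_def)
  have h': "h \<in> lmod_hom R M (cycles C d i)" using h im by (auto simp: lmod_hom_def)
  have "bij_betw h (carrier M) (carrier (cycles C d i))" using im hi by (simp add: bij_betw_def)
  then obtain g where g: "g \<in> lmod_hom R (cycles C d i) M" "\<And>x. x \<in> carrier M \<Longrightarrow> g (h x) = x"
    using lmod_hom_inverse[OF M module_complexD(6)[OF C] h'] by metis
  have "injective_module R M"
    by (rule injective_module_retract[OF Z M h' g])
  then show "M \<in> Inj R" by (simp add: Inj_def)
next
  fix I :: "('r, 'u) lmod" assume "I \<in> Inj R"
  then have I: "injective_module R I" by (simp add: Inj_def)
  interpret I: left_module R I by (rule injective_module_left_module[OF I])
  \<comment> \<open>For the converse inclusion: I in degrees 0 and 1 with the identity between them,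
    zero modules elsewhere. The cycles in degree 1 are all of I.\<close>
  define C where "C j = (if j = 0 \<or> j = 1 then I else zero_module I)" for j :: int
  define d where "d j x = (if j = 0 then x else \<zero>\<^bsub>I\<^esub>)" for j :: int and x
  have [simp]: "ring.zero (C j) = ring.zero I" "ring.add (C j) = ring.add I" "smult (C j) = smult I" for j
    by (auto simp: C_def zero_module_def)
  have car: "carrier (C j) = (if j = 0 \<or> j = 1 then carrier I else {\<zero>\<^bsub>I\<^esub>})" for j
    by (auto simp: C_def zero_module_def)
  have inj: "injective_module R (C j)" for j
    using I injective_zero_module[OF I] by (simp add: C_def)
  have C: "module_complex R C d"
    unfolding module_complex_def
  proof (intro conjI allI ballI)
    fix j
    show "left_module R (C j)" by (rule injective_module_left_module[OF inj])
    show "d j \<in> lmod_hom R (C j) (C (j + 1))"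
      by (rule lmod_homI) (auto simp: car d_def I.smult_zero split: if_splits)
    show "d (j + 1) (d j x) = \<zero>\<^bsub>C (j + 2)\<^esub>" if "x \<in> carrier (C j)" for x
      using that by (auto simp: car d_def split: if_splits)
  qed
  have A: "acyclic_complex R C d"
  proof (rule acyclic_complexI[OF C])
    fix i x assume x: "x \<in> carrier (C (i + 1))" "d (i + 1) x = \<zero>\<^bsub>C (i + 2)\<^esub>"
    have "i = 0 \<or> x = \<zero>\<^bsub>I\<^esub>" using x by (cases "i = - 1") (auto simp: car d_def split: if_splits)
    moreover have "x \<in> carrier (C i)" using x calculation by (auto simp: car split: if_splits)
    ultimately show "\<exists>y\<in>carrier (C i). d i y = x" by (intro bexI[of _ x]) (auto simp: d_def)
  qed
  have "bij_betw (\<lambda>x. x) (carrier I) (lmod_ker (C 1) (C (1 + 1)) (d 1))"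
    by (auto simp: bij_betw_def lmod_ker_def car d_def)
  moreover have "(\<lambda>x. x) \<in> lmod_hom R I (C 1)" by (auto simp: lmod_hom_def car)
  ultimately show "I \<in> acyclic_kernels R"
    unfolding acyclic_kernels_def using A inj I.left_module_axioms by blast
qed

text \<open>Goodness of a group, as a splitting in every degree; by
  \<open>contractible_iff_splits\<close> this is contractibility.\<close>

definition acyclics_contractible :: "'u itself \<Rightarrow> 'a monoid \<Rightarrow> bool" where
  "acyclics_contractible U G \<longleftrightarrow>
     (\<forall>(C :: int \<Rightarrow> ('a \<Rightarrow> int, 'u) lmod) d i. acyclic_complex \<int>\<langle>G\<rangle> C d \<and> (\<forall>i. injective_module \<int>\<langle>G\<rangle> (C i)) \<longrightarrow>
        splits_at \<int>\<langle>G\<rangle> C d i)"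

lemma acyclics_contractibleD:
  fixes C :: "int \<Rightarrow> ('a \<Rightarrow> int, 'u) lmod"
  assumes "acyclics_contractible TYPE('u) G" "acyclic_complex \<int>\<langle>G\<rangle> C d" "\<And>i. injective_module \<int>\<langle>G\<rangle> (C i)"
  shows "splits_at \<int>\<langle>G\<rangle> C d i"
  using assms unfolding acyclics_contractible_def by blast

text \<open>The cycles are images of divisible groups under the differential, hence divisible, and
  over the trivial group divisible modules are injective.\<close>

lemma acyclics_contractible_trivial_group:
  fixes G :: "'a monoid"
  assumes G: "Group.group G" and triv: "carrier G = {\<one>\<^bsub>G\<^esub>}"
  shows "acyclics_contractible TYPE('u) G"
  unfolding acyclics_contractible_def
proof (intro allI impI, elim conjE)
  fix C :: "int \<Rightarrow> ('a \<Rightarrow> int, 'u) lmod" and d i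
  assume A: "acyclic_complex \<int>\<langle>G\<rangle> C d" and inj: "\<forall>i. injective_module \<int>\<langle>G\<rangle> (C i)"
  note CD = module_complexD[OF acyclic_complexD(1)[OF A]]
  have "divisible_module G (cycles C d j)" for j
    unfolding divisible_module_def
  proof (intro allI impI ballI)
    fix n :: int and z assume n: "n > 0" and z: "z \<in> carrier (cycles C d j)"
    let ?n = "\<lambda>g. if g = \<one>\<^bsub>G\<^esub> then n else 0"
    obtain x where x: "x \<in> carrier (C (j - 1))" "d (j - 1) x = z" using acyclic_complexD(2)[OF A, of z j] z by auto
    obtain y where y: "y \<in> carrier (C (j - 1))" "?n \<odot>\<^bsub>C (j - 1)\<^esub> y = x"
      using injective_divisible[OF G inj[rule_format, of "j - 1"]] n x(1) unfolding divisible_module_def by blast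
    have "d (j - 1) (?n \<odot>\<^bsub>C (j - 1)\<^esub> y) = ?n \<odot>\<^bsub>cycles C d j\<^esub> d (j - 1) y"
      by (rule lmod_homD(3)[OF CD(7) scalar_closed[OF G] y(1)])
    then have "?n \<odot>\<^bsub>cycles C d j\<^esub> d (j - 1) y = z" using y(2) x(2) by simp
    then show "\<exists>y\<in>carrier (cycles C d j). ?n \<odot>\<^bsub>cycles C d j\<^esub> y = z" using lmod_homD(1)[OF CD(7) y(1)] by blast
  qed
  then have "injective_module \<int>\<langle>G\<rangle> (cycles C d (i - 1))" by (intro injective_if_trivial_group[OF G triv CD(6)])
  then show "splits_at \<int>\<langle>G\<rangle> C d i" by (rule splits_if_injective_cycles[OF A])
qed

lemma torsion_free_finite_trivial:
  assumes G: "Group.group G" and fin: "finite (carrier G)" and tf: "torsion_free G"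
  shows "carrier G = {\<one>\<^bsub>G\<^esub>}"
proof -
  interpret G: Group.group G by (rule G)
  have "order G > 0" using fin G.order_gt_0_iff_finite by blast
  then have "x = \<one>\<^bsub>G\<^esub>" if "x \<in> carrier G" for x
    using tf G.pow_order_eq_1[OF that] that unfolding torsion_free_def by blast
  then show ?thesis by auto
qed

lemma transport_inj:
  assumes M: "left_module R M" and e: "inj e"
  shows "left_module R (transport e M)" "carrier (transport e M) = e ` carrier M" "\<zero>\<^bsub>transport e M\<^esub> = e \<zero>\<^bsub>M\<^esub>"
    "e \<in> lmod_hom R M (transport e M)" "the_inv e \<in> lmod_hom R (transport e M) M"
proof -
  have e': "inj_on e (carrier M)" using e by (rule inj_on_subset) simp
  note t = transport_module[OF M e']
  interpret T: left_module R "transport e M" by (rule t(1))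
  show "left_module R (transport e M)" "e \<in> lmod_hom R M (transport e M)" by (rule t)+
  show c: "carrier (transport e M) = e ` carrier M" "\<zero>\<^bsub>transport e M\<^esub> = e \<zero>\<^bsub>M\<^esub>" by (simp_all add: transport_def)
  have eq: "inv_into (carrier M) e x = the_inv e x" if "x \<in> carrier (transport e M)" for x
    using that inv_into_f_f[OF e'] the_inv_f_f[OF e] unfolding c by auto
  show "the_inv e \<in> lmod_hom R (transport e M) M"
  proof (rule lmod_homI)
    fix x assume x: "x \<in> carrier (transport e M)"
    show "the_inv e x \<in> carrier M" using lmod_homD(1)[OF t(3) x] eq[OF x] by simp
    show "the_inv e (a \<odot>\<^bsub>transport e M\<^esub> x) = a \<odot>\<^bsub>M\<^esub> the_inv e x" if a: "a \<in> carrier R" for a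
      using lmod_homD(3)[OF t(3) a x] eq[OF x] eq[OF T.smult_closed[OF a x]] by simp
    show "the_inv e (x \<oplus>\<^bsub>transport e M\<^esub> y) = the_inv e x \<oplus>\<^bsub>M\<^esub> the_inv e y" if y: "y \<in> carrier (transport e M)" for y
      using lmod_homD(2)[OF t(3) x y] eq[OF x] eq[OF y] eq[OF T.M.a_closed[OF x y]] by simp
  qed
qed

lemma transport_complex:
  assumes A: "acyclic_complex R K \<delta>" and e: "inj e"
  shows "acyclic_complex R (\<lambda>i. transport e (K i)) (\<lambda>i x. e (\<delta> i (the_inv e x)))"
    and "e \<in> lmod_hom R (cycles K \<delta> i) (cycles (\<lambda>i. transport e (K i)) (\<lambda>i x. e (\<delta> i (the_inv e x))) i)"
    and "the_inv e \<in> lmod_hom R (cycles (\<lambda>i. transport e (K i)) (\<lambda>i x. e (\<delta> i (the_inv e x))) i) (cycles K \<delta> i)"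
proof -
  let ?K = "\<lambda>i. transport e (K i)" and ?\<delta> = "\<lambda>i x. e (\<delta> i (the_inv e x))"
  note K = acyclic_complexD(1)[OF A]
  note KD = module_complexD[OF K]
  note t = transport_inj[OF KD(1) e]
  have [simp]: "the_inv e (e x) = x" for x using the_inv_f_f[OF e] .
  have eiff: "e x = e y \<longleftrightarrow> x = y" for x y using e by (simp add: inj_eq)
  have C: "module_complex R ?K ?\<delta>"
    unfolding module_complex_def
  proof (intro conjI allI ballI)
    fix i
    show "left_module R (transport e (K i))" by (rule t(1))
    show "?\<delta> i \<in> lmod_hom R (transport e (K i)) (transport e (K (i + 1)))"
      by (rule lmod_hom_compose[OF lmod_hom_compose[OF t(5) KD(2)] t(4)])
    show "?\<delta> (i + 1) (?\<delta> i x) = \<zero>\<^bsub>transport e (K (i + 2))\<^esub>" if "x \<in> carrier (transport e (K i))" for x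
      using KD(4)[OF lmod_homD(1)[OF t(5) that]] by (simp add: t(3))
  qed
  show "acyclic_complex R ?K ?\<delta>"
  proof (rule acyclic_complexI[OF C])
    fix i x assume x: "x \<in> carrier (transport e (K (i + 1)))" "?\<delta> (i + 1) x = \<zero>\<^bsub>transport e (K (i + 2))\<^esub>"
    obtain k where k: "k \<in> carrier (K (i + 1))" "x = e k" using x(1) t(2) by auto
    have "\<delta> (i + 1) k = \<zero>\<^bsub>K (i + 1 + 1)\<^esub>" using x(2) k(2) by (simp add: t(3) eiff add.commute)
    from acyclic_complexD(2)[OF A k(1) this] obtain y where y: "y \<in> carrier (K i)" "\<delta> i y = k" by auto
    then show "\<exists>y\<in>carrier (transport e (K i)). ?\<delta> i y = x" using k(2) t(2) by (intro bexI[of _ "e y"]) auto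
  qed
  show "e \<in> lmod_hom R (cycles K \<delta> i) (cycles ?K ?\<delta> i)"
    using lmod_homD[OF t(4)[of i]] by (intro lmod_homI) (auto simp: t(3))
  show "the_inv e \<in> lmod_hom R (cycles ?K ?\<delta> i) (cycles K \<delta> i)"
    using lmod_homD[OF t(5)[of i]] by (intro lmod_homI) (auto simp: t(3) eiff)
qed

section \<open>Passage to subgroups\<close>

context
  fixes G :: "'a monoid" (structure) and H
  assumes G: "Group.group G" and H: "subgroup H G"
begin

interpretation G: Group.group G by (rule G)
interpretation H: subgroup H G by (rule H)
interpretation RS: restriction "\<int>\<langle>G\<rangle>" "\<int>\<langle>G\<lparr>carrier := H\<rparr>\<rangle>" by (rule restriction_subgroup[OF G H])

lemma coinduced_eqI:
  assumes M: "abelian_group M" and F: "F \<in> carrier (coinduced \<int>\<langle>G\<rangle> \<int>\<langle>G\<lparr>carrier := H\<rparr>\<rangle> M)"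
    and F': "F' \<in> carrier (coinduced \<int>\<langle>G\<rangle> \<int>\<langle>G\<lparr>carrier := H\<rparr>\<rangle> M)"
    and eq: "\<And>g. g \<in> carrier G \<Longrightarrow> F (basis_elt g) = F' (basis_elt g)"
  shows "F = F'"
proof
  fix r show "F r = F' r"
  proof (cases "r \<in> carrier \<int>\<langle>G\<rangle>")
    case True
    show ?thesis
      by (rule additive_eq_on_RG[where f = F and f' = F' and M = M, OF G M
            RS.coinduced_carrier(1)[OF F] RS.coinduced_carrier(2)[OF F]
            RS.coinduced_carrier(1)[OF F'] RS.coinduced_carrier(2)[OF F'] eq True])
  next
    case False
    then show ?thesis using RS.coinduced_carrier(4)[OF F] RS.coinduced_carrier(4)[OF F'] by simp
  qed
qed

text \<open>The group ring of G is free over that of \<open>H\<close> on coset representatives, so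
  an \<open>H\<close>-equivariant function on G is enough to prescribe an element of the coinduced
  module.\<close>

lemma coinduced_of_equivariant:
  assumes M: "left_module \<int>\<langle>G\<lparr>carrier := H\<rparr>\<rangle> M" and t: "\<And>g. g \<in> carrier G \<Longrightarrow> t g \<in> carrier M"
    and eq: "\<And>h g. \<lbrakk>h \<in> H; g \<in> carrier G\<rbrakk> \<Longrightarrow> t (h \<otimes> g) = basis_elt h \<odot>\<^bsub>M\<^esub> t g"
  obtains F where "F \<in> carrier (coinduced \<int>\<langle>G\<rangle> \<int>\<langle>G\<lparr>carrier := H\<rparr>\<rangle> M)" "\<And>g. g \<in> carrier G \<Longrightarrow> F (basis_elt g) = t g"
proof -
  interpret M: left_module "\<int>\<langle>G\<lparr>carrier := H\<rparr>\<rangle>" M by (rule M)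
  interpret R: Ring.ring "\<int>\<langle>G\<rangle>" by (rule ring_RG[OF G])
  note gH = G.subgroup_imp_group[OF H]
  note act = basis_elt_act[OF gH M, simplified]
  obtain F0 where F0: "\<And>r. r \<in> carrier \<int>\<langle>G\<rangle> \<Longrightarrow> F0 r \<in> carrier M"
    "\<And>r s. \<lbrakk>r \<in> carrier \<int>\<langle>G\<rangle>; s \<in> carrier \<int>\<langle>G\<rangle>\<rbrakk> \<Longrightarrow> F0 (r \<oplus>\<^bsub>\<int>\<langle>G\<rangle>\<^esub> s) = F0 r \<oplus>\<^bsub>M\<^esub> F0 s"
    "\<And>g. g \<in> carrier G \<Longrightarrow> F0 (basis_elt g) = t g"
    using additive_extension_RG[OF G M.M.abelian_group_axioms, of t] t by metis
  define F where "F r = (if r \<in> carrier \<int>\<langle>G\<rangle> then F0 r else \<zero>\<^bsub>M\<^esub>)" for r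
  have b: "basis_elt h \<in> carrier \<int>\<langle>G\<rangle>" if "h \<in> carrier G" for h by (rule basis_elt_closed[OF G that])
  have eqv: "F0 (basis_elt h \<otimes>\<^bsub>\<int>\<langle>G\<rangle>\<^esub> r) = basis_elt h \<odot>\<^bsub>M\<^esub> F0 r" if h: "h \<in> H" and r: "r \<in> carrier \<int>\<langle>G\<rangle>" for h r
  proof -
    have hG: "h \<in> carrier G" using h by simp
    show ?thesis
    proof (rule additive_eq_on_RG[where f = "\<lambda>r. F0 (basis_elt h \<otimes>\<^bsub>\<int>\<langle>G\<rangle>\<^esub> r)" and f' = "\<lambda>r. basis_elt h \<odot>\<^bsub>M\<^esub> F0 r" and M = M,
          OF G M.M.abelian_group_axioms _ _ _ _ _ r])
      fix r s assume rs: "r \<in> carrier \<int>\<langle>G\<rangle>" "s \<in> carrier \<int>\<langle>G\<rangle>"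
      show "F0 (basis_elt h \<otimes>\<^bsub>\<int>\<langle>G\<rangle>\<^esub> r) \<in> carrier M" using F0(1) b[OF hG] rs by simp
      show "basis_elt h \<odot>\<^bsub>M\<^esub> F0 r \<in> carrier M" using act(1)[OF F0(1)[OF rs(1)] h] .
      show "F0 (basis_elt h \<otimes>\<^bsub>\<int>\<langle>G\<rangle>\<^esub> (r \<oplus>\<^bsub>\<int>\<langle>G\<rangle>\<^esub> s)) = F0 (basis_elt h \<otimes>\<^bsub>\<int>\<langle>G\<rangle>\<^esub> r) \<oplus>\<^bsub>M\<^esub> F0 (basis_elt h \<otimes>\<^bsub>\<int>\<langle>G\<rangle>\<^esub> s)"
        using F0(2)[of "basis_elt h \<otimes>\<^bsub>\<int>\<langle>G\<rangle>\<^esub> r" "basis_elt h \<otimes>\<^bsub>\<int>\<langle>G\<rangle>\<^esub> s"] b[OF hG] rs by (simp add: R.r_distr)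
      show "basis_elt h \<odot>\<^bsub>M\<^esub> F0 (r \<oplus>\<^bsub>\<int>\<langle>G\<rangle>\<^esub> s) = basis_elt h \<odot>\<^bsub>M\<^esub> F0 r \<oplus>\<^bsub>M\<^esub> basis_elt h \<odot>\<^bsub>M\<^esub> F0 s"
        unfolding F0(2)[OF rs] by (rule act(4)[OF F0(1)[OF rs(1)] h F0(1)[OF rs(2)]])
    next
      fix g assume g: "g \<in> carrier G"
      show "F0 (basis_elt h \<otimes>\<^bsub>\<int>\<langle>G\<rangle>\<^esub> basis_elt g) = basis_elt h \<odot>\<^bsub>M\<^esub> F0 (basis_elt g)"
        unfolding basis_elt_mult[OF G hG g] F0(3)[OF g] F0(3)[OF G.m_closed[OF hG g]] by (rule eq[OF h g])
    qed
  qed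
  have "F \<in> lmod_hom \<int>\<langle>G\<lparr>carrier := H\<rparr>\<rangle> (regular_module \<int>\<langle>G\<rangle>) M"
  proof (rule lmod_hom_equivariant[OF gH RS.regular_restrict M])
    fix g x assume "g \<in> carrier (G\<lparr>carrier := H\<rparr>)" and x: "x \<in> carrier (regular_module \<int>\<langle>G\<rangle>)"
    then have g: "g \<in> H" by simp
    then show "F (basis_elt g \<odot>\<^bsub>regular_module \<int>\<langle>G\<rangle>\<^esub> x) = basis_elt g \<odot>\<^bsub>M\<^esub> F x"
      using x eqv[OF g] b[of g] by (simp add: regular_module_def F_def)
  qed (use F0 in \<open>auto simp: regular_module_def F_def\<close>)
  then have "F \<in> carrier (coinduced \<int>\<langle>G\<rangle> \<int>\<langle>G\<lparr>carrier := H\<rparr>\<rangle> M)" by (simp add: coinduced_def F_def)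
  moreover have "F (basis_elt g) = t g" if "g \<in> carrier G" for g using F0(3)[OF that] b[OF that] by (simp add: F_def)
  ultimately show ?thesis by (rule that)
qed

text \<open>Coinduction is exact because the group ring is free over that of \<open>H\<close>.
  Concretely, preimages of the values of a cycle are chosen at each group element and made
  \<open>H\<close>-equivariant with the help of \<kappa>.\<close>

lemma coinduced_complex:
  fixes C :: "int \<Rightarrow> ('a \<Rightarrow> int, 'm) Module.module"
  assumes A: "acyclic_complex \<int>\<langle>G\<lparr>carrier := H\<rparr>\<rangle> C d"
  shows "acyclic_complex \<int>\<langle>G\<rangle> (\<lambda>i. coinduced \<int>\<langle>G\<rangle> \<int>\<langle>G\<lparr>carrier := H\<rparr>\<rangle> (C i))
    (\<lambda>i F r. if r \<in> carrier \<int>\<langle>G\<rangle> then d i (F r) else \<zero>\<^bsub>C (i + 1)\<^esub>)" (is "acyclic_complex _ ?K ?\<delta>")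
proof -
  note CD = module_complexD[OF acyclic_complexD(1)[OF A]]
  have \<delta>c: "?\<delta> i F \<in> carrier (?K (i + 1))" if F: "F \<in> carrier (?K i)" for i F
  proof (rule RS.coinduced_carrierI)
    note FC = RS.coinduced_carrier[OF F]
    interpret R: Ring.ring "\<int>\<langle>G\<rangle>" by (rule ring_RG[OF G])
    show "?\<delta> i F r \<in> carrier (C (i + 1))" if r: "r \<in> carrier \<int>\<langle>G\<rangle>" for r
      using lmod_homD(1)[OF CD(2) FC(1)[OF r]] r by simp
    show "?\<delta> i F (r \<oplus>\<^bsub>\<int>\<langle>G\<rangle>\<^esub> r') = ?\<delta> i F r \<oplus>\<^bsub>C (i + 1)\<^esub> ?\<delta> i F r'" if r: "r \<in> carrier \<int>\<langle>G\<rangle>" "r' \<in> carrier \<int>\<langle>G\<rangle>" for r r'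
      using lmod_homD(2)[OF CD(2) FC(1)[OF r(1)] FC(1)[OF r(2)]] FC(2)[OF r] r by simp
    show "?\<delta> i F (a \<otimes>\<^bsub>\<int>\<langle>G\<rangle>\<^esub> r) = a \<odot>\<^bsub>C (i + 1)\<^esub> ?\<delta> i F r" if a: "a \<in> carrier \<int>\<langle>G\<lparr>carrier := H\<rparr>\<rangle>" and r: "r \<in> carrier \<int>\<langle>G\<rangle>" for a r
      using lmod_homD(3)[OF CD(2) a FC(1)[OF r]] FC(3)[OF a r] r RS.mem_carrier[OF a] by simp
  qed simp
  have C: "module_complex \<int>\<langle>G\<rangle> ?K ?\<delta>"
    unfolding module_complex_def
  proof (intro conjI allI ballI)
    fix i
    interpret R: Ring.ring "\<int>\<langle>G\<rangle>" by (rule ring_RG[OF G])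
    show "left_module \<int>\<langle>G\<rangle> (?K i)" by (rule RS.left_module_coinduced[OF CD(1)])
    show "?\<delta> i \<in> lmod_hom \<int>\<langle>G\<rangle> (?K i) (?K (i + 1))"
    proof (rule lmod_homI[OF \<delta>c])
      interpret Cj: left_module "\<int>\<langle>G\<lparr>carrier := H\<rparr>\<rangle>" "C (i + 1)" by (rule CD(1))
      fix F assume F: "F \<in> carrier (?K i)"
      show "?\<delta> i (F \<oplus>\<^bsub>?K i\<^esub> F') = ?\<delta> i F \<oplus>\<^bsub>?K (i + 1)\<^esub> ?\<delta> i F'" if F': "F' \<in> carrier (?K i)" for F'
        using lmod_homD(2)[OF CD(2) RS.coinduced_carrier(1)[OF F] RS.coinduced_carrier(1)[OF F']]
        by (auto simp: coinduced_def fun_eq_iff)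
      show "?\<delta> i (a \<odot>\<^bsub>?K i\<^esub> F) = a \<odot>\<^bsub>?K (i + 1)\<^esub> ?\<delta> i F" if "a \<in> carrier \<int>\<langle>G\<rangle>" for a
        using that by (auto simp: coinduced_def fun_eq_iff)
    qed
    show "?\<delta> (i + 1) (?\<delta> i F) = \<zero>\<^bsub>?K (i + 2)\<^esub>" if F: "F \<in> carrier (?K i)" for F
      using CD(4)[OF RS.coinduced_carrier(1)[OF F]] by (auto simp: coinduced_def fun_eq_iff add.commute)
  qed
  show ?thesis
  proof (rule acyclic_complexI[OF C])
    fix i F assume F: "F \<in> carrier (?K (i + 1))" and z: "?\<delta> (i + 1) F = \<zero>\<^bsub>?K (i + 2)\<^esub>"
    have "\<exists>y\<in>carrier (C i). d i y = F (basis_elt g)" if g: "g \<in> carrier G" for g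
    proof -
      note b = basis_elt_closed[OF G g]
      have "d (i + 1) (F (basis_elt g)) = \<zero>\<^bsub>C (i + 1 + 1)\<^esub>"
        using fun_cong[OF z, of "basis_elt g"] b by (simp add: coinduced_def add.commute)
      from acyclic_complexD(2)[OF A RS.coinduced_carrier(1)[OF F b] this] show ?thesis by simp
    qed
    then obtain y where y: "\<And>g. g \<in> carrier G \<Longrightarrow> y g \<in> carrier (C i)" "\<And>g. g \<in> carrier G \<Longrightarrow> d i (y g) = F (basis_elt g)"
      by metis
    obtain \<kappa> where \<kappa>: "\<And>g. g \<in> carrier G \<Longrightarrow> \<kappa> g \<in> H"
      "\<And>h g. h \<in> H \<Longrightarrow> g \<in> carrier G \<Longrightarrow> \<kappa> (h \<otimes> g) = h \<otimes> \<kappa> g"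
      using G.left_equivariant_retraction[OF H] by metis
    note gH = G.subgroup_imp_group[OF H]
    note act = basis_elt_act[OF gH CD(1), simplified]
    \<comment> \<open>The element \<kappa>(g)^-1 g is the representative of the coset of g, so
      \<open>?t\<close> takes the preimage chosen at the representative and moves it to g by
      \<kappa>(g).\<close>
    let ?t = "\<lambda>g. basis_elt (\<kappa> g) \<odot>\<^bsub>C i\<^esub> y (inv (\<kappa> g) \<otimes> g)"
    have yc: "y (inv (\<kappa> g) \<otimes> g) \<in> carrier (C i)" if "g \<in> carrier G" for g using y(1) \<kappa>(1)[OF that] that by simp
    have t_eq: "?t (h \<otimes> g) = basis_elt h \<odot>\<^bsub>C i\<^esub> ?t g" if h: "h \<in> H" and g: "g \<in> carrier G" for h g
    proof -
      have k: "\<kappa> g \<in> H" "\<kappa> g \<in> carrier G" "h \<in> carrier G" using \<kappa>(1)[OF g] h by auto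
      have "inv (h \<otimes> \<kappa> g) \<otimes> (h \<otimes> g) = inv (\<kappa> g) \<otimes> g"
        using k g by (simp add: G.inv_mult_group G.m_assoc G.inv_solve_left')
      then show ?thesis unfolding \<kappa>(2)[OF h g] using act(3)[OF yc[OF g] h k(1)] by simp
    qed
    obtain F' where F': "F' \<in> carrier (?K i)" "\<And>g. g \<in> carrier G \<Longrightarrow> F' (basis_elt g) = ?t g"
    proof (rule coinduced_of_equivariant[OF CD(1), of ?t])
      show "?t g \<in> carrier (C i)" if "g \<in> carrier G" for g by (rule act(1)[OF yc[OF that] \<kappa>(1)[OF that]])
    qed (use t_eq that in auto)
    have "?\<delta> i F' = F"
    proof (rule coinduced_eqI)
      show "abelian_group (C (i + 1))" using CD(1)[of "i + 1"] by (simp add: left_module_def)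
      show "?\<delta> i F' \<in> carrier (?K (i + 1))" by (rule \<delta>c[OF F'(1)])
      show "F \<in> carrier (?K (i + 1))" by (rule F)
      fix g assume g: "g \<in> carrier G"
      note b = basis_elt_closed[OF G g]
      have k: "\<kappa> g \<in> H" "\<kappa> g \<in> carrier G" using \<kappa>(1)[OF g] by auto
      have bk: "basis_elt (\<kappa> g) \<in> carrier \<int>\<langle>G\<lparr>carrier := H\<rparr>\<rangle>" using basis_elt_closed[OF gH, of "\<kappa> g"] k by simp
      have kg: "inv (\<kappa> g) \<otimes> g \<in> carrier G" using k g by simp
      have "?\<delta> i F' (basis_elt g) = d i (?t g)" using b F'(2)[OF g] by simp
      also have "\<dots> = basis_elt (\<kappa> g) \<odot>\<^bsub>C (i + 1)\<^esub> F (basis_elt (inv (\<kappa> g) \<otimes> g))"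
        using lmod_homD(3)[OF CD(2) bk yc[OF g]] y(2)[OF kg] by simp
      also have "\<dots> = F (basis_elt (\<kappa> g) \<otimes>\<^bsub>\<int>\<langle>G\<rangle>\<^esub> basis_elt (inv (\<kappa> g) \<otimes> g))"
        by (rule RS.coinduced_carrier(3)[OF F bk basis_elt_closed[OF G kg], symmetric])
      also have "\<dots> = F (basis_elt g)"
        unfolding basis_elt_mult[OF G k(2) kg] using k g by (simp add: G.m_assoc[symmetric])
      finally show "?\<delta> i F' (basis_elt g) = F (basis_elt g)" .
    qed
    then show "\<exists>y\<in>carrier (?K i). ?\<delta> i y = F" using F'(1) by blast
  qed
qed

text \<open>The coinduced complex splits over G. The cycles of C embed \<open>H\<close>-linearly in
  its cycles as functions supported on \<open>H\<close>, and evaluation at 1 leads back to C; with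
  the splitting in between this composes to an \<open>H\<close>-linear section.\<close>

lemma acyclics_contractible_subgroup:
  assumes P: "acyclics_contractible TYPE('u) G"
  shows "acyclics_contractible TYPE('u) (G\<lparr>carrier := H\<rparr>)"
  unfolding acyclics_contractible_def
proof (intro allI impI, elim conjE)
  let ?R = "\<int>\<langle>G\<rangle>" and ?S = "\<int>\<langle>G\<lparr>carrier := H\<rparr>\<rangle>"
  fix C :: "int \<Rightarrow> ('a \<Rightarrow> int, 'u) lmod" and d i
  assume A: "acyclic_complex ?S C d" and inj: "\<forall>i. injective_module ?S (C i)"
  note CD = module_complexD[OF acyclic_complexD(1)[OF A]]
  note gH = G.subgroup_imp_group[OF H]
  let ?K = "\<lambda>i. coinduced ?R ?S (C i)" and ?\<delta> = "\<lambda>i F r. if r \<in> carrier ?R then d i (F r) else \<zero>\<^bsub>C (i + 1)\<^esub>"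
  have AK: "acyclic_complex ?R ?K ?\<delta>" by (rule coinduced_complex[OF A])
  note KD = module_complexD[OF acyclic_complexD(1)[OF AK]]
  have "inj (Inl :: ('a \<Rightarrow> int) \<Rightarrow> ('a \<Rightarrow> int) + nat + 'u)" by simp
  then obtain e :: "(('a \<Rightarrow> int) \<Rightarrow> ('a \<Rightarrow> int, 'u) universe) \<Rightarrow> ('a \<Rightarrow> int, 'u) universe" where e: "inj e"
    by (rule inj_function_universe)
  have e_inv: "the_inv e (e x) = x" for x using the_inv_f_f[OF e] .
  have injK: "injective_module ?R (transport e (?K j))" for j
  proof (rule RS.injective_coinduced)
    show "injective_module ?S (C j)" using inj by blast
    show "left_module ?S M" if "left_module ?R M" for M :: "('a \<Rightarrow> int, 'u) lmod" by (rule left_module_subgroup[OF G that H])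
    show "inj_on e (carrier (?K j))" by (rule inj_on_subset[OF e subset_UNIV])
  qed
  let ?K' = "\<lambda>i. transport e (?K i)" and ?\<delta>' = "\<lambda>i x. e (?\<delta> i (the_inv e x))"
  note tr = transport_complex[OF AK e]
  obtain \<sigma>0 where \<sigma>0: "\<sigma>0 \<in> lmod_hom ?R (cycles ?K' ?\<delta>' i) (?K' (i - 1))" "\<And>z. z \<in> carrier (cycles ?K' ?\<delta>' i) \<Longrightarrow> ?\<delta>' (i - 1) (\<sigma>0 z) = z"
    using acyclics_contractibleD[OF P tr(1) injK, of i] unfolding splits_at_def by blast
  define \<sigma> where "\<sigma> F = the_inv e (\<sigma>0 (e F))" for F
  have \<sigma>: "\<sigma> \<in> lmod_hom ?R (cycles ?K ?\<delta> i) (?K (i - 1))"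
    unfolding \<sigma>_def[abs_def] by (rule lmod_hom_compose[OF lmod_hom_compose[OF tr(2) \<sigma>0(1)] transport_inj(5)[OF KD(1) e]])
  have \<delta>\<sigma>: "?\<delta> (i - 1) (\<sigma> F) = F" if F: "F \<in> carrier (cycles ?K ?\<delta> i)" for F
  proof -
    have "e (?\<delta> (i - 1) (\<sigma> F)) = e F"
      unfolding \<sigma>_def by (rule \<sigma>0(2)[OF lmod_homD(1)[OF tr(2) F]])
    then show ?thesis using e by (simp only: inj_eq)
  qed
  let ?Z = "cycles C d i"
  interpret R: Ring.ring ?R by (rule ring_RG[OF G])
  interpret Ci: left_module ?S "C i" by (rule CD(1))
  interpret Ch: left_module ?S "C (i - 1)" by (rule CD(1))
  note act = basis_elt_act[OF gH CD(1), of _ i, simplified]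
  define t where "t z g = (if g \<in> H then basis_elt g \<odot>\<^bsub>C i\<^esub> z else \<zero>\<^bsub>C i\<^esub>)" for z g
  have bS: "basis_elt h \<in> carrier ?S" if "h \<in> H" for h using basis_elt_closed[OF gH, of h] that by simp
  have "\<exists>F. F \<in> carrier (?K i) \<and> (\<forall>g\<in>carrier G. F (basis_elt g) = t z g)" if z: "z \<in> carrier (C i)" for z
  proof (rule coinduced_of_equivariant[OF CD(1), of "t z" i])
    show "t z g \<in> carrier (C i)" for g using act(1)[OF z, of g] by (simp add: t_def)
    show "t z (h \<otimes> g) = basis_elt h \<odot>\<^bsub>C i\<^esub> t z g" if h: "h \<in> H" and g: "g \<in> carrier G" for h g
    proof (cases "g \<in> H")
      case True
      then show ?thesis using act(3)[OF z h True] h by (simp add: t_def)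
    next
      case False
      have "h \<otimes> g \<notin> H"
      proof
        assume "h \<otimes> g \<in> H"
        then have "inv h \<otimes> (h \<otimes> g) \<in> H" using h by simp
        moreover have "inv h \<otimes> (h \<otimes> g) = g" using h g by (simp add: G.m_assoc[symmetric])
        ultimately show False using False by simp
      qed
      then show ?thesis using False Ci.smult_zero[OF bS[OF h]] by (simp add: t_def)
    qed
  qed blast
  then obtain u where u: "\<And>z. z \<in> carrier (C i) \<Longrightarrow> u z \<in> carrier (?K i)"
    "\<And>z g. \<lbrakk>z \<in> carrier (C i); g \<in> carrier G\<rbrakk> \<Longrightarrow> u z (basis_elt g) = t z g" by metis
  note b = basis_elt_closed[OF G]
  have uK: "u z \<in> carrier (cycles ?K ?\<delta> i)" if z: "z \<in> carrier ?Z" for z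
  proof -
    have zC: "z \<in> carrier (C i)" "d i z = \<zero>\<^bsub>C (i + 1)\<^esub>" using z by auto
    have "?\<delta> i (u z) = \<zero>\<^bsub>?K (i + 1)\<^esub>"
    proof (rule coinduced_eqI)
      show "abelian_group (C (i + 1))" using CD(1)[of "i + 1"] by (simp add: left_module_def)
      interpret Cj: left_module ?S "C (i + 1)" by (rule CD(1))
      interpret Kj: left_module ?R "?K (i + 1)" by (rule KD(1))
      show "?\<delta> i (u z) \<in> carrier (?K (i + 1))" by (rule lmod_homD(1)[OF KD(2) u(1)[OF zC(1)]])
      show "\<zero>\<^bsub>?K (i + 1)\<^esub> \<in> carrier (?K (i + 1))" by simp
      fix g assume g: "g \<in> carrier G"
      have "d i (t z g) = \<zero>\<^bsub>C (i + 1)\<^esub>"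
        using lmod_homD(3)[OF CD(2) bS zC(1)] zC(2) Cj.smult_zero[OF bS] lmod_hom_facts(1)[OF CD(1) CD(1) CD(2), of i]
        by (simp add: t_def)
      then show "?\<delta> i (u z) (basis_elt g) = \<zero>\<^bsub>?K (i + 1)\<^esub> (basis_elt g)"
        using b[OF g] u(2)[OF zC(1) g] by (simp add: coinduced_def)
    qed
    then show ?thesis using u(1)[OF zC(1)] by simp
  qed
  have u_add: "u (z \<oplus>\<^bsub>C i\<^esub> z') = u z \<oplus>\<^bsub>?K i\<^esub> u z'" if z: "z \<in> carrier (C i)" "z' \<in> carrier (C i)" for z z'
  proof (rule coinduced_eqI)
    interpret K: left_module ?R "?K i" by (rule KD(1))
    show "abelian_group (C i)" by (rule Ci.M.abelian_group_axioms)
    show "u (z \<oplus>\<^bsub>C i\<^esub> z') \<in> carrier (?K i)" "u z \<oplus>\<^bsub>?K i\<^esub> u z' \<in> carrier (?K i)" using u(1) z by simp_all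
    show "u (z \<oplus>\<^bsub>C i\<^esub> z') (basis_elt g) = (u z \<oplus>\<^bsub>?K i\<^esub> u z') (basis_elt g)" if g: "g \<in> carrier G" for g
      using u(2)[OF z(1) g] u(2)[OF z(2) g] u(2)[OF Ci.M.a_closed[OF z] g] act(4)[OF z(1) _ z(2), of g]
      by (simp add: coinduced_def t_def)
  qed
  have u_act: "u (basis_elt h \<odot>\<^bsub>C i\<^esub> z) = basis_elt h \<odot>\<^bsub>?K i\<^esub> u z" if h: "h \<in> H" and z: "z \<in> carrier (C i)" for h z
  proof (rule coinduced_eqI)
    interpret K: left_module ?R "?K i" by (rule KD(1))
    have hG: "h \<in> carrier G" using h by simp
    show "abelian_group (C i)" by (rule Ci.M.abelian_group_axioms)
    show "u (basis_elt h \<odot>\<^bsub>C i\<^esub> z) \<in> carrier (?K i)" by (rule u(1)[OF act(1)[OF z h]])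
    show "basis_elt h \<odot>\<^bsub>?K i\<^esub> u z \<in> carrier (?K i)" by (rule K.smult_closed[OF b[OF hG] u(1)[OF z]])
    fix g assume g: "g \<in> carrier G"
    have gh: "g \<otimes> h \<in> H \<longleftrightarrow> g \<in> H"
    proof
      assume "g \<otimes> h \<in> H"
      then have "g \<otimes> h \<otimes> inv h \<in> H" using h by simp
      then show "g \<in> H" using g hG by (simp add: G.m_assoc)
    qed (use h in simp)
    have "(basis_elt h \<odot>\<^bsub>?K i\<^esub> u z) (basis_elt g) = u z (basis_elt (g \<otimes> h))"
      using b[OF g] basis_elt_mult[OF G g hG] by (simp add: coinduced_def)
    also have "\<dots> = t z (g \<otimes> h)" using u(2)[OF z] g hG by simp
    also have "\<dots> = t (basis_elt h \<odot>\<^bsub>C i\<^esub> z) g" using act(3)[OF z _ h, of g] by (simp add: t_def gh)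
    finally show "u (basis_elt h \<odot>\<^bsub>C i\<^esub> z) (basis_elt g) = (basis_elt h \<odot>\<^bsub>?K i\<^esub> u z) (basis_elt g)"
      using u(2)[OF act(1)[OF z h] g] by simp
  qed
  note one = R.one_closed
  have \<sigma>u: "\<sigma> (u z) \<in> carrier (?K (i - 1))" if "z \<in> carrier ?Z" for z by (rule lmod_homD(1)[OF \<sigma> uK[OF that]])
  define \<tau> where "\<tau> z = \<sigma> (u z) \<one>\<^bsub>?R\<^esub>" for z
  have "\<tau> \<in> lmod_hom ?S ?Z (C (i - 1))"
  proof (rule lmod_hom_equivariant[OF gH CD(6) CD(1)])
    fix z assume z: "z \<in> carrier ?Z"
    show "\<tau> z \<in> carrier (C (i - 1))" unfolding \<tau>_def by (rule RS.coinduced_carrier(1)[OF \<sigma>u[OF z] one])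
    show "\<tau> (z \<oplus>\<^bsub>?Z\<^esub> z') = \<tau> z \<oplus>\<^bsub>C (i - 1)\<^esub> \<tau> z'" if z': "z' \<in> carrier ?Z" for z'
    proof -
      have "\<sigma> (u z \<oplus>\<^bsub>?K i\<^esub> u z') = \<sigma> (u z) \<oplus>\<^bsub>?K (i - 1)\<^esub> \<sigma> (u z')"
        using lmod_homD(2)[OF \<sigma> uK[OF z] uK[OF z']] by simp
      moreover have "u (z \<oplus>\<^bsub>C i\<^esub> z') = u z \<oplus>\<^bsub>?K i\<^esub> u z'" using u_add z z' by simp
      ultimately show ?thesis by (simp add: \<tau>_def coinduced_def)
    qed
    show "\<tau> (basis_elt h \<odot>\<^bsub>?Z\<^esub> z) = basis_elt h \<odot>\<^bsub>C (i - 1)\<^esub> \<tau> z" if "h \<in> carrier (G\<lparr>carrier := H\<rparr>)" for h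
    proof -
      have h: "h \<in> H" "h \<in> carrier G" using that by auto
      have "\<tau> (basis_elt h \<odot>\<^bsub>C i\<^esub> z) = (basis_elt h \<odot>\<^bsub>?K (i - 1)\<^esub> \<sigma> (u z)) \<one>\<^bsub>?R\<^esub>"
        unfolding \<tau>_def using u_act[OF h(1), of z] z lmod_homD(3)[OF \<sigma> b[OF h(2)] uK[OF z]] by simp
      also have "\<dots> = \<sigma> (u z) (basis_elt h \<otimes>\<^bsub>?R\<^esub> \<one>\<^bsub>?R\<^esub>)" using b[OF h(2)] by (simp add: coinduced_def)
      also have "\<dots> = basis_elt h \<odot>\<^bsub>C (i - 1)\<^esub> \<tau> z"
        unfolding \<tau>_def by (rule RS.coinduced_carrier(3)[OF \<sigma>u[OF z] bS[OF h(1)] one])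
      finally show ?thesis by simp
    qed
  qed
  moreover have "d (i - 1) (\<tau> z) = z" if z: "z \<in> carrier ?Z" for z
  proof -
    have "d (i - 1) (\<tau> z) = u z \<one>\<^bsub>?R\<^esub>" using fun_cong[OF \<delta>\<sigma>[OF uK[OF z]], of "\<one>\<^bsub>?R\<^esub>"] by (simp add: \<tau>_def)
    also have "\<dots> = z" using u(2)[of z \<one>] z act(2)[of z] by (simp add: RG_one[OF G] t_def)
    finally show ?thesis .
  qed
  ultimately show "splits_at ?S C d i" unfolding splits_at_def by blast
qed

end

section \<open>Finite injective dimension\<close>

definition product_module :: "(nat \<Rightarrow> ('r, 'm) Module.module) \<Rightarrow> ('r, nat \<Rightarrow> 'm) Module.module" where
  "product_module M =
     \<lparr>carrier = {x. \<forall>n. x n \<in> carrier (M n)}, monoid.mult = (\<lambda>x y. x), monoid.one = (\<lambda>n. \<zero>\<^bsub>M n\<^esub>),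
      ring.zero = (\<lambda>n. \<zero>\<^bsub>M n\<^esub>), ring.add = (\<lambda>x y n. x n \<oplus>\<^bsub>M n\<^esub> y n), smult = (\<lambda>a x n. a \<odot>\<^bsub>M n\<^esub> x n)\<rparr>"

lemma product_module_simps [simp]:
  "x \<in> carrier (product_module M) \<longleftrightarrow> (\<forall>n. x n \<in> carrier (M n))"
  "ring.zero (product_module M) = (\<lambda>n. \<zero>\<^bsub>M n\<^esub>)"
  "ring.add (product_module M) x y = (\<lambda>n. x n \<oplus>\<^bsub>M n\<^esub> y n)"
  "smult (product_module M) a x = (\<lambda>n. a \<odot>\<^bsub>M n\<^esub> x n)"
  by (simp_all add: product_module_def)

lemma left_module_product:
  assumes R: "Ring.ring R" and M: "\<And>n. left_module R (M n)"
  shows "left_module R (product_module M)"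
proof -
  have ab: "abelian_group (M n)" for n using M[of n] by (simp add: left_module_def)
  note * = left_module.smult_closed[OF M] left_module.smult_l_distr[OF M] left_module.smult_r_distr[OF M]
    left_module.smult_assoc[OF M] left_module.smult_one[OF M]
    abelian_monoid.a_closed[OF abelian_group.axioms(1)[OF ab]] abelian_monoid.a_assoc[OF abelian_group.axioms(1)[OF ab]]
    abelian_monoid.zero_closed[OF abelian_group.axioms(1)[OF ab]] abelian_monoid.l_zero[OF abelian_group.axioms(1)[OF ab]]
  show ?thesis
  proof (rule left_moduleI)
    show "x \<oplus>\<^bsub>product_module M\<^esub> y = y \<oplus>\<^bsub>product_module M\<^esub> x"
      if "x \<in> carrier (product_module M)" "y \<in> carrier (product_module M)" for x y
      using that abelian_monoid.a_comm[OF abelian_group.axioms(1)[OF ab]] by (simp add: fun_eq_iff)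
    show "\<exists>y\<in>carrier (product_module M). y \<oplus>\<^bsub>product_module M\<^esub> x = \<zero>\<^bsub>product_module M\<^esub>"
      if "x \<in> carrier (product_module M)" for x
      using that abelian_group.l_neg[OF ab] abelian_group.a_inv_closed[OF ab]
      by (intro bexI[of _ "\<lambda>n. \<ominus>\<^bsub>M n\<^esub> x n"]) (simp_all add: fun_eq_iff)
  qed (simp_all add: * R fun_eq_iff)
qed

lemma injective_product:
  fixes M :: "nat \<Rightarrow> ('r, 'u) lmod"
  assumes R: "Ring.ring R" and M: "\<And>n. injective_module R (M n)" and e: "inj e"
  shows "injective_module R (transport e (product_module M) :: ('r, 'u) lmod)"
  unfolding injective_module_def
proof (intro conjI allI impI, goal_cases)
  note t = transport_inj[OF left_module_product[OF R injective_module_left_module[OF M]] e]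
  case 1
  show ?case by (rule t(1))
next
  note t = transport_inj[OF left_module_product[OF R injective_module_left_module[OF M]] e]
  case (2 A B i f)
  have "(\<lambda>x. the_inv e (f x) n) \<in> lmod_hom R A (M n)" for n
    using lmod_homD[OF lmod_hom_compose[OF conjunct2[OF conjunct2[OF conjunct2[OF conjunct2[OF 2]]]] t(5)]]
    by (intro lmod_homI) simp_all
  then have "\<exists>g\<in>lmod_hom R B (M n). \<forall>x\<in>carrier A. g (i x) = the_inv e (f x) n" for n
    using 2 M[of n] unfolding injective_module_def by blast
  then obtain g where g: "\<And>n. g n \<in> lmod_hom R B (M n)" "\<And>n x. x \<in> carrier A \<Longrightarrow> g n (i x) = the_inv e (f x) n"
    by metis
  have h: "(\<lambda>b n. g n b) \<in> lmod_hom R B (product_module M)"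
    using lmod_homD[OF g(1)] by (intro lmod_homI) simp_all
  show ?case
  proof (intro bexI ballI)
    show "(\<lambda>b. e (\<lambda>n. g n b)) \<in> lmod_hom R B (transport e (product_module M))" by (rule lmod_hom_compose[OF h t(4)])
    fix x assume x: "x \<in> carrier A"
    have "f x \<in> carrier (transport e (product_module M))" using 2 x lmod_homD(1)[of f R A _ x] by blast
    then obtain y where y: "f x = e y" unfolding t(2) by blast
    show "e (\<lambda>n. g n (i x)) = f x" unfolding g(2)[OF x] y the_inv_f_f[OF e] ..
  qed
qed

text \<open>The n-th factor is C shifted n degrees to the right, so degree i of the product contains
  every C(i - n) at once.\<close>

lemma product_complex:
  assumes R: "Ring.ring R" and A: "acyclic_complex R C d"
  shows "acyclic_complex R (\<lambda>i. product_module (\<lambda>n. C (i - int n))) (\<lambda>i x n. d (i - int n) (x n))" (is "acyclic_complex R ?P ?D")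
proof -
  note CD = module_complexD[OF acyclic_complexD(1)[OF A]]
  have i1: "i + 1 - int n = i - int n + 1" and i2: "i + 2 - int n = i - int n + 2" and i3: "k + 1 + 1 = k + 2"
    for i k :: int and n by simp_all
  have C: "module_complex R ?P ?D"
    unfolding module_complex_def
  proof (intro conjI allI ballI)
    fix i
    show "left_module R (?P i)" by (rule left_module_product[OF R CD(1)])
    show "?D i \<in> lmod_hom R (?P i) (?P (i + 1))"
      by (rule lmod_homI) (simp_all add: i1 lmod_homD[OF CD(2)])
    show "?D (i + 1) (?D i x) = \<zero>\<^bsub>?P (i + 2)\<^esub>" if "x \<in> carrier (?P i)" for x
      using CD(4) that by (simp add: i1 i2 fun_eq_iff)
  qed
  show ?thesis
  proof (rule acyclic_complexI[OF C])
    fix i x assume x: "x \<in> carrier (?P (i + 1))" and z: "?D (i + 1) x = \<zero>\<^bsub>?P (i + 2)\<^esub>"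
    have "\<exists>y\<in>carrier (C (i - int n)). d (i - int n) y = x n" for n
    proof -
      have xn: "x n \<in> carrier (C (i - int n + 1))" using x by (simp add: i1)
      have "d (i - int n + 1) (x n) = \<zero>\<^bsub>C (i - int n + 1 + 1)\<^esub>"
        using fun_cong[OF z, of n] by (simp only: product_module_simps i1 i2 i3)
      from acyclic_complexD(2)[OF A xn this] show ?thesis by simp
    qed
    then obtain y where "\<And>n. y n \<in> carrier (C (i - int n))" "\<And>n. d (i - int n) (y n) = x n" by metis
    then show "\<exists>y\<in>carrier (?P i). ?D i y = x" by (intro bexI[of _ y]) auto
  qed
qed

lemma inj_dim_injective:
  assumes M: "injective_module R M"
  shows "inj_dim R M \<le> enat n"
proof -
  interpret M: left_module R M by (rule injective_module_left_module[OF M])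
  define I where "I k = (if k = 0 then M else zero_module M)" for k :: nat
  have [simp]: "ring.zero (I k) = ring.zero M" "ring.add (I k) = ring.add M" "smult (I k) = smult M" for k
    by (simp_all add: I_def zero_module_def)
  have car: "carrier (I k) = (if k = 0 then carrier M else {\<zero>\<^bsub>M\<^esub>})" for k by (simp add: I_def zero_module_def)
  have "injective_resolution R M I (\<lambda>x. x) (\<lambda>_ _. \<zero>\<^bsub>M\<^esub>)"
    unfolding injective_resolution_def
  proof (intro conjI allI)
    show "injective_module R (I k)" for k using M injective_zero_module[OF M] by (simp add: I_def)
    show "(\<lambda>_. \<zero>\<^bsub>M\<^esub>) \<in> lmod_hom R (I k) (I (Suc k))" for k by (rule lmod_homI) (auto simp: car M.smult_zero)
  qed (auto simp: car lmod_ker_def lmod_hom_def)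
  moreover have "\<forall>k>0. carrier (I k) = {\<zero>\<^bsub>I k\<^esub>}" by (simp add: car)
  ultimately have "enat 0 \<in> {enat n | n. \<exists>I \<epsilon> d. injective_resolution R M I \<epsilon> d \<and> (\<forall>i>n. carrier (I i) = {\<zero>\<^bsub>I i\<^esub>})}" by blast
  then have "inj_dim R M \<le> enat 0" unfolding inj_dim_def by (rule Inf_lower)
  then show ?thesis by (rule order_trans) simp
qed

lemma finite_inj_dimE:
  fixes M :: "('r, 'u) lmod"
  assumes "inj_dim R M < \<infinity>"
  obtains n and I :: "nat \<Rightarrow> ('r, 'u) lmod" and \<epsilon> d where "injective_resolution R M I \<epsilon> d" "\<And>i. i > n \<Longrightarrow> carrier (I i) = {\<zero>\<^bsub>I i\<^esub>}"
proof -
  have "\<exists>n (I :: nat \<Rightarrow> ('r, 'u) lmod) \<epsilon> d. injective_resolution R M I \<epsilon> d \<and> (\<forall>i>n. carrier (I i) = {\<zero>\<^bsub>I i\<^esub>})"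
  proof (rule ccontr)
    assume "\<not> ?thesis"
    then have "inj_dim R M = Inf {}" unfolding inj_dim_def by (intro arg_cong[of _ _ Inf]) blast
    then show False using assms by (simp add: top_enat_def)
  qed
  then show ?thesis using that by blast
qed

text \<open>Schanuel's lemma in the form of a chain homotopy: the comparison maps \<open>a\<close>, \<open>b\<close> between the syzygies of two
  injective resolutions satisfy \<open>b \<circ> a = id\<close> up to a map \<open>t\<close> that extends over the injective module.\<close>

lemma comparison_step:
  fixes I I' E E' :: "('r, 'u) lmod"
  assumes I: "injective_module R I" and E: "injective_module R E" and I': "injective_module R I'" and E': "left_module R E'"
    and d: "d \<in> lmod_hom R I I'" and \<delta>: "\<delta> \<in> lmod_hom R E E'"
    and a: "a \<in> lmod_hom R (I\<lparr>carrier := lmod_ker I I' d\<rparr>) (E\<lparr>carrier := lmod_ker E E' \<delta>\<rparr>)"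
    and b: "b \<in> lmod_hom R (E\<lparr>carrier := lmod_ker E E' \<delta>\<rparr>) (I\<lparr>carrier := lmod_ker I I' d\<rparr>)"
    and t: "t \<in> lmod_hom R I I" "\<And>x. x \<in> carrier I \<Longrightarrow> d (t x) = \<zero>\<^bsub>I'\<^esub>"
    and ab: "\<And>z. z \<in> lmod_ker I I' d \<Longrightarrow> b (a z) \<oplus>\<^bsub>I\<^esub> t z = z"
  obtains a' b' t' where "a' \<in> lmod_hom R (I'\<lparr>carrier := d ` carrier I\<rparr>) (E'\<lparr>carrier := \<delta> ` carrier E\<rparr>)"
    "b' \<in> lmod_hom R (E'\<lparr>carrier := \<delta> ` carrier E\<rparr>) (I'\<lparr>carrier := d ` carrier I\<rparr>)"
    "t' \<in> lmod_hom R I' I'" "t' ` carrier I' \<subseteq> d ` carrier I"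
    "\<And>z. z \<in> d ` carrier I \<Longrightarrow> b' (a' z) \<oplus>\<^bsub>I'\<^esub> t' z = z"
proof -
  note lI = injective_module_left_module[OF I] and lE = injective_module_left_module[OF E]
    and lI' = injective_module_left_module[OF I']
  interpret I: left_module R I by (rule lI)
  interpret E: left_module R E by (rule lE)
  interpret I': left_module R I' by (rule lI')
  interpret E': left_module R E' by (rule E')
  let ?Z = "I\<lparr>carrier := lmod_ker I I' d\<rparr>" and ?M = "E\<lparr>carrier := lmod_ker E E' \<delta>\<rparr>"
  let ?Z' = "I'\<lparr>carrier := d ` carrier I\<rparr>" and ?M' = "E'\<lparr>carrier := \<delta> ` carrier E\<rparr>"
  have Z: "left_module R ?Z" and M: "left_module R ?M"
    by (rule left_module_ker[OF lI lI' d], rule left_module_ker[OF lE E' \<delta>])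
  have image: "left_module R (N\<lparr>carrier := f ` carrier L\<rparr>)" "f \<in> lmod_hom R L (N\<lparr>carrier := f ` carrier L\<rparr>)"
    if L: "left_module R L" and N: "left_module R N" and f: "f \<in> lmod_hom R L N" for f and L N :: "('r, 'u) lmod"
  proof -
    interpret L: left_module R L by (rule L)
    interpret N: left_module R N by (rule N)
    show "left_module R (N\<lparr>carrier := f ` carrier L\<rparr>)"
    proof (rule N.submodule)
      show "\<zero>\<^bsub>N\<^esub> \<in> f ` carrier L" using lmod_hom_facts(1)[OF L N f] L.M.zero_closed by (metis imageI)
      show "x \<oplus>\<^bsub>N\<^esub> y \<in> f ` carrier L" if "x \<in> f ` carrier L" "y \<in> f ` carrier L" for x y
        using that lmod_homD(2)[OF f, symmetric] by auto
      show "a \<odot>\<^bsub>N\<^esub> x \<in> f ` carrier L" if "a \<in> carrier R" "x \<in> f ` carrier L" for a x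
        using that lmod_homD(3)[OF f, symmetric] L.smult_closed by auto
    qed (use lmod_homD(1)[OF f] in blast)
    show "f \<in> lmod_hom R L (N\<lparr>carrier := f ` carrier L\<rparr>)" using f by (auto simp: lmod_hom_def)
  qed
  note Z' = image[OF lI lI' d] and M' = image[OF lE E' \<delta>]
  have incl: "(\<lambda>x. x) \<in> lmod_hom R ?Z I" "(\<lambda>x. x) \<in> lmod_hom R ?M E" "(\<lambda>x. x) \<in> lmod_hom R ?Z' I'" "(\<lambda>x. x) \<in> lmod_hom R ?M' E'"
    using lmod_homD(1)[OF d] lmod_homD(1)[OF \<delta>] by (auto simp: lmod_hom_def lmod_ker_def)
  obtain A where A: "A \<in> lmod_hom R I E" "\<And>x. x \<in> carrier ?Z \<Longrightarrow> A x = a x"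
    using injective_moduleD[OF E Z lI incl(1) inj_on_id2 lmod_hom_compose[OF a incl(2)]] by metis
  obtain B where B: "B \<in> lmod_hom R E I" "\<And>y. y \<in> carrier ?M \<Longrightarrow> B y = b y"
    using injective_moduleD[OF I M lE incl(2) inj_on_id2 lmod_hom_compose[OF b incl(1)]] by metis
  obtain a' where a': "a' \<in> lmod_hom R ?Z' ?M'" "\<And>x. x \<in> carrier I \<Longrightarrow> a' (d x) = \<delta> (A x)"
  proof (rule lmod_hom_factor[OF lI M'(1) Z'(2) _ Z'(1) lmod_hom_compose[OF A(1) M'(2)]])
    show "\<delta> (A x) = \<zero>\<^bsub>?M'\<^esub>" if "x \<in> carrier I" "d x = \<zero>\<^bsub>?Z'\<^esub>" for x
      using that A(2)[of x] lmod_homD(1)[OF a, of x] by (simp add: lmod_ker_def)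
  qed (use that in auto)
  obtain b' where b': "b' \<in> lmod_hom R ?M' ?Z'" "\<And>y. y \<in> carrier E \<Longrightarrow> b' (\<delta> y) = d (B y)"
  proof (rule lmod_hom_factor[OF lE Z'(1) M'(2) _ M'(1) lmod_hom_compose[OF B(1) Z'(2)]])
    show "d (B y) = \<zero>\<^bsub>?Z'\<^esub>" if "y \<in> carrier E" "\<delta> y = \<zero>\<^bsub>?M'\<^esub>" for y
      using that B(2)[of y] lmod_homD(1)[OF b, of y] by (simp add: lmod_ker_def)
  qed (use that in auto)
  \<comment> \<open>On cycles x = b(a x) + t x, so r vanishes there and factors through d. Extending
    the factor over I' to T and setting t' = d T yields the new homotopy; d t = 0 makes the term
    with t disappear.\<close>
  define r where "r x = x \<ominus>\<^bsub>I\<^esub> B (A x) \<ominus>\<^bsub>I\<^esub> t x" for x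
  have BA: "(\<lambda>x. B (A x)) \<in> lmod_hom R I I" by (rule lmod_hom_compose[OF A(1) B(1)])
  have r: "r \<in> lmod_hom R I I"
    unfolding r_def[abs_def] by (rule lmod_hom_diff[OF lI lmod_hom_diff[OF lI lmod_hom_id BA] t(1)])
  have cl: "B (A x) \<in> carrier I" "t x \<in> carrier I" if "x \<in> carrier I" for x
    using lmod_homD(1)[OF BA that] lmod_homD(1)[OF t(1) that] by auto
  have cancel: "p \<ominus>\<^bsub>I\<^esub> q \<ominus>\<^bsub>I\<^esub> s = \<zero>\<^bsub>I\<^esub>" if "q \<oplus>\<^bsub>I\<^esub> s = p" "q \<in> carrier I" "s \<in> carrier I" for p q s
    unfolding that(1)[symmetric] using that(2,3) by algebra
  obtain T0 where T0: "T0 \<in> lmod_hom R ?Z' I" "\<And>x. x \<in> carrier I \<Longrightarrow> T0 (d x) = r x"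
  proof (rule lmod_hom_factor[OF lI lI Z'(2) _ Z'(1) r])
    show "r x = \<zero>\<^bsub>I\<^esub>" if x: "x \<in> carrier I" "d x = \<zero>\<^bsub>?Z'\<^esub>" for x
    proof -
      have xz: "x \<in> lmod_ker I I' d" using x by (simp add: lmod_ker_def)
      have "a x \<in> lmod_ker E E' \<delta>" using lmod_homD(1)[OF a, of x] xz by simp
      then have "B (A x) = b (a x)" using A(2)[of x] B(2)[of "a x"] xz by simp
      then show ?thesis unfolding r_def using ab[OF xz] cl[OF x(1)] by (intro cancel) simp_all
    qed
  qed (use that in auto)
  obtain T where T: "T \<in> lmod_hom R I' I" "\<And>z. z \<in> carrier ?Z' \<Longrightarrow> T z = T0 z"
    using injective_moduleD[OF I Z'(1) lI' incl(3) inj_on_id2 T0(1)] by metis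
  show ?thesis
  proof (rule that[OF a'(1) b'(1) lmod_hom_compose[OF T(1) d]])
    show "(\<lambda>x. d (T x)) ` carrier I' \<subseteq> d ` carrier I" using lmod_homD(1)[OF T(1)] by blast
    fix z assume "z \<in> d ` carrier I"
    then obtain x where x: "x \<in> carrier I" "z = d x" by blast
    have "d (T z) = d (r x)" using T(2)[of z] T0(2)[OF x(1)] x by simp
    also have "\<dots> = d (x \<ominus>\<^bsub>I\<^esub> B (A x)) \<ominus>\<^bsub>I'\<^esub> d (t x)"
      unfolding r_def using lmod_hom_facts(3)[OF lI lI' d, of "x \<ominus>\<^bsub>I\<^esub> B (A x)" "t x"] cl[OF x(1)] x(1) by simp
    also have "\<dots> = d x \<ominus>\<^bsub>I'\<^esub> d (B (A x)) \<ominus>\<^bsub>I'\<^esub> \<zero>\<^bsub>I'\<^esub>"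
      using lmod_hom_facts(3)[OF lI lI' d x(1) cl(1)[OF x(1)]] t(2)[OF x(1)] by simp
    finally have dT: "d (T z) = d x \<ominus>\<^bsub>I'\<^esub> d (B (A x)) \<ominus>\<^bsub>I'\<^esub> \<zero>\<^bsub>I'\<^esub>" .
    have ba: "b' (a' z) = d (B (A x))" using a'(2)[OF x(1)] b'(2)[OF lmod_homD(1)[OF A(1) x(1)]] x(2) by simp
    have pq: "p \<oplus>\<^bsub>I'\<^esub> (q \<ominus>\<^bsub>I'\<^esub> p \<ominus>\<^bsub>I'\<^esub> \<zero>\<^bsub>I'\<^esub>) = q" if "p \<in> carrier I'" "q \<in> carrier I'" for p q
    proof -
      have "\<ominus>\<^bsub>I'\<^esub> \<zero>\<^bsub>I'\<^esub> = \<zero>\<^bsub>I'\<^esub>" by (metis I'.M.minus_equality I'.M.l_zero I'.M.zero_closed)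
      then have "q \<ominus>\<^bsub>I'\<^esub> p \<ominus>\<^bsub>I'\<^esub> \<zero>\<^bsub>I'\<^esub> = q \<ominus>\<^bsub>I'\<^esub> p" using that by (simp add: I'.M.minus_eq)
      moreover have "p \<oplus>\<^bsub>I'\<^esub> (q \<ominus>\<^bsub>I'\<^esub> p) = q" using that by algebra
      ultimately show ?thesis by simp
    qed
    show "b' (a' z) \<oplus>\<^bsub>I'\<^esub> d (T z) = z"
      unfolding dT ba unfolding x(2) by (rule pq[OF lmod_homD(1)[OF d cl(1)[OF x(1)]] lmod_homD(1)[OF d x(1)]])
  qed
qed

text \<open>The comparison is carried N degrees to the right, starting from the retraction with t =
  0. Where the resolution is zero the map a vanishes, so t is the identity on cycles; being defined
  on the whole injective module with values in the cycles, it is a retraction onto them.\<close>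

lemma injective_cycles_if_finite_resolution:
  fixes C :: "int \<Rightarrow> ('r, 'u) lmod" and M :: "('r, 'u) lmod" and E :: "nat \<Rightarrow> ('r, 'u) lmod"
  assumes A: "acyclic_complex R C d" and inj: "\<And>i. injective_module R (C i)"
    and M: "left_module R M" and a: "a \<in> lmod_hom R (cycles C d j) M" and b: "b \<in> lmod_hom R M (cycles C d j)"
    and ba: "\<And>z. z \<in> carrier (cycles C d j) \<Longrightarrow> b (a z) = z"
    and E: "injective_resolution R M E \<epsilon> \<delta>" and N: "carrier (E N) = {\<zero>\<^bsub>E N\<^esub>}"
  shows "injective_module R (cycles C d (j + int N))"
proof -
  note CD = module_complexD[OF acyclic_complexD(1)[OF A]]
  have Ei: "injective_module R (E k)" and \<delta>: "\<delta> k \<in> lmod_hom R (E k) (E (Suc k))"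
    and ex: "\<delta> k ` carrier (E k) = lmod_ker (E (Suc k)) (E (Suc (Suc k))) (\<delta> (Suc k))" for k
    using E by (auto simp: injective_resolution_def)
  have \<epsilon>: "\<epsilon> \<in> lmod_hom R M (E 0)" "inj_on \<epsilon> (carrier M)" "\<epsilon> ` carrier M = lmod_ker (E 0) (E (Suc 0)) (\<delta> 0)"
    using E by (auto simp: injective_resolution_def)
  have lE: "left_module R (E k)" for k by (rule injective_module_left_module[OF Ei])
  let ?M = "\<lambda>k. E k\<lparr>carrier := lmod_ker (E k) (E (Suc k)) (\<delta> k)\<rparr>" and ?Z = "\<lambda>k. cycles C d (j + int k)"
  define Q where "Q k a b t \<longleftrightarrow> a \<in> lmod_hom R (?Z k) (?M k) \<and> b \<in> lmod_hom R (?M k) (?Z k) \<and> t \<in> lmod_hom R (C (j + int k)) (C (j + int k)) \<and>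
    (\<forall>x\<in>carrier (C (j + int k)). d (j + int k) (t x) = \<zero>\<^bsub>C (j + int k + 1)\<^esub>) \<and>
    (\<forall>z\<in>carrier (?Z k). b (a z) \<oplus>\<^bsub>C (j + int k)\<^esub> t z = z)" for k a b t
  have QD: "a \<in> lmod_hom R (?Z k) (?M k)" "b \<in> lmod_hom R (?M k) (?Z k)" "t \<in> lmod_hom R (C (j + int k)) (C (j + int k))"
    "\<And>x. x \<in> carrier (C (j + int k)) \<Longrightarrow> d (j + int k) (t x) = \<zero>\<^bsub>C (j + int k + 1)\<^esub>"
    "\<And>z. z \<in> carrier (?Z k) \<Longrightarrow> b (a z) \<oplus>\<^bsub>C (j + int k)\<^esub> t z = z" if "Q k a b t" for k a b t
    using that unfolding Q_def by metis+
  have ex_Q: "\<exists>a b t. Q k a b t" for k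
  proof (induction k)
    case 0
    have \<epsilon>': "\<epsilon> \<in> lmod_hom R M (?M 0)" using \<epsilon> by (auto simp: lmod_hom_def)
    have "bij_betw \<epsilon> (carrier M) (carrier (?M 0))" using \<epsilon>(2,3) by (simp add: bij_betw_def)
    then obtain \<eta> where \<eta>: "\<eta> \<in> lmod_hom R (?M 0) M" "\<And>x. x \<in> carrier M \<Longrightarrow> \<eta> (\<epsilon> x) = x"
      using lmod_hom_inverse[OF M left_module_ker[OF lE lE \<delta>] \<epsilon>'] by metis
    interpret Cj: left_module R "C j" by (rule CD(1))
    interpret Ck: left_module R "C (j + 1)" by (rule CD(1))
    show ?case
      unfolding Q_def
    proof (intro exI conjI)
      show "(\<lambda>z. \<epsilon> (a z)) \<in> lmod_hom R (?Z 0) (?M 0)" using lmod_hom_compose[OF a \<epsilon>'] by simp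
      show "(\<lambda>y. b (\<eta> y)) \<in> lmod_hom R (?M 0) (?Z 0)" using lmod_hom_compose[OF \<eta>(1) b] by simp
      show "(\<lambda>_. \<zero>\<^bsub>C j\<^esub>) \<in> lmod_hom R (C (j + int 0)) (C (j + int 0))" by (rule lmod_homI) (simp_all add: Cj.smult_zero)
      show "\<forall>x\<in>carrier (C (j + int 0)). d (j + int 0) \<zero>\<^bsub>C j\<^esub> = \<zero>\<^bsub>C (j + int 0 + 1)\<^esub>"
        using lmod_hom_facts(1)[OF CD(1) CD(1) CD(2)[of j]] by simp
      show "\<forall>z\<in>carrier (?Z 0). b (\<eta> (\<epsilon> (a z))) \<oplus>\<^bsub>C (j + int 0)\<^esub> \<zero>\<^bsub>C j\<^esub> = z"
        using \<eta>(2)[OF lmod_homD(1)[OF a]] ba by simp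
    qed
  next
    case (Suc k)
    then obtain a b t where Q: "Q k a b t" by blast
    note * = QD[OF Q]
    have k1: "j + int (Suc k) = j + int k + 1" by simp
    have Z': "C (j + int k + 1)\<lparr>carrier := d (j + int k) ` carrier (C (j + int k))\<rparr> = ?Z (Suc k)"
    proof -
      have "d (j + int k) ` carrier (C (j + int k)) = lmod_ker (C (j + int k + 1)) (C (j + int k + 2)) (d (j + int k + 1))"
        using A unfolding acyclic_complex_def by blast
      moreover have "j + int k + 1 + 1 = j + int k + 2" by simp
      ultimately show ?thesis unfolding k1 cycles_def by (simp only:)
    qed
    have img: "d (j + int k) ` carrier (C (j + int k)) = carrier (?Z (Suc k))" using arg_cong[OF Z', of carrier] by simp
    let ?Z' = "C (j + int k + 1)\<lparr>carrier := d (j + int k) ` carrier (C (j + int k))\<rparr>"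
      and ?M' = "E (Suc k)\<lparr>carrier := \<delta> k ` carrier (E k)\<rparr>" and ?d = "d (j + int k) ` carrier (C (j + int k))"
    have ab: "b (a z) \<oplus>\<^bsub>C (j + int k)\<^esub> t z = z" if "z \<in> lmod_ker (C (j + int k)) (C (j + int k + 1)) (d (j + int k))" for z
      using *(5)[of z] that by (simp add: lmod_ker_def)
    obtain a' b' t' where 1: "a' \<in> lmod_hom R ?Z' ?M'" "b' \<in> lmod_hom R ?M' ?Z'"
      "t' \<in> lmod_hom R (C (j + int k + 1)) (C (j + int k + 1))" "t' ` carrier (C (j + int k + 1)) \<subseteq> ?d"
      "\<And>z. z \<in> ?d \<Longrightarrow> b' (a' z) \<oplus>\<^bsub>C (j + int k + 1)\<^esub> t' z = z"
      using comparison_step[OF inj[of "j + int k"] Ei[of k] inj[of "j + int k + 1"] lE[of "Suc k"] CD(2)[of "j + int k"] \<delta>[of k]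
          *(1)[unfolded cycles_def] *(2)[unfolded cycles_def] *(3) *(4) ab] by metis
    have "Q (Suc k) a' b' t'"
      unfolding Q_def
    proof (intro conjI ballI)
      show "a' \<in> lmod_hom R (?Z (Suc k)) (?M (Suc k))" "b' \<in> lmod_hom R (?M (Suc k)) (?Z (Suc k))"
        using 1(1,2) unfolding Z' ex .
      show "t' \<in> lmod_hom R (C (j + int (Suc k))) (C (j + int (Suc k)))" unfolding k1 by (rule 1(3))
      show "d (j + int (Suc k)) (t' x) = \<zero>\<^bsub>C (j + int (Suc k) + 1)\<^esub>" if x: "x \<in> carrier (C (j + int (Suc k)))" for x
      proof -
        have "t' x \<in> ?d" using 1(4) x unfolding k1 by blast
        then have "t' x \<in> carrier (?Z (Suc k))" unfolding img .
        then show ?thesis by (simp only: cycles_simps mem_Collect_eq)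
      qed
      show "b' (a' z) \<oplus>\<^bsub>C (j + int (Suc k))\<^esub> t' z = z" if "z \<in> carrier (?Z (Suc k))" for z
        using 1(5)[of z] that unfolding img k1 .
    qed
    then show ?case by blast
  qed
  let ?C = "C (j + int N)"
  obtain a b t where Q: "Q N a b t" using ex_Q by blast
  note * = QD[OF Q]
  interpret C: left_module R ?C by (rule CD(1))
  have tz: "t z = z" if z: "z \<in> carrier (?Z N)" for z
  proof -
    have "a z \<in> carrier (E N)" using lmod_homD(1)[OF *(1) z] by (simp add: lmod_ker_def)
    then have "a z = \<zero>\<^bsub>E N\<^esub>" using N by simp
    then have "b (a z) = \<zero>\<^bsub>?C\<^esub>"
      using lmod_hom_facts(1)[OF left_module_ker[OF lE lE \<delta>] CD(6) *(2)] by simp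
    then show ?thesis using *(5)[OF z] lmod_homD(1)[OF *(3)] z by simp
  qed
  show ?thesis
  proof (rule injective_module_retract[OF inj[of "j + int N"] CD(6), of "\<lambda>z. z" _ t])
    show "(\<lambda>z. z) \<in> lmod_hom R (?Z N) ?C" by (auto simp: lmod_hom_def)
    show "t \<in> lmod_hom R ?C (?Z N)" using *(3,4) by (auto simp: lmod_hom_def)
    show "t z = z" if "z \<in> carrier (?Z N)" for z by (rule tz[OF that])
  qed
qed

lemma acyclic_restrict:
  assumes G: "Group.group G" and H: "subgroup H G" and A: "acyclic_complex \<int>\<langle>G\<rangle> C d"
  shows "acyclic_complex \<int>\<langle>G\<lparr>carrier := H\<rparr>\<rangle> C d"
  using A left_module_subgroup[OF G _ H] lmod_hom_subring[OF _ carrier_RS[OF G H]]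
  unfolding acyclic_complex_def module_complex_def by blast

text \<open>Membership in \<open>Phi_inj\<close> gives a finite injective dimension for each module
  separately, with no uniform bound. Applied to the cycles of the product of all shifts it gives one
  N that serves every factor; then the factor whose cycles lie N degrees to the left of the target
  can be selected.\<close>

lemma acyclics_contractible_Phi_inj:
  fixes G :: "'a monoid"
  assumes G: "G \<in> Phi_inj TYPE('u) \<Z> \<CC>"
    and P: "\<And>K. \<lbrakk>subgroup K G; G\<lparr>carrier := K\<rparr> \<in> \<CC>\<rbrakk> \<Longrightarrow> acyclics_contractible TYPE('u) (G\<lparr>carrier := K\<rparr>)"
  shows "acyclics_contractible TYPE('u) G"
  unfolding acyclics_contractible_def
proof (intro allI impI, elim conjE)
  let ?R = "\<int>\<langle>G\<rangle>"
  fix C :: "int \<Rightarrow> ('a \<Rightarrow> int, 'u) lmod" and d and i :: int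
  assume A: "acyclic_complex ?R C d" and inj: "\<forall>i. injective_module ?R (C i)"
  note CD = module_complexD[OF acyclic_complexD(1)[OF A]]
  have grp: "Group.group G" using G by (simp add: Phi_inj_def)
  note ring = ring_RG[OF grp]
  let ?P = "\<lambda>i. product_module (\<lambda>n. C (i - int n))" and ?D = "\<lambda>i x n. d (i - int n) (x n)"
  have AP: "acyclic_complex ?R ?P ?D" by (rule product_complex[OF ring A])
  note PD = module_complexD[OF acyclic_complexD(1)[OF AP]]
  have "inj (\<lambda>n. Inr (Inl n) :: ('a \<Rightarrow> int) + nat + 'u)" by (auto intro: injI)
  then obtain e :: "(nat \<Rightarrow> ('a \<Rightarrow> int, 'u) universe) \<Rightarrow> ('a \<Rightarrow> int, 'u) universe" where e: "inj e"
    by (rule inj_function_universe)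
  let ?P' = "\<lambda>i. transport e (?P i)" and ?D' = "\<lambda>i x. e (?D i (the_inv e x))"
  note tr = transport_complex[OF AP e]
  have injP: "injective_module ?R (?P' j)" for j
    by (rule injective_product[OF ring _ e]) (rule inj[rule_format])
  \<comment> \<open>Injective cycles in degree i - 1 are what produces a splitting in degree
    i.\<close>
  let ?i = "i - 1"
  let ?M = "cycles ?P' ?D' ?i"
  note M = module_complexD(6)[OF acyclic_complexD(1)[OF tr(1)], of ?i]
  have "\<forall>K. subgroup K G \<and> G\<lparr>carrier := K\<rparr> \<in> \<CC> \<longrightarrow> inj_dim \<int>\<langle>G\<lparr>carrier := K\<rparr>\<rangle> ?M \<le> enat 0"
  proof (intro allI impI, elim conjE)
    fix K assume K: "subgroup K G" "G\<lparr>carrier := K\<rparr> \<in> \<CC>"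
    have AK: "acyclic_complex \<int>\<langle>G\<lparr>carrier := K\<rparr>\<rangle> ?P' ?D'" by (rule acyclic_restrict[OF grp K(1) tr(1)])
    have injK: "injective_module \<int>\<langle>G\<lparr>carrier := K\<rparr>\<rangle> (?P' j)" for j by (rule injective_subgroup[OF grp injP K(1)])
    show "inj_dim \<int>\<langle>G\<lparr>carrier := K\<rparr>\<rangle> ?M \<le> enat 0"
      by (rule inj_dim_injective[OF injective_cycles_if_splits[OF acyclic_complexD(1)[OF AK] injK acyclics_contractibleD[OF P[OF K] AK injK]]])
  qed
  then have "\<exists>n. \<forall>K. subgroup K G \<and> G\<lparr>carrier := K\<rparr> \<in> \<CC> \<longrightarrow> inj_dim \<int>\<langle>G\<lparr>carrier := K\<rparr>\<rangle> ?M \<le> enat n" by (rule exI)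
  moreover have "\<forall>M :: ('a \<Rightarrow> int, 'u) lmod. left_module ?R M \<longrightarrow> (inj_dim ?R M < \<infinity> \<longleftrightarrow>
      (\<exists>n. \<forall>K. subgroup K G \<and> G\<lparr>carrier := K\<rparr> \<in> \<CC> \<longrightarrow> inj_dim \<int>\<langle>G\<lparr>carrier := K\<rparr>\<rangle> M \<le> enat n))"
    using G by (simp add: Phi_inj_def)
  ultimately have "inj_dim ?R ?M < \<infinity>" using M by (simp only:)
  then obtain n and E :: "nat \<Rightarrow> ('a \<Rightarrow> int, 'u) lmod" and \<epsilon> \<delta>
    where E: "injective_resolution ?R ?M E \<epsilon> \<delta>" "\<And>i. i > n \<Longrightarrow> carrier (E i) = {\<zero>\<^bsub>E i\<^esub>}"
    by (rule finite_inj_dimE) blast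
  \<comment> \<open>The terms of the resolution vanish beyond n, so \<open>E N\<close> is zero.
    Factor N of the product in degree i - 1 is C(i - 1 - N), and N comparison steps lead from its
    cycles to those in degree i - 1.\<close>
  define N where "N = Suc n"
  let ?Z = "cycles C d (?i - int N)"
  define a where "a z = (\<lambda>n. if n = N then z else \<zero>\<^bsub>C (?i - int n)\<^esub>)" for z
  have ij: "?i + 1 - int m = ?i - int m + 1" for m by simp
  have a: "a \<in> lmod_hom ?R ?Z (cycles ?P ?D ?i)"
  proof (rule lmod_homI)
    fix z assume z: "z \<in> carrier ?Z"
    have ab: "abelian_group (C m)" for m using CD(1)[of m] by (simp add: left_module_def)
    note zc = abelian_monoid.zero_closed[OF abelian_group.axioms(1)[OF ab]]
      and lz = abelian_monoid.l_zero[OF abelian_group.axioms(1)[OF ab]]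
    have "a z m \<in> carrier (C (?i - int m))" for m using z zc by (auto simp: a_def)
    moreover have "d (?i - int m) (a z m) = \<zero>\<^bsub>C (?i - int m + 1)\<^esub>" for m
      using z lmod_hom_facts(1)[OF CD(1) CD(1) CD(2)[of "?i - int m"]] by (auto simp: a_def)
    ultimately show "a z \<in> carrier (cycles ?P ?D ?i)" by (simp add: ij fun_eq_iff del: diff_add_cancel)
    show "a (r \<odot>\<^bsub>?Z\<^esub> z) = r \<odot>\<^bsub>cycles ?P ?D ?i\<^esub> a z" if "r \<in> carrier ?R" for r
      using left_module.smult_zero[OF CD(1) that] by (auto simp: a_def fun_eq_iff)
    show "a (z \<oplus>\<^bsub>?Z\<^esub> z') = a z \<oplus>\<^bsub>cycles ?P ?D ?i\<^esub> a z'" for z'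
      using lz[OF zc] by (auto simp: a_def fun_eq_iff)
  qed
  have b: "(\<lambda>x. x N) \<in> lmod_hom ?R (cycles ?P ?D ?i) ?Z"
  proof (rule lmod_homI)
    fix x assume "x \<in> carrier (cycles ?P ?D ?i)"
    then have x: "\<And>m. x m \<in> carrier (C (?i - int m))" "?D ?i x = \<zero>\<^bsub>?P (?i + 1)\<^esub>" by auto
    have "d (?i - int N) (x N) = \<zero>\<^bsub>C (?i - int N + 1)\<^esub>"
      using fun_cong[OF x(2), of N] by (simp only: product_module_simps ij)
    then show "x N \<in> carrier ?Z" using x(1)[of N] by simp
  qed simp_all
  have "injective_module ?R (cycles C d (?i - int N + int N))"
  proof (rule injective_cycles_if_finite_resolution[OF A _ M lmod_hom_compose[OF a tr(2)] lmod_hom_compose[OF tr(3) b] _ E(1) E(2)])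
    show "the_inv e (e (a z)) N = z" for z by (simp add: the_inv_f_f[OF e] a_def)
  qed (use inj in \<open>auto simp: N_def\<close>)
  then have "injective_module ?R (cycles C d (i - 1))" by simp
  then show "splits_at ?R C d i" by (rule splits_if_injective_cycles[OF A])
qed

section \<open>The complex of additive maps with the diagonal action\<close>

definition additive_maps :: "('r, 'm) Module.module \<Rightarrow> ('r, 'n) Module.module \<Rightarrow> ('m \<Rightarrow> 'n) ring" where
  "additive_maps K M =
     \<lparr>carrier = {f. (\<forall>x\<in>carrier K. f x \<in> carrier M) \<and>
                   (\<forall>x\<in>carrier K. \<forall>y\<in>carrier K. f (x \<oplus>\<^bsub>K\<^esub> y) = f x \<oplus>\<^bsub>M\<^esub> f y) \<and>
                   (\<forall>x. x \<notin> carrier K \<longrightarrow> f x = \<zero>\<^bsub>M\<^esub>)},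
      monoid.mult = (\<lambda>f g. f), monoid.one = (\<lambda>_. \<zero>\<^bsub>M\<^esub>), ring.zero = (\<lambda>_. \<zero>\<^bsub>M\<^esub>), ring.add = (\<lambda>f g x. f x \<oplus>\<^bsub>M\<^esub> g x)\<rparr>"

text \<open>The action g f g^-1 on additive maps, whose fixed points are the linear maps. The value
  0 outside the carrier keeps the result among the additive maps, which are normalized in the same
  way.\<close>

definition conjugation ::
  "'a monoid \<Rightarrow> ('a \<Rightarrow> int, 'm) Module.module \<Rightarrow> ('a \<Rightarrow> int, 'n) Module.module \<Rightarrow> 'a \<Rightarrow> ('m \<Rightarrow> 'n) \<Rightarrow> 'm \<Rightarrow> 'n" where
  "conjugation G K M g f =
     (\<lambda>x. if x \<in> carrier K then basis_elt g \<odot>\<^bsub>M\<^esub> f (basis_elt (inv\<^bsub>G\<^esub> g) \<odot>\<^bsub>K\<^esub> x) else \<zero>\<^bsub>M\<^esub>)"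

lemma additive_maps_simps [simp]:
  "\<zero>\<^bsub>additive_maps K M\<^esub> = (\<lambda>_. \<zero>\<^bsub>M\<^esub>)" "f \<oplus>\<^bsub>additive_maps K M\<^esub> g = (\<lambda>x. f x \<oplus>\<^bsub>M\<^esub> g x)"
  by (simp_all add: additive_maps_def)

lemma additive_mapsD:
  assumes "f \<in> carrier (additive_maps K M)"
  shows "x \<in> carrier K \<Longrightarrow> f x \<in> carrier M"
    and "\<lbrakk>x \<in> carrier K; y \<in> carrier K\<rbrakk> \<Longrightarrow> f (x \<oplus>\<^bsub>K\<^esub> y) = f x \<oplus>\<^bsub>M\<^esub> f y"
    and "x \<notin> carrier K \<Longrightarrow> f x = \<zero>\<^bsub>M\<^esub>"
    and "abelian_group M \<Longrightarrow> f y \<in> carrier M"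
proof -
  show 1: "x \<in> carrier K \<Longrightarrow> f x \<in> carrier M" and 2: "x \<notin> carrier K \<Longrightarrow> f x = \<zero>\<^bsub>M\<^esub>" for x
    using assms by (simp_all add: additive_maps_def)
  show "\<lbrakk>x \<in> carrier K; y \<in> carrier K\<rbrakk> \<Longrightarrow> f (x \<oplus>\<^bsub>K\<^esub> y) = f x \<oplus>\<^bsub>M\<^esub> f y"
    using assms by (simp add: additive_maps_def)
  show "f y \<in> carrier M" if "abelian_group M"
    using 1[of y] 2[of y] abelian_monoid.zero_closed[OF abelian_group.axioms(1)[OF that]] by (cases "y \<in> carrier K") auto
qed

lemma additive_mapsI:
  assumes "\<And>x. x \<in> carrier K \<Longrightarrow> f x \<in> carrier M"
    and "\<And>x y. \<lbrakk>x \<in> carrier K; y \<in> carrier K\<rbrakk> \<Longrightarrow> f (x \<oplus>\<^bsub>K\<^esub> y) = f x \<oplus>\<^bsub>M\<^esub> f y"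
    and "\<And>x. x \<notin> carrier K \<Longrightarrow> f x = \<zero>\<^bsub>M\<^esub>"
  shows "f \<in> carrier (additive_maps K M)"
  using assms by (simp add: additive_maps_def)

lemma abelian_group_additive_maps:
  assumes K: "abelian_group K" and M: "abelian_group M"
  shows "abelian_group (additive_maps K M)"
proof -
  interpret K: abelian_group K by (rule K)
  interpret M: abelian_group M by (rule M)
  note D = additive_mapsD
  have ac: "a \<oplus>\<^bsub>M\<^esub> b \<oplus>\<^bsub>M\<^esub> (c \<oplus>\<^bsub>M\<^esub> e) = a \<oplus>\<^bsub>M\<^esub> c \<oplus>\<^bsub>M\<^esub> (b \<oplus>\<^bsub>M\<^esub> e)"
    if "a \<in> carrier M" "b \<in> carrier M" "c \<in> carrier M" "e \<in> carrier M" for a b c e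
    using that by algebra
  show ?thesis
  proof (rule abelian_groupI)
    fix f g assume f: "f \<in> carrier (additive_maps K M)" and g: "g \<in> carrier (additive_maps K M)"
    note fM = D(4)[OF f M] and gM = D(4)[OF g M]
    show "f \<oplus>\<^bsub>additive_maps K M\<^esub> g \<in> carrier (additive_maps K M)"
      unfolding additive_maps_simps
      by (rule additive_mapsI) (simp_all add: fM gM D(2)[OF f] D(2)[OF g] D(3)[OF f] D(3)[OF g] ac)
    show "f \<oplus>\<^bsub>additive_maps K M\<^esub> g = g \<oplus>\<^bsub>additive_maps K M\<^esub> f"
      by (simp add: M.a_comm[OF fM gM])
  next
    fix f assume f: "f \<in> carrier (additive_maps K M)"
    note fM = D(4)[OF f M]
    show "\<zero>\<^bsub>additive_maps K M\<^esub> \<oplus>\<^bsub>additive_maps K M\<^esub> f = f" by (simp add: fM)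
    have 0: "\<ominus>\<^bsub>M\<^esub> \<zero>\<^bsub>M\<^esub> = \<zero>\<^bsub>M\<^esub>" by (metis M.minus_equality M.l_zero M.zero_closed)
    have "(\<lambda>x. \<ominus>\<^bsub>M\<^esub> f x) \<in> carrier (additive_maps K M)"
      by (rule additive_mapsI) (simp_all add: fM D(2)[OF f] D(3)[OF f] M.minus_add 0)
    then show "\<exists>g\<in>carrier (additive_maps K M). g \<oplus>\<^bsub>additive_maps K M\<^esub> f = \<zero>\<^bsub>additive_maps K M\<^esub>"
      by (intro bexI[of _ "\<lambda>x. \<ominus>\<^bsub>M\<^esub> f x"]) (simp_all add: M.l_neg[OF fM])
  next
    fix f g h assume "f \<in> carrier (additive_maps K M)" "g \<in> carrier (additive_maps K M)" "h \<in> carrier (additive_maps K M)"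
    then show "f \<oplus>\<^bsub>additive_maps K M\<^esub> g \<oplus>\<^bsub>additive_maps K M\<^esub> h = f \<oplus>\<^bsub>additive_maps K M\<^esub> (g \<oplus>\<^bsub>additive_maps K M\<^esub> h)"
      by (simp add: M.a_assoc[OF D(4)[OF _ M] D(4)[OF _ M] D(4)[OF _ M]])
  qed (auto intro: additive_mapsI)
qed

text \<open>The degree i is fixed because the cycles Z in degree i are the source of all additive
  maps considered; only the target C(q) varies with the degree of J.\<close>

locale averaged_complex =
  fixes G :: "'a monoid" (structure) and C :: "int \<Rightarrow> ('a \<Rightarrow> int, 'u) lmod" and D R and i :: int
  assumes G: "Group.group G" and acyclic: "acyclic_complex \<int>\<langle>G\<rangle> C D"
    and injective: "injective_module \<int>\<langle>G\<rangle> (C q)" and averaging: "averaging G (C q) (R q)"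
begin

interpretation G: Group.group G by (rule G)

lemmas CD = module_complexD[OF acyclic_complexD(1)[OF acyclic]]

abbreviation (input) "Z \<equiv> cycles C D i"
abbreviation (input) "J \<equiv> (\<lambda>q. additive_maps Z (C q))"
abbreviation (input) "act \<equiv> (\<lambda>q. conjugation G Z (C q))"
abbreviation (input) "\<delta> \<equiv> (\<lambda>q f x. D q (f x))"
abbreviation (input) "\<rho> \<equiv> (\<lambda>q u x. if x \<in> carrier Z then R q (\<lambda>g. u g x) else \<zero>\<^bsub>C q\<^esub>)"

interpretation Cq: left_module "\<int>\<langle>G\<rangle>" "C q" for q by (rule CD(1))
interpretation Z: left_module "\<int>\<langle>G\<rangle>" Z by (rule CD(6))

lemma abelian_C: "abelian_group (C q)" by (rule Cq.M.abelian_group_axioms)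

lemmas actC = basis_elt_act[OF G CD(1)] and actZ = basis_elt_act[OF G CD(6)]

lemma J_closed: "f \<in> carrier (J q) \<Longrightarrow> f x \<in> carrier (C q)"
  by (rule additive_mapsD(4)[OF _ abelian_C])

lemma D_zero: "D q \<zero>\<^bsub>C q\<^esub> = \<zero>\<^bsub>C (q + 1)\<^esub>"
  by (rule lmod_hom_facts(1)[OF CD(1) CD(1) CD(2)])

sublocale E: equivariant_complex G J act \<delta> \<rho>
proof (intro equivariant_complex.intro equivariant_complex_axioms.intro G)
  fix q
  show "abelian_group (J q)"
    by (rule abelian_group_additive_maps[OF Z.M.abelian_group_axioms abelian_C])
next
  fix g f q assume g: "g \<in> carrier G" and f: "f \<in> carrier (J q)"
  note D = additive_mapsD[OF f] and ig = G.inv_closed[OF g]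
  show "act q g f \<in> carrier (J q)"
  proof (rule additive_mapsI)
    fix x assume x: "x \<in> carrier Z"
    show "act q g f x \<in> carrier (C q)" using x actC(1)[OF J_closed[OF f] g] by (simp add: conjugation_def)
    fix y assume y: "y \<in> carrier Z"
    show "act q g f (x \<oplus>\<^bsub>Z\<^esub> y) = act q g f x \<oplus>\<^bsub>C q\<^esub> act q g f y"
      using x y Z.M.a_closed[OF x y] actZ(4)[OF x ig y] D(2)[OF actZ(1)[OF x ig] actZ(1)[OF y ig]]
        actC(4)[OF J_closed[OF f] g J_closed[OF f]] by (simp add: conjugation_def del: cycles_simps)
  qed (simp add: conjugation_def del: cycles_simps)
next
  fix g f f' q assume g: "g \<in> carrier G" and f: "f \<in> carrier (J q)" and f': "f' \<in> carrier (J q)"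
  show "act q g (f \<oplus>\<^bsub>J q\<^esub> f') = act q g f \<oplus>\<^bsub>J q\<^esub> act q g f'"
    using actC(4)[OF J_closed[OF f] g J_closed[OF f']] by (auto simp: conjugation_def fun_eq_iff)
next
  fix f q assume f: "f \<in> carrier (J q)"
  show "act q \<one> f = f"
    using actZ(2) actC(2)[OF J_closed[OF f]] additive_mapsD(3)[OF f] by (auto simp: conjugation_def fun_eq_iff simp del: cycles_simps)
next
  fix g h f q assume g: "g \<in> carrier G" and h: "h \<in> carrier G" and f: "f \<in> carrier (J q)"
  show "act q (g \<otimes> h) f = act q g (act q h f)"
    using actZ(3)[OF _ G.inv_closed[OF h] G.inv_closed[OF g]] actZ(1)[OF _ G.inv_closed[OF g]] actC(3)[OF J_closed[OF f] g h]
    by (auto simp: conjugation_def fun_eq_iff G.inv_mult_group g h simp del: cycles_simps)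
next
  fix f q q' assume f: "f \<in> carrier (J q)" and q': "q' = q + (1 :: int)"
  note D = additive_mapsD[OF f]
  show "\<delta> q f \<in> carrier (J q')"
    unfolding q'
    by (rule additive_mapsI) (simp_all add: lmod_homD[OF CD(2)] J_closed[OF f] D(2,3) D_zero del: cycles_simps)
  show "\<delta> q (f \<oplus>\<^bsub>J q\<^esub> f') = \<delta> q f \<oplus>\<^bsub>J q'\<^esub> \<delta> q f'" if f': "f' \<in> carrier (J q)" for f'
    unfolding q' by (simp add: lmod_homD(2)[OF CD(2) J_closed[OF f] J_closed[OF f']])
  show "\<delta> q' (\<delta> q f) = \<zero>\<^bsub>J q''\<^esub>" if "q'' = q + 2" for q''
    unfolding q' that by (simp add: CD(4)[OF J_closed[OF f]])
  show "\<delta> q (act q g f) = act q' g (\<delta> q f)" if g: "g \<in> carrier G" for g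
    unfolding q' using lmod_homD(3)[OF CD(2) basis_elt_closed[OF G g] J_closed[OF f]] D_zero
    by (auto simp: conjugation_def fun_eq_iff)
next
  fix u :: "'a \<Rightarrow> _" and q assume u: "\<And>g. g \<in> carrier G \<Longrightarrow> u g \<in> carrier (J q)"
  note uC = J_closed[OF u]
  show "\<rho> q u \<in> carrier (J q)"
  proof (rule additive_mapsI)
    fix x assume x: "x \<in> carrier Z"
    show "\<rho> q u x \<in> carrier (C q)" using x averagingD(1)[OF averaging uC, of "\<lambda>g. g" "\<lambda>_. x"] by (simp del: cycles_simps)
    fix y assume y: "y \<in> carrier Z"
    have "R q (\<lambda>g. u g (x \<oplus>\<^bsub>Z\<^esub> y)) = R q (\<lambda>g. u g x \<oplus>\<^bsub>C q\<^esub> u g y)"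
      by (rule averagingD(2)[OF averaging]) (rule additive_mapsD(2)[OF u x y])
    also have "\<dots> = R q (\<lambda>g. u g x) \<oplus>\<^bsub>C q\<^esub> R q (\<lambda>g. u g y)" by (rule averagingD(3)[OF averaging uC uC])
    finally show "\<rho> q u (x \<oplus>\<^bsub>Z\<^esub> y) = \<rho> q u x \<oplus>\<^bsub>C q\<^esub> \<rho> q u y" using x y Z.M.a_closed[OF x y] by (simp del: cycles_simps)
  qed (simp del: cycles_simps)
  show "\<rho> q (\<lambda>g. u g \<oplus>\<^bsub>J q\<^esub> v g) = \<rho> q u \<oplus>\<^bsub>J q\<^esub> \<rho> q v" if v: "\<And>g. g \<in> carrier G \<Longrightarrow> v g \<in> carrier (J q)" for v
  proof
    fix x
    have "R q (\<lambda>g. u g x \<oplus>\<^bsub>C q\<^esub> v g x) = R q (\<lambda>g. u g x) \<oplus>\<^bsub>C q\<^esub> R q (\<lambda>g. v g x)"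
      by (rule averagingD(3)[OF averaging uC J_closed[OF v]])
    then show "\<rho> q (\<lambda>g. u g \<oplus>\<^bsub>J q\<^esub> v g) x = (\<rho> q u \<oplus>\<^bsub>J q\<^esub> \<rho> q v) x" by (simp del: cycles_simps)
  qed
  show "\<rho> q (\<lambda>g. act q h (u (inv h \<otimes> g))) = act q h (\<rho> q u)" if h: "h \<in> carrier G" for h
  proof
    fix x
    show "\<rho> q (\<lambda>g. act q h (u (inv h \<otimes> g))) x = act q h (\<rho> q u) x"
    proof (cases "x \<in> carrier Z")
      case True
      \<comment> \<open>At a fixed x all maps are evaluated at h^-1 x, so the action on the source
        disappears and the averaging of C(q) applies.\<close>
      let ?y = "basis_elt (inv h) \<odot>\<^bsub>Z\<^esub> x"
      have "R q (\<lambda>g. basis_elt h \<odot>\<^bsub>C q\<^esub> u (inv h \<otimes> g) ?y) = basis_elt h \<odot>\<^bsub>C q\<^esub> R q (\<lambda>g. u g ?y)"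
        by (rule averagingD(4)[OF averaging h uC])
      then show ?thesis using True actZ(1)[OF True G.inv_closed[OF h]] by (simp add: conjugation_def del: cycles_simps)
    qed (simp add: conjugation_def del: cycles_simps)
  qed
next
  fix u v :: "'a \<Rightarrow> ('a \<Rightarrow> int, 'u) universe \<Rightarrow> ('a \<Rightarrow> int, 'u) universe" and q
  assume "\<And>g. g \<in> carrier G \<Longrightarrow> u g = v g"
  then have eq: "R q (\<lambda>g. u g x) = R q (\<lambda>g. v g x)" for x by (intro averagingD(2)[OF averaging]) simp
  show "\<rho> q u = \<rho> q v"
  proof
    fix x show "\<rho> q u x = \<rho> q v x" by (simp only: eq[of x])
  qed
next
  fix f q assume f: "f \<in> carrier (J q)"
  have "R q (\<lambda>_. f x) = f x" for x by (rule averagingD(5)[OF averaging J_closed[OF f]])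
  then show "\<rho> q (\<lambda>_. f) = f" using additive_mapsD(3)[OF f] by (auto simp: fun_eq_iff simp del: cycles_simps)
qed

text \<open>Composition with a contraction of C over \<open>H\<close> contracts the complex of
  additive maps. It commutes with conjugation by \<open>H\<close> because the contraction is
  \<open>H\<close>-linear.\<close>

lemma contracts_if_acyclics_contractible:
  assumes H: "subgroup H G" and P: "acyclics_contractible TYPE('u) (G\<lparr>carrier := H\<rparr>)"
  shows "\<exists>s. E.contracts H s"
proof -
  interpret H: subgroup H G by (rule H)
  have A: "acyclic_complex \<int>\<langle>G\<lparr>carrier := H\<rparr>\<rangle> C D" by (rule acyclic_restrict[OF G H acyclic])
  have "splits_at \<int>\<langle>G\<lparr>carrier := H\<rparr>\<rangle> C D j" for j
    by (rule acyclics_contractibleD[OF P A injective_subgroup[OF G injective H]])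
  then have "contractible_complex \<int>\<langle>G\<lparr>carrier := H\<rparr>\<rangle> C D" using contractible_iff_splits[OF acyclic_complexD(1)[OF A]] by blast
  then obtain s where s: "\<And>q. s q \<in> lmod_hom \<int>\<langle>G\<lparr>carrier := H\<rparr>\<rangle> (C q) (C (q - 1))"
    "\<And>q x. x \<in> carrier (C q) \<Longrightarrow> D (q - 1) (s q x) \<oplus>\<^bsub>C q\<^esub> s (q + 1) (D q x) = x"
    unfolding contractible_complex_def by metis
  note AD = module_complexD[OF acyclic_complexD(1)[OF A]]
  have s0: "s q \<zero>\<^bsub>C q\<^esub> = \<zero>\<^bsub>C (q - 1)\<^esub>" for q by (rule lmod_hom_facts(1)[OF AD(1) AD(1) s(1)])
  have "E.contracts H (\<lambda>q f x. s q (f x))"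
    unfolding E.contracts_def
  proof (intro allI ballI conjI)
    fix q f assume f: "f \<in> carrier (J q)"
    note fD = additive_mapsD[OF f]
    show "(\<lambda>x. s q (f x)) \<in> carrier (J (q - 1))"
      by (rule additive_mapsI) (simp_all add: lmod_homD[OF s(1)] J_closed[OF f] fD(2,3) s0 del: cycles_simps)
    show "(\<lambda>x. s q ((f \<oplus>\<^bsub>J q\<^esub> f') x)) = (\<lambda>x. s q (f x)) \<oplus>\<^bsub>J (q - 1)\<^esub> (\<lambda>x. s q (f' x))" if f': "f' \<in> carrier (J q)" for f'
      by (simp add: lmod_homD(2)[OF s(1) J_closed[OF f] J_closed[OF f']])
    show "(\<lambda>x. s q (act q g f x)) = act (q - 1) g (\<lambda>x. s q (f x))" if g: "g \<in> H" for g
    proof -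
      have "basis_elt g \<in> carrier \<int>\<langle>G\<lparr>carrier := H\<rparr>\<rangle>" using basis_elt_closed[OF G.subgroup_imp_group[OF H], of g] g by simp
      from lmod_homD(3)[OF s(1) this J_closed[OF f]] show ?thesis using s0 by (auto simp: conjugation_def fun_eq_iff)
    qed
    show "\<delta> (q - 1) (\<lambda>x. s q (f x)) \<oplus>\<^bsub>J q\<^esub> (\<lambda>x. s (q + 1) (\<delta> q f x)) = f"
      by (simp add: s(2)[OF J_closed[OF f]])
  qed
  then show ?thesis by blast
qed

text \<open>An invariant preimage of the inclusion of the cycles is an equivariant splitting.\<close>

lemma splits_at_if_invariant_lift:
  assumes lift: "\<And>z. \<lbrakk>z \<in> carrier (J i); \<delta> i z = \<zero>\<^bsub>J (i + 1)\<^esub>; E.invariant i (carrier G) z\<rbrakk> \<Longrightarrow>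
    \<exists>w\<in>carrier (J (i - 1)). \<delta> (i - 1) w = z \<and> E.invariant (i - 1) (carrier G) w"
  shows "splits_at \<int>\<langle>G\<rangle> C D i"
proof -
  \<comment> \<open>The inclusion of the cycles, extended by 0. It is a cocycle because the
    differential vanishes on cycles, and invariant because it is linear.\<close>
  define z where "z x = (if x \<in> carrier Z then x else \<zero>\<^bsub>C i\<^esub>)" for x
  have "\<exists>w\<in>carrier (J (i - 1)). \<delta> (i - 1) w = z \<and> E.invariant (i - 1) (carrier G) w"
  proof (rule lift)
    show "z \<in> carrier (J i)"
    proof (rule additive_mapsI)
      show "z (x \<oplus>\<^bsub>Z\<^esub> y) = z x \<oplus>\<^bsub>C i\<^esub> z y" if "x \<in> carrier Z" "y \<in> carrier Z" for x y
        using that Z.M.a_closed[OF that] by (simp add: z_def)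
    qed (auto simp: z_def)
    show "\<delta> i z = \<zero>\<^bsub>J (i + 1)\<^esub>" using D_zero by (auto simp: z_def fun_eq_iff)
    show "E.invariant i (carrier G) z"
      unfolding E.invariant_def
    proof
      fix g assume g: "g \<in> carrier G"
      note ig = G.inv_closed[OF g]
      show "act i g z = z"
      proof
        fix x show "act i g z x = z x"
        proof (cases "x \<in> carrier Z")
          case True
          have xC: "x \<in> carrier (C i)" using True by simp
          have "basis_elt g \<odot>\<^bsub>C i\<^esub> (basis_elt (inv g) \<odot>\<^bsub>C i\<^esub> x) = x"
            using actC(3)[OF xC g ig] actC(2)[OF xC] g by simp
          then show ?thesis using True actZ(1)[OF True ig] by (simp add: conjugation_def z_def)
        next
          case False
          then show ?thesis unfolding conjugation_def z_def by (simp del: cycles_simps)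
        qed
      qed
    qed
  qed
  then obtain w where w: "w \<in> carrier (J (i - 1))" "\<delta> (i - 1) w = z" "E.invariant (i - 1) (carrier G) w" by blast
  note wD = additive_mapsD[OF w(1)]
  have "w \<in> lmod_hom \<int>\<langle>G\<rangle> Z (C (i - 1))"
  proof (rule lmod_hom_equivariant[OF G CD(6) CD(1) wD(1,2)])
    fix g x assume g: "g \<in> carrier G" and x: "x \<in> carrier Z"
    have gx: "basis_elt g \<odot>\<^bsub>Z\<^esub> x \<in> carrier Z" by (rule actZ(1)[OF x g])
    have "w (basis_elt g \<odot>\<^bsub>Z\<^esub> x) = act (i - 1) g w (basis_elt g \<odot>\<^bsub>Z\<^esub> x)" using w(3) g by (simp add: E.invariant_def)
    also have "\<dots> = basis_elt g \<odot>\<^bsub>C (i - 1)\<^esub> w (basis_elt (inv g) \<odot>\<^bsub>Z\<^esub> (basis_elt g \<odot>\<^bsub>Z\<^esub> x))"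
      using gx unfolding conjugation_def by (simp only: if_True)
    also have "basis_elt (inv g) \<odot>\<^bsub>Z\<^esub> (basis_elt g \<odot>\<^bsub>Z\<^esub> x) = x"
      using actZ(3)[OF x G.inv_closed[OF g] g] actZ(2)[OF x] g by simp
    finally show "w (basis_elt g \<odot>\<^bsub>Z\<^esub> x) = basis_elt g \<odot>\<^bsub>C (i - 1)\<^esub> w x" .
  qed
  moreover have "D (i - 1) (w x) = x" if "x \<in> carrier Z" for x
    using fun_cong[OF w(2), of x] that by (simp add: z_def)
  ultimately show ?thesis unfolding splits_at_def by blast
qed

end

section \<open>Goodness from chains of subgroups and from actions\<close>

lemma acyclics_contractibleI:
  fixes G :: "'a monoid"
  assumes G: "Group.group G"
    and splits: "\<And>(C :: int \<Rightarrow> ('a \<Rightarrow> int, 'u) lmod) D R i. averaged_complex G C D R \<Longrightarrow> splits_at \<int>\<langle>G\<rangle> C D i"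
  shows "acyclics_contractible TYPE('u) G"
  unfolding acyclics_contractible_def
proof (intro allI impI, elim conjE)
  fix C :: "int \<Rightarrow> ('a \<Rightarrow> int, 'u) lmod" and D i
  assume A: "acyclic_complex \<int>\<langle>G\<rangle> C D" and inj: "\<forall>i. injective_module \<int>\<langle>G\<rangle> (C i)"
  have "\<exists>\<rho>. averaging G (C q) \<rho>" for q by (rule injective_averaging[OF G inj[rule_format, of q]]) blast
  then obtain R where "\<And>q. averaging G (C q) (R q)" by metis
  then have "averaged_complex G C D R" using G A inj by (intro averaged_complex.intro) auto
  then show "splits_at \<int>\<langle>G\<rangle> C D i" by (rule splits)
qed

lemma acyclics_contractible_chain:
  fixes G :: "'a monoid"
  assumes G: "Group.group G" and \<H>: "\<And>H. H \<in> \<H> \<Longrightarrow> subgroup H G" and ne: "\<H> \<noteq> {}"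
    and chain: "\<And>H K. H \<in> \<H> \<Longrightarrow> K \<in> \<H> \<Longrightarrow> H \<subseteq> K \<or> K \<subseteq> H"
    and wf: "wf {(H, K). H \<in> \<H> \<and> K \<in> \<H> \<and> H \<subset> K}" and Un: "\<Union>\<H> = carrier G"
    and P: "\<And>H. H \<in> \<H> \<Longrightarrow> acyclics_contractible TYPE('u) (G\<lparr>carrier := H\<rparr>)"
  shows "acyclics_contractible TYPE('u) G"
proof (rule acyclics_contractibleI[OF G])
  fix C :: "int \<Rightarrow> ('a \<Rightarrow> int, 'u) lmod" and D R i
  assume "averaged_complex G C D R"
  then interpret averaged_complex G C D R i .
  show "splits_at \<int>\<langle>G\<rangle> C D i"
  proof (rule splits_at_if_invariant_lift)
    have contr: "\<exists>s. E.contracts H s" if "H \<in> \<H>" for H by (rule contracts_if_acyclics_contractible[OF \<H>[OF that] P[OF that]])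
    show "\<exists>w\<in>carrier (additive_maps (cycles C D i) (C (i - 1))). (\<lambda>x. D (i - 1) (w x)) = z \<and> E.invariant (i - 1) (carrier G) w"
      if "z \<in> carrier (additive_maps (cycles C D i) (C i))" "(\<lambda>x. D i (z x)) = \<zero>\<^bsub>additive_maps (cycles C D i) (C (i + 1))\<^esub>"
        "E.invariant i (carrier G) z" for z
      by (rule E.invariant_lift_of_chain[OF \<H> ne chain wf Un contr that])
  qed
qed

text \<open>The cell neighbourhoods form the required cover: their setwise stabilizers are isotropy
  groups of points, over which the complex of additive maps is contractible by assumption.\<close>

lemma acyclics_contractible_action:
  fixes G :: "'a monoid" and X :: "'x topology"
  assumes G: "Group.group G" and X: "fin_dim_contractible_G_CW G X E \<phi>"
    and P: "\<And>x. x \<in> topspace X \<Longrightarrow> acyclics_contractible TYPE('u) (G\<lparr>carrier := stabilizer G \<phi> x\<rparr>)"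
  shows "acyclics_contractible TYPE('u) G"
proof (rule acyclics_contractibleI[OF G])
  fix C :: "int \<Rightarrow> ('a \<Rightarrow> int, 'u) lmod" and D R i
  assume "averaged_complex G C D R"
  then interpret averaged_complex G C D R i .
  obtain N where N: "\<forall>n>N. E n = {}" and CW: "G_CW_complex G X E \<phi>" and ne: "topspace X \<noteq> {}" and contr: "contractible_space X"
    using X unfolding fin_dim_contractible_G_CW_def by blast
  have action: "group_action G (topspace X) \<phi>" and cont: "\<And>g. g \<in> carrier G \<Longrightarrow> continuous_map X X (\<phi> g)"
    using CW homeomorphic_imp_continuous_map unfolding G_CW_complex_def by blast+
  obtain \<V> where \<V>: "\<And>U n. U \<in> \<V> n \<Longrightarrow> openin X U"
    "\<And>U U' n. \<lbrakk>U \<in> \<V> n; U' \<in> \<V> n; U \<inter> U' \<noteq> {}\<rbrakk> \<Longrightarrow> U = U'"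
    "topspace X \<subseteq> (\<Union>n\<le>N. \<Union>(\<V> n))"
    "\<And>g U n. \<lbrakk>g \<in> carrier G; U \<in> \<V> n\<rbrakk> \<Longrightarrow> \<phi> g ` U \<in> \<V> n"
    "\<And>U n. U \<in> \<V> n \<Longrightarrow> \<exists>x\<in>topspace X. {g \<in> carrier G. \<phi> g ` U = U} = stabilizer G \<phi> x"
  proof (rule G_CW_complex_cover[OF G CW N], goal_cases)
    case (1 \<V>)
    show ?case by (rule 1(1); (rule 1(2) | rule 1(3) | rule 1(4) | rule 1(5) | rule 1(6)))
  qed
  have stab: "\<exists>s. E.contracts {g \<in> carrier G. \<phi> g ` U = U} s" if U: "U \<in> \<V> n" for U n
  proof -
    obtain x where x: "x \<in> topspace X" "{g \<in> carrier G. \<phi> g ` U = U} = stabilizer G \<phi> x" using \<V>(5)[OF U] by blast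
    show ?thesis
      unfolding x(2)
      by (rule contracts_if_acyclics_contractible[OF group_action.stabilizer_subgroup[OF action x(1)] P[OF x(1)]])
  qed
  interpret V: equivariant_cover G "\<lambda>q. additive_maps (cycles C D i) (C q)" "\<lambda>q. conjugation G (cycles C D i) (C q)" "\<lambda>q f x. D q (f x)"
    "\<lambda>q u x. if x \<in> carrier (cycles C D i) then R q (\<lambda>g. u g x) else \<zero>\<^bsub>C q\<^esub>" X \<phi> \<V> N
  proof (intro equivariant_cover.intro equivariant_cover_axioms.intro E.equivariant_complex_axioms action contr ne \<V>(3))
    show "continuous_map X X (\<phi> g)" if "g \<in> carrier G" for g by (rule cont[OF that])
    show "openin X U" if "U \<in> \<V> n" for U n by (rule \<V>(1)[OF that])
    show "U = U'" if "U \<in> \<V> n" "U' \<in> \<V> n" "U \<inter> U' \<noteq> {}" for U U' n by (rule \<V>(2)[OF that])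
    show "\<phi> g ` U \<in> \<V> n" if "g \<in> carrier G" "U \<in> \<V> n" for g U n by (rule \<V>(4)[OF that])
    show "\<exists>s. E.contracts {g \<in> carrier G. \<phi> g ` U = U} s" if "U \<in> \<V> n" for U n by (rule stab[OF that])
  qed
  show "splits_at \<int>\<langle>G\<rangle> C D i"
    by (rule splits_at_if_invariant_lift) (rule V.invariant_lift_of_cover)
qed

section \<open>Local membership and the transfinite inductions\<close>

text \<open>A word uses finitely many generators, and in a chain finitely many members lie in a
  single one.\<close>

lemma (in Group.group) Union_generate_chain:
  assumes A: "A \<subseteq> carrier G" and ne: "\<A> \<noteq> {}" and sub: "\<And>B. B \<in> \<A> \<Longrightarrow> B \<subseteq> A"
    and chain: "\<And>B B'. B \<in> \<A> \<Longrightarrow> B' \<in> \<A> \<Longrightarrow> B \<subseteq> B' \<or> B' \<subseteq> B" and Un: "A \<subseteq> \<Union>\<A>"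
  shows "\<Union>(generate G ` \<A>) = generate G A"
proof
  show "\<Union>(generate G ` \<A>) \<subseteq> generate G A" using mono_generate[OF sub] by blast
  have dir: "\<exists>B\<in>\<A>. x \<in> generate G B \<and> y \<in> generate G B"
    if "B \<in> \<A>" "B' \<in> \<A>" "x \<in> generate G B" "y \<in> generate G B'" for x y B B'
    using chain[OF that(1,2)] mono_generate[of B B'] mono_generate[of B' B] that by blast
  show "generate G A \<subseteq> \<Union>(generate G ` \<A>)"
  proof
    fix x assume "x \<in> generate G A"
    then show "x \<in> \<Union>(generate G ` \<A>)"
    proof induction
      case one
      then show ?case using ne generate.one[of G] by auto
    next
      case (incl h)
      then show ?case using Un by (auto intro: generate.incl)
    next
      case (inv h)
      then show ?case using Un by (auto intro: generate.inv)
    next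
      case (eng h1 h2)
      then obtain B B' where B: "B \<in> \<A>" "h1 \<in> generate G B" "B' \<in> \<A>" "h2 \<in> generate G B'" by blast
      then obtain B where "B \<in> \<A>" "h1 \<in> generate G B" "h2 \<in> generate G B" using dir[OF B(1,3,2,4)] by blast
      then show ?case by (auto intro: generate.eng)
    qed
  qed
qed

text \<open>Induction on the cardinality of the generating set. For finite sets goodness passes down
  from the larger good subgroup K. An infinite set is well-ordered by its cardinal, so that proper
  initial segments are smaller and, the order having no last element, exhaust it; the subgroups that
  they generate form the chain.\<close>

lemma acyclics_contractible_generate:
  fixes G :: "'a monoid"
  assumes G: "Group.group G"
    and fin: "\<And>A. \<lbrakk>finite A; A \<subseteq> carrier G\<rbrakk> \<Longrightarrow>
      \<exists>K. subgroup K G \<and> generate G A \<subseteq> K \<and> acyclics_contractible TYPE('u) (G\<lparr>carrier := K\<rparr>)"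
    and A: "A \<subseteq> carrier G"
  shows "acyclics_contractible TYPE('u) (G\<lparr>carrier := generate G A\<rparr>)"
  using A
proof (induction A rule: wf_induct_rule[OF wf_inv_image[OF wf_ordLess, of card_of]])
  interpret G: Group.group G by (rule G)
  case (1 A)
  then have A: "A \<subseteq> carrier G" by simp
  have sg: "subgroup (generate G B) G" if "B \<subseteq> carrier G" for B by (rule G.generate_is_subgroup[OF that])
  show ?case
  proof (cases "finite A")
    case True
    obtain K where K: "subgroup K G" "generate G A \<subseteq> K" "acyclics_contractible TYPE('u) (G\<lparr>carrier := K\<rparr>)"
      using fin[OF True A] by blast
    have "subgroup (generate G A) (G\<lparr>carrier := K\<rparr>)" by (rule G.subgroup_incl[OF sg[OF A] K(1,2)])
    from acyclics_contractible_subgroup[OF G.subgroup_imp_group[OF K(1)] this K(3)] show ?thesis by simp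
  next
    case False
    define r where "r = |A|"
    have r: "Card_order r" "Field r = A" by (simp_all add: r_def)
    then interpret r: wo_rel r by (simp add: wo_rel_def card_order_on_well_order_on)
    have pair: "(a, b) \<in> r \<or> (b, a) \<in> r" if "a \<in> A" "b \<in> A" for a b
      using r.TOTALS that r(2) by blast
    have underS_sub: "underS r a \<subseteq> A" for a unfolding r(2)[symmetric] by (auto simp: Order_Relation.underS_def Field_def)
    have mono: "underS r a \<subseteq> underS r b" if "(a, b) \<in> r" for a b
      using that r.TRANS r.ANTISYM by (auto simp: Order_Relation.underS_def dest: transD antisymD)
    let ?\<A> = "underS r ` A"
    let ?\<H> = "generate G ` ?\<A>"
    let ?H = "generate G A"
    let ?G = "G\<lparr>carrier := ?H\<rparr>"
    have sub_gen: "subgroup K G" "K \<subseteq> ?H" if K: "K \<in> ?\<H>" for K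
    proof -
      obtain a where a: "K = generate G (underS r a)" using K by blast
      show "subgroup K G" unfolding a using sg underS_sub A by blast
      show "K \<subseteq> ?H" unfolding a by (rule G.mono_generate[OF underS_sub])
    qed
    have chain\<A>: "B \<subseteq> B' \<or> B' \<subseteq> B" if "B \<in> ?\<A>" "B' \<in> ?\<A>" for B B'
      using that pair mono by blast
    show ?thesis
    proof (rule acyclics_contractible_chain[where \<H> = ?\<H>])
      show "Group.group ?G" by (rule G.subgroup_imp_group[OF sg[OF A]])
      show "subgroup K ?G" if "K \<in> ?\<H>" for K by (rule G.subgroup_incl[OF sub_gen(1)[OF that] sg[OF A] sub_gen(2)[OF that]])
      have "A \<noteq> {}" using False by auto
      then show "?\<H> \<noteq> {}" by simp
      show "K \<subseteq> K' \<or> K' \<subseteq> K" if K: "K \<in> ?\<H>" "K' \<in> ?\<H>" for K K'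
      proof -
        obtain B B' where B: "B \<in> ?\<A>" "B' \<in> ?\<A>" "K = generate G B" "K' = generate G B'" using K by blast
        then show ?thesis using chain\<A>[OF B(1,2)] G.mono_generate by blast
      qed
      show "wf {(K, K'). K \<in> ?\<H> \<and> K' \<in> ?\<H> \<and> K \<subset> K'}"
      proof (rule wf_subset)
        \<comment> \<open>Different segments may generate the same subgroup. Choosing one index for
          each subgroup turns strict inclusion into the strict order of indices, which is
          well-founded.\<close>
        define f where "f K = (SOME a. a \<in> A \<and> K = generate G (underS r a))" for K
        have f: "f K \<in> A \<and> K = generate G (underS r (f K))" if "K \<in> ?\<H>" for K
          unfolding f_def by (rule someI_ex) (use that in blast)
        show "wf (inv_image (r - Id) f)" by (rule wf_inv_image[OF r.WF])
        have "(f K, f K') \<in> r - Id" if K: "K \<in> ?\<H>" "K' \<in> ?\<H>" "K \<subset> K'" for K K'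
        proof -
          have "(f K', f K) \<notin> r"
          proof
            assume "(f K', f K) \<in> r"
            then have "generate G (underS r (f K')) \<subseteq> generate G (underS r (f K))" by (intro G.mono_generate mono)
            then show False using f[OF K(1)] f[OF K(2)] K(3) by auto
          qed
          moreover have "(f K, f K') \<in> r" using pair[of "f K" "f K'"] f[OF K(1)] f[OF K(2)] calculation by blast
          ultimately show ?thesis by auto
        qed
        then show "{(K, K'). K \<in> ?\<H> \<and> K' \<in> ?\<H> \<and> K \<subset> K'} \<subseteq> inv_image (r - Id) f" by (auto simp: inv_image_def)
      qed
      have "A \<subseteq> \<Union>?\<A>"
      proof
        fix a assume a: "a \<in> A"
        then obtain b where "b \<in> A" "a \<noteq> b" "(a, b) \<in> r"
          using infinite_Card_order_limit[OF r(1), of a] False r(2) by auto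
        then show "a \<in> \<Union>?\<A>" by (auto simp: Order_Relation.underS_def)
      qed
      then show "\<Union>?\<H> = carrier ?G"
        using G.Union_generate_chain[OF A, of ?\<A>] \<open>A \<noteq> {}\<close> underS_sub chain\<A> by auto
      show "acyclics_contractible TYPE('u) (?G\<lparr>carrier := K\<rparr>)" if K: "K \<in> ?\<H>" for K
      proof -
        obtain a where a: "a \<in> A" "K = generate G (underS r a)" using K by blast
        have "|underS r a| <o r" using card_of_underS[OF r(1), of a] a(1) r(2) by simp
        then have "(underS r a, A) \<in> inv_image ordLess card_of" by (simp add: r_def inv_image_def)
        moreover have "underS r a \<subseteq> carrier G" using underS_sub A by blast
        ultimately have "acyclics_contractible TYPE('u) (G\<lparr>carrier := generate G (underS r a)\<rparr>)" by (rule "1.IH")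
        then show ?thesis using a(2) by simp
      qed
    qed
  qed
qed

section \<open>Transfinite induction over the hierarchy\<close>

lemma torsion_free_subgroup:
  assumes G: "Group.group G" and tf: "torsion_free G" and H: "subgroup H G"
  shows "torsion_free (G\<lparr>carrier := H\<rparr>)"
proof -
  interpret G: Group.group G by (rule G)
  show ?thesis
    using tf subgroup.subset[OF H] G.nat_pow_consistent[of _ _ H, symmetric] unfolding torsion_free_def by auto
qed

text \<open>Torsion-freeness is demanded of the single group and not of the class: a stage contains
  groups with torsion, but isotropy groups and other subgroups of a torsion-free group are
  torsion-free, so what is known of an earlier stage applies to them.\<close>

definition good_class :: "'u itself \<Rightarrow> 'a monoid set \<Rightarrow> bool" where
  "good_class U \<CC> \<longleftrightarrow> (\<forall>G\<in>\<CC>. Group.group G \<and> (torsion_free G \<longrightarrow> acyclics_contractible U G))"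

lemma good_classD:
  assumes "good_class U \<CC>" "G \<in> \<CC>"
  shows "Group.group G" "torsion_free G \<Longrightarrow> acyclics_contractible U G"
  using assms unfolding good_class_def by blast+

lemma good_class_finite_groups: "good_class TYPE('u) (finite_groups :: 'a monoid set)"
  unfolding good_class_def finite_groups_def
  using torsion_free_finite_trivial acyclics_contractible_trivial_group by blast

lemma good_class_H_stage:
  fixes \<CC> :: "'a monoid set"
  assumes \<CC>: "good_class TYPE('u) \<CC>"
  shows "good_class TYPE('u) (H_stage TYPE('u) \<CC> \<alpha>)"
proof (induction \<alpha> rule: less_induct)
  case (less \<alpha>)
  show ?case
  proof (cases "\<alpha> = 0")
    case True
    then show ?thesis using \<CC> by (subst H_stage.simps) simp
  next
    case False
    show ?thesis
      unfolding good_class_def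
    proof (intro ballI conjI impI)
      fix G assume "G \<in> H_stage TYPE('u) \<CC> \<alpha>"
      then have "G \<in> {G. Group.group G \<and> (\<exists>(X :: ('a, 'u) universe topology) E \<phi>. fin_dim_contractible_G_CW G X E \<phi> \<and>
          (\<forall>x\<in>topspace X. \<exists>\<beta>\<in>{..<\<alpha>}. G\<lparr>carrier := stabilizer G \<phi> x\<rparr> \<in> H_stage TYPE('u) \<CC> \<beta>))}"
        using False by (subst (asm) H_stage.simps) simp
      then obtain X :: "('a, 'u) universe topology" and E \<phi> where G: "Group.group G" and X: "fin_dim_contractible_G_CW G X E \<phi>"
        and stab: "\<And>x. x \<in> topspace X \<Longrightarrow> \<exists>\<beta>\<in>{..<\<alpha>}. G\<lparr>carrier := stabilizer G \<phi> x\<rparr> \<in> H_stage TYPE('u) \<CC> \<beta>"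
        by auto
      show "Group.group G" by (rule G)
      assume tf: "torsion_free G"
      have act: "group_action G (topspace X) \<phi>"
        using X unfolding fin_dim_contractible_G_CW_def G_CW_complex_def by blast
      show "acyclics_contractible TYPE('u) G"
      proof (rule acyclics_contractible_action[OF G X])
        fix x assume x: "x \<in> topspace X"
        obtain \<beta> where \<beta>: "\<beta> < \<alpha>" "G\<lparr>carrier := stabilizer G \<phi> x\<rparr> \<in> H_stage TYPE('u) \<CC> \<beta>" using stab[OF x] by auto
        show "acyclics_contractible TYPE('u) (G\<lparr>carrier := stabilizer G \<phi> x\<rparr>)"
          by (rule good_classD(2)[OF less.IH[OF \<beta>(1)] \<beta>(2) torsion_free_subgroup[OF G tf group_action.stabilizer_subgroup[OF act x]]])
      qed
    qed
  qed
qed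

text \<open>Each finite subset lies in a subgroup from some stage of the H-hierarchy, which is good;
  the group is generated by its own carrier, so the statement on generated subgroups applies to
  it.\<close>

lemma good_class_LH_class:
  fixes \<CC> :: "'a monoid set"
  assumes \<CC>: "good_class TYPE('u) \<CC>"
  shows "good_class TYPE('u) (LH_class TYPE('u) \<CC>)"
  unfolding good_class_def
proof (intro ballI conjI impI)
  fix G assume LH: "G \<in> LH_class TYPE('u) \<CC>"
  show G: "Group.group G" using LH by (simp add: LH_class_def)
  interpret G: Group.group G by (rule G)
  assume tf: "torsion_free G"
  have "acyclics_contractible TYPE('u) (G\<lparr>carrier := generate G (carrier G)\<rparr>)"
  proof (rule acyclics_contractible_generate[OF G])
    fix A assume A: "finite A" "A \<subseteq> carrier G"
    obtain K where K: "subgroup K G" "generate G A \<subseteq> K" "G\<lparr>carrier := K\<rparr> \<in> H_class TYPE('u) \<CC>"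
      using LH A unfolding LH_class_def by blast
    obtain \<alpha> where \<alpha>: "G\<lparr>carrier := K\<rparr> \<in> H_stage TYPE('u) \<CC> \<alpha>" using K(3) unfolding H_class_def by blast
    have "acyclics_contractible TYPE('u) (G\<lparr>carrier := K\<rparr>)"
      by (rule good_classD(2)[OF good_class_H_stage[OF \<CC>] \<alpha> torsion_free_subgroup[OF G tf K(1)]])
    then show "\<exists>K. subgroup K G \<and> generate G A \<subseteq> K \<and> acyclics_contractible TYPE('u) (G\<lparr>carrier := K\<rparr>)" using K(1,2) by blast
  qed simp
  moreover have "generate G (carrier G) = carrier G"
    using G.generate_incl[OF subset_refl] generate.incl[of _ "carrier G" G] by blast
  ultimately show "acyclics_contractible TYPE('u) G" by simp
qed

lemma good_class_Phi_inj:
  fixes \<CC> :: "'a monoid set"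
  assumes \<CC>: "good_class TYPE('u) \<CC>"
  shows "good_class TYPE('u) (Phi_inj TYPE('u) \<Z> \<CC>)"
  unfolding good_class_def
proof (intro ballI conjI impI)
  fix G assume Phi: "G \<in> Phi_inj TYPE('u) \<Z> \<CC>"
  show G: "Group.group G" using Phi by (simp add: Phi_inj_def)
  assume tf: "torsion_free G"
  show "acyclics_contractible TYPE('u) G"
    by (rule acyclics_contractible_Phi_inj[OF Phi]) (rule good_classD(2)[OF \<CC> _ torsion_free_subgroup[OF G tf]])
qed

lemma good_class_F_stage:
  fixes \<alpha> :: "'a monoid ordinal"
  shows "good_class TYPE('u) (F_stage TYPE('u) \<Z> \<alpha>)"
proof (induction \<alpha> rule: less_induct)
  case (less \<alpha>)
  show ?case
    unfolding good_class_def
  proof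
    fix G assume G: "G \<in> F_stage TYPE('u) \<Z> \<alpha>"
    show "Group.group G \<and> (torsion_free G \<longrightarrow> acyclics_contractible TYPE('u) G)"
    proof (cases "\<alpha> = 0")
      case True
      then have "G \<in> finite_groups" using G by (subst (asm) F_stage.simps) simp
      then show ?thesis using good_class_finite_groups[where 'u = 'u] unfolding good_class_def by blast
    next
      case \<alpha>: False
      show ?thesis
      proof (cases "\<exists>\<beta>. is_successor \<alpha> \<beta>")
        case True
        then obtain \<beta> where \<beta>: "is_successor \<alpha> \<beta>"
          "G \<in> LH_class TYPE('u) (F_stage TYPE('u) \<Z> \<beta>) \<union> Phi_inj TYPE('u) \<Z> (F_stage TYPE('u) \<Z> \<beta>)"
          using G \<alpha> by (subst (asm) F_stage.simps) auto
        then have "good_class TYPE('u) (F_stage TYPE('u) \<Z> \<beta>)" by (intro less.IH) (simp add: is_successor_def)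
        from good_class_LH_class[OF this] good_class_Phi_inj[OF this] \<beta>(2) show ?thesis unfolding good_class_def by blast
      next
        case False
        then have "G \<in> (\<Union>\<beta>\<in>{..<\<alpha>}. F_stage TYPE('u) \<Z> \<beta>)"
          using G \<alpha> by (subst (asm) F_stage.simps[of _ _ \<alpha>]) (auto split: if_splits)
        then obtain \<beta> where \<beta>: "\<beta> < \<alpha>" "G \<in> F_stage TYPE('u) \<Z> \<beta>" by auto
        show ?thesis using less.IH[OF \<beta>(1)] \<beta>(2) unfolding good_class_def by blast
      qed
    qed
  qed
qed

theorem corollary3p6:
  fixes G :: "'a monoid"
  assumes "G \<in> F_hat TYPE('u) \<Z>"
    and "torsion_free G"
  shows "(\<forall>(C :: int \<Rightarrow> ('a \<Rightarrow> int, 'u) lmod) d.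
            acyclic_complex (group_ring \<Z> G) C d \<and>
            (\<forall>i. injective_module (group_ring \<Z> G) (C i)) \<longrightarrow>
            contractible_complex (group_ring \<Z> G) C d) \<and>
         acyclic_kernels (group_ring \<Z> G) =
           (Inj (group_ring \<Z> G) :: ('a \<Rightarrow> int, 'u) lmod set)"
proof -
  obtain \<alpha> where \<alpha>: "G \<in> F_stage TYPE('u) \<Z> \<alpha>" using assms(1) unfolding F_hat_def by blast
  have P: "acyclics_contractible TYPE('u) G" by (rule good_classD(2)[OF good_class_F_stage \<alpha> assms(2)])
  have contr: "contractible_complex (group_ring \<Z> G) C d"
    if A: "acyclic_complex (group_ring \<Z> G) C d" and inj: "\<And>i. injective_module (group_ring \<Z> G) (C i)"
    for C :: "int \<Rightarrow> ('a \<Rightarrow> int, 'u) lmod" and d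
    using acyclics_contractibleD[OF P A inj] contractible_iff_splits[OF acyclic_complexD(1)[OF A]] by blast
  have "acyclic_kernels (group_ring \<Z> G) = (Inj (group_ring \<Z> G) :: ('a \<Rightarrow> int, 'u) lmod set)"
    by (rule acyclic_kernels_eq_Inj) (rule contr)
  then show ?thesis using contr by blast
qed

end
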